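(* Let $u(x,y,t)$ be the exact solution of the problem $$\frac{\partial u}{\partial t}=\kappa_1\frac{\partial^\alpha u}{\partial|x|^\alpha}+\kappa_2\frac{\partial^\beta u}{\partial|y|^\beta}+g(x,y,t,u)\ \text{ in }\Omega\times(0,T],\qquad u=0\ \text{ on }\partial\Omega\times(0,T],\qquad u(\cdot,\cdot,0)=\varphi\ \text{ on }\overline\Omega,$$ under the assumptions in the context, and let $u^n_{i,j}$ be the numerical solution given by the scheme $$\mathscr{B}^{\alpha}_x\mathscr{B}^{\beta}_yD_t^{(2)}u^{n}_{i,j}+\tau^2\sigma_n^2\delta^{\alpha}_x\delta^{\beta}_yD_t^{(2)}u^{n}_{i,j}=\mathscr{B}^{\beta}_y\delta^{\alpha}_xu^{n}_{i,j}+\mathscr{B}^{\alpha}_x\delta^{\beta}_yu^{n}_{i,j}+\mathscr{B}^{\alpha}_x\mathscr{B}^{\beta}_yg^n_{i,j},\qquad (x_i,y_j)\in\Omega_h,\ 1\le n\le N,$$ with $u^n_{i,j}=0$ for $(x_i,y_j)\in\partial\Omega_h$, $1\le n\le N$, and $u^0_{i,j}=\varphi(x_i,y_j)$ for $(x_i,y_j)\in\overline\Omega_h$. Put $\eta^n_{i,j}=u(x_i,y_j,t_n)-u^n_{i,j}$. For any positive real number $\nu\in(0,1)$, if $0<\tau\le\tau_0=\frac{1-\nu}{9L}$, then the numerical scheme is convergent, and it holds that $$\max_{1\le n\le N}\lVert\eta^n\rVert=O(\tau^2+h_x^4+h_y^4).$$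
   Context: Parameters and data: $1<\alpha,\beta<2$; $\kappa_1,\kappa_2$ are positive constants; $\Omega=(a,b)\times(c,d)$; $\varphi(x,y)$ is a known sufficiently smooth function; $g(x,y,t,u)$ satisfies the Lipschitz condition $|g(x,y,t,u)-g(x,y,t,v)|\le L|u-v|$ for all $u,v\in\mathbb{R}$, where $L$ is the Lipschitz constant. Riesz derivatives: with $c_\gamma=-\frac{1}{2\cos(\pi\gamma/2)}$ for $\gamma=\alpha,\beta$, $$\frac{\partial^\alpha u}{\partial|x|^\alpha}=\frac{c_\alpha}{\Gamma(2-\alpha)}\frac{\partial^2}{\partial x^2}\Big[\int_a^xu(\xi,y,t)(x-\xi)^{1-\alpha}d\xi+\int_x^bu(\xi,y,t)(\xi-x)^{1-\alpha}d\xi\Big],$$ $$\frac{\partial^\beta u}{\partial|y|^\beta}=\frac{c_\beta}{\Gamma(2-\beta)}\frac{\partial^2}{\partial y^2}\Big[\int_c^yu(x,\xi,t)(y-\xi)^{1-\beta}d\xi+\int_y^du(x,\xi,t)(\xi-y)^{1-\beta}d\xi\Big].$$ Standing assumptions on the solution: the problem has a unique solution $u\in C^{6,6,3}_{x,y,t}([a,b]\times[c,d]\times[0,T])$ (smoothness orders 6, 6 and 3 in $x$, $y$ and $t$ respectively). For $\gamma=\alpha,\beta$ let $\mathscr{C}^{4+\gamma}(\mathbb{R})=\{v: v\in L_1(\mathbb{R}),\ \int_{-\infty}^{\infty}(1+|\varpi|)^{4+\gamma}|\widehat v(\varpi)|\,d\varpi<\infty\}$, where $\widehat v(\varpi)=\int_{-\infty}^\infty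 e^{-i\varpi x}v(x)\,dx$. For fixed $t\in[0,T]$ and $y\in[c,d]$, the extension by zero of $x\mapsto u(x,y,t)$ from $[a,b]$ to $\mathbb{R}$ belongs to $\mathscr{C}^{4+\alpha}(\mathbb{R})$; for fixed $t\in[0,T]$ and $x\in[a,b]$, the extension by zero of $y\mapsto u(x,y,t)$ from $[c,d]$ to $\mathbb{R}$ belongs to $\mathscr{C}^{4+\beta}(\mathbb{R})$. Grid: $x_i=a+ih_x$ ($0\le i\le M_1$), $y_j=c+jh_y$ ($0\le j\le M_2$), $t_n=n\tau$ ($0\le n\le N$), with $h_x=(b-a)/M_1$, $h_y=(d-c)/M_2$, $\tau=T/N$. $\overline\Omega_h$ is the set of all grid points $(x_i,y_j)$, $\Omega_h=\overline\Omega_h\cap\Omega$, $\partial\Omega_h=\overline\Omega_h\cap\partial\Omega$. Coefficients: for $\gamma=\alpha,\beta$, $g^{(\gamma)}_0=\frac{\Gamma(\gamma+1)}{\Gamma^2(\gamma/2+1)}$, $g^{(\gamma)}_k=\big(1-\frac{\gamma+1}{\gamma/2+k}\big)g^{(\gamma)}_{k-1}$ and $g^{(\gamma)}_{-k}=g^{(\gamma)}_k$ for $k=1,2,\dots$; and $c_2^\gamma=\gamma/24$. Difference operators on grid functions $v=(v_{i,j})$: $(\delta^\alpha_xv)_{i,j}=-\frac{\kappa_1}{h_x^\alpha}\sum_{k=i-M_1}^{i}g^{(\alpha)}_kv_{i-k,j}$, $(\delta^\beta_yv)_{i,j}=-\frac{\kappa_2}{h_y^\beta}\sum_{k=j-M_2}^{j}g^{(\beta)}_kv_{i,j-k}$.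 Compact operators: $(\mathscr{B}^\alpha_xv)_{i,j}=c_2^\alpha v_{i-1,j}+(1-2c_2^\alpha)v_{i,j}+c_2^\alpha v_{i+1,j}$ for $1\le i\le M_1-1$ and $(\mathscr{B}^\alpha_xv)_{i,j}=v_{i,j}$ for $i\in\{0,M_1\}$ ($0\le j\le M_2$); $(\mathscr{B}^\beta_yv)_{i,j}=c_2^\beta v_{i,j-1}+(1-2c_2^\beta)v_{i,j}+c_2^\beta v_{i,j+1}$ for $1\le j\le M_2-1$ and $(\mathscr{B}^\beta_yv)_{i,j}=v_{i,j}$ for $j\in\{0,M_2\}$ ($0\le i\le M_1$). BDF2 operator: $D_t^{(2)}v^1=\frac{v^1-v^0}{\tau}$ and, for $n\ge2$, $D_t^{(2)}v^n=\frac32\cdot\frac{v^n-v^{n-1}}{\tau}-\frac12\cdot\frac{v^{n-1}-v^{n-2}}{\tau}$. Also $\sigma_1=1$ and $\sigma_n=\frac23$ for $n\ge2$. Linearized source: $g^1_{i,j}=g(x_i,y_j,t_1,u^0_{i,j})$ and $g^n_{i,j}=g(x_i,y_j,t_n,2u^{n-1}_{i,j}-u^{n-2}_{i,j})$ for $n\ge2$. Norm: $\lVert v\rVert=\big(h_xh_y\sum_{i=1}^{M_1-1}\sum_{j=1}^{M_2-1}v_{i,j}^2\big)^{1/2}$.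
   Formalization: Adds that g(x,y,t,w) is continuous in (x,y) on the closed rectangle for fixed t and w; without it g could be altered on the boundary, where the compact scheme evaluates it although the equation does not, and the claimed order fails. *)

theory Defs
  imports "HOL-Analysis.Analysis"
begin

text \<open>Functions on space-time are curried, \<open>u x y t\<close>; grid functions are \<open>v i j\<close> and sequences of
  grid functions are \<open>U n i j\<close>, with natural-number indices.\<close>

subsection \<open>The continuous problem\<close>

definition riesz_const :: "real \<Rightarrow> real" where
  "riesz_const \<gamma> = - 1 / (2 * cos (pi * \<gamma> / 2))"

text \<open>Riesz derivative of order \<open>\<gamma>\<close> on \<open>[p, q]\<close> of a function of one variable. The kernels are
  singular but integrable for \<open>1 < \<gamma> < 2\<close>; \<open>powr\<close> gives them the value 0 at the singular point.\<close>

definition riesz_deriv :: "real \<Rightarrow> real \<Rightarrow> real \<Rightarrow> (real \<Rightarrow> real) \<Rightarrow> real \<Rightarrow> real" where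
  "riesz_deriv \<gamma> p q v x =
     riesz_const \<gamma> / Gamma (2 - \<gamma>) *
     deriv (deriv (\<lambda>z. (LBINT \<xi>:{p..z}. v \<xi> * (z - \<xi>) powr (1 - \<gamma>))
                     + (LBINT \<xi>:{z..q}. v \<xi> * (\<xi> - z) powr (1 - \<gamma>)))) x"

text \<open>\<open>u \<in> C\<^bsup>m,n,k\<^esup>\<close> on the closed box: all mixed partial derivatives of orders at most
  \<open>m\<close>, \<open>n\<close>, \<open>k\<close> in \<open>x\<close>, \<open>y\<close>, \<open>t\<close> exist (one-sided on the faces of the box) and are jointly
  continuous; \<open>D p q r\<close> is the derivative of orders \<open>p\<close>, \<open>q\<close>, \<open>r\<close>.\<close>

definition C_box ::
  "nat \<Rightarrow> nat \<Rightarrow> nat \<Rightarrow> real \<Rightarrow> real \<Rightarrow> real \<Rightarrow> real \<Rightarrow> real \<Rightarrow> (real \<Rightarrow> real \<Rightarrow> real \<Rightarrow> real) \<Rightarrow> bool" where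
  "C_box m n k a b c d T u \<longleftrightarrow>
     (\<exists>D :: nat \<Rightarrow> nat \<Rightarrow> nat \<Rightarrow> real \<Rightarrow> real \<Rightarrow> real \<Rightarrow> real.
        (\<forall>x\<in>{a..b}. \<forall>y\<in>{c..d}. \<forall>t\<in>{0..T}. D 0 0 0 x y t = u x y t) \<and>
        (\<forall>p\<le>m. \<forall>q\<le>n. \<forall>r\<le>k.
           continuous_on ({a..b} \<times> {c..d} \<times> {0..T}) (\<lambda>(x, y, t). D p q r x y t) \<and>
           (\<forall>x\<in>{a..b}. \<forall>y\<in>{c..d}. \<forall>t\<in>{0..T}.
              (p < m \<longrightarrow> ((\<lambda>z. D p q r z y t) has_real_derivative D (Suc p) q r x y t) (at x within {a..b})) \<and>
              (q < n \<longrightarrow> ((\<lambda>z. D p q r x z t) has_real_derivative D p (Suc q) r x y t) (at y within {c..d})) \<and>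
              (r < k \<longrightarrow> ((\<lambda>z. D p q r x y z) has_real_derivative D p q (Suc r) x y t) (at t within {0..T})))))"

definition solves_problem ::
  "real \<Rightarrow> real \<Rightarrow> real \<Rightarrow> real \<Rightarrow> real \<Rightarrow> real \<Rightarrow> real \<Rightarrow> real \<Rightarrow> real \<Rightarrow> (real \<Rightarrow> real \<Rightarrow> real)
   \<Rightarrow> (real \<Rightarrow> real \<Rightarrow> real \<Rightarrow> real \<Rightarrow> real) \<Rightarrow> (real \<Rightarrow> real \<Rightarrow> real \<Rightarrow> real) \<Rightarrow> bool" where
  "solves_problem \<alpha> \<beta> \<kappa>1 \<kappa>2 a b c d T \<phi> g u \<longleftrightarrow>
     (\<forall>x\<in>{a<..<b}. \<forall>y\<in>{c<..<d}. \<forall>t\<in>{0<..T}.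
        ((\<lambda>s. u x y s) has_real_derivative
           (\<kappa>1 * riesz_deriv \<alpha> a b (\<lambda>\<xi>. u \<xi> y t) x
            + \<kappa>2 * riesz_deriv \<beta> c d (\<lambda>\<xi>. u x \<xi> t) y
            + g x y t (u x y t))) (at t within {0..T})) \<and>
     (\<forall>(x, y) \<in> frontier ({a<..<b} \<times> {c<..<d}). \<forall>t\<in>{0<..T}. u x y t = 0) \<and>
     (\<forall>(x, y) \<in> closure ({a<..<b} \<times> {c<..<d}). u x y 0 = \<phi> x y)"

text \<open>\<open>u\<close> is the unique \<open>C\<^bsup>6,6,3\<^esup>\<close> solution; its values off the closed box are irrelevant.\<close>

definition unique_smooth_solution ::
  "real \<Rightarrow> real \<Rightarrow> real \<Rightarrow> real \<Rightarrow> real \<Rightarrow> real \<Rightarrow> real \<Rightarrow> real \<Rightarrow> real \<Rightarrow> (real \<Rightarrow> real \<Rightarrow> real)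
   \<Rightarrow> (real \<Rightarrow> real \<Rightarrow> real \<Rightarrow> real \<Rightarrow> real) \<Rightarrow> (real \<Rightarrow> real \<Rightarrow> real \<Rightarrow> real) \<Rightarrow> bool" where
  "unique_smooth_solution \<alpha> \<beta> \<kappa>1 \<kappa>2 a b c d T \<phi> g u \<longleftrightarrow>
     C_box 6 6 3 a b c d T u \<and> solves_problem \<alpha> \<beta> \<kappa>1 \<kappa>2 a b c d T \<phi> g u \<and>
     (\<forall>w. C_box 6 6 3 a b c d T w \<and> solves_problem \<alpha> \<beta> \<kappa>1 \<kappa>2 a b c d T \<phi> g w \<longrightarrow>
        (\<forall>x\<in>{a..b}. \<forall>y\<in>{c..d}. \<forall>t\<in>{0..T}. w x y t = u x y t))"

definition fourier_transform :: "(real \<Rightarrow> real) \<Rightarrow> real \<Rightarrow> complex" where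
  "fourier_transform v \<omega> = (LBINT x. exp (- \<i> * of_real (\<omega> * x)) * of_real (v x))"

definition fourier_class :: "real \<Rightarrow> (real \<Rightarrow> real) set" where
  "fourier_class s = {v. integrable lborel v \<and>
     integrable lborel (\<lambda>\<omega>. (1 + \<bar>\<omega>\<bar>) powr s * cmod (fourier_transform v \<omega>))}"

definition zero_extension :: "real \<Rightarrow> real \<Rightarrow> (real \<Rightarrow> real) \<Rightarrow> real \<Rightarrow> real" where
  "zero_extension p q v x = (if x \<in> {p..q} then v x else 0)"

subsection \<open>The numerical scheme\<close>

text \<open>The \<open>m\<close>-th of the points dividing \<open>[p, q]\<close> into \<open>M\<close> equal parts.\<close>

definition node :: "real \<Rightarrow> real \<Rightarrow> nat \<Rightarrow> nat \<Rightarrow> real" where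
  "node p q M m = p + real m * ((q - p) / real M)"

fun frac_coeff_nat :: "real \<Rightarrow> nat \<Rightarrow> real" where
  "frac_coeff_nat \<gamma> 0 = Gamma (\<gamma> + 1) / (Gamma (\<gamma> / 2 + 1))\<^sup>2"
| "frac_coeff_nat \<gamma> (Suc k) = (1 - (\<gamma> + 1) / (\<gamma> / 2 + real (Suc k))) * frac_coeff_nat \<gamma> k"

definition frac_coeff :: "real \<Rightarrow> int \<Rightarrow> real" where
  "frac_coeff \<gamma> k = frac_coeff_nat \<gamma> (nat \<bar>k\<bar>)"

definition delta_x :: "real \<Rightarrow> real \<Rightarrow> real \<Rightarrow> nat \<Rightarrow> (nat \<Rightarrow> nat \<Rightarrow> real) \<Rightarrow> nat \<Rightarrow> nat \<Rightarrow> real" where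
  "delta_x \<kappa> \<gamma> h M v i j =
     - (\<kappa> / h powr \<gamma>) * (\<Sum>k\<in>{int i - int M..int i}. frac_coeff \<gamma> k * v (nat (int i - k)) j)"

definition delta_y :: "real \<Rightarrow> real \<Rightarrow> real \<Rightarrow> nat \<Rightarrow> (nat \<Rightarrow> nat \<Rightarrow> real) \<Rightarrow> nat \<Rightarrow> nat \<Rightarrow> real" where
  "delta_y \<kappa> \<gamma> h M v i j =
     - (\<kappa> / h powr \<gamma>) * (\<Sum>k\<in>{int j - int M..int j}. frac_coeff \<gamma> k * v i (nat (int j - k)))"

definition c2 :: "real \<Rightarrow> real" where
  "c2 \<gamma> = \<gamma> / 24"

definition compact_x :: "real \<Rightarrow> nat \<Rightarrow> (nat \<Rightarrow> nat \<Rightarrow> real) \<Rightarrow> nat \<Rightarrow> nat \<Rightarrow> real" where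
  "compact_x \<gamma> M v i j =
     (if 0 < i \<and> i < M
      then c2 \<gamma> * v (i - 1) j + (1 - 2 * c2 \<gamma>) * v i j + c2 \<gamma> * v (i + 1) j
      else v i j)"

definition compact_y :: "real \<Rightarrow> nat \<Rightarrow> (nat \<Rightarrow> nat \<Rightarrow> real) \<Rightarrow> nat \<Rightarrow> nat \<Rightarrow> real" where
  "compact_y \<gamma> M v i j =
     (if 0 < j \<and> j < M
      then c2 \<gamma> * v i (j - 1) + (1 - 2 * c2 \<gamma>) * v i j + c2 \<gamma> * v i (j + 1)
      else v i j)"

text \<open>The next three definitions are only used for time levels \<open>n \<ge> 1\<close>.\<close>

definition bdf2 :: "real \<Rightarrow> (nat \<Rightarrow> nat \<Rightarrow> nat \<Rightarrow> real) \<Rightarrow> nat \<Rightarrow> nat \<Rightarrow> nat \<Rightarrow> real" where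
  "bdf2 \<tau> U n i j =
     (if n = 1 then (U 1 i j - U 0 i j) / \<tau>
      else 3/2 * ((U n i j - U (n - 1) i j) / \<tau>) - 1/2 * ((U (n - 1) i j - U (n - 2) i j) / \<tau>))"

definition sigma :: "nat \<Rightarrow> real" where
  "sigma n = (if n = 1 then 1 else 2/3)"

definition linearized_source ::
  "real \<Rightarrow> real \<Rightarrow> real \<Rightarrow> real \<Rightarrow> real \<Rightarrow> (real \<Rightarrow> real \<Rightarrow> real \<Rightarrow> real \<Rightarrow> real)
   \<Rightarrow> nat \<Rightarrow> nat \<Rightarrow> nat \<Rightarrow> (nat \<Rightarrow> nat \<Rightarrow> nat \<Rightarrow> real) \<Rightarrow> nat \<Rightarrow> nat \<Rightarrow> nat \<Rightarrow> real" where
  "linearized_source a b c d T g M1 M2 N U n i j =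
     g (node a b M1 i) (node c d M2 j) (node 0 T N n)
       (if n = 1 then U 0 i j else 2 * U (n - 1) i j - U (n - 2) i j)"

definition numerical_solution ::
  "real \<Rightarrow> real \<Rightarrow> real \<Rightarrow> real \<Rightarrow> real \<Rightarrow> real \<Rightarrow> real \<Rightarrow> real \<Rightarrow> real \<Rightarrow> (real \<Rightarrow> real \<Rightarrow> real)
   \<Rightarrow> (real \<Rightarrow> real \<Rightarrow> real \<Rightarrow> real \<Rightarrow> real) \<Rightarrow> nat \<Rightarrow> nat \<Rightarrow> nat
   \<Rightarrow> (nat \<Rightarrow> nat \<Rightarrow> nat \<Rightarrow> real) \<Rightarrow> bool" where
  "numerical_solution \<alpha> \<beta> \<kappa>1 \<kappa>2 a b c d T \<phi> g M1 M2 N U \<longleftrightarrow>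
     (let hx = (b - a) / real M1; hy = (d - c) / real M2; \<tau> = T / real N;
          Bx = compact_x \<alpha> M1; By = compact_y \<beta> M2;
          dx = delta_x \<kappa>1 \<alpha> hx M1; dy = delta_y \<kappa>2 \<beta> hy M2
      in
        (\<forall>n\<in>{1..N}. \<forall>i\<in>{0<..<M1}. \<forall>j\<in>{0<..<M2}.
           Bx (By (bdf2 \<tau> U n)) i j + \<tau>\<^sup>2 * (sigma n)\<^sup>2 * dx (dy (bdf2 \<tau> U n)) i j
           = By (dx (U n)) i j + Bx (dy (U n)) i j
             + Bx (By (linearized_source a b c d T g M1 M2 N U n)) i j) \<and>
        (\<forall>n\<in>{1..N}. \<forall>i\<le>M1. \<forall>j\<le>M2. i = 0 \<or> i = M1 \<or> j = 0 \<or> j = M2 \<longrightarrow> U n i j = 0) \<and>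
        (\<forall>i\<le>M1. \<forall>j\<le>M2. U 0 i j = \<phi> (node a b M1 i) (node c d M2 j)))"

definition grid_norm :: "real \<Rightarrow> real \<Rightarrow> nat \<Rightarrow> nat \<Rightarrow> (nat \<Rightarrow> nat \<Rightarrow> real) \<Rightarrow> real" where
  "grid_norm hx hy M1 M2 v = sqrt (hx * hy * (\<Sum>i\<in>{1..<M1}. \<Sum>j\<in>{1..<M2}. (v i j)\<^sup>2))"

definition max_error ::
  "real \<Rightarrow> real \<Rightarrow> real \<Rightarrow> real \<Rightarrow> real \<Rightarrow> (real \<Rightarrow> real \<Rightarrow> real \<Rightarrow> real)
   \<Rightarrow> nat \<Rightarrow> nat \<Rightarrow> nat \<Rightarrow> (nat \<Rightarrow> nat \<Rightarrow> nat \<Rightarrow> real) \<Rightarrow> real" where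
  "max_error a b c d T u M1 M2 N U =
     Max ((\<lambda>n. grid_norm ((b - a) / real M1) ((d - c) / real M2) M1 M2
                 (\<lambda>i j. u (node a b M1 i) (node c d M2 j) (node 0 T N n) - U n i j)) ` {1..N})"

end

theory Submission
  imports Defs "HOL-Analysis.Analysis"
begin

text \<open>Membership in the Fourier class forces the solution and its first five derivatives normal to each side to
  vanish there, so the Riesz derivative is an absolutely convergent Riesz potential of the second derivative. In cosine
  transforms it has the symbol \<open>-\<bar>\<omega>\<bar>\<^sup>\<alpha>\<close>, while the fractional differences have the symbol
  \<open>\<bar>2 sin (h\<omega>/2)\<bar>\<^sup>\<alpha> / h\<^sup>\<alpha>\<close>; after compact averaging the two differ at
  fourth order. An oscillatory integral estimate against the sixth derivative turns this into a pointwise truncation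
  error that is uniform in time. For stability, all matrices of the scheme are Kronecker products of diagonally dominant
  symmetric matrices, hence positive semidefinite; testing the error equation with the error itself, the BDF2 form
  is a difference of energies plus a square, and the discrete Gronwall argument applies.\<close>

section \<open>The fractional coefficients and their symbol\<close>

text \<open>The Fourier hypothesis is given separately for each time and each line, with no bound
  that is uniform in \<open>t\<close>. It is therefore used only qualitatively, for the vanishing at
  the sides; all constants come from compactness of the closed box. The price is that the sixth
  derivative may jump at the ends of the interval, so its transform has no useful decay, while the
  multiplier left after moving six derivatives onto the solution has size h^4 \<omega>^(\<alpha> -
  2), which is not integrable at infinity. Cancellation has to be exploited: the cosine transform of
  such a multiplier is a kernel of size h^4 |s|^(1 - \<alpha>), and that is integrable over a
  bounded interval. The same estimate with two derivatives instead of six bounds fractional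
  differences independently of the mesh, so the splitting term with its factor \<tau>^2 costs no
  order. The first time step is only first order accurate, but its residual enters the stability
  estimate with an extra factor \<tau>.\<close>

lemma frac_coeff_nat_Suc:
  assumes "\<gamma> > 0"
  shows "(real k + 1 + \<gamma> / 2) * frac_coeff_nat \<gamma> (Suc k) = (real k - \<gamma> / 2) * frac_coeff_nat \<gamma> k"
proof -
  have "\<gamma> / 2 + real (Suc k) > 0" using assms by (simp add: add_pos_nonneg)
  hence "(\<gamma> / 2 + real (Suc k)) * (1 - (\<gamma> + 1) / (\<gamma> / 2 + real (Suc k))) = real k - \<gamma> / 2"
    by (simp add: right_diff_distrib del: of_nat_Suc)
  hence "(real k + 1 + \<gamma> / 2) * (1 - (\<gamma> + 1) / (\<gamma> / 2 + real (Suc k))) = real k - \<gamma> / 2"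
    by (simp add: add_ac)
  thus ?thesis unfolding frac_coeff_nat.simps by (simp only: mult.assoc[symmetric])
qed

lemma frac_coeff_nat_0_pos: "\<gamma> > 0 \<Longrightarrow> frac_coeff_nat \<gamma> 0 > 0"
  using Gamma_real_pos[of "\<gamma> + 1"] Gamma_real_pos[of "\<gamma> / 2 + 1"]
  by (auto intro!: divide_pos_pos zero_less_power)

declare frac_coeff_nat.simps [simp del]

text \<open>Since 0 < \<gamma>/2 < 1, the factor k - \<gamma>/2 of the recurrence is negative at k =
  0 only, so the sign changes exactly once, after the coefficient of index 0.\<close>

lemma frac_coeff_nat_neg:
  assumes "0 < \<gamma>" "\<gamma> < 2"
  shows "frac_coeff_nat \<gamma> (Suc k) < 0"
proof (induction k)
  case 0
  have "(1 + \<gamma> / 2) * frac_coeff_nat \<gamma> 1 = - (\<gamma> / 2 * frac_coeff_nat \<gamma> 0)"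
    using frac_coeff_nat_Suc[of \<gamma> 0] assms by simp
  moreover have "\<gamma> / 2 * frac_coeff_nat \<gamma> 0 > 0" using assms frac_coeff_nat_0_pos by simp
  ultimately have "(1 + \<gamma> / 2) * frac_coeff_nat \<gamma> 1 < 0" by simp
  thus ?case using assms by (simp add: mult_less_0_iff)
next
  case (Suc k)
  have "(real (Suc k) - \<gamma> / 2) * frac_coeff_nat \<gamma> (Suc k) < 0"
    using Suc assms by (intro mult_pos_neg) auto
  hence "(real (Suc k) + 1 + \<gamma> / 2) * frac_coeff_nat \<gamma> (Suc (Suc k)) < 0"
    using frac_coeff_nat_Suc[of \<gamma> "Suc k"] assms by simp
  moreover have "real (Suc k) + 1 + \<gamma> / 2 > 0" using assms by simp
  ultimately show ?case by (simp add: mult_less_0_iff)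
qed

text \<open>The weighted terms decay like k^(-\<gamma>), so \<gamma> > 1 is what makes them
  summable; this permits termwise differentiation of the symbol. A telescoping majorant takes the
  place of asymptotics.\<close>

lemma summable_weighted_frac_coeff:
  assumes "1 < \<gamma>" "\<gamma> < 2"
  shows "summable (\<lambda>k. (real k + 1) * \<bar>frac_coeff_nat \<gamma> (Suc k)\<bar>)"
proof -
  let ?g = "\<lambda>k. \<bar>frac_coeff_nat \<gamma> (Suc k)\<bar>"
  \<comment> \<open>Chosen so that the recurrence gives d k - d (k + 1) = ((\<gamma> - 1) (k + 1) +
    \<gamma>/2) |g_(k+1)|: differences of the quadratic weight dominate the linear one.\<close>
  define d where "d k = (real k + 1 + \<gamma> / 2) * (real k + 1) * ?g k" for k
  have step: "(\<gamma> - 1) * ((real k + 1) * ?g k) \<le> d k - d (Suc k)" for k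
  proof -
    have "(real (Suc k) + 1 + \<gamma> / 2) * ?g (Suc k) = (real (Suc k) - \<gamma> / 2) * ?g k"
      using arg_cong[OF frac_coeff_nat_Suc[of \<gamma> "Suc k"], of abs] assms by (simp add: abs_mult)
    moreover have "d (Suc k) = (real (Suc k) + 1) * ((real (Suc k) + 1 + \<gamma> / 2) * ?g (Suc k))"
      unfolding d_def by (simp only: mult_ac)
    ultimately have "d (Suc k) = (real (Suc k) + 1) * ((real (Suc k) - \<gamma> / 2) * ?g k)"
      by simp
    hence "d k - d (Suc k) = ((real k + 1 + \<gamma> / 2) * (real k + 1)) * ?g k - (real (Suc k) + 1) * ((real (Suc k) - \<gamma> / 2) * ?g k)"
      by (simp only: d_def)
    also have "\<dots> = ((\<gamma> - 1) * (real k + 1) + \<gamma> / 2) * ?g k"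
      by (simp add: field_simps)
    also have "\<dots> \<ge> ((\<gamma> - 1) * (real k + 1)) * ?g k"
      using assms by (intro mult_right_mono) auto
    finally show ?thesis by (simp add: mult_ac)
  qed
  have d0: "d k \<ge> 0" for k unfolding d_def using assms by (intro mult_nonneg_nonneg) auto
  show ?thesis
  proof (rule summableI_nonneg_bounded)
    fix n
    have "(\<gamma> - 1) * (\<Sum>k<n. (real k + 1) * ?g k) \<le> (\<Sum>k<n. d k - d (Suc k))"
      unfolding sum_distrib_left by (intro sum_mono step)
    also have "\<dots> = d 0 - d n" by (rule sum_lessThan_telescope')
    also have "\<dots> \<le> d 0" using d0 by simp
    finally show "(\<Sum>k<n. (real k + 1) * ?g k) \<le> d 0 / (\<gamma> - 1)"
      using assms by (simp add: field_simps)
  qed simp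
qed

lemma summable_abs_frac_coeff:
  assumes "1 < \<gamma>" "\<gamma> < 2"
  shows "summable (\<lambda>k. \<bar>frac_coeff_nat \<gamma> k\<bar>)"
proof -
  have "summable (\<lambda>k. \<bar>frac_coeff_nat \<gamma> (Suc k)\<bar>)"
    by (rule summable_comparison_test'[OF summable_weighted_frac_coeff[OF assms]])
      (simp add: mult_le_cancel_right1)
  thus ?thesis by (subst (asm) summable_Suc_iff)
qed

section \<open>Closed form of the symbol\<close>

definition frac_symbol :: "real \<Rightarrow> real \<Rightarrow> real" where
  "frac_symbol \<gamma> \<theta> = frac_coeff_nat \<gamma> 0 + 2 * (\<Sum>k. frac_coeff_nat \<gamma> (Suc k) * cos (real (Suc k) * \<theta>))"

lemma summable_frac_symbol:
  assumes "1 < \<gamma>" "\<gamma> < 2" and "\<And>k. \<bar>c k\<bar> \<le> 1"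
  shows "summable (\<lambda>k. frac_coeff_nat \<gamma> (Suc k) * c k)"
    "summable (\<lambda>k. real (Suc k) * frac_coeff_nat \<gamma> (Suc k) * c k)"
proof -
  show "summable (\<lambda>k. real (Suc k) * frac_coeff_nat \<gamma> (Suc k) * c k)"
    by (rule summable_comparison_test'[OF summable_weighted_frac_coeff[OF assms(1,2)]])
      (use assms(3) in \<open>auto simp: abs_mult add_ac intro!: mult_right_le_one_le\<close>)
  show "summable (\<lambda>k. frac_coeff_nat \<gamma> (Suc k) * c k)"
    by (rule summable_comparison_test'[where N=0, OF summable_abs_frac_coeff[OF assms(1,2), folded summable_Suc_iff[of "\<lambda>k. \<bar>frac_coeff_nat \<gamma> k\<bar>"]]])
      (use assms(3) in \<open>auto simp: abs_mult intro!: mult_right_le_one_le\<close>)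
qed

lemma has_derivative_frac_symbol:
  assumes "1 < \<gamma>" "\<gamma> < 2"
  shows "(frac_symbol \<gamma> has_real_derivative
           - 2 * (\<Sum>k. real (Suc k) * frac_coeff_nat \<gamma> (Suc k) * sin (real (Suc k) * \<theta>))) (at \<theta>)"
proof -
  let ?g = "\<lambda>k. frac_coeff_nat \<gamma> (Suc k)"
  have unif: "uniformly_convergent_on UNIV (\<lambda>n x. \<Sum>k<n. - (real (Suc k) * ?g k * sin (real (Suc k) * x)))"
    by (rule Weierstrass_m_test'[OF _ summable_weighted_frac_coeff[OF assms]])
      (auto simp: abs_mult add_ac intro!: mult_right_le_one_le)
  have "((\<lambda>x. \<Sum>k. ?g k * cos (real (Suc k) * x)) has_field_derivative
      (\<Sum>k. - (real (Suc k) * ?g k * sin (real (Suc k) * \<theta>)))) (at \<theta>)"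
  proof (rule has_field_derivative_series'(2)[OF convex_UNIV _ unif])
    fix n x
    show "((\<lambda>x. ?g n * cos (real (Suc n) * x)) has_field_derivative
       - (real (Suc n) * ?g n * sin (real (Suc n) * x))) (at x within UNIV)"
      by (auto intro!: derivative_eq_intros)
  next
    show "summable (\<lambda>n. ?g n * cos (real (Suc n) * \<theta>))"
      by (rule summable_frac_symbol(1)[OF assms]) simp
  qed auto
  hence "((\<lambda>x. \<Sum>k. ?g k * cos (real (Suc k) * x)) has_field_derivative
      - (\<Sum>k. (real (Suc k) * ?g k * sin (real (Suc k) * \<theta>)))) (at \<theta>)"
    by (subst (asm) suminf_minus) (rule summable_frac_symbol(2)[OF assms], simp, simp)
  from DERIV_add[OF DERIV_const DERIV_cmult[OF this, of 2]] show ?thesis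
    unfolding frac_symbol_def[abs_def] by simp
qed

text \<open>The recurrence for the coefficients is a first-order differential equation for the
  symbol, the one solved by sin^\<gamma>(\<theta>/2). Multiplication by half-angle functions moves
  integer frequencies to half-integer ones, where contributions of consecutive coefficients meet and
  the recurrence applies.\<close>

lemma frac_symbol_ode:
  assumes "1 < \<gamma>" "\<gamma> < 2"
  defines "F' \<equiv> \<lambda>\<theta>. - 2 * (\<Sum>k. real (Suc k) * frac_coeff_nat \<gamma> (Suc k) * sin (real (Suc k) * \<theta>))"
  shows "F' \<theta> * sin (\<theta> / 2) = \<gamma> / 2 * cos (\<theta> / 2) * frac_symbol \<gamma> \<theta>"
proof -
  let ?g = "frac_coeff_nat \<gamma>" and ?c = "\<lambda>k::nat. cos ((real k + 1/2) * \<theta>)"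
  note s = summable_frac_symbol[OF assms(1,2)]
  have pm: "cos ((real (Suc k)) * \<theta>) * cos (\<theta> / 2) = (?c k + ?c (Suc k)) / 2"
    "sin ((real (Suc k)) * \<theta>) * sin (\<theta> / 2) = (?c k - ?c (Suc k)) / 2" for k
  proof -
    have e: "(real k + 1/2) * \<theta> = real (Suc k) * \<theta> - \<theta> / 2"
      "(real (Suc k) + 1/2) * \<theta> = real (Suc k) * \<theta> + \<theta> / 2" by (simp_all add: algebra_simps)
    show "cos ((real (Suc k)) * \<theta>) * cos (\<theta> / 2) = (?c k + ?c (Suc k)) / 2"
      "sin ((real (Suc k)) * \<theta>) * sin (\<theta> / 2) = (?c k - ?c (Suc k)) / 2"
      unfolding e cos_add cos_diff by simp_all
  qed
  \<comment> \<open>\<open>A\<close> and \<open>B\<close> pair the coefficient of index k + 1 with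
    the half-integer frequency just below and just above it; \<open>A1\<close> and \<open>B1\<close>
    carry the extra factor k + 1 of the derivative.\<close>
  define A where "A = (\<Sum>k. ?g (Suc k) * ?c k)"
  define B where "B = (\<Sum>k. ?g (Suc k) * ?c (Suc k))"
  define A1 where "A1 = (\<Sum>k. real (Suc k) * ?g (Suc k) * ?c k)"
  define B1 where "B1 = (\<Sum>k. real (Suc k) * ?g (Suc k) * ?c (Suc k))"
  have c1: "\<bar>?c k\<bar> \<le> 1" for k by simp
  note sA = s(1)[of ?c, OF c1] and sA1 = s(2)[of ?c, OF c1]
    and sB = s(1)[of "\<lambda>k. ?c (Suc k)", OF c1] and sB1 = s(2)[of "\<lambda>k. ?c (Suc k)", OF c1]
  have s0: "summable (\<lambda>k. ?g (Suc k) * cos (real (Suc k) * \<theta>))"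
    "summable (\<lambda>k. real (Suc k) * ?g (Suc k) * sin (real (Suc k) * \<theta>))"
    by (rule s; simp)+
  have "cos (\<theta> / 2) * frac_symbol \<gamma> \<theta> = ?g 0 * ?c 0 + 2 * (\<Sum>k. ?g (Suc k) * cos (real (Suc k) * \<theta>) * cos (\<theta> / 2))"
    unfolding frac_symbol_def suminf_mult2[OF s0(1), symmetric] by (simp add: algebra_simps)
  also have "(\<Sum>k. ?g (Suc k) * cos (real (Suc k) * \<theta>) * cos (\<theta> / 2)) = (\<Sum>k. (?g (Suc k) * ?c k + ?g (Suc k) * ?c (Suc k)) / 2)"
    unfolding mult.assoc pm by (simp add: algebra_simps)
  also have "\<dots> = (A + B) / 2"
    unfolding A_def B_def suminf_add[OF sA sB] by (rule suminf_divide[OF summable_add[OF sA sB]])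
  finally have F: "cos (\<theta> / 2) * frac_symbol \<gamma> \<theta> = ?g 0 * ?c 0 + A + B" by simp
  have "F' \<theta> * sin (\<theta> / 2) = - 2 * (\<Sum>k. real (Suc k) * ?g (Suc k) * sin (real (Suc k) * \<theta>) * sin (\<theta> / 2))"
    unfolding F'_def suminf_mult2[OF s0(2), symmetric] by (simp add: algebra_simps)
  also have "(\<Sum>k. real (Suc k) * ?g (Suc k) * sin (real (Suc k) * \<theta>) * sin (\<theta> / 2)) = (\<Sum>k. (real (Suc k) * ?g (Suc k) * ?c k - real (Suc k) * ?g (Suc k) * ?c (Suc k)) / 2)"
    unfolding mult.assoc pm by (simp add: algebra_simps)
  also have "\<dots> = (A1 - B1) / 2"
    unfolding A1_def B1_def suminf_diff[OF sA1 sB1] by (rule suminf_divide[OF summable_diff[OF sA1 sB1]])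
  finally have F': "F' \<theta> * sin (\<theta> / 2) = B1 - A1" by simp
  \<comment> \<open>The recurrence rewrites the sum at the lower frequencies with coefficient index
    k in place of k + 1; splitting off k = 0 leaves \<open>B1\<close> - \<gamma>/2
    \<open>B\<close>.\<close>
  have "A1 + \<gamma> / 2 * A = (\<Sum>k. real (Suc k) * ?g (Suc k) * ?c k + \<gamma> / 2 * (?g (Suc k) * ?c k))"
    unfolding A1_def A_def using suminf_add[OF sA1 summable_mult[OF sA, of "\<gamma>/2"]] suminf_mult[OF sA, of "\<gamma>/2"] by simp
  also have "\<dots> = (\<Sum>k. (real k - \<gamma> / 2) * ?g k * ?c k)"
  proof (rule arg_cong[where f=suminf], rule ext)
    fix k
    have "real (Suc k) * ?g (Suc k) * ?c k + \<gamma> / 2 * (?g (Suc k) * ?c k) = ((real k + 1 + \<gamma> / 2) * ?g (Suc k)) * ?c k"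
      by (simp add: algebra_simps)
    thus "real (Suc k) * ?g (Suc k) * ?c k + \<gamma> / 2 * (?g (Suc k) * ?c k) = (real k - \<gamma> / 2) * ?g k * ?c k"
      using frac_coeff_nat_Suc[of \<gamma> k] assms(1) by simp
  qed
  also have "\<dots> = - \<gamma> / 2 * ?g 0 * ?c 0 + (\<Sum>k. (real (Suc k) - \<gamma> / 2) * ?g (Suc k) * ?c (Suc k))"
  proof (subst suminf_split_head)
    have "summable (\<lambda>k. (real (Suc k) - \<gamma> / 2) * ?g (Suc k) * ?c (Suc k))"
      using summable_diff[OF sB1 summable_mult[OF sB, of "\<gamma>/2"]] by (simp add: algebra_simps)
    thus "summable (\<lambda>k. (real k - \<gamma> / 2) * ?g k * ?c k)" by (subst (asm) summable_Suc_iff)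
  qed simp
  also have "(\<Sum>k. (real (Suc k) - \<gamma> / 2) * ?g (Suc k) * ?c (Suc k)) = B1 - \<gamma> / 2 * B"
    unfolding B1_def B_def using suminf_diff[OF sB1 summable_mult[OF sB, of "\<gamma>/2"]] suminf_mult[OF sB, of "\<gamma>/2"]
    by (simp add: algebra_simps)
  finally have "B1 - A1 = \<gamma> / 2 * (?g 0 * ?c 0 + A + B)" by (simp add: algebra_simps)
  thus ?thesis unfolding F' F[symmetric] by simp
qed

text \<open>Half a period kills every cosine and leaves the constant coefficient; this fixes the
  factor that the differential equation leaves open.\<close>

lemma has_integral_frac_symbol:
  assumes "1 < \<gamma>" "\<gamma> < 2"
  shows "(frac_symbol \<gamma> has_integral pi * frac_coeff_nat \<gamma> 0) {0..pi}"
proof -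
  let ?g = "\<lambda>k. frac_coeff_nat \<gamma> (Suc k)"
  have sm: "summable (\<lambda>k. \<bar>?g k\<bar>)"
    using summable_abs_frac_coeff[OF assms] by (subst summable_Suc_iff)
  have unif: "uniformly_convergent_on UNIV (\<lambda>n x. \<Sum>k<n. ?g k * cos (real (Suc k) * x))"
    by (rule Weierstrass_m_test'[OF _ sm]) (auto simp: abs_mult intro!: mult_right_le_one_le)
  define G where "G x = (\<Sum>k. ?g k * sin (real (Suc k) * x) / real (Suc k))" for x
  have G: "(G has_field_derivative (\<Sum>k. ?g k * cos (real (Suc k) * x))) (at x)" for x
    unfolding G_def
  proof (rule has_field_derivative_series'(2)[OF convex_UNIV _ unif])
    fix n x
    show "((\<lambda>x. ?g n * sin (real (Suc n) * x) / real (Suc n)) has_field_derivative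
       (?g n * cos (real (Suc n) * x))) (at x within UNIV)"
      by (auto intro!: derivative_eq_intros simp del: of_nat_Suc)
    show "summable (\<lambda>n. ?g n * sin (real (Suc n) * 0) / real (Suc n))" by simp
  qed auto
  have G0: "G 0 = 0" "G pi = 0"
    unfolding G_def by (simp_all del: of_nat_Suc add: sin_npi)
  have "(frac_symbol \<gamma> has_integral (frac_coeff_nat \<gamma> 0 * pi + 2 * G pi) - (frac_coeff_nat \<gamma> 0 * 0 + 2 * G 0)) {0..pi}"
  proof (rule fundamental_theorem_of_calculus)
    fix x :: real
    have "((\<lambda>x. frac_coeff_nat \<gamma> 0 * x + 2 * G x) has_field_derivative frac_symbol \<gamma> x) (at x within {0..pi})"
      unfolding frac_symbol_def
      by (auto intro!: derivative_eq_intros has_field_derivative_at_within[OF G])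
    thus "((\<lambda>x. frac_coeff_nat \<gamma> 0 * x + 2 * G x) has_vector_derivative frac_symbol \<gamma> x) (at x within {0..pi})"
      by (simp add: has_real_derivative_iff_has_vector_derivative)
  qed simp
  thus ?thesis by (simp add: G0 mult.commute)
qed

text \<open>The substitution t = sin^2(\<theta>/2) applied directly would give a Beta integrand with
  (1 - t)^(-1/2), unbounded at t = 1. An extra factor cos^2(\<theta>/2) makes the integrand
  continuous, and an explicit antiderivative then removes this factor.\<close>

lemma has_integral_sin_powr:
  fixes \<gamma> :: real
  assumes "1 < \<gamma>"
  shows "((\<lambda>\<theta>. sin (\<theta> / 2) powr \<gamma>) has_integral sqrt pi * Gamma ((\<gamma> + 1) / 2) / Gamma (\<gamma> / 2 + 1)) {0..pi}"
proof -
  let ?S = "\<lambda>\<theta>. sin (\<theta> / 2)" and ?C = "\<lambda>\<theta>. cos (\<theta> / 2)"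
  define f where "f = (\<lambda>t::real. t powr ((\<gamma> + 1) / 2 - 1) * (1 - t) powr (3/2 - 1))"
  have pos: "?S \<theta> \<ge> 0" "?C \<theta> \<ge> 0" if "\<theta> \<in> {0..pi}" for \<theta>
    using that by (auto intro!: sin_ge_zero cos_ge_zero)
  have beta: "(f has_integral Beta ((\<gamma> + 1) / 2) (3/2)) {0..1}"
    unfolding f_def using assms by (intro has_integral_Beta_real) auto
  have "((\<lambda>x. (?S x * ?C x) *\<^sub>R f ((?S x)\<^sup>2)) has_integral integral {(?S 0)\<^sup>2..(?S pi)\<^sup>2} f) {0..pi}"
  proof (rule has_integral_substitution)
    show "(\<lambda>x. (?S x)\<^sup>2) ` {0..pi} \<subseteq> {0..1}"
      by (auto simp: abs_square_le_1)
    show "continuous_on {0..1} f"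
      unfolding f_def using assms by (intro continuous_on_mult continuous_on_powr' continuous_intros) auto
    fix x :: real
    show "((\<lambda>x. (?S x)\<^sup>2) has_real_derivative ?S x * ?C x) (at x within {0..pi})"
      by (auto intro!: derivative_eq_intros)
  qed auto
  also have "integral {(?S 0)\<^sup>2..(?S pi)\<^sup>2} f = Beta ((\<gamma> + 1) / 2) (3/2)"
    using beta by (simp add: integral_unique)
  finally have "((\<lambda>x. (?S x * ?C x) *\<^sub>R f ((?S x)\<^sup>2)) has_integral Beta ((\<gamma> + 1) / 2) (3/2)) {0..pi}" .
  hence I1: "((\<lambda>x. ?S x powr \<gamma> * (?C x)\<^sup>2) has_integral Beta ((\<gamma> + 1) / 2) (3/2)) {0..pi}"
  proof (rule has_integral_eq[rotated])
    fix x assume x: "x \<in> {0..pi}"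
    have "1 - (?S x)\<^sup>2 = (?C x)\<^sup>2" by (simp add: cos_squared_eq)
    moreover have "((?C x)\<^sup>2) powr (3/2 - 1) = ?C x"
      using pos[OF x] by (simp add: powr_half_sqrt)
    moreover have "?S x * ((?S x)\<^sup>2) powr ((\<gamma> + 1) / 2 - 1) = ?S x powr \<gamma>"
    proof (cases "?S x = 0")
      case False
      hence "?S x > 0" using pos[OF x] by simp
      have "?S x * ((?S x)\<^sup>2) powr ((\<gamma> + 1) / 2 - 1) = ?S x powr 1 * (?S x powr 2) powr ((\<gamma> + 1) / 2 - 1)"
        using \<open>?S x > 0\<close> by (simp add: powr_numeral)
      also have "\<dots> = ?S x powr (1 + 2 * ((\<gamma> + 1) / 2 - 1))"
        unfolding powr_powr powr_add ..
      finally show ?thesis by (simp add: field_simps)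
    qed (use assms in simp)
    ultimately have "f ((?S x)\<^sup>2) = ((?S x)\<^sup>2) powr ((\<gamma> + 1) / 2 - 1) * ?C x"
      and *: "?S x * ((?S x)\<^sup>2) powr ((\<gamma> + 1) / 2 - 1) = ?S x powr \<gamma>"
      unfolding f_def by simp_all
    hence "(?S x * ?C x) *\<^sub>R f ((?S x)\<^sup>2) = (?S x * ((?S x)\<^sup>2) powr ((\<gamma> + 1) / 2 - 1)) * (?C x)\<^sup>2"
      by (simp only: real_scaleR_def power2_eq_square mult_ac)
    thus "(?S x * ?C x) *\<^sub>R f ((?S x)\<^sup>2) = ?S x powr \<gamma> * (?C x)\<^sup>2"
      by (simp only: *)
  qed
  \<comment> \<open>Its derivative is (\<gamma> + 2) sin^\<gamma> cos^2 - sin^\<gamma> at the half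
    angle and it vanishes at 0 and \<pi>, so the integral of sin^\<gamma> is \<gamma> + 2 times the
    one with cos^2.\<close>
  define F where "F = (\<lambda>x. 2 * (?S x powr (\<gamma> + 1) * ?C x))"
  have I2: "((\<lambda>x. (\<gamma> + 2) * (?S x powr \<gamma> * (?C x)\<^sup>2) - ?S x powr \<gamma>) has_integral F pi - F 0) {0..pi}"
  proof (rule fundamental_theorem_of_calculus_interior)
    show "continuous_on {0..pi} F"
      unfolding F_def using assms pos by (intro continuous_on_mult continuous_on_powr' continuous_intros) auto
    fix x :: real assume x: "x \<in> {0<..<pi}"
    hence s: "?S x > 0" by (intro sin_gt_zero) auto
    have "(?S has_real_derivative ?C x / 2) (at x)" by (auto intro!: derivative_eq_intros)
    from DERIV_chain2[OF has_real_derivative_powr[OF s, of "\<gamma> + 1"] this]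
    have dS: "((\<lambda>x. ?S x powr (\<gamma> + 1)) has_real_derivative (\<gamma> + 1) * ?S x powr \<gamma> * (?C x / 2)) (at x)"
      by simp
    have "(F has_real_derivative 2 * (((\<gamma> + 1) * ?S x powr \<gamma> * (?C x / 2)) * ?C x + ?S x powr (\<gamma> + 1) * (- ?S x / 2))) (at x)"
      unfolding F_def using s by (auto intro!: derivative_eq_intros dS)
    also have "2 * (((\<gamma> + 1) * ?S x powr \<gamma> * (?C x / 2)) * ?C x + ?S x powr (\<gamma> + 1) * (- ?S x / 2))
       = (\<gamma> + 1) * ?S x powr \<gamma> * (?C x)\<^sup>2 - ?S x powr \<gamma> * (?S x)\<^sup>2"
      using s by (simp add: powr_add power2_eq_square algebra_simps)
    also have "(?S x)\<^sup>2 = 1 - (?C x)\<^sup>2" by (simp add: sin_squared_eq)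
    also have "(\<gamma> + 1) * ?S x powr \<gamma> * (?C x)\<^sup>2 - ?S x powr \<gamma> * (1 - (?C x)\<^sup>2) = (\<gamma> + 2) * (?S x powr \<gamma> * (?C x)\<^sup>2) - ?S x powr \<gamma>"
      by (simp add: algebra_simps)
    finally show "(F has_vector_derivative (\<gamma> + 2) * (?S x powr \<gamma> * (?C x)\<^sup>2) - ?S x powr \<gamma>) (at x)"
      by (simp add: has_real_derivative_iff_has_vector_derivative)
  qed simp
  have "F pi - F 0 = 0" unfolding F_def using assms by simp
  with has_integral_diff[OF has_integral_mult_right[OF I1, of "\<gamma> + 2"] I2]
  have "((\<lambda>x. ?S x powr \<gamma>) has_integral (\<gamma> + 2) * Beta ((\<gamma> + 1) / 2) (3/2)) {0..pi}" by simp
  also have "(\<gamma> + 2) * Beta ((\<gamma> + 1) / 2) (3/2) = sqrt pi * Gamma ((\<gamma> + 1) / 2) / Gamma (\<gamma> / 2 + 1)"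
  proof -
    have "(1/2::real) \<notin> \<int>\<^sub>\<le>\<^sub>0"
    proof
      assume "(1/2::real) \<in> \<int>\<^sub>\<le>\<^sub>0"
      then obtain n where "1/2 = real_of_int n" "n \<le> 0" by (auto elim: nonpos_Ints_cases)
      moreover from this have "real_of_int n \<le> 0" by simp
      ultimately show False by linarith
    qed
    hence "Gamma (3/2 :: real) = sqrt pi / 2"
      using Gamma_plus1[of "1/2::real"] by (simp add: Gamma_one_half_real)
    moreover have "Gamma ((\<gamma> + 1) / 2 + 3/2) = (\<gamma> / 2 + 1) * Gamma (\<gamma> / 2 + 1)"
    proof -
      have "\<gamma> / 2 + 1 \<notin> \<int>\<^sub>\<le>\<^sub>0" using assms by (auto elim!: nonpos_Ints_cases) 
      thus ?thesis using Gamma_plus1[of "\<gamma> / 2 + 1"] by (simp add: add.commute add_divide_distrib)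
    qed
    moreover have "Gamma (\<gamma> / 2 + 1) > 0" using assms by (intro Gamma_real_pos) auto
    moreover define Y where "Y = Gamma (\<gamma> / 2 + 1)"
    moreover define G2 where "G2 = Gamma ((\<gamma> + 1) / 2)"
    ultimately have "(\<gamma> + 2) * Beta ((\<gamma> + 1) / 2) (3/2) = (\<gamma> + 2) * (G2 * (sqrt pi / 2) / ((\<gamma> / 2 + 1) * Y))"
      and "Y > 0" unfolding Beta_def by (simp_all only:)
    moreover have "(k * (G2 * (sqrt pi / 2) / ((k / 2) * Y))) = sqrt pi * G2 / Y" if "k > 0" for k
      using that \<open>Y > 0\<close> by (simp add: field_simps)
    from this[of "\<gamma> + 2"]
    have "(\<gamma> + 2) * (G2 * (sqrt pi / 2) / ((\<gamma> / 2 + 1) * Y)) = sqrt pi * G2 / Y"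
      using assms by (simp add: add_divide_distrib)
    ultimately show ?thesis unfolding G2_def[symmetric] Y_def[symmetric] by simp
  qed
  finally show ?thesis .
qed

lemma Gamma_duplication_real:
  fixes x :: real
  assumes "x > 0"
  shows "Gamma x * Gamma (x + 1/2) = 2 powr (1 - 2 * x) * sqrt pi * Gamma (2 * x)"
proof -
  have "complex_of_real (Gamma x * Gamma (x + 1/2)) = Gamma (complex_of_real x) * Gamma (complex_of_real x + 1/2)"
    using Gamma_complex_of_real[of "x + 1/2"] by (simp add: Gamma_complex_of_real)
  also have "\<dots> = exp ((1 - 2 * complex_of_real x) * of_real (ln 2)) * of_real (sqrt pi) * Gamma (2 * complex_of_real x)"
  proof (rule Gamma_legendre_duplication)
    show "complex_of_real x \<notin> \<int>\<^sub>\<le>\<^sub>0" using assms by (metis complex_nonpos_Reals_iff Re_complex_of_real nonpos_Ints_subset_nonpos_Reals subsetD not_less)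
    show "complex_of_real x + 1/2 \<notin> \<int>\<^sub>\<le>\<^sub>0"
    proof
      assume "complex_of_real x + 1/2 \<in> \<int>\<^sub>\<le>\<^sub>0"
      hence "complex_of_real x + 1/2 \<in> \<real>\<^sub>\<le>\<^sub>0" using nonpos_Ints_subset_nonpos_Reals by blast
      thus False using assms by (simp add: complex_nonpos_Reals_iff)
    qed
  qed
  also have "\<dots> = complex_of_real (exp ((1 - 2 * x) * ln 2) * sqrt pi * Gamma (2 * x))"
    using Gamma_complex_of_real[of "2 * x"] by (simp flip: exp_of_real)
  finally show ?thesis unfolding of_real_eq_iff by (simp add: powr_def)
qed

text \<open>By the differential equation the quotient of the symbol by sin^\<gamma>(\<theta>/2) is
  constant on \<open>{0<..pi}\<close>. Comparing integrals over \<open>{0..pi}\<close> determines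
  the constant as a quotient of Gamma values, which the duplication formula evaluates to
  2^\<gamma>.\<close>

lemma frac_symbol_half_period:
  assumes "1 < \<gamma>" "\<gamma> < 2" "\<theta> \<in> {0..pi}"
  shows "frac_symbol \<gamma> \<theta> = (2 * sin (\<theta> / 2)) powr \<gamma>"
proof -
  let ?F = "frac_symbol \<gamma>"
  have cont: "continuous_on A ?F" for A
    by (intro continuous_at_imp_continuous_on ballI DERIV_isCont[OF has_derivative_frac_symbol[OF assms(1,2)]])
  have pos: "sin (x / 2) > 0" if "x \<in> {0<..pi}" for x :: real
    using that by (intro sin_gt_zero) auto
  \<comment> \<open>The constant is read off at \<pi>, where sin(\<theta>/2) = 1. The point 0 has to
    be excluded from the quotient and is recovered by continuity.\<close>
  define C where "C = ?F pi"
  have "((\<lambda>x. ?F x * sin (x / 2) powr (- \<gamma>)) has_real_derivative 0) (at x within {0<..pi})" if x: "x \<in> {0<..pi}" for x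
  proof -
    let ?F' = "- 2 * (\<Sum>k. real (Suc k) * frac_coeff_nat \<gamma> (Suc k) * sin (real (Suc k) * x))"
    have "((\<lambda>x. ?F x * sin (x / 2) powr (- \<gamma>)) has_real_derivative
        ?F' * sin (x / 2) powr (- \<gamma>) + ?F x * (- \<gamma> * sin (x / 2) powr (- \<gamma> - 1) * (cos (x / 2) / 2))) (at x within {0<..pi})"
      using pos[OF x]
      by (auto intro!: derivative_eq_intros has_field_derivative_at_within[OF has_derivative_frac_symbol[OF assms(1,2)]]
          simp: powr_diff)
    also have "sin (x / 2) powr (- \<gamma>) = sin (x / 2) * sin (x / 2) powr (- \<gamma> - 1)"
      using pos[OF x] by (simp add: powr_diff)
    also have "?F' * (sin (x / 2) * sin (x / 2) powr (- \<gamma> - 1)) = (?F' * sin (x / 2)) * sin (x / 2) powr (- \<gamma> - 1)"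
      by simp
    also note frac_symbol_ode[OF assms(1,2)]
    finally show ?thesis by (simp add: algebra_simps)
  qed
  hence "\<exists>c. \<forall>x\<in>{0<..pi}. ?F x * sin (x / 2) powr (- \<gamma>) = c"
    by (intro has_field_derivative_zero_constant) auto
  then obtain c where "\<forall>x\<in>{0<..pi}. ?F x * sin (x / 2) powr (- \<gamma>) = c" by blast
  moreover from this have "c = C" by (auto simp: C_def dest: bspec[of _ _ pi])
  ultimately have "?F x * sin (x / 2) powr (- \<gamma>) = C" if "x \<in> {0<..pi}" for x
    using that by blast
  hence eq0: "?F x = C * sin (x / 2) powr \<gamma>" if "x \<in> {0<..pi}" for x
    using that pos[OF that] by (simp add: powr_minus_divide) (simp add: divide_eq_eq)
  have eq: "?F x = C * sin (x / 2) powr \<gamma>" if "x \<in> {0..pi}" for x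
  proof -
    have "?F x - C * sin (x / 2) powr \<gamma> = 0"
    proof (rule continuous_constant_on_closure[where f = "\<lambda>x. ?F x - C * sin (x / 2) powr \<gamma>"])
      show "continuous_on (closure {0<..<pi}) (\<lambda>x. ?F x - C * sin (x / 2) powr \<gamma>)"
        using assms by (intro continuous_on_diff continuous_on_mult continuous_on_powr' continuous_intros cont) (auto intro!: sin_ge_zero)
      show "x \<in> closure {0<..<pi}" using that by simp
    qed (use eq0 in auto)
    thus ?thesis by simp
  qed
  have "((\<lambda>x. C * sin (x / 2) powr \<gamma>) has_integral pi * frac_coeff_nat \<gamma> 0) {0..pi}"
    using has_integral_frac_symbol[OF assms(1,2)] eq by (rule has_integral_eq[rotated])
  moreover have "((\<lambda>x. C * sin (x / 2) powr \<gamma>) has_integral C * (sqrt pi * Gamma ((\<gamma> + 1) / 2) / Gamma (\<gamma> / 2 + 1))) {0..pi}"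
    using assms by (intro has_integral_mult_right has_integral_sin_powr) auto
  ultimately have "C * (sqrt pi * Gamma ((\<gamma> + 1) / 2) / Gamma (\<gamma> / 2 + 1)) = pi * (Gamma (\<gamma> + 1) / (Gamma (\<gamma> / 2 + 1))\<^sup>2)"
    using has_integral_unique unfolding frac_coeff_nat.simps by blast
  \<comment> \<open>Duplication at the argument (\<gamma> + 1)/2 relates precisely the three Gamma
    values that occur.\<close>
  moreover have "Gamma ((\<gamma> + 1) / 2) * Gamma (\<gamma> / 2 + 1) = 2 powr (- \<gamma>) * sqrt pi * Gamma (\<gamma> + 1)"
  proof -
    have "2 * ((\<gamma> + 1) / 2) = \<gamma> + 1" "(\<gamma> + 1) / 2 + 1 / 2 = \<gamma> / 2 + 1" "1 - (\<gamma> + 1) = - \<gamma>"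
      by (simp_all add: field_simps)
    moreover have "(\<gamma> + 1) / 2 > 0" using assms by simp
    ultimately show ?thesis using Gamma_duplication_real[of "(\<gamma> + 1) / 2"] by (simp only:)
  qed
  moreover have "Gamma (\<gamma> / 2 + 1) > 0" "Gamma ((\<gamma> + 1) / 2) > 0" "Gamma (\<gamma> + 1) > 0"
    using assms by (auto intro!: Gamma_real_pos)
  moreover define s G1 G2 G3 p where "s = sqrt pi" and "G1 = Gamma (\<gamma> / 2 + 1)"
    and "G2 = Gamma ((\<gamma> + 1) / 2)" and "G3 = Gamma (\<gamma> + 1)" and "p = 2 powr (- \<gamma>)"
  ultimately have CG: "C * (s * G2 / G1) = pi * (G3 / G1\<^sup>2)" and "G2 * G1 = p * s * G3" and "G1 > 0" "G3 > 0"
    by simp_all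
  have "C * s * (G2 * G1) = pi * G3" using CG \<open>G1 > 0\<close> by (simp add: power2_eq_square field_simps)
  hence "(C * p * (s * s)) * G3 = pi * G3" unfolding \<open>G2 * G1 = _\<close> by (simp only: mult_ac)
  hence "C * p * (s * s) = pi" using \<open>G3 > 0\<close> by simp
  hence "(C * 2 powr (- \<gamma>)) * (sqrt pi * sqrt pi) = pi"
    unfolding s_def p_def .
  hence "C * 2 powr (- \<gamma>) = 1" by simp
  hence "C = 2 powr \<gamma>" by (simp add: powr_minus field_simps)
  thus ?thesis using eq[OF assms(3)] assms(3)
    by (subst powr_mult) (auto intro!: sin_ge_zero)
qed

text \<open>By the Chebyshev recurrence cos(k \<theta>) is determined by cos \<theta>, so
  \<open>arccos\<close> reduces every angle to \<open>{0..pi}\<close>.\<close>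

lemma frac_symbol_eq:
  assumes "1 < \<gamma>" "\<gamma> < 2"
  shows "frac_symbol \<gamma> \<theta> = \<bar>2 * sin (\<theta> / 2)\<bar> powr \<gamma>"
proof -
  define r where "r = arccos (cos \<theta>)"
  have r: "cos r = cos \<theta>" "r \<in> {0..pi}"
    unfolding r_def by (auto intro: arccos_lbound arccos_ubound cos_arccos)
  have "cos (real k * r) = cos (real k * \<theta>) \<and> cos (real (Suc k) * r) = cos (real (Suc k) * \<theta>)" for k
  proof (induction k)
    case (Suc k)
    have e: "cos (real (Suc (Suc k)) * x) = 2 * cos x * cos (real (Suc k) * x) - cos (real k * x)" for x
    proof -
      have "real (Suc (Suc k)) * x = real (Suc k) * x + x" "real k * x = real (Suc k) * x - x"
        by (simp_all add: algebra_simps)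
      thus ?thesis by (simp only: cos_add cos_diff) (simp add: algebra_simps)
    qed
    show ?case using Suc unfolding e by (auto simp: r)
  qed (auto simp: r)
  hence "frac_symbol \<gamma> \<theta> = frac_symbol \<gamma> r" unfolding frac_symbol_def by (metis (no_types))
  also have "\<dots> = (2 * sin (r / 2)) powr \<gamma>" by (rule frac_symbol_half_period[OF assms r(2)])
  also have "2 * sin (r / 2) = \<bar>2 * sin (\<theta> / 2)\<bar>"
  proof (rule power2_eq_imp_eq)
    show "(2 * sin (r / 2))\<^sup>2 = \<bar>2 * sin (\<theta> / 2)\<bar>\<^sup>2"
      using cos_double_sin[of "r / 2"] cos_double_sin[of "\<theta> / 2"] r by (simp add: power_mult_distrib)
    show "0 \<le> 2 * sin (r / 2)" using r(2) by (auto intro!: sin_ge_zero)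
  qed simp
  finally show ?thesis .
qed

section \<open>Cosine transforms\<close>

text \<open>Both are the Gamma integral, after the substitutions r t and r t^2. They serve the two
  successive integrations in \<open>nn_integral_Mellin_Poisson\<close>, the second one being of
  Gaussian type.\<close>

lemma Gamma_integral_scaled:
  fixes s r :: real
  assumes "s > 0" "r > 0"
  shows "((\<lambda>t. t powr (s - 1) * exp (- r * t)) has_integral Gamma s * r powr (- s)) {0<..}"
    and "((\<lambda>t. t powr (2 * s - 1) * exp (- r * t\<^sup>2)) has_integral Gamma s * r powr (- s) / 2) {0<..}"
proof -
  define f where "f = (\<lambda>t::real. t powr (s - 1) * exp (- t))"
  have "((\<lambda>t. t powr (s - 1) / exp t) has_integral Gamma s) {0..}"
    by (rule Gamma_integral_real[OF assms(1)])
  hence "((\<lambda>t. if t \<in> {0<..} then f t else 0) has_integral Gamma s) {0..}"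
    by (rule has_integral_spike[of "{0}", rotated 2]) (auto simp: f_def exp_minus field_simps)
  hence f: "(f has_integral Gamma s) {0<..}"
    by (subst (asm) has_integral_restrict) auto
  have f_abs: "f absolutely_integrable_on {0<..}"
    using f by (subst absolutely_integrable_on_iff_nonneg) (auto simp: f_def)
  have img: "(\<lambda>t. r * t) ` {0<..} = {0<..}" "(\<lambda>t. r * t\<^sup>2) ` {0<..} = {0<..}"
  proof -
    have "x = r * (x / r)" "x = r * (sqrt (x / r))\<^sup>2" "x / r > 0" "sqrt (x / r) > 0" if "x > 0" for x
      using that assms by auto
    thus "(\<lambda>t. r * t) ` {0<..} = {0<..}" "(\<lambda>t. r * t\<^sup>2) ` {0<..} = {0<..}"
      using assms by (auto simp: image_iff; (metis greaterThan_iff)?)+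
  qed
  have "(\<lambda>x. \<bar>r\<bar> * f (r * x)) absolutely_integrable_on {0<..} \<and> integral {0<..} (\<lambda>x. \<bar>r\<bar> * f (r * x)) = Gamma s"
    using f_abs f assms img
    by (subst has_absolute_integral_change_of_variables_1')
      (auto intro!: derivative_eq_intros inj_onI simp: integral_unique)
  hence "((\<lambda>x. \<bar>r\<bar> * f (r * x)) has_integral Gamma s) {0<..}"
    by (metis has_integral_integral set_lebesgue_integral_eq_integral(1))
  hence "((\<lambda>x. r powr (- s) * (\<bar>r\<bar> * f (r * x))) has_integral r powr (- s) * Gamma s) {0<..}"
    by (rule has_integral_mult_right)
  thus "((\<lambda>t. t powr (s - 1) * exp (- r * t)) has_integral Gamma s * r powr (- s)) {0<..}"
  proof (subst (asm) has_integral_cong)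
    fix t :: real assume "t \<in> {0<..}"
    thus "r powr (- s) * (\<bar>r\<bar> * f (r * t)) = t powr (s - 1) * exp (- r * t)"
      using assms by (simp add: f_def powr_mult powr_diff powr_minus field_simps)
  qed (simp add: mult.commute)
  have "(\<lambda>x. \<bar>2 * r * x\<bar> * f (r * x\<^sup>2)) absolutely_integrable_on {0<..} \<and> integral {0<..} (\<lambda>x. \<bar>2 * r * x\<bar> * f (r * x\<^sup>2)) = Gamma s"
    using f_abs f assms img
    by (subst has_absolute_integral_change_of_variables_1'[where g = "\<lambda>x. r * x\<^sup>2"])
      (auto intro!: derivative_eq_intros inj_onI simp: integral_unique)
  hence "((\<lambda>x. \<bar>2 * r * x\<bar> * f (r * x\<^sup>2)) has_integral Gamma s) {0<..}"
    by (metis has_integral_integral set_lebesgue_integral_eq_integral(1))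
  hence "((\<lambda>x. r powr (- s) / 2 * (\<bar>2 * r * x\<bar> * f (r * x\<^sup>2))) has_integral r powr (- s) / 2 * Gamma s) {0<..}"
    by (rule has_integral_mult_right)
  thus "((\<lambda>t. t powr (2 * s - 1) * exp (- r * t\<^sup>2)) has_integral Gamma s * r powr (- s) / 2) {0<..}"
  proof (subst (asm) has_integral_cong)
    fix t :: real assume t: "t \<in> {0<..}"
    hence "(t\<^sup>2) powr (s - 1) = t powr (2 * s - 2)"
      using powr_powr[of t 2 "s - 1"] by (simp add: powr_numeral algebra_simps)
    thus "r powr (- s) / 2 * (\<bar>2 * r * t\<bar> * f (r * t\<^sup>2)) = t powr (2 * s - 1) * exp (- r * t\<^sup>2)"
      using t assms by (simp add: f_def powr_mult powr_diff powr_minus power2_eq_square field_simps powr_numeral)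
  qed (simp add: mult.commute)
qed

lemma nn_integral_Gamma_scaled:
  fixes s r :: real
  assumes "s > 0" "r > 0"
  shows "(\<integral>\<^sup>+t. ennreal (indicator {0<..} t * (t powr (s - 1) * exp (- r * t))) \<partial>lborel) = ennreal (Gamma s * r powr (- s))"
    and "(\<integral>\<^sup>+t. ennreal (indicator {0<..} t * (t powr (2 * s - 1) * exp (- r * t\<^sup>2))) \<partial>lborel) = ennreal (Gamma s * r powr (- s) / 2)"
  using nn_integral_has_integral_lebesgue[OF _ Gamma_integral_scaled(1)[OF assms]]
    nn_integral_has_integral_lebesgue[OF _ Gamma_integral_scaled(2)[OF assms]] by simp_all

text \<open>Write \<open>1 / (t\<^sup>2 + s\<^sup>2)\<close> as a Laplace transform and interchange the integrals.\<close>

lemma nn_integral_Mellin_Poisson: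
  fixes \<mu> s :: real
  assumes "0 < \<mu>" "\<mu> < 1" "s \<noteq> 0"
  shows "(\<integral>\<^sup>+t. ennreal (indicator {0<..} t * (t powr (1 - \<mu>) / (t\<^sup>2 + s\<^sup>2))) \<partial>lborel)
    = ennreal (pi / (2 * sin (pi * \<mu> / 2)) * \<bar>s\<bar> powr (- \<mu>))"
proof -
  let ?I = "indicator {0<..} :: real \<Rightarrow> real"
  have inner: "(\<integral>\<^sup>+r. ennreal (?I r * exp (- (t\<^sup>2 + s\<^sup>2) * r)) \<partial>lborel) = ennreal (1 / (t\<^sup>2 + s\<^sup>2))" for t
  proof -
    have "t\<^sup>2 + s\<^sup>2 > 0" using assms by (simp add: add_nonneg_pos)
    have "(\<integral>\<^sup>+r. ennreal (?I r * exp (- (t\<^sup>2 + s\<^sup>2) * r)) \<partial>lborel)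
        = (\<integral>\<^sup>+r. ennreal (?I r * (r powr (1 - 1) * exp (- (t\<^sup>2 + s\<^sup>2) * r))) \<partial>lborel)"
      by (intro nn_integral_cong) (auto simp: indicator_def)
    also have "\<dots> = ennreal (1 / (t\<^sup>2 + s\<^sup>2))"
    proof -
      have "Gamma 1 * (t\<^sup>2 + s\<^sup>2) powr (- 1) = 1 / (t\<^sup>2 + s\<^sup>2)"
        using powr_minus_divide[of "t\<^sup>2 + s\<^sup>2" 1] powr_one[OF less_imp_le[OF \<open>t\<^sup>2 + s\<^sup>2 > 0\<close>]] by (simp only: Gamma_1 mult_1_left)
      thus ?thesis
        using nn_integral_Gamma_scaled(1)[OF zero_less_one \<open>t\<^sup>2 + s\<^sup>2 > 0\<close>] by (simp only:)
    qed
    finally show ?thesis .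
  qed
  have mult: "ennreal (?I t * t powr (1 - \<mu>)) * ennreal (1 / (t\<^sup>2 + s\<^sup>2)) = ennreal (?I t * (t powr (1 - \<mu>) / (t\<^sup>2 + s\<^sup>2)))" for t
  proof -
    have "ennreal (?I t * t powr (1 - \<mu>)) * ennreal (1 / (t\<^sup>2 + s\<^sup>2)) = ennreal ((?I t * t powr (1 - \<mu>)) * (1 / (t\<^sup>2 + s\<^sup>2)))"
      by (rule ennreal_mult[symmetric]) auto
    also have "(?I t * t powr (1 - \<mu>)) * (1 / (t\<^sup>2 + s\<^sup>2)) = ?I t * (t powr (1 - \<mu>) / (t\<^sup>2 + s\<^sup>2))"
      by (simp only: times_divide_eq_right mult_1_right mult.assoc)
    finally show ?thesis .
  qed
  have "(\<integral>\<^sup>+t. ennreal (?I t * (t powr (1 - \<mu>) / (t\<^sup>2 + s\<^sup>2))) \<partial>lborel)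
      = (\<integral>\<^sup>+t. \<integral>\<^sup>+r. ennreal (?I t * t powr (1 - \<mu>)) * ennreal (?I r * exp (- (t\<^sup>2 + s\<^sup>2) * r)) \<partial>lborel \<partial>lborel)"
  proof (intro nn_integral_cong)
    fix t
    have "(\<integral>\<^sup>+r. ennreal (?I t * t powr (1 - \<mu>)) * ennreal (?I r * exp (- (t\<^sup>2 + s\<^sup>2) * r)) \<partial>lborel)
        = ennreal (?I t * t powr (1 - \<mu>)) * (\<integral>\<^sup>+r. ennreal (?I r * exp (- (t\<^sup>2 + s\<^sup>2) * r)) \<partial>lborel)"
      by (rule nn_integral_cmult) simp
    also have "\<dots> = ennreal (?I t * (t powr (1 - \<mu>) / (t\<^sup>2 + s\<^sup>2)))"
      unfolding inner by (rule mult)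
    finally show "ennreal (?I t * (t powr (1 - \<mu>) / (t\<^sup>2 + s\<^sup>2)))
        = (\<integral>\<^sup>+r. ennreal (?I t * t powr (1 - \<mu>)) * ennreal (?I r * exp (- (t\<^sup>2 + s\<^sup>2) * r)) \<partial>lborel)"
      by (rule sym)
  qed
  \<comment> \<open>All integrands are nonnegative, so the order of integration may be exchanged
    before anything is known about integrability.\<close>
  also have "\<dots> = (\<integral>\<^sup>+r. \<integral>\<^sup>+t. ennreal (?I t * t powr (1 - \<mu>)) * ennreal (?I r * exp (- (t\<^sup>2 + s\<^sup>2) * r)) \<partial>lborel \<partial>lborel)"
    by (rule lborel_pair.Fubini') measurable
  also have "\<dots> = (\<integral>\<^sup>+r. ennreal (Gamma (1 - \<mu> / 2) / 2) * ennreal (?I r * (r powr (\<mu> / 2 - 1) * exp (- s\<^sup>2 * r))) \<partial>lborel)"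
  proof (intro nn_integral_cong)
    fix r :: real
    show "(\<integral>\<^sup>+t. ennreal (?I t * t powr (1 - \<mu>)) * ennreal (?I r * exp (- (t\<^sup>2 + s\<^sup>2) * r)) \<partial>lborel)
       = ennreal (Gamma (1 - \<mu> / 2) / 2) * ennreal (?I r * (r powr (\<mu> / 2 - 1) * exp (- s\<^sup>2 * r)))"
    proof (cases "r > 0")
      case True
      have "(\<integral>\<^sup>+t. ennreal (?I t * t powr (1 - \<mu>)) * ennreal (?I r * exp (- (t\<^sup>2 + s\<^sup>2) * r)) \<partial>lborel)
        = (\<integral>\<^sup>+t. ennreal (exp (- s\<^sup>2 * r)) * ennreal (?I t * (t powr (2 * (1 - \<mu> / 2) - 1) * exp (- r * t\<^sup>2))) \<partial>lborel)"
      proof (rule nn_integral_cong)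
        fix t :: real
        have "exp (- (t\<^sup>2 + s\<^sup>2) * r) = exp (- s\<^sup>2 * r) * exp (- r * t\<^sup>2)"
          unfolding exp_add[symmetric] by (simp add: algebra_simps)
        moreover have "2 * (1 - \<mu> / 2) - 1 = 1 - \<mu>" by simp
        ultimately have "(?I t * t powr (1 - \<mu>)) * (?I r * exp (- (t\<^sup>2 + s\<^sup>2) * r)) = exp (- s\<^sup>2 * r) * (?I t * (t powr (2 * (1 - \<mu> / 2) - 1) * exp (- r * t\<^sup>2)))"
          using True by (simp only: indicator_simps greaterThan_iff mult_1_left mult_ac)
        thus "ennreal (?I t * t powr (1 - \<mu>)) * ennreal (?I r * exp (- (t\<^sup>2 + s\<^sup>2) * r))
            = ennreal (exp (- s\<^sup>2 * r)) * ennreal (?I t * (t powr (2 * (1 - \<mu> / 2) - 1) * exp (- r * t\<^sup>2)))"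
          by (subst (1 2) ennreal_mult[symmetric]) (simp_all only: mult_nonneg_nonneg indicator_pos_le powr_ge_zero exp_ge_zero)
      qed
      also have "\<dots> = ennreal (exp (- s\<^sup>2 * r)) * ennreal (Gamma (1 - \<mu> / 2) * r powr (- (1 - \<mu> / 2)) / 2)"
        by (subst nn_integral_cmult) (use nn_integral_Gamma_scaled(2)[of "1 - \<mu> / 2" r] assms True in simp_all)
      also have "\<dots> = ennreal (Gamma (1 - \<mu> / 2) / 2) * ennreal (?I r * (r powr (\<mu> / 2 - 1) * exp (- s\<^sup>2 * r)))"
        using True assms Gamma_real_pos[of "1 - \<mu> / 2"] by (simp add: mult_ac flip: ennreal_mult)
      finally show ?thesis .
    qed simp
  qed
  also have "\<dots> = ennreal (Gamma (1 - \<mu> / 2) / 2) * ennreal (Gamma (\<mu> / 2) * (s\<^sup>2) powr (- (\<mu> / 2)))"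
    by (subst nn_integral_cmult) (use nn_integral_Gamma_scaled(1)[of "\<mu> / 2" "s\<^sup>2"] assms in simp_all)
  also have "\<dots> = ennreal (Gamma (\<mu> / 2) * Gamma (1 - \<mu> / 2) / 2 * (s\<^sup>2) powr (- (\<mu> / 2)))"
    using assms Gamma_real_pos[of "1 - \<mu> / 2"] Gamma_real_pos[of "\<mu> / 2"] by (simp add: mult_ac flip: ennreal_mult)
  also have "Gamma (\<mu> / 2) * Gamma (1 - \<mu> / 2) = pi / sin (pi * \<mu> / 2)"
  proof -
    have "complex_of_real (Gamma (\<mu> / 2) * Gamma (1 - \<mu> / 2)) = Gamma (of_real (\<mu> / 2)) * Gamma (1 - of_real (\<mu> / 2))"
      by (simp flip: Gamma_complex_of_real)
    also have "\<dots> = complex_of_real (pi / sin (pi * (\<mu> / 2)))"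
      unfolding Gamma_reflection_complex by (simp flip: sin_of_real)
    finally show ?thesis unfolding of_real_eq_iff by simp
  qed
  also have "(s\<^sup>2) powr (- (\<mu> / 2)) = \<bar>s\<bar> powr (- \<mu>)"
  proof -
    have "s\<^sup>2 = \<bar>s\<bar> powr 2" using assms by simp
    hence "(s\<^sup>2) powr (- (\<mu> / 2)) = (\<bar>s\<bar> powr 2) powr (- (\<mu> / 2))" by (simp only:)
    also have "\<dots> = \<bar>s\<bar> powr (- \<mu>)" unfolding powr_powr by simp
    finally show ?thesis .
  qed
  finally show ?thesis by (simp add: mult.commute)
qed

lemma LBINT_swap:
  fixes K :: "real \<Rightarrow> real \<Rightarrow> real"
  assumes "case_prod K \<in> borel_measurable (lborel \<Otimes>\<^sub>M lborel)"
    and "AE s in lborel. integrable lborel (K s)"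
    and "integrable lborel (\<lambda>s. LBINT t. \<bar>K s t\<bar>)"
  shows "(LBINT s. LBINT t. K s t) = (LBINT t. LBINT s. K s t)"
proof -
  have "integrable (lborel \<Otimes>\<^sub>M lborel) (case_prod K)"
    using assms by (intro lborel_pair.Fubini_integrable) auto
  from lborel_pair.Fubini_integral[OF this] show ?thesis ..
qed

lemma integral_Poisson_kernel:
  "integrable lborel (\<lambda>r::real. 1 / (1 + r\<^sup>2))" "(LBINT r. 1 / (1 + r\<^sup>2)) = pi"
proof -
  have top: "((arctan \<circ> real_of_ereal) \<longlongrightarrow> pi / 2) (at_left \<infinity>)"
    by (simp add: ereal_tendsto_simps tendsto_arctan_at_top)
  have bot: "((arctan \<circ> real_of_ereal) \<longlongrightarrow> - (pi / 2)) (at_right (-\<infinity>))"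
    by (simp add: ereal_tendsto_simps tendsto_arctan_at_bot)
  have d: "DERIV arctan x :> 1 / (1 + x\<^sup>2)" for x
    by (auto intro!: derivative_eq_intros simp: divide_inverse)
  have c: "isCont (\<lambda>x::real. 1 / (1 + x\<^sup>2)) x" for x
    by (intro continuous_intros) (simp add: add_nonneg_eq_0_iff)
  have nn: "AE x in lborel. -\<infinity> < ereal x \<longrightarrow> ereal x < \<infinity> \<longrightarrow> 0 \<le> 1 / (1 + x\<^sup>2)"
    by simp
  note * = interval_integral_FTC_nonneg[OF _ d c nn bot top, simplified]
  show "integrable lborel (\<lambda>r::real. 1 / (1 + r\<^sup>2))"
    using *(1) by (simp add: set_integrable_def)
  show "(LBINT r. 1 / (1 + r\<^sup>2)) = pi"
    using *(2) by (simp add: interval_lebesgue_integral_def set_lebesgue_integral_def)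
qed

text \<open>Scaling y = x + r/(n + 1) turns the shrinking Poisson kernel into the fixed weight 1/(1
  + r^2). Besides boundedness only continuity at the single point x enters, so the lemma applies to
  functions that jump elsewhere.\<close>

lemma Poisson_integral_tendsto:
  fixes f :: "real \<Rightarrow> real"
  assumes [measurable]: "f \<in> borel_measurable borel" and B: "\<And>y. \<bar>f y\<bar> \<le> B" and cont: "isCont f x"
  shows "(\<lambda>n. LBINT y. f y * (inverse (real (Suc n)) / ((inverse (real (Suc n)))\<^sup>2 + (x - y)\<^sup>2))) \<longlonglongrightarrow> pi * f x"
proof -
  let ?e = "\<lambda>n. inverse (real (Suc n))"
  have eq: "(LBINT y. f y * (?e n / ((?e n)\<^sup>2 + (x - y)\<^sup>2))) = (LBINT r. f (x + ?e n * r) * (1 / (1 + r\<^sup>2)))" for n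
  proof -
    have "?e n * (f (x + ?e n * r) * (?e n / ((?e n)\<^sup>2 + (x - (x + ?e n * r))\<^sup>2))) = f (x + ?e n * r) * (1 / (1 + r\<^sup>2))" for r
    proof -
      have "?e n > 0" by simp
      moreover have "e * (w * (e / (e\<^sup>2 + (x - (x + e * r))\<^sup>2))) = w * (1 / (1 + r\<^sup>2))" if "e > 0" for e w
      proof -
        have "e\<^sup>2 + (x - (x + e * r))\<^sup>2 = e\<^sup>2 * (1 + r\<^sup>2)" by (simp add: power2_eq_square algebra_simps)
        thus ?thesis using that by (simp add: power2_eq_square)
      qed
      ultimately show ?thesis by blast
    qed
    thus ?thesis
      by (subst lborel_integral_real_affine[where c = "?e n" and t = x]) (simp_all flip: integral_mult_right_zero)
  qed
  have "(\<lambda>n. LBINT r. f (x + ?e n * r) * (1 / (1 + r\<^sup>2))) \<longlonglongrightarrow> (LBINT r. f x * (1 / (1 + r\<^sup>2)))"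
  proof (rule integral_dominated_convergence[where w = "\<lambda>r. B * (1 / (1 + r\<^sup>2))"])
    show "integrable lborel (\<lambda>r. B * (1 / (1 + r\<^sup>2)))"
      by (rule integrable_mult_right) (rule integral_Poisson_kernel(1))
    show "AE r in lborel. (\<lambda>n. f (x + ?e n * r) * (1 / (1 + r\<^sup>2))) \<longlonglongrightarrow> f x * (1 / (1 + r\<^sup>2))"
    proof (intro AE_I2 tendsto_mult tendsto_const)
      fix r
      have "(\<lambda>n. x + ?e n * r) \<longlonglongrightarrow> x + 0 * r" by (intro tendsto_intros LIMSEQ_inverse_real_of_nat)
      thus "(\<lambda>n. f (x + ?e n * r)) \<longlonglongrightarrow> f x" by (intro isCont_tendsto_compose[OF cont]) simp
    qed
    show "AE r in lborel. norm (f (x + ?e n * r) * (1 / (1 + r\<^sup>2))) \<le> B * (1 / (1 + r\<^sup>2))" for n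
      using B by (intro AE_I2) (auto simp: abs_mult intro!: divide_right_mono)
  qed simp_all
  also have "(LBINT r. f x * (1 / (1 + r\<^sup>2))) = pi * f x"
    unfolding integral_mult_right_zero integral_Poisson_kernel(2) by simp
  finally show ?thesis unfolding eq .
qed


lemma has_bochner_integral_Gamma_scaled:
  fixes s r :: real
  assumes "s > 0" "r > 0"
  shows "has_bochner_integral lborel (\<lambda>t. indicator {0<..} t * (t powr (s - 1) * exp (- r * t))) (Gamma s * r powr (- s))"
  using assms Gamma_real_pos[of s]
  by (intro has_bochner_integral_nn_integral nn_integral_Gamma_scaled(1)) auto

lemma has_bochner_integral_exp_half_line:
  assumes "(r::real) > 0"
  shows "has_bochner_integral lborel (\<lambda>t. indicator {0<..} t * exp (- r * t)) (1 / r)"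
proof -
  have "(\<lambda>t::real. indicator {0<..} t * (t powr (1 - 1) * exp (- r * t))) = (\<lambda>t. indicator {0<..} t * exp (- r * t))"
    by (auto simp: indicator_def)
  with has_bochner_integral_Gamma_scaled[of 1 r] show ?thesis
    using assms by (simp add: powr_minus divide_inverse)
qed

lemma integral_exp_cos_half_line:
  assumes "(\<epsilon>::real) > 0"
  shows "integrable lborel (\<lambda>\<omega>. indicator {0<..} \<omega> * (exp (- \<epsilon> * \<omega>) * cos (\<omega> * s)))"
    and "(LBINT \<omega>. indicator {0<..} \<omega> * (exp (- \<epsilon> * \<omega>) * cos (\<omega> * s))) = \<epsilon> / (\<epsilon>\<^sup>2 + s\<^sup>2)"
proof -
  let ?h = "\<lambda>\<omega>. exp (- \<epsilon> * \<omega>) * cos (\<omega> * s)"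
  have int_exp: "integrable lborel (\<lambda>t. indicator {0<..} t * exp (- \<epsilon> * t))"
    using has_bochner_integral_exp_half_line[OF assms] by (auto simp: has_bochner_integral_iff)
  show int: "integrable lborel (\<lambda>\<omega>. indicator {0<..} \<omega> * ?h \<omega>)"
    by (rule Bochner_Integration.integrable_bound[OF int_exp]) (auto simp: indicator_def abs_mult)
  define D where "D = \<epsilon>\<^sup>2 + s\<^sup>2"
  have D: "D > 0" unfolding D_def using assms by (simp add: add_pos_nonneg)
  define F where "F = (\<lambda>\<omega>. exp (- \<epsilon> * \<omega>) * (s * sin (\<omega> * s) - \<epsilon> * cos (\<omega> * s)) / D)"
  have "(LBINT \<omega>=0..\<infinity>. ?h \<omega>) = 0 - F 0"
  proof (rule interval_integral_FTC_integrable)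
    fix \<omega> :: real
    have "(F has_real_derivative (exp (- \<epsilon> * \<omega>) * (s * (cos (\<omega> * s) * s) + \<epsilon> * (sin (\<omega> * s) * s))
        - \<epsilon> * exp (- \<epsilon> * \<omega>) * (s * sin (\<omega> * s) - \<epsilon> * cos (\<omega> * s))) / D) (at \<omega>)"
      unfolding F_def using D by (auto intro!: derivative_eq_intros simp: field_simps)
    also have "(exp (- \<epsilon> * \<omega>) * (s * (cos (\<omega> * s) * s) + \<epsilon> * (sin (\<omega> * s) * s))
        - \<epsilon> * exp (- \<epsilon> * \<omega>) * (s * sin (\<omega> * s) - \<epsilon> * cos (\<omega> * s))) / D = ?h \<omega> * D / D"
      unfolding D_def by (simp add: power2_eq_square algebra_simps)
    finally show "(F has_vector_derivative ?h \<omega>) (at \<omega>)"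
      using D by (simp add: has_real_derivative_iff_has_vector_derivative)
  next
    show "set_integrable lborel (einterval 0 \<infinity>) ?h"
      using int by (simp add: set_integrable_def einterval_def zero_ereal_def greaterThan_def)
    have "isCont F 0" unfolding F_def using D by (intro continuous_intros) auto
    hence "(F \<longlongrightarrow> F 0) (at_right 0)"
      unfolding isCont_def by (rule filterlim_mono) (auto intro: at_le)
    thus "((F \<circ> real_of_ereal) \<longlongrightarrow> F 0) (at_right 0)"
      unfolding zero_ereal_def by (simp only: ereal_tendsto_simps)
    have "((\<lambda>\<omega>. exp (- \<epsilon> * \<omega>) * ((\<bar>s\<bar> + \<epsilon>) / D)) \<longlongrightarrow> 0 * ((\<bar>s\<bar> + \<epsilon>) / D)) at_top"
    proof (intro tendsto_mult tendsto_const)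
      have "filterlim (\<lambda>\<omega>. - \<epsilon> * \<omega>) at_bot at_top"
        using assms by (intro filterlim_tendsto_neg_mult_at_bot[OF tendsto_const] filterlim_ident) auto
      thus "((\<lambda>\<omega>. exp (- \<epsilon> * \<omega>)) \<longlongrightarrow> 0) at_top"
        by (rule filterlim_compose[OF exp_at_bot])
    qed
    hence "((\<lambda>\<omega>. exp (- \<epsilon> * \<omega>) * ((\<bar>s\<bar> + \<epsilon>) / D)) \<longlongrightarrow> 0) at_top" by simp
    hence "(F \<longlongrightarrow> 0) at_top"
    proof (rule Lim_null_comparison[rotated])
      show "\<forall>\<^sub>F \<omega> in at_top. norm (F \<omega>) \<le> exp (- \<epsilon> * \<omega>) * ((\<bar>s\<bar> + \<epsilon>) / D)"
      proof (intro always_eventually allI)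
        fix \<omega>
        have "\<bar>s * sin (\<omega> * s) - \<epsilon> * cos (\<omega> * s)\<bar> \<le> \<bar>s * sin (\<omega> * s)\<bar> + \<bar>\<epsilon> * cos (\<omega> * s)\<bar>" by (rule abs_triangle_ineq4)
        also have "\<dots> \<le> \<bar>s\<bar> + \<epsilon>"
          using assms by (intro add_mono) (auto simp: abs_mult intro!: mult_left_le)
        finally show "norm (F \<omega>) \<le> exp (- \<epsilon> * \<omega>) * ((\<bar>s\<bar> + \<epsilon>) / D)"
          unfolding F_def using D by (simp add: abs_mult divide_right_mono)
      qed
    qed
    thus "((F \<circ> real_of_ereal) \<longlongrightarrow> 0) (at_left \<infinity>)"
      by (simp only: ereal_tendsto_simps)
  qed (auto intro!: continuous_intros simp: zero_ereal_def)
  thus "(LBINT \<omega>. indicator {0<..} \<omega> * ?h \<omega>) = \<epsilon> / (\<epsilon>\<^sup>2 + s\<^sup>2)"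
    by (simp add: interval_lebesgue_integral_def set_lebesgue_integral_def einterval_def zero_ereal_def
        greaterThan_def F_def D_def)
qed

section \<open>Cosine transforms with a phase\<close>

text \<open>For integrable real f this is the real part of e^(i \<theta>) times the Fourier
  transform. The phase keeps the calculus real: \<theta> = \<omega> x yields the integrand of the
  inversion formula at x, and a derivative becomes a shift of \<theta> by \<pi>/2.\<close>

definition cosine_transform :: "(real \<Rightarrow> real) \<Rightarrow> real \<Rightarrow> real \<Rightarrow> real" where
  "cosine_transform f \<theta> \<omega> = (LBINT y. f y * cos (\<theta> - \<omega> * y))"

lemma integrable_times_bounded:
  fixes f g :: "real \<Rightarrow> real"
  assumes "integrable lborel f" "g \<in> borel_measurable borel" "\<And>y. \<bar>g y\<bar> \<le> B"
  shows "integrable lborel (\<lambda>y. f y * g y)"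
proof (rule Bochner_Integration.integrable_bound[of _ "\<lambda>y. B * f y"])
  show "AE y in lborel. norm (f y * g y) \<le> norm (B * f y)"
  proof (intro AE_I2)
    fix y
    have "\<bar>f y\<bar> * \<bar>g y\<bar> \<le> \<bar>f y\<bar> * \<bar>B\<bar>" using assms(3)[of y] by (intro mult_left_mono) auto
    thus "norm (f y * g y) \<le> norm (B * f y)" by (simp add: abs_mult mult.commute)
  qed
qed (use assms in auto)

lemma integrable_cosine_transform:
  fixes f :: "real \<Rightarrow> real"
  assumes "integrable lborel f"
  shows "integrable lborel (\<lambda>y. f y * cos (\<theta> - \<omega> * y))"
  by (rule integrable_times_bounded[OF assms, of _ 1]) auto

lemma cosine_transform_bound:
  assumes "integrable lborel f"
  shows "\<bar>cosine_transform f \<theta> \<omega>\<bar> \<le> (LBINT y. \<bar>f y\<bar>)"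
proof -
  have "\<bar>cosine_transform f \<theta> \<omega>\<bar> \<le> (LBINT y. \<bar>f y * cos (\<theta> - \<omega> * y)\<bar>)"
    unfolding cosine_transform_def by (rule integral_abs_bound)
  also have "\<dots> \<le> (LBINT y. \<bar>f y\<bar>)"
    using integrable_abs[OF assms] integrable_abs[OF integrable_cosine_transform[OF assms]]
    by (intro integral_mono) (auto simp: abs_mult intro!: mult_left_le)
  finally show ?thesis .
qed

lemma measurable_cosine_transform [measurable]:
  assumes [measurable]: "f \<in> borel_measurable borel"
  shows "(\<lambda>\<omega>. cosine_transform f (\<omega> * x) \<omega>) \<in> borel_measurable borel"
  unfolding cosine_transform_def by simp

text \<open>A factor e^(i \<theta>) has modulus one, so the bound does not see the phase.\<close>

lemma cosine_transform_le_fourier: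
  assumes f: "integrable lborel f"
  shows "\<bar>cosine_transform f \<theta> \<omega>\<bar> \<le> cmod (fourier_transform f \<omega>)"
proof -
  let ?h = "\<lambda>y. exp (- \<i> * of_real (\<omega> * y)) * complex_of_real (f y)"
  have [measurable]: "f \<in> borel_measurable borel" using f by auto
  have int: "integrable lborel ?h"
  proof (rule Bochner_Integration.integrable_bound[OF f])
    show "?h \<in> borel_measurable lborel" by simp
    have "cmod (exp (- \<i> * of_real (\<omega> * y))) = 1" for y by (simp add: norm_exp_eq_Re)
    thus "AE y in lborel. norm (?h y) \<le> norm (f y)" by (simp add: norm_mult)
  qed
  have "Re (exp (\<i> * of_real \<theta>) * fourier_transform f \<omega>) = Re (LBINT y. exp (\<i> * of_real \<theta>) * ?h y)"
    unfolding fourier_transform_def by simp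
  also have "\<dots> = (LBINT y. Re (exp (\<i> * of_real \<theta>) * ?h y))"
    using int by (intro integral_Re[symmetric]) simp
  also have "\<dots> = cosine_transform f \<theta> \<omega>"
    unfolding cosine_transform_def
  proof (intro Bochner_Integration.integral_cong refl)
    fix y
    have "exp (\<i> * of_real \<theta>) * exp (- \<i> * of_real (\<omega> * y)) = exp (\<i> * of_real (\<theta> - \<omega> * y))"
      unfolding exp_add[symmetric] by (simp add: algebra_simps)
    hence "exp (\<i> * of_real \<theta>) * ?h y = exp (\<i> * of_real (\<theta> - \<omega> * y)) * of_real (f y)"
      by (simp only: mult.assoc[symmetric])
    also have "Re \<dots> = f y * cos (\<theta> - \<omega> * y)"
      by (simp add: Re_exp del: of_real_diff of_real_mult)
    finally show "Re (exp (\<i> * of_real \<theta>) * ?h y) = f y * cos (\<theta> - \<omega> * y)" .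
  qed
  finally have "\<bar>cosine_transform f \<theta> \<omega>\<bar> \<le> cmod (exp (\<i> * of_real \<theta>) * fourier_transform f \<omega>)"
    by (metis abs_Re_le_cmod)
  thus ?thesis by (simp add: norm_mult norm_exp_eq_Re)
qed

text \<open>The damping makes the double integral absolutely convergent, and the frequency integral
  of e^(-\<epsilon> \<omega>) cos(\<omega> (x - y)) is the Poisson kernel.\<close>

lemma Abel_mean_cosine_transform:
  assumes f: "integrable lborel f" and "(\<epsilon>::real) > 0"
  shows "(LBINT \<omega>. indicator {0<..} \<omega> * (exp (- \<epsilon> * \<omega>) * cosine_transform f (\<omega> * x) \<omega>))
    = (LBINT y. f y * (\<epsilon> / (\<epsilon>\<^sup>2 + (x - y)\<^sup>2)))"
proof -
  have [measurable]: "f \<in> borel_measurable borel" using f by auto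
  let ?e = "\<lambda>\<omega>. indicator {0<..} \<omega> * exp (- \<epsilon> * \<omega>) :: real"
  define K where "K = (\<lambda>\<omega> y. ?e \<omega> * (f y * cos (\<omega> * x - \<omega> * y)))"
  have int_exp: "integrable lborel ?e"
    using has_bochner_integral_exp_half_line[OF assms(2)] by (auto simp: has_bochner_integral_iff)
  have "(LBINT \<omega>. LBINT y. K \<omega> y) = (LBINT y. LBINT \<omega>. K \<omega> y)"
  proof (rule LBINT_swap[where K = K])
    show "case_prod K \<in> borel_measurable (lborel \<Otimes>\<^sub>M lborel)" unfolding K_def by simp
    show "AE \<omega> in lborel. integrable lborel (K \<omega>)"
      unfolding K_def using integrable_cosine_transform[OF f] by simp
    show "integrable lborel (\<lambda>\<omega>. LBINT y. \<bar>K \<omega> y\<bar>)"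
    proof (rule Bochner_Integration.integrable_bound[OF integrable_mult_left[OF int_exp, of "LBINT y. \<bar>f y\<bar>"]])
      show "AE \<omega> in lborel. norm (LBINT y. \<bar>K \<omega> y\<bar>) \<le> norm (?e \<omega> * (LBINT y. \<bar>f y\<bar>))"
      proof (intro AE_I2)
        fix \<omega>
        have "(LBINT y. \<bar>K \<omega> y\<bar>) = ?e \<omega> * (LBINT y. \<bar>f y * cos (\<omega> * x - \<omega> * y)\<bar>)"
          unfolding K_def by (simp add: abs_mult)
        also have "\<dots> \<le> ?e \<omega> * (LBINT y. \<bar>f y\<bar>)"
          using integrable_abs[OF f] integrable_abs[OF integrable_cosine_transform[OF f]]
          by (intro mult_left_mono integral_mono) (auto simp: abs_mult intro!: mult_left_le)
        finally show "norm (LBINT y. \<bar>K \<omega> y\<bar>) \<le> norm (?e \<omega> * (LBINT y. \<bar>f y\<bar>))" by simp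
      qed
    qed (simp add: K_def)
  qed
  moreover have "(LBINT y. K \<omega> y) = indicator {0<..} \<omega> * (exp (- \<epsilon> * \<omega>) * cosine_transform f (\<omega> * x) \<omega>)" for \<omega>
    unfolding K_def cosine_transform_def by simp
  moreover have "(LBINT \<omega>. K \<omega> y) = f y * (\<epsilon> / (\<epsilon>\<^sup>2 + (x - y)\<^sup>2))" for y
  proof -
    have "K \<omega> y = f y * (indicator {0<..} \<omega> * (exp (- \<epsilon> * \<omega>) * cos (\<omega> * (x - y))))" for \<omega>
      unfolding K_def by (simp add: algebra_simps)
    thus ?thesis using integral_exp_cos_half_line(2)[OF assms(2), of "x - y"] by simp
  qed
  ultimately show ?thesis by simp
qed

text \<open>Abel summation: as the damping disappears, the mean tends to the undamped integral by
  domination and to \<pi> f(x) by the Poisson kernel. The factor is \<pi> instead of 2 \<pi> because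
  only positive frequencies are integrated.\<close>

lemma cosine_inversion:
  fixes f :: "real \<Rightarrow> real"
  assumes f: "integrable lborel f" and B: "\<And>y. \<bar>f y\<bar> \<le> B" and cont: "isCont f x"
    and int: "integrable lborel (\<lambda>\<omega>. indicator {0<..} \<omega> * cosine_transform f (\<omega> * x) \<omega>)"
  shows "(LBINT \<omega>. indicator {0<..} \<omega> * cosine_transform f (\<omega> * x) \<omega>) = pi * f x"
proof -
  have [measurable]: "f \<in> borel_measurable borel" using f by auto
  let ?e = "\<lambda>n. inverse (real (Suc n))" and ?c = "\<lambda>\<omega>. cosine_transform f (\<omega> * x) \<omega>"
  have "(\<lambda>n. LBINT \<omega>. indicator {0<..} \<omega> * (exp (- ?e n * \<omega>) * ?c \<omega>)) \<longlonglongrightarrow> (LBINT \<omega>. indicator {0<..} \<omega> * ?c \<omega>)"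
  proof (rule integral_dominated_convergence[where w = "\<lambda>\<omega>. \<bar>indicator {0<..} \<omega> * ?c \<omega>\<bar>"])
    show "AE \<omega> in lborel. (\<lambda>n. indicator {0<..} \<omega> * (exp (- ?e n * \<omega>) * ?c \<omega>)) \<longlonglongrightarrow> indicator {0<..} \<omega> * ?c \<omega>"
    proof (intro AE_I2)
      fix \<omega>
      have "(\<lambda>n. indicator {0<..} \<omega> * (exp (- ?e n * \<omega>) * ?c \<omega>)) \<longlonglongrightarrow> indicator {0<..} \<omega> * (exp (- 0 * \<omega>) * ?c \<omega>)"
        by (intro tendsto_intros LIMSEQ_inverse_real_of_nat)
      thus "(\<lambda>n. indicator {0<..} \<omega> * (exp (- ?e n * \<omega>) * ?c \<omega>)) \<longlonglongrightarrow> indicator {0<..} \<omega> * ?c \<omega>" by simp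
    qed
    show "AE \<omega> in lborel. norm (indicator {0<..} \<omega> * (exp (- ?e n * \<omega>) * ?c \<omega>)) \<le> \<bar>indicator {0<..} \<omega> * ?c \<omega>\<bar>" for n
      by (intro AE_I2) (auto simp: indicator_def abs_mult intro!: mult_left_le_one_le)
    show "integrable lborel (\<lambda>\<omega>. \<bar>indicator {0<..} \<omega> * ?c \<omega>\<bar>)" using int by (rule integrable_abs)
  qed simp_all
  moreover have "(\<lambda>n. LBINT \<omega>. indicator {0<..} \<omega> * (exp (- ?e n * \<omega>) * ?c \<omega>)) \<longlonglongrightarrow> pi * f x"
    using Poisson_integral_tendsto[OF _ B cont] by (subst Abel_mean_cosine_transform[OF f]) auto
  ultimately show ?thesis by (rule LIMSEQ_unique)
qed

text \<open>This is the Fourier transform of |s|^(-\<mu>), obtained without conditionally convergent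
  integrals. The power \<omega>^(\<mu> - 1) is written as a Laplace integral of t^(-\<mu>); for
  fixed t the frequency integral is an Abel mean with damping t, hence a Poisson integral, and
  integration over t yields |x - y|^(-\<mu>) by the Mellin formula.\<close>

lemma cosine_transform_Riesz_potential:
  fixes f :: "real \<Rightarrow> real"
  assumes \<mu>: "0 < \<mu>" "\<mu> < 1" and f: "integrable lborel f"
    and int: "integrable lborel (\<lambda>\<omega>. indicator {0<..} \<omega> * (\<omega> powr (\<mu> - 1) * cosine_transform f (\<omega> * x) \<omega>))"
    and int': "integrable lborel (\<lambda>y. f y * \<bar>x - y\<bar> powr (- \<mu>))"
  shows "Gamma (1 - \<mu>) * (LBINT \<omega>. indicator {0<..} \<omega> * (\<omega> powr (\<mu> - 1) * cosine_transform f (\<omega> * x) \<omega>))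
    = pi / (2 * sin (pi * \<mu> / 2)) * (LBINT y. f y * \<bar>x - y\<bar> powr (- \<mu>))"
proof -
  have [measurable]: "f \<in> borel_measurable borel" using f by auto
  let ?I = "indicator {0<..} :: real \<Rightarrow> real" and ?c = "\<lambda>\<omega>. cosine_transform f (\<omega> * x) \<omega>"
  let ?G = "Gamma (1 - \<mu>)" and ?S = "pi / (2 * sin (pi * \<mu> / 2))"
  define K where "K = (\<lambda>\<omega> t. ?I \<omega> * ?c \<omega> * (?I t * (t powr (- \<mu>) * exp (- \<omega> * t))))"
  define k where "k = (\<lambda>y t. ?I t * (t powr (1 - \<mu>) / (t\<^sup>2 + (x - y)\<^sup>2)))"
  define H where "H = (\<lambda>y t. f y * k y t)"
  have k_nonneg: "k y t \<ge> 0" for y t unfolding k_def by simp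
  have Gpos: "?G > 0" using \<mu> by (intro Gamma_real_pos) auto
  have spos: "sin (pi * \<mu> / 2) > 0" using \<mu> by (intro sin_gt_zero) (auto simp: field_simps)
  have Ht: "has_bochner_integral lborel (k y) (?S * \<bar>x - y\<bar> powr (- \<mu>))"
    if "y \<noteq> x" for y
    unfolding k_def
  proof (rule has_bochner_integral_nn_integral)
    show "AE t in lborel. 0 \<le> ?I t * (t powr (1 - \<mu>) / (t\<^sup>2 + (x - y)\<^sup>2))" by simp
    show "0 \<le> ?S * \<bar>x - y\<bar> powr (- \<mu>)" using spos by simp
    show "(\<integral>\<^sup>+t. ennreal (?I t * (t powr (1 - \<mu>) / (t\<^sup>2 + (x - y)\<^sup>2))) \<partial>lborel) = ennreal (?S * \<bar>x - y\<bar> powr (- \<mu>))"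
      using that \<mu> by (intro nn_integral_Mellin_Poisson) auto
  qed measurable
  have inner: "has_bochner_integral lborel (\<lambda>t. ?I t * (t powr (- \<mu>) * exp (- \<omega> * t))) (?G * \<omega> powr (\<mu> - 1))" if "\<omega> > 0" for \<omega>
    using has_bochner_integral_Gamma_scaled[of "1 - \<mu>" \<omega>] that \<mu> by simp
  have Kt: "integrable lborel (K \<omega>)" "(LBINT t. K \<omega> t) = ?G * (?I \<omega> * (\<omega> powr (\<mu> - 1) * ?c \<omega>))"
    "(LBINT t. \<bar>K \<omega> t\<bar>) = ?G * \<bar>?I \<omega> * (\<omega> powr (\<mu> - 1) * ?c \<omega>)\<bar>" for \<omega>
  proof -
    note i = has_bochner_integral_integrable[of lborel] 
    have *: "integrable lborel (K \<omega>) \<and> (LBINT t. K \<omega> t) = ?G * (?I \<omega> * (\<omega> powr (\<mu> - 1) * ?c \<omega>)) \<and>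
      (LBINT t. \<bar>K \<omega> t\<bar>) = ?G * \<bar>?I \<omega> * (\<omega> powr (\<mu> - 1) * ?c \<omega>)\<bar>"
    proof (cases "\<omega> > 0")
      case True
      note i = inner[OF True, unfolded has_bochner_integral_iff]
      have "\<bar>K \<omega> t\<bar> = \<bar>?c \<omega>\<bar> * (?I t * (t powr (- \<mu>) * exp (- \<omega> * t)))" for t
        unfolding K_def using True by (simp add: abs_mult)
      thus ?thesis using i True unfolding K_def by (simp add: abs_mult)
    qed (simp add: K_def)
    show "integrable lborel (K \<omega>)" "(LBINT t. K \<omega> t) = ?G * (?I \<omega> * (\<omega> powr (\<mu> - 1) * ?c \<omega>))"
    "(LBINT t. \<bar>K \<omega> t\<bar>) = ?G * \<bar>?I \<omega> * (\<omega> powr (\<mu> - 1) * ?c \<omega>)\<bar>" using * by blast+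
  qed
  have "?G * (LBINT \<omega>. ?I \<omega> * (\<omega> powr (\<mu> - 1) * ?c \<omega>)) = (LBINT \<omega>. LBINT t. K \<omega> t)"
    unfolding Kt by simp
  also have "\<dots> = (LBINT t. LBINT \<omega>. K \<omega> t)"
  proof (rule LBINT_swap[where K = K])
    show "case_prod K \<in> borel_measurable (lborel \<Otimes>\<^sub>M lborel)" unfolding K_def by simp
    show "integrable lborel (\<lambda>\<omega>. LBINT t. \<bar>K \<omega> t\<bar>)"
      unfolding Kt using int by (intro integrable_mult_right integrable_abs)
  qed (simp add: Kt)
  \<comment> \<open>For fixed t > 0 the inner integral is t^(-\<mu>) times the Abel mean with
    damping t; the numerator t of the Poisson kernel raises the power to t^(1 - \<mu>), the weight
    of the Mellin formula.\<close>
  also have "\<dots> = (LBINT t. LBINT y. H y t)"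
  proof (rule Bochner_Integration.integral_cong[OF refl])
    fix t
    show "(LBINT \<omega>. K \<omega> t) = (LBINT y. H y t)"
    proof (cases "t > 0")
      case True
      have "(LBINT \<omega>. K \<omega> t) = (LBINT \<omega>. t powr (- \<mu>) * (?I \<omega> * (exp (- t * \<omega>) * ?c \<omega>)))"
        using True by (intro Bochner_Integration.integral_cong) (auto simp: K_def mult_ac)
      also have "\<dots> = t powr (- \<mu>) * (LBINT y. f y * (t / (t\<^sup>2 + (x - y)\<^sup>2)))"
        unfolding Abel_mean_cosine_transform[OF f True, symmetric] by simp
      also have "\<dots> = (LBINT y. H y t)"
        unfolding integral_mult_right_zero[symmetric]
        using True by (intro Bochner_Integration.integral_cong) (auto simp: H_def k_def powr_diff powr_minus field_simps)
      finally show ?thesis .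
    qed (simp add: K_def H_def k_def)
  qed
  also have "\<dots> = (LBINT y. LBINT t. H y t)"
  proof (rule LBINT_swap[where K = H, symmetric])
    show "case_prod H \<in> borel_measurable (lborel \<Otimes>\<^sub>M lborel)" unfolding H_def k_def by simp
    \<comment> \<open>At y = x the kernel is t^(-1 - \<mu>), which is not integrable near 0; this
      single point is a null set.\<close>
    have ae: "AE y in lborel. y \<noteq> x" by (rule AE_lborel_singleton)
    show "AE y in lborel. integrable lborel (H y)"
      using ae
    proof eventually_elim
      fix y assume "y \<noteq> x"
      from Ht[OF this] show "integrable lborel (H y)"
        unfolding H_def has_bochner_integral_iff by simp
    qed
    have "AE y in lborel. (LBINT t. \<bar>H y t\<bar>) = ?S * \<bar>f y * \<bar>x - y\<bar> powr (- \<mu>)\<bar>"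
      using ae
    proof eventually_elim
      fix y assume "y \<noteq> x"
      have "\<bar>H y t\<bar> = \<bar>f y\<bar> * k y t" for t
        unfolding H_def using k_nonneg by (simp add: abs_mult)
      thus "(LBINT t. \<bar>H y t\<bar>) = ?S * \<bar>f y * \<bar>x - y\<bar> powr (- \<mu>)\<bar>"
        using Ht[OF \<open>y \<noteq> x\<close>] by (simp add: has_bochner_integral_iff abs_mult)
    qed
    moreover have "integrable lborel (\<lambda>y. ?S * \<bar>f y * \<bar>x - y\<bar> powr (- \<mu>)\<bar>)"
      using int' by (intro integrable_mult_right integrable_abs)
    moreover have "(\<lambda>y. LBINT t. \<bar>H y t\<bar>) \<in> borel_measurable lborel"
      unfolding H_def k_def by simp
    ultimately show "integrable lborel (\<lambda>y. LBINT t. \<bar>H y t\<bar>)"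
      using integrable_cong_AE[of "\<lambda>y. LBINT t. \<bar>H y t\<bar>" lborel "\<lambda>y. ?S * \<bar>f y * \<bar>x - y\<bar> powr (- \<mu>)\<bar>"] by simp
  qed
  also have "\<dots> = (LBINT y. ?S * (f y * \<bar>x - y\<bar> powr (- \<mu>)))"
  proof (rule integral_cong_AE)
    have ae: "AE y in lborel. y \<noteq> x" by (rule AE_lborel_singleton)
    thus "AE y in lborel. (LBINT t. H y t) = ?S * (f y * \<bar>x - y\<bar> powr (- \<mu>))"
    proof eventually_elim
      fix y assume "y \<noteq> x"
      from Ht[OF this] show "(LBINT t. H y t) = ?S * (f y * \<bar>x - y\<bar> powr (- \<mu>))"
        unfolding H_def by (simp add: has_bochner_integral_iff)
    qed
    show "(\<lambda>y. LBINT t. H y t) \<in> borel_measurable lborel" unfolding H_def k_def by simp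
  qed simp
  finally show ?thesis by simp
qed

section \<open>Riesz potentials of flat functions\<close>

text \<open>Composition with a clamp is manifestly continuous; on the outer rays it repeats the
  endpoint values, which are 0.\<close>

lemma zero_extension_eq_clamp:
  assumes "p \<le> q" "f p = 0" "f q = 0"
  shows "zero_extension p q f = (\<lambda>x. f (max p (min q x)))"
  using assms by (auto simp: zero_extension_def max_def min_def)

lemma continuous_zero_extension:
  assumes "p \<le> q" "f p = 0" "f q = 0" "continuous_on {p..q} f"
  shows "continuous_on A (zero_extension p q f)"
proof -
  have "continuous_on A (\<lambda>x. f (max p (min q x)))"
    by (rule continuous_on_compose2[OF assms(4)]) (use assms(1) in \<open>auto intro!: continuous_intros\<close>)
  thus ?thesis by (simp add: zero_extension_eq_clamp[OF assms(1-3)])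
qed

lemma isCont_zero_extension:
  assumes "continuous_on {p..q} f" "x \<noteq> p" "x \<noteq> q"
  shows "isCont (zero_extension p q f) x"
proof -
  consider "x \<in> {p<..<q}" | "x \<in> - {p..q}" using assms by force
  thus ?thesis
  proof cases
    case 1
    have "isCont f x" using assms(1) 1 by (intro continuous_on_interior[of "{p..q}"]) auto
    moreover have "\<forall>\<^sub>F y in nhds x. zero_extension p q f y = f y"
      using eventually_nhds_in_open[OF open_greaterThanLessThan 1]
      by eventually_elim (auto simp: zero_extension_def)
    ultimately show ?thesis by (simp add: isCont_cong)
  next
    case 2
    have "\<forall>\<^sub>F y in nhds x. zero_extension p q f y = 0"
      using eventually_nhds_in_open[OF open_Compl[OF closed_atLeastAtMost] 2]
      by eventually_elim (auto simp: zero_extension_def)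
    thus ?thesis using isCont_cong by fastforce
  qed
qed

lemma integrable_zero_extension:
  fixes f :: "real \<Rightarrow> real"
  assumes "continuous_on {p..q} f"
  shows "integrable lborel (zero_extension p q f)"
proof -
  have "zero_extension p q f = (\<lambda>x. indicator {p..q} x *\<^sub>R f x)"
    by (auto simp: zero_extension_def indicator_def)
  with borel_integrable_atLeastAtMost'[OF assms] show ?thesis by (simp add: set_integrable_def)
qed

lemma zero_extension_bounded:
  fixes f :: "real \<Rightarrow> real"
  assumes "continuous_on {p..q} f"
  obtains B where "B \<ge> 0" "\<And>x. \<bar>zero_extension p q f x\<bar> \<le> B"
proof -
  have "bounded (f ` {p..q})" by (rule compact_imp_bounded[OF compact_continuous_image[OF assms compact_Icc]])
  then obtain B where "\<forall>x\<in>{p..q}. \<bar>f x\<bar> \<le> B" by (auto simp: bounded_iff)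
  hence "\<bar>zero_extension p q f x\<bar> \<le> max 0 B" for x
    by (auto simp: zero_extension_def intro: max.coboundedI2)
  thus ?thesis using that[of "max 0 B"] by auto
qed

text \<open>Integration by parts: the boundary terms vanish with f, and the sine that appears is the
  cosine with its phase shifted by \<pi>/2.\<close>

lemma cosine_transform_deriv:
  assumes "p \<le> q" "f p = 0" "f q = 0" "continuous_on {p..q} f'"
    and deriv: "\<And>x. x \<in> {p..q} \<Longrightarrow> (f has_real_derivative f' x) (at x within {p..q})"
  shows "cosine_transform (zero_extension p q f') \<theta> \<omega> = - \<omega> * cosine_transform (zero_extension p q f) (\<theta> - pi / 2) \<omega>"
proof -
  have cont: "continuous_on {p..q} f" using deriv by (rule DERIV_continuous_on)
  let ?g = "\<lambda>y. f' y * cos (\<theta> - \<omega> * y) + \<omega> * (f y * cos (\<theta> - pi / 2 - \<omega> * y))"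
  have "(LBINT y. indicator {p..q} y *\<^sub>R ?g y) = f q * cos (\<theta> - \<omega> * q) - f p * cos (\<theta> - \<omega> * p)"
  proof (rule integral_FTC_atLeastAtMost[OF assms(1)])
    show "continuous_on {p..q} ?g" by (intro continuous_intros assms cont)
    fix x assume "p \<le> x" "x \<le> q"
    have "sin (\<theta> - \<omega> * x) = cos (\<theta> - pi / 2 - \<omega> * x)"
    proof -
      have "cos (\<theta> - pi / 2 - \<omega> * x) = cos ((\<theta> - \<omega> * x) - pi / 2)" by (simp add: algebra_simps)
      thus ?thesis unfolding cos_diff by simp
    qed
    moreover have "((\<lambda>y. f y * cos (\<theta> - \<omega> * y)) has_real_derivative f' x * cos (\<theta> - \<omega> * x) + f x * (sin (\<theta> - \<omega> * x) * \<omega>)) (at x within {p..q})"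
      using \<open>p \<le> x\<close> \<open>x \<le> q\<close> by (auto intro!: derivative_eq_intros deriv)
    ultimately show "((\<lambda>y. f y * cos (\<theta> - \<omega> * y)) has_vector_derivative ?g x) (at x within {p..q})"
      by (simp add: has_real_derivative_iff_has_vector_derivative mult_ac)
  qed
  moreover have "indicator {p..q} y *\<^sub>R ?g y = zero_extension p q f' y * cos (\<theta> - \<omega> * y) + \<omega> * (zero_extension p q f y * cos (\<theta> - pi / 2 - \<omega> * y))" for y
    by (simp add: zero_extension_def indicator_def)
  ultimately have "0 = (LBINT y. zero_extension p q f' y * cos (\<theta> - \<omega> * y) + \<omega> * (zero_extension p q f y * cos (\<theta> - pi / 2 - \<omega> * y)))"
    using assms(2,3) by simp
  also have "\<dots> = cosine_transform (zero_extension p q f') \<theta> \<omega> + \<omega> * cosine_transform (zero_extension p q f) (\<theta> - pi / 2) \<omega>"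
    unfolding cosine_transform_def
    by (subst Bochner_Integration.integral_add)
      (auto intro!: integrable_mult_right integrable_cosine_transform integrable_zero_extension assms cont)
  finally show ?thesis by simp
qed

lemma cosine_transform_shift_pi: "cosine_transform f (\<theta> - pi) \<omega> = - cosine_transform f \<theta> \<omega>"
proof -
  have "cos (\<theta> - pi - \<omega> * y) = - cos (\<theta> - \<omega> * y)" for y
  proof -
    have "cos (\<theta> - pi - \<omega> * y) = cos ((\<theta> - \<omega> * y) - pi)" by (simp add: algebra_simps)
    thus ?thesis unfolding cos_diff by simp
  qed
  thus ?thesis unfolding cosine_transform_def by simp
qed

text \<open>An integrable bound on the transform makes the inversion integral \<open>J\<close>
  continuous on the whole line, while off the endpoints it equals \<pi> times the zero extension.
  Hence the extension cannot jump. The bound has to be uniform in the phase, because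
  \<open>J\<close> is taken at varying points.\<close>

lemma endpoint_values_zero:
  fixes f :: "real \<Rightarrow> real"
  assumes "p < q" and cont: "continuous_on {p..q} f"
    and bound: "\<And>\<theta> \<omega>. \<omega> > 0 \<Longrightarrow> \<bar>cosine_transform (zero_extension p q f) \<theta> \<omega>\<bar> \<le> B \<omega>"
    and B: "integrable lborel (\<lambda>\<omega>. indicator {0<..} \<omega> * B \<omega>)"
  shows "f p = 0" "f q = 0"
proof -
  let ?f = "zero_extension p q f"
  define J where "J x = (LBINT \<omega>. indicator {0<..} \<omega> * cosine_transform ?f (\<omega> * x) \<omega>)" for x
  note int = integrable_zero_extension[OF cont]
  have [measurable]: "?f \<in> borel_measurable borel" using int by auto
  have bd: "AE \<omega> in lborel. norm (indicator {0<..} \<omega> * cosine_transform ?f (\<omega> * x) \<omega>) \<le> indicator {0<..} \<omega> * B \<omega>" for x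
    using bound by (intro AE_I2) (auto simp: indicator_def)
  obtain C where C: "\<And>x. \<bar>?f x\<bar> \<le> C" using zero_extension_bounded[OF cont] by blast
  have int2: "integrable lborel (\<lambda>\<omega>. indicator {0<..} \<omega> * cosine_transform ?f (\<omega> * x) \<omega>)" for x
  proof (rule Bochner_Integration.integrable_bound[OF B])
    show "AE \<omega> in lborel. norm (indicator {0<..} \<omega> * cosine_transform ?f (\<omega> * x) \<omega>) \<le> norm (indicator {0<..} \<omega> * B \<omega>)"
    proof (intro AE_I2)
      fix \<omega>
      have "norm (indicator {0<..} \<omega> * cosine_transform ?f (\<omega> * x) \<omega>) \<le> indicator {0<..} \<omega> * B \<omega>"
        using bound by (auto simp: indicator_def)
      also have "\<dots> \<le> norm (indicator {0<..} \<omega> * B \<omega>)" by (simp only: real_norm_def abs_ge_self)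
      finally show "norm (indicator {0<..} \<omega> * cosine_transform ?f (\<omega> * x) \<omega>) \<le> norm (indicator {0<..} \<omega> * B \<omega>)" .
    qed
  qed simp
  have inv: "J x = pi * ?f x" if "x \<noteq> p" "x \<noteq> q" for x
    unfolding J_def by (rule cosine_inversion[OF int C isCont_zero_extension[OF cont that] int2])
  have contJ: "continuous_on UNIV J"
  proof (rule continuous_on_sequentiallyI)
    fix X x assume X: "X \<longlonglongrightarrow> (x::real)"
    show "(\<lambda>n. J (X n)) \<longlonglongrightarrow> J x"
      unfolding J_def
    proof (rule integral_dominated_convergence[where w = "\<lambda>\<omega>. indicator {0<..} \<omega> * B \<omega>"])
      show "AE \<omega> in lborel. (\<lambda>n. indicator {0<..} \<omega> * cosine_transform ?f (\<omega> * X n) \<omega>) \<longlonglongrightarrow> indicator {0<..} \<omega> * cosine_transform ?f (\<omega> * x) \<omega>"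
      proof (intro AE_I2 tendsto_mult tendsto_const)
        fix \<omega>
        show "(\<lambda>n. cosine_transform ?f (\<omega> * X n) \<omega>) \<longlonglongrightarrow> cosine_transform ?f (\<omega> * x) \<omega>"
          unfolding cosine_transform_def
        proof (rule integral_dominated_convergence[where w = "\<lambda>y. \<bar>?f y\<bar>"])
          show "AE y in lborel. (\<lambda>n. ?f y * cos (\<omega> * X n - \<omega> * y)) \<longlonglongrightarrow> ?f y * cos (\<omega> * x - \<omega> * y)"
            by (intro AE_I2 tendsto_intros X)
          show "AE y in lborel. norm (?f y * cos (\<omega> * X n - \<omega> * y)) \<le> \<bar>?f y\<bar>" for n
            by (intro AE_I2) (auto simp: abs_mult intro!: mult_left_le)
        qed (use int in auto)
      qed
    qed (use bd B in auto)
  qed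
  have "J p = 0"
  proof (rule continuous_constant_on_closure[where S = "{..<p}" and f = J])
    show "J x = 0" if "x \<in> {..<p}" for x using inv[of x] that \<open>p < q\<close> by (auto simp: zero_extension_def)
  qed (auto intro: continuous_on_subset[OF contJ])
  moreover have "J q = 0"
  proof (rule continuous_constant_on_closure[where S = "{q<..}" and f = J])
    show "J x = 0" if "x \<in> {q<..}" for x using inv[of x] that \<open>p < q\<close> by (auto simp: zero_extension_def)
  qed (auto intro: continuous_on_subset[OF contJ])
  moreover have "J x - pi * f x = 0" if "x \<in> {p..q}" for x
  proof (rule continuous_constant_on_closure[where S = "{p<..<q}" and f = "\<lambda>x. J x - pi * f x"])
    show "J x - pi * f x = 0" if "x \<in> {p<..<q}" for x using inv[of x] that by (auto simp: zero_extension_def)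
    show "continuous_on (closure {p<..<q}) (\<lambda>x. J x - pi * f x)"
      using \<open>p < q\<close> by (auto intro!: continuous_intros cont continuous_on_subset[OF contJ])
    show "x \<in> closure {p<..<q}" using that \<open>p < q\<close> by simp
  qed
  from this[of p] this[of q] \<open>p < q\<close> have "J p = pi * f p" "J q = pi * f q" by simp_all
  ultimately show "f p = 0" "f q = 0" by simp_all
qed

section \<open>Functions that are flat at the ends of an interval\<close>

text \<open>Carrying the whole family of derivatives as data allows one-sided derivatives at the
  endpoints, which an iterated \<open>deriv\<close> could not express.\<close>

definition jet :: "nat \<Rightarrow> real \<Rightarrow> real \<Rightarrow> (nat \<Rightarrow> real \<Rightarrow> real) \<Rightarrow> bool" where
  "jet m p q V \<longleftrightarrow> p < q \<and> continuous_on {p..q} (V m) \<and>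
     (\<forall>k<m. \<forall>x\<in>{p..q}. (V k has_real_derivative V (Suc k) x) (at x within {p..q}))"

text \<open>The zero extension of \<open>V 0\<close> is then m - 1 times continuously differentiable
  on the line. Nothing is said about \<open>V m\<close> at the ends; its extension may jump
  there.\<close>

definition flat_jet :: "nat \<Rightarrow> real \<Rightarrow> real \<Rightarrow> (nat \<Rightarrow> real \<Rightarrow> real) \<Rightarrow> bool" where
  "flat_jet m p q V \<longleftrightarrow> jet m p q V \<and> (\<forall>k<m. V k p = 0 \<and> V k q = 0)"

lemma jet_continuous: "jet m p q V \<Longrightarrow> k \<le> m \<Longrightarrow> continuous_on {p..q} (V k)"
  unfolding jet_def by (cases "k = m") (auto intro!: DERIV_continuous_on[where f = "V k" and D = "V (Suc k)"])

lemma cosine_transform_jet: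
  assumes "jet m p q V" "k < m" "V k p = 0" "V k q = 0"
  shows "cosine_transform (zero_extension p q (V (Suc k))) \<theta> \<omega> = - \<omega> * cosine_transform (zero_extension p q (V k)) (\<theta> - pi / 2) \<omega>"
  using assms jet_continuous[OF assms(1), of "Suc k"] unfolding jet_def
  by (intro cosine_transform_deriv) auto

text \<open>Two integrations by parts shift the phase by \<pi>, whence the minus sign.\<close>

lemma cosine_transform_flat_jet:
  assumes "flat_jet m p q V" "Suc k < m"
  shows "cosine_transform (zero_extension p q (V (Suc (Suc k)))) \<theta> \<omega> = - \<omega>\<^sup>2 * cosine_transform (zero_extension p q (V k)) \<theta> \<omega>"
proof -
  have "\<theta> - pi / 2 - pi / 2 = \<theta> - pi" by simp
  thus ?thesis
    using assms cosine_transform_jet[of m p q V "Suc k" \<theta> \<omega>] cosine_transform_jet[of m p q V k "\<theta> - pi / 2" \<omega>]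
    by (simp add: flat_jet_def cosine_transform_shift_pi power2_eq_square)
qed

text \<open>Strong induction on the order. If all lower derivatives vanish at the ends, k
  integrations by parts bound the transform of \<open>V k\<close> by |\<omega>|^k times the Fourier
  transform, and this is integrable because k \<le> m - 1 \<le> s; then
  \<open>endpoint_values_zero\<close> gives order k.\<close>

lemma fourier_class_imp_flat_jet:
  assumes jet: "jet m p q V" and fc: "zero_extension p q (V 0) \<in> fourier_class s" and s: "real m - 1 \<le> s"
  shows "flat_jet m p q V"
proof -
  let ?v = "zero_extension p q (V 0)"
  have int: "integrable lborel ?v" and int2: "integrable lborel (\<lambda>\<omega>. (1 + \<bar>\<omega>\<bar>) powr s * cmod (fourier_transform ?v \<omega>))"
    using fc by (auto simp: fourier_class_def)
  have "V k p = 0 \<and> V k q = 0" if "k < m" for k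
    using that
  proof (induction k rule: less_induct)
    case (less k)
    \<comment> \<open>Only vanishing below order k enters, which the outer induction supplies. The
      phase is arbitrary because it shifts with every integration by parts.\<close>
    have le: "\<bar>cosine_transform (zero_extension p q (V j)) \<theta> \<omega>\<bar> \<le> \<bar>\<omega>\<bar> ^ j * cmod (fourier_transform ?v \<omega>)" if "j \<le> k" for j \<theta> \<omega>
      using that
    proof (induction j arbitrary: \<theta>)
      case 0
      show ?case using cosine_transform_le_fourier[OF int] by simp
    next
      case (Suc j)
      have "V j p = 0" "V j q = 0" using less.IH[of j] Suc.prems less.prems by auto
      hence "\<bar>cosine_transform (zero_extension p q (V (Suc j))) \<theta> \<omega>\<bar> = \<bar>\<omega>\<bar> * \<bar>cosine_transform (zero_extension p q (V j)) (\<theta> - pi / 2) \<omega>\<bar>"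
        using Suc.prems less.prems by (subst cosine_transform_jet[OF jet]) (auto simp: abs_mult)
      also have "\<dots> \<le> \<bar>\<omega>\<bar> * (\<bar>\<omega>\<bar> ^ j * cmod (fourier_transform ?v \<omega>))"
        using Suc by (intro mult_left_mono) auto
      finally show ?case by simp
    qed
    let ?B = "\<lambda>\<omega>. (1 + \<bar>\<omega>\<bar>) powr s * cmod (fourier_transform ?v \<omega>)"
    have "\<bar>cosine_transform (zero_extension p q (V k)) \<theta> \<omega>\<bar> \<le> ?B \<omega>" for \<theta> \<omega>
    proof -
      have "\<bar>\<omega>\<bar> ^ k \<le> (1 + \<bar>\<omega>\<bar>) ^ k" by (intro power_mono) auto
      also have "\<dots> = (1 + \<bar>\<omega>\<bar>) powr real k" by (simp add: powr_realpow)
      also have "\<dots> \<le> (1 + \<bar>\<omega>\<bar>) powr s" using s less.prems by (intro powr_mono) auto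
      finally have "\<bar>\<omega>\<bar> ^ k * cmod (fourier_transform ?v \<omega>) \<le> ?B \<omega>" by (intro mult_right_mono) auto
      thus ?thesis using le[of k \<theta> \<omega>] by linarith
    qed
    moreover have "integrable lborel (\<lambda>\<omega>. indicator {0<..} \<omega> * ?B \<omega>)"
    proof (rule Bochner_Integration.integrable_bound[OF int2])
      show "(\<lambda>\<omega>. indicator {0<..} \<omega> * ?B \<omega>) \<in> borel_measurable lborel"
        using borel_measurable_integrable[OF int2] by simp
    qed (auto simp: indicator_def)
    ultimately show ?case
      using endpoint_values_zero[of p q "V k" ?B] jet_continuous[OF jet, of k] jet less.prems
      unfolding jet_def by (metis less_imp_le)
  qed
  thus ?thesis using jet by (simp add: flat_jet_def)
qed


lemma integrable_half_line:
  fixes h :: "real \<Rightarrow> real"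
  assumes "a > -1" "b > 1" and [measurable]: "h \<in> borel_measurable borel"
    and small: "\<And>\<omega>. 0 < \<omega> \<Longrightarrow> \<omega> \<le> 1 \<Longrightarrow> \<bar>h \<omega>\<bar> \<le> A * \<omega> powr a"
    and large: "\<And>\<omega>. 1 \<le> \<omega> \<Longrightarrow> \<bar>h \<omega>\<bar> \<le> A * \<omega> powr (- b)"
  shows "integrable lborel (\<lambda>\<omega>. indicator {0<..} \<omega> * h \<omega>)"
proof -
  have "((\<lambda>x::real. x powr a) has_integral (1 powr (a + 1) / (a + 1))) {0..1}"
    by (rule has_integral_powr_from_0) (use assms in auto)
  from nn_integral_has_integral_lebesgue'[OF _ this]
  have 1: "integrable lborel (\<lambda>x::real. x powr a * indicator {0..1} x)"
    by (intro integrableI_nonneg) (auto simp: ennreal_mult ennreal_indicator)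
  have "((\<lambda>x::real. x powr (- b)) has_integral (- (1 powr (- b + 1)) / (- b + 1))) {1..}"
    by (rule has_integral_powr_to_inf) (use assms in auto)
  from nn_integral_has_integral_lebesgue'[OF _ this]
  have 2: "integrable lborel (\<lambda>x::real. x powr (- b) * indicator {1..} x)"
    by (intro integrableI_nonneg) (auto simp: ennreal_mult ennreal_indicator)
  have A: "A \<ge> 0" using large[of 1] by (simp add: order_trans[OF abs_ge_zero])
  have "integrable lborel (\<lambda>x. A * (x powr a * indicator {0..1} x + x powr (- b) * indicator {1..} x))"
    using 1 2 by (intro integrable_mult_right Bochner_Integration.integrable_add)
  thus ?thesis
  proof (rule Bochner_Integration.integrable_bound)
    show "AE \<omega> in lborel. norm (indicator {0<..} \<omega> * h \<omega>) \<le> norm (A * (\<omega> powr a * indicator {0..1} \<omega> + \<omega> powr (- b) * indicator {1..} \<omega>))"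
    proof (intro AE_I2)
      fix \<omega> :: real
      have "norm (indicator {0<..} \<omega> * h \<omega>) \<le> A * (\<omega> powr a * indicator {0..1} \<omega> + \<omega> powr (- b) * indicator {1..} \<omega>)"
        using small[of \<omega>] large[of \<omega>] A by (auto simp: indicator_def distrib_left intro: add_increasing add_increasing2)
      thus "norm (indicator {0<..} \<omega> * h \<omega>) \<le> norm (A * (\<omega> powr a * indicator {0..1} \<omega> + \<omega> powr (- b) * indicator {1..} \<omega>))"
        by (rule order_trans) simp
    qed
  qed simp
qed

text \<open>The transform is bounded near 0 and decays like \<omega>^(-2) after two more
  integrations by parts: hence the two spare derivatives and the restriction of r to the open
  interval from -1 to 1.\<close>

lemma integrable_powr_cosine_transform:
  assumes V: "flat_jet m p q V" and "k + 2 \<le> m" and r: "-1 < r" "r < 1"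
  shows "integrable lborel (\<lambda>\<omega>. indicator {0<..} \<omega> * (\<omega> powr r * cosine_transform (zero_extension p q (V k)) (\<omega> * x) \<omega>))"
proof -
  have jet: "jet m p q V" using V by (simp add: flat_jet_def)
  have int: "integrable lborel (zero_extension p q (V j))" if "j \<le> m" for j
    using jet_continuous[OF jet that] by (rule integrable_zero_extension)
  have [measurable]: "zero_extension p q (V k) \<in> borel_measurable borel" using int[of k] assms(2) by auto
  let ?c = "\<lambda>j. LBINT y. \<bar>zero_extension p q (V j) y\<bar>"
  define A where "A = max (?c k) (?c (Suc (Suc k)))"
  have A: "?c k \<le> A" "?c (Suc (Suc k)) \<le> A" unfolding A_def by auto
  show ?thesis
  proof (rule integrable_half_line[where a = r and b = "2 - r" and A = A])
    fix \<omega> :: real assume \<omega>: "0 < \<omega>" "\<omega> \<le> 1"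
    have "\<bar>cosine_transform (zero_extension p q (V k)) (\<omega> * x) \<omega>\<bar> \<le> A"
      using cosine_transform_bound[OF int, of k "\<omega> * x" \<omega>] A assms(2) by linarith
    from mult_right_mono[OF this, of "\<omega> powr r"]
    show "\<bar>\<omega> powr r * cosine_transform (zero_extension p q (V k)) (\<omega> * x) \<omega>\<bar> \<le> A * \<omega> powr r"
      by (simp add: abs_mult mult.commute)
  next
    fix \<omega> :: real assume \<omega>: "1 \<le> \<omega>"
    have "\<omega>\<^sup>2 * \<bar>cosine_transform (zero_extension p q (V k)) (\<omega> * x) \<omega>\<bar> = \<bar>cosine_transform (zero_extension p q (V (Suc (Suc k)))) (\<omega> * x) \<omega>\<bar>"
      using assms(2) by (subst cosine_transform_flat_jet[OF V]) (auto simp: abs_mult)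
    also have "\<dots> \<le> A"
      using cosine_transform_bound[OF int, of "Suc (Suc k)" "\<omega> * x" \<omega>] A assms(2) by linarith
    finally have "\<bar>cosine_transform (zero_extension p q (V k)) (\<omega> * x) \<omega>\<bar> \<le> A / \<omega>\<^sup>2"
      using \<omega> by (simp add: field_simps)
    from mult_left_mono[OF this, of "\<omega> powr r"]
    have "\<bar>\<omega> powr r * cosine_transform (zero_extension p q (V k)) (\<omega> * x) \<omega>\<bar> \<le> \<omega> powr r * (A / \<omega>\<^sup>2)"
      by (simp add: abs_mult)
    also have "\<omega> powr r * (A / \<omega>\<^sup>2) = A * \<omega> powr (- (2 - r))"
      using \<omega> by (simp add: powr_diff powr_numeral)
    finally show "\<bar>\<omega> powr r * cosine_transform (zero_extension p q (V k)) (\<omega> * x) \<omega>\<bar> \<le> A * \<omega> powr (- (2 - r))" .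
  qed (use r in auto)
qed

lemma flat_jet_inversion:
  assumes V: "flat_jet m p q V" and "k + 2 \<le> m"
  shows "(LBINT \<omega>. indicator {0<..} \<omega> * cosine_transform (zero_extension p q (V k)) (\<omega> * x) \<omega>) = pi * zero_extension p q (V k) x"
    and "integrable lborel (\<lambda>\<omega>. indicator {0<..} \<omega> * cosine_transform (zero_extension p q (V k)) (\<omega> * x) \<omega>)"
proof -
  have jet: "jet m p q V" using V by (simp add: flat_jet_def)
  have cont: "continuous_on {p..q} (V k)" using jet_continuous[OF jet] assms(2) by simp
  have "isCont (zero_extension p q (V k)) x"
    using continuous_zero_extension[of p q "V k" UNIV] V cont assms(2)
    by (simp add: flat_jet_def jet_def continuous_on_eq_continuous_at)
  moreover have "(\<lambda>\<omega>. indicator {0<..} \<omega> * (\<omega> powr 0 * cosine_transform (zero_extension p q (V k)) (\<omega> * x) \<omega>))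
    = (\<lambda>\<omega>. indicator {0<..} \<omega> * cosine_transform (zero_extension p q (V k)) (\<omega> * x) \<omega>)"
    by (auto simp: indicator_def)
  with integrable_powr_cosine_transform[OF assms, of 0 x]
  show *: "integrable lborel (\<lambda>\<omega>. indicator {0<..} \<omega> * cosine_transform (zero_extension p q (V k)) (\<omega> * x) \<omega>)"
    by simp
  moreover obtain B where "\<And>y. \<bar>zero_extension p q (V k) y\<bar> \<le> B" using zero_extension_bounded[OF cont] by blast
  ultimately show "(LBINT \<omega>. indicator {0<..} \<omega> * cosine_transform (zero_extension p q (V k)) (\<omega> * x) \<omega>) = pi * zero_extension p q (V k) x"
    by (intro cosine_inversion integrable_zero_extension cont)
qed

section \<open>The Riesz derivative as a potential of the second derivative\<close>

text \<open>The cut makes the kernel integrable on the line. With D = q - p it is invisible for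
  differences of points of \<open>{p..q}\<close>. At s = 0 the value is 0 by the convention for
  \<open>powr\<close>.\<close>

definition Riesz_kernel :: "real \<Rightarrow> real \<Rightarrow> real \<Rightarrow> real" where
  "Riesz_kernel \<mu> D s = indicator {-D..D} s * \<bar>s\<bar> powr (- \<mu>)"

lemma integrable_Riesz_kernel:
  assumes "\<mu> < 1" "D \<ge> 0"
  shows "integrable lborel (Riesz_kernel \<mu> D)"
    and "(LBINT s. Riesz_kernel \<mu> D s) = 2 * (D powr (1 - \<mu>) / (1 - \<mu>))"
proof -
  let ?k = "\<lambda>s::real. s powr (- \<mu>) * indicator {0..D} s"
  have "((\<lambda>x::real. x powr (- \<mu>)) has_integral (D powr (- \<mu> + 1) / (- \<mu> + 1))) {0..D}"
    by (rule has_integral_powr_from_0) (use assms in auto)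
  from nn_integral_has_integral_lebesgue'[OF _ this]
  have k: "has_bochner_integral lborel ?k (D powr (1 - \<mu>) / (1 - \<mu>))"
    using assms by (intro has_bochner_integral_nn_integral) (auto simp: ennreal_mult ennreal_indicator)
  hence k': "has_bochner_integral lborel (\<lambda>s. ?k (- s)) (D powr (1 - \<mu>) / (1 - \<mu>))"
    by (subst (asm) lborel_has_bochner_integral_real_affine_iff[where c = "-1" and t = 0]) simp_all
  have eq: "Riesz_kernel \<mu> D = (\<lambda>s. ?k s + ?k (- s))"
    by (rule ext) (auto simp: Riesz_kernel_def indicator_def)
  show "integrable lborel (Riesz_kernel \<mu> D)" "(LBINT s. Riesz_kernel \<mu> D s) = 2 * (D powr (1 - \<mu>) / (1 - \<mu>))"
    using has_bochner_integral_add[OF k k'] unfolding eq has_bochner_integral_iff by simp_all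
qed

text \<open>The reflection moves the dependence on z from the singular kernel to the smooth factor,
  where it can be differentiated.\<close>

lemma integral_Riesz_kernel_reflect:
  fixes e :: "real \<Rightarrow> real"
  assumes "\<mu> < 1" "D \<ge> 0" "e \<in> borel_measurable borel" "\<And>y. \<bar>e y\<bar> \<le> B"
  shows "integrable lborel (\<lambda>s. e (z - s) * Riesz_kernel \<mu> D s)"
    and "integrable lborel (\<lambda>y. e y * Riesz_kernel \<mu> D (z - y))"
    and "(LBINT y. e y * Riesz_kernel \<mu> D (z - y)) = (LBINT s. e (z - s) * Riesz_kernel \<mu> D s)"
proof -
  have "integrable lborel (\<lambda>s. Riesz_kernel \<mu> D s * e (z - s))"
    using assms by (intro integrable_times_bounded[OF integrable_Riesz_kernel(1), of _ _ _ B]) auto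
  thus 1: "integrable lborel (\<lambda>s. e (z - s) * Riesz_kernel \<mu> D s)" by (simp add: mult.commute)
  show 2: "integrable lborel (\<lambda>y. e y * Riesz_kernel \<mu> D (z - y))"
    using lborel_integrable_real_affine[OF 1, of "-1" z] by simp
  show "(LBINT y. e y * Riesz_kernel \<mu> D (z - y)) = (LBINT s. e (z - s) * Riesz_kernel \<mu> D s)"
    by (subst lborel_integral_real_affine[of "-1" _ z]) simp_all
qed

text \<open>The Riesz derivative after both outer derivatives have been moved under the integral;
  accordingly f stands for the second derivative of the function of interest.\<close>

definition Riesz_potential :: "real \<Rightarrow> real \<Rightarrow> real \<Rightarrow> (real \<Rightarrow> real) \<Rightarrow> real \<Rightarrow> real" where
  "Riesz_potential \<alpha> p q f x = riesz_const \<alpha> / Gamma (2 - \<alpha>) *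
     (LBINT s. zero_extension p q f (x - s) * Riesz_kernel (\<alpha> - 1) (q - p) s)"

text \<open>The potential lemma for \<open>V 2\<close> with \<mu> = \<alpha> - 1: the factor
  \<omega>^(\<alpha> - 2) times the -\<omega>^2 of two derivatives is the symbol -\<omega>^\<alpha>,
  and sin(\<pi> (\<alpha> - 1)/2) = -cos(\<pi> \<alpha>/2) matches
  \<open>riesz_const\<close>.\<close>

lemma Riesz_potential_cosine_transform:
  assumes V: "flat_jet m p q V" and "4 \<le> m" and \<alpha>: "1 < \<alpha>" "\<alpha> < 2" and x: "x \<in> {p..q}"
  shows "pi * Riesz_potential \<alpha> p q (V 2) x =
    - (LBINT \<omega>. indicator {0<..} \<omega> * (\<omega> powr \<alpha> * cosine_transform (zero_extension p q (V 0)) (\<omega> * x) \<omega>))"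
    and "integrable lborel (\<lambda>\<omega>. indicator {0<..} \<omega> * (\<omega> powr \<alpha> * cosine_transform (zero_extension p q (V 0)) (\<omega> * x) \<omega>))"
proof -
  have jet: "jet m p q V" and pq: "p \<le> q" using V by (auto simp: flat_jet_def jet_def)
  have cont: "continuous_on {p..q} (V 2)" using jet_continuous[OF jet] assms(2) by simp
  let ?e = "zero_extension p q (V 2)"
  have [measurable]: "?e \<in> borel_measurable borel" using integrable_zero_extension[OF cont] by auto
  obtain B where B: "\<And>y. \<bar>?e y\<bar> \<le> B" using zero_extension_bounded[OF cont] by blast
  \<comment> \<open>Both x and the support of the extension lie in \<open>{p..q}\<close>, so the cut
    of the kernel has no effect.\<close>
  have eq: "?e y * Riesz_kernel (\<alpha> - 1) (q - p) (x - y) = ?e y * \<bar>x - y\<bar> powr (- (\<alpha> - 1))" for y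
    using x by (auto simp: zero_extension_def Riesz_kernel_def indicator_def)
  note refl = integral_Riesz_kernel_reflect[of "\<alpha> - 1" "q - p" ?e B x]
  have eq2: "indicator {0<..} \<omega> * (\<omega> powr (\<alpha> - 1 - 1) * cosine_transform ?e (\<omega> * x) \<omega>)
      = - (indicator {0<..} \<omega> * (\<omega> powr \<alpha> * cosine_transform (zero_extension p q (V 0)) (\<omega> * x) \<omega>))" for \<omega>
  proof (cases "\<omega> > 0")
    case True
    have "\<omega> powr (\<alpha> - 1 - 1) * \<omega>\<^sup>2 = \<omega> powr \<alpha>"
      using True by (simp add: powr_diff power2_eq_square)
    moreover have "cosine_transform ?e (\<omega> * x) \<omega> = - \<omega>\<^sup>2 * cosine_transform (zero_extension p q (V 0)) (\<omega> * x) \<omega>"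
      using cosine_transform_flat_jet[OF V, of 0] assms(2) by (simp add: numeral_2_eq_2)
    ultimately show ?thesis by (simp add: mult.assoc[symmetric])
  qed simp
  have int: "integrable lborel (\<lambda>\<omega>. indicator {0<..} \<omega> * (\<omega> powr (\<alpha> - 1 - 1) * cosine_transform ?e (\<omega> * x) \<omega>))"
    using assms by (intro integrable_powr_cosine_transform[OF V]) auto
  thus "integrable lborel (\<lambda>\<omega>. indicator {0<..} \<omega> * (\<omega> powr \<alpha> * cosine_transform (zero_extension p q (V 0)) (\<omega> * x) \<omega>))"
    unfolding eq2 by simp
  have "Gamma (1 - (\<alpha> - 1)) * (LBINT \<omega>. indicator {0<..} \<omega> * (\<omega> powr (\<alpha> - 1 - 1) * cosine_transform ?e (\<omega> * x) \<omega>))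
    = pi / (2 * sin (pi * (\<alpha> - 1) / 2)) * (LBINT y. ?e y * \<bar>x - y\<bar> powr (- (\<alpha> - 1)))"
  proof (rule cosine_transform_Riesz_potential)
    show "integrable lborel (\<lambda>y. ?e y * \<bar>x - y\<bar> powr (- (\<alpha> - 1)))"
      using refl(2) \<alpha> pq B unfolding eq by simp
  qed (use \<alpha> int integrable_zero_extension[OF cont] in auto)
  also have "sin (pi * (\<alpha> - 1) / 2) = - cos (pi * \<alpha> / 2)"
  proof -
    have "pi * (\<alpha> - 1) / 2 = pi * \<alpha> / 2 - pi / 2" by (simp add: field_simps)
    thus ?thesis by (simp only: sin_diff) simp
  qed
  also have "(LBINT y. ?e y * \<bar>x - y\<bar> powr (- (\<alpha> - 1))) = (LBINT s. ?e (x - s) * Riesz_kernel (\<alpha> - 1) (q - p) s)"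
    using refl(3) \<alpha> pq B unfolding eq by simp
  finally have G: "Gamma (2 - \<alpha>) * (- (LBINT \<omega>. indicator {0<..} \<omega> * (\<omega> powr \<alpha> * cosine_transform (zero_extension p q (V 0)) (\<omega> * x) \<omega>)))
     = pi * riesz_const \<alpha> * (LBINT s. ?e (x - s) * Riesz_kernel (\<alpha> - 1) (q - p) s)"
    unfolding eq2 by (simp add: riesz_const_def)
  have "Gamma (2 - \<alpha>) > 0" using \<alpha> by (intro Gamma_real_pos) auto
  with G show "pi * Riesz_potential \<alpha> p q (V 2) x =
    - (LBINT \<omega>. indicator {0<..} \<omega> * (\<omega> powr \<alpha> * cosine_transform (zero_extension p q (V 0)) (\<omega> * x) \<omega>))"
    unfolding Riesz_potential_def by (simp add: field_simps)
qed

text \<open>Two one-sided statements are glued along the closed cover of the line by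
  \<open>{p..q}\<close> and the outer rays. At p and q the slopes agree because
  \<open>V (Suc k)\<close> vanishes there as well.\<close>

lemma has_derivative_zero_extension:
  assumes V: "flat_jet m p q V" and "Suc k < m"
  shows "(zero_extension p q (V k) has_real_derivative zero_extension p q (V (Suc k)) x) (at x)"
proof -
  let ?A = "{p..q}" and ?B = "{..p} \<union> {q..}" and ?e = "zero_extension p q (V k)" and ?e' = "zero_extension p q (V (Suc k)) x"
  have z: "V k p = 0" "V k q = 0" "V (Suc k) p = 0" "V (Suc k) q = 0" and "p < q"
    using assms by (auto simp: flat_jet_def jet_def)
  have "(?e has_real_derivative ?e') (at x within ?A)"
  proof (cases "x \<in> ?A")
    case True
    hence "(V k has_real_derivative V (Suc k) x) (at x within ?A)"
      using assms by (auto simp: flat_jet_def jet_def)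
    thus ?thesis using True
      by (subst has_field_derivative_cong_ev[where g = "V k" and y = x]) (auto simp: zero_extension_def)
  next
    case False
    hence "x \<notin> closure ?A" by (auto simp: closure_closed closed_Un)
    hence "at x within ?A = bot"
      using False by (simp add: at_within_eq_bot_iff)
    thus ?thesis by (simp add: has_field_derivative_iff)
  qed
  moreover have "(?e has_real_derivative ?e') (at x within ?B)"
  proof (cases "x \<in> ?B")
    case True
    hence "?e' = 0" using z \<open>p < q\<close> by (auto simp: zero_extension_def)
    moreover have "(?e has_real_derivative 0) (at x within ?B)"
      by (rule has_field_derivative_transform_within[of "\<lambda>x. 0" 0 x ?B 1])
        (use True z \<open>p < q\<close> in \<open>auto simp: zero_extension_def\<close>)
    ultimately show ?thesis by simp
  next
    case False
    hence "x \<notin> closure ?B" by (auto simp: closure_closed closed_Un)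
    hence "at x within ?B = bot"
      using False by (simp add: at_within_eq_bot_iff)
    thus ?thesis by (simp add: has_field_derivative_iff)
  qed
  ultimately have "(?e has_real_derivative ?e') (at x within (?A \<union> ?B))"
    unfolding has_field_derivative_iff by (rule Lim_Un)
  moreover have "?A \<union> ?B = UNIV" using \<open>p < q\<close> by auto
  ultimately show ?thesis by simp
qed


lemma zero_extension_lipschitz:
  assumes V: "flat_jet m p q V" and "Suc k < m"
  obtains W where "W \<ge> 0" "\<And>x y. \<bar>zero_extension p q (V k) x - zero_extension p q (V k) y\<bar> \<le> W * \<bar>x - y\<bar>"
proof -
  have "continuous_on {p..q} (V (Suc k))"
    using V jet_continuous[of m p q V "Suc k"] assms(2) by (simp add: flat_jet_def)
  then obtain W where W: "W \<ge> 0" "\<And>x. \<bar>zero_extension p q (V (Suc k)) x\<bar> \<le> W"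
    using zero_extension_bounded by blast
  have "norm (zero_extension p q (V k) x - zero_extension p q (V k) y) \<le> W * norm (x - y)" for x y
    by (rule field_differentiable_bound[OF convex_UNIV])
      (use W(2) has_derivative_zero_extension[OF assms] in auto)
  thus ?thesis using that[of W] W(1) by simp
qed

text \<open>A Taylor remainder bounded by W h^2 uniformly in the base point survives integration
  against the integrable kernel. The uniform Lipschitz constant of the derivative is where k + 2 < m
  enters.\<close>

lemma has_derivative_convolution_Riesz_kernel:
  assumes V: "flat_jet m p q V" and k: "k + 2 < m" and \<mu>: "\<mu> < 1" and D: "D \<ge> 0"
  shows "((\<lambda>z. LBINT s. zero_extension p q (V k) (z - s) * Riesz_kernel \<mu> D s) has_real_derivative
    (LBINT s. zero_extension p q (V (Suc k)) (z - s) * Riesz_kernel \<mu> D s)) (at z)"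
proof -
  let ?e = "\<lambda>k. zero_extension p q (V k)" and ?K = "Riesz_kernel \<mu> D"
  define P where "P k z = (LBINT s. ?e k (z - s) * ?K s)" for k z
  have int: "integrable lborel (\<lambda>s. ?e j (z - s) * ?K s)" if "j \<le> m" for j z
  proof -
    have cont: "continuous_on {p..q} (V j)" using V jet_continuous[of m p q V j] that by (simp add: flat_jet_def)
    then obtain B where B: "\<And>y. \<bar>?e j y\<bar> \<le> B" using zero_extension_bounded by blast
    show ?thesis
      by (rule integral_Riesz_kernel_reflect(1)[OF \<mu> D _ B]) (use integrable_zero_extension[OF cont] in auto)
  qed
  obtain W where W: "W \<ge> 0" "\<And>x y. \<bar>?e (Suc k) x - ?e (Suc k) y\<bar> \<le> W * \<bar>x - y\<bar>"
    using zero_extension_lipschitz[OF V, of "Suc k"] k by auto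
  \<comment> \<open>Subtracting the linear map with slope taken at x leaves a function whose
    derivative is at most W |h| on the segment.\<close>
  have Taylor: "\<bar>?e k (x + h) - ?e k x - h * ?e (Suc k) x\<bar> \<le> W * h\<^sup>2" for x h
  proof -
    let ?g = "\<lambda>y. ?e k y - y * ?e (Suc k) x"
    have "norm (?g (x + h) - ?g x) \<le> (W * \<bar>h\<bar>) * norm (x + h - x)"
    proof (rule field_differentiable_bound[OF convex_closed_segment])
      fix y assume y: "y \<in> closed_segment x (x + h)"
      show "(?g has_field_derivative (?e (Suc k) y - ?e (Suc k) x)) (at y within closed_segment x (x + h))"
        using k by (auto intro!: derivative_eq_intros has_field_derivative_at_within[OF has_derivative_zero_extension[OF V]])
      have "\<bar>?e (Suc k) y - ?e (Suc k) x\<bar> \<le> W * \<bar>y - x\<bar>" by (rule W(2))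
      also have "\<dots> \<le> W * \<bar>h\<bar>"
        using y W(1) by (intro mult_left_mono) (auto simp: closed_segment_eq_real_ivl split: if_splits)
      finally show "norm (?e (Suc k) y - ?e (Suc k) x) \<le> W * \<bar>h\<bar>" by simp
    qed auto
    also have "?g (x + h) - ?g x = ?e k (x + h) - ?e k x - h * ?e (Suc k) x" by (simp add: algebra_simps)
    finally show ?thesis by (simp add: power2_eq_square mult.assoc)
  qed
  define I where "I = (LBINT s. ?K s)"
  have K0: "?K s \<ge> 0" for s unfolding Riesz_kernel_def by simp
  have bound: "\<bar>P k (z + h) - P k z - h * P (Suc k) z\<bar> \<le> W * I * h\<^sup>2" for h
  proof -
    have "P k (z + h) - P k z - h * P (Suc k) z = (LBINT s. ?e k (z + h - s) * ?K s - ?e k (z - s) * ?K s - h * (?e (Suc k) (z - s) * ?K s))"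
      (is "_ = ?J") unfolding P_def using k by (simp add: int)
    hence "\<bar>P k (z + h) - P k z - h * P (Suc k) z\<bar> = \<bar>?J\<bar>" by (simp only:)
    also have "\<dots> \<le> (LBINT s. \<bar>?e k (z + h - s) * ?K s - ?e k (z - s) * ?K s - h * (?e (Suc k) (z - s) * ?K s)\<bar>)"
      by (rule integral_abs_bound)
    also have "\<dots> \<le> (LBINT s. (W * h\<^sup>2) * ?K s)"
    proof (rule integral_mono)
      show "integrable lborel (\<lambda>s. (W * h\<^sup>2) * ?K s)"
        by (rule integrable_mult_right) (rule integrable_Riesz_kernel(1)[OF \<mu> D])
      show "integrable lborel (\<lambda>s. \<bar>?e k (z + h - s) * ?K s - ?e k (z - s) * ?K s - h * (?e (Suc k) (z - s) * ?K s)\<bar>)"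
      proof -
        have "k \<le> m" "Suc k \<le> m" using k by auto
        note i = int[OF this(1), of "z + h"] int[OF this(1), of z] int[OF this(2), of z]
        show ?thesis
          by (rule integrable_abs, rule Bochner_Integration.integrable_diff[OF Bochner_Integration.integrable_diff[OF i(1,2)]])
            (rule integrable_mult_right, rule i(3))
      qed
      fix s
      have "?e k (z + h - s) * ?K s - ?e k (z - s) * ?K s - h * (?e (Suc k) (z - s) * ?K s)
        = (?e k ((z - s) + h) - ?e k (z - s) - h * ?e (Suc k) (z - s)) * ?K s"
        (is "?L = _") by (simp add: left_diff_distrib add_diff_eq diff_add_eq)
      hence "\<bar>?L\<bar> = \<bar>?e k ((z - s) + h) - ?e k (z - s) - h * ?e (Suc k) (z - s)\<bar> * ?K s"
        using K0[of s] by (simp only: abs_mult abs_of_nonneg)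
      also have "\<dots> \<le> (W * h\<^sup>2) * ?K s"
        by (intro mult_right_mono Taylor K0)
      finally show "\<bar>?e k (z + h - s) * ?K s - ?e k (z - s) * ?K s - h * (?e (Suc k) (z - s) * ?K s)\<bar> \<le> (W * h\<^sup>2) * ?K s" .
    qed
    also have "\<dots> = W * I * h\<^sup>2" unfolding I_def by simp
    finally show ?thesis .
  qed
  have "((\<lambda>h. (P k (z + h) - P k z) / h - P (Suc k) z) \<longlongrightarrow> 0) (at 0)"
  proof (rule Lim_null_comparison)
    show "\<forall>\<^sub>F h in at 0. norm ((P k (z + h) - P k z) / h - P (Suc k) z) \<le> W * I * \<bar>h\<bar>"
      unfolding eventually_at
    proof (intro exI[of _ 1] conjI ballI impI)
      fix h :: real assume h: "h \<noteq> 0 \<and> dist h 0 < 1"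
      have "norm ((P k (z + h) - P k z) / h - P (Suc k) z) = \<bar>P k (z + h) - P k z - h * P (Suc k) z\<bar> / \<bar>h\<bar>"
        using h by (simp add: field_simps flip: abs_divide)
      also have "\<dots> \<le> W * I * h\<^sup>2 / \<bar>h\<bar>" by (intro divide_right_mono bound) simp
      also have "\<dots> = W * I * \<bar>h\<bar>" using h by (simp add: power2_eq_square abs_if)
      finally show "norm ((P k (z + h) - P k z) / h - P (Suc k) z) \<le> W * I * \<bar>h\<bar>" .
    qed simp
    show "((\<lambda>h. W * I * \<bar>h\<bar>) \<longlongrightarrow> 0) (at 0)" by (auto intro!: tendsto_eq_intros)
  qed
  hence "((\<lambda>h. (P k (z + h) - P k z) / h) \<longlongrightarrow> P (Suc k) z) (at 0)" by (simp add: LIM_zero_iff)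
  thus ?thesis unfolding DERIV_def P_def .
qed

text \<open>Around an interior point the two one-sided integrals are the halves of one convolution,
  and both outer derivatives then fall on the zero extension. Since \<open>deriv\<close> sees only a
  neighbourhood, agreement on the open interval suffices.\<close>

lemma riesz_deriv_eq_Riesz_potential:
  assumes V: "flat_jet m p q V" and "4 \<le> m" and \<alpha>: "1 < \<alpha>" "\<alpha> < 2" and x: "x \<in> {p<..<q}"
    and v: "\<And>y. y \<in> {p..q} \<Longrightarrow> v y = V 0 y"
  shows "riesz_deriv \<alpha> p q v x = Riesz_potential \<alpha> p q (V 2) x"
proof -
  have jet: "jet m p q V" and pq: "p < q" using V by (auto simp: flat_jet_def jet_def)
  let ?e = "\<lambda>k. zero_extension p q (V k)" and ?K = "Riesz_kernel (\<alpha> - 1) (q - p)"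
  define P where "P k z = (LBINT s. ?e k (z - s) * ?K s)" for k z
  define f where "f z = (LBINT \<xi>:{p..z}. v \<xi> * (z - \<xi>) powr (1 - \<alpha>)) + (LBINT \<xi>:{z..q}. v \<xi> * (\<xi> - z) powr (1 - \<alpha>))" for z
  have f: "f z = P 0 z" if z: "z \<in> {p<..<q}" for z
  proof -
    have cont: "continuous_on {p..q} (V 0)" using jet_continuous[OF jet] by simp
    have [measurable]: "?e 0 \<in> borel_measurable borel" using integrable_zero_extension[OF cont] by auto
    obtain B where B: "\<And>y. \<bar>?e 0 y\<bar> \<le> B" using zero_extension_bounded[OF cont] by blast
    have i: "integrable lborel (\<lambda>y. ?e 0 y * ?K (z - y))" and r: "P 0 z = (LBINT y. ?e 0 y * ?K (z - y))"
      using integral_Riesz_kernel_reflect(2,3)[of "\<alpha> - 1" "q - p" "?e 0" B z] \<alpha> pq B by (simp_all add: P_def)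
    have 1: "(LBINT \<xi>:{p..z}. v \<xi> * (z - \<xi>) powr (1 - \<alpha>)) = (LBINT y. (?e 0 y * ?K (z - y)) * indicator {p..z} y)"
      unfolding set_lebesgue_integral_def
      by (rule Bochner_Integration.integral_cong) (use z in \<open>auto simp: indicator_def zero_extension_def v Riesz_kernel_def\<close>)
    have 2: "(LBINT \<xi>:{z..q}. v \<xi> * (\<xi> - z) powr (1 - \<alpha>)) = (LBINT y. (?e 0 y * ?K (z - y)) * indicator {z..q} y)"
      unfolding set_lebesgue_integral_def
      by (rule Bochner_Integration.integral_cong) (use z in \<open>auto simp: indicator_def zero_extension_def v Riesz_kernel_def\<close>)
    have "f z = (LBINT y. (?e 0 y * ?K (z - y)) * indicator {p..z} y + (?e 0 y * ?K (z - y)) * indicator {z..q} y)"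
      unfolding f_def 1 2
      by (rule Bochner_Integration.integral_add[symmetric]; rule integrable_times_bounded[OF i, of _ 1]) (auto simp: indicator_def)
    \<comment> \<open>The point y = z belongs to both intervals, but the kernel is 0 there, so
      nothing is counted twice.\<close>
    also have "\<dots> = (LBINT y. ?e 0 y * ?K (z - y))"
      by (rule Bochner_Integration.integral_cong) (use z in \<open>auto simp: indicator_def zero_extension_def Riesz_kernel_def\<close>)
    finally show ?thesis unfolding r .
  qed
  have dP: "(P k has_real_derivative P (Suc k) z) (at z)" if "k + 2 < m" for k z
    unfolding P_def using has_derivative_convolution_Riesz_kernel[OF V that] \<alpha> pq by simp
  have "deriv f z = P 1 z" if z: "z \<in> {p<..<q}" for z
  proof -
    have "\<forall>\<^sub>F y in nhds z. f y = P 0 y"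
      using eventually_nhds_in_open[OF open_greaterThanLessThan z] by eventually_elim (rule f)
    hence "deriv f z = deriv (P 0) z" by (rule deriv_cong_ev) simp
    thus ?thesis using DERIV_imp_deriv[OF dP[of 0 z]] assms(2) by simp
  qed
  hence "\<forall>\<^sub>F y in nhds x. deriv f y = P 1 y"
    using eventually_nhds_in_open[OF open_greaterThanLessThan x] by (auto elim: eventually_mono)
  hence "deriv (deriv f) x = deriv (P 1) x" by (rule deriv_cong_ev) simp
  also have "\<dots> = P 2 x" using DERIV_imp_deriv[OF dP[of 1 x]] assms(2) by (simp add: numeral_2_eq_2)
  finally show ?thesis unfolding riesz_deriv_def Riesz_potential_def f_def P_def by simp
qed

section \<open>Oscillatory integrals\<close>

text \<open>On \<open>{0<..1/\<bar>s\<bar>}\<close> the amplitude is estimated directly, beyond that by one integration by parts.\<close>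

lemma oscillatory_integral_bound:
  fixes \<kappa> \<kappa>' :: "real \<Rightarrow> real"
  assumes \<alpha>: "1 < \<alpha>" "\<alpha> < 2" and A: "A \<ge> 0"
    and deriv: "\<And>\<omega>. \<omega> > 0 \<Longrightarrow> (\<kappa> has_real_derivative \<kappa>' \<omega>) (at \<omega>)"
    and cont': "continuous_on {0<..} \<kappa>'"
    and b0: "\<And>\<omega>. \<omega> > 0 \<Longrightarrow> \<bar>\<kappa> \<omega>\<bar> \<le> A * \<omega> powr (\<alpha> - 2)"
    and b1: "\<And>\<omega>. \<omega> > 0 \<Longrightarrow> \<bar>\<kappa>' \<omega>\<bar> \<le> A * \<omega> powr (\<alpha> - 3)"
    and int: "integrable lborel (\<lambda>\<omega>. indicator {0<..} \<omega> * \<kappa> \<omega>)"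
    and s: "s \<noteq> 0"
  shows "\<bar>LBINT \<omega>. indicator {0<..} \<omega> * \<kappa> \<omega> * cos (\<omega> * s)\<bar> \<le> A * (1 / (\<alpha> - 1) + 2 + 1 / (2 - \<alpha>)) * \<bar>s\<bar> powr (1 - \<alpha>)"
proof -
  define r where "r = \<bar>s\<bar>"
  define a where "a = 1 / r"
  have r: "r > 0" and a: "a > 0" using s by (auto simp: r_def a_def)
  have cs: "cos (\<omega> * s) = cos (\<omega> * r)" for \<omega> unfolding r_def by (auto simp: abs_if)
  let ?h = "\<lambda>\<omega>. indicator {0<..} \<omega> * \<kappa> \<omega> * cos (\<omega> * r)"
  have inth: "integrable lborel ?h"
    by (rule integrable_times_bounded[OF int, of _ 1]) auto
  have i1: "integrable lborel (\<lambda>\<omega>. ?h \<omega> * indicator {0..<a} \<omega>)" and i2: "integrable lborel (\<lambda>\<omega>. ?h \<omega> * indicator {a..} \<omega>)"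
    by (rule integrable_times_bounded[OF inth, of _ 1]; auto simp: indicator_def)+
  have "(LBINT \<omega>. ?h \<omega>) = (LBINT \<omega>. ?h \<omega> * indicator {0..<a} \<omega> + ?h \<omega> * indicator {a..} \<omega>)"
    by (rule Bochner_Integration.integral_cong) (auto simp: indicator_def)
  also have "\<dots> = (LBINT \<omega>. ?h \<omega> * indicator {0..<a} \<omega>) + (LBINT \<omega>. ?h \<omega> * indicator {a..} \<omega>)"
    by (rule Bochner_Integration.integral_add[OF i1 i2])
  finally have split: "(LBINT \<omega>. ?h \<omega>) = (LBINT \<omega>. ?h \<omega> * indicator {0..<a} \<omega>) + (LBINT \<omega>. ?h \<omega> * indicator {a..} \<omega>)" .
  \<comment> \<open>The cut at a = 1/r is the one for which both pieces scale like r^(1 -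
    \<alpha>).\<close>
  have ra: "a powr (\<alpha> - 1) = r powr (1 - \<alpha>)" "a powr (\<alpha> - 2) / r = r powr (1 - \<alpha>)"
  proof -
    have 1: "a = r powr (- 1)" using r by (simp add: a_def powr_minus divide_inverse)
    show "a powr (\<alpha> - 1) = r powr (1 - \<alpha>)" unfolding 1 powr_powr by (simp add: algebra_simps)
    have "a powr (\<alpha> - 2) = r powr (2 - \<alpha>)" unfolding 1 powr_powr by (simp add: algebra_simps)
    also have "\<dots> / r = r powr (2 - \<alpha> - 1)" using r by (simp only: powr_diff[of r "2 - \<alpha>" 1] powr_one less_imp_le)
    finally show "a powr (\<alpha> - 2) / r = r powr (1 - \<alpha>)" by (simp add: algebra_simps)
  qed
  have "((\<lambda>x::real. x powr (\<alpha> - 2)) has_integral (a powr (\<alpha> - 2 + 1) / (\<alpha> - 2 + 1))) {0..a}"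
    by (rule has_integral_powr_from_0) (use \<alpha> a in auto)
  from nn_integral_has_integral_lebesgue'[OF _ this]
  have "(\<integral>\<^sup>+x. ennreal (x powr (\<alpha> - 2)) * indicator {0..a} x \<partial>lborel) = ennreal (a powr (\<alpha> - 1) / (\<alpha> - 1))" by simp
  hence bi: "has_bochner_integral lborel (\<lambda>x. x powr (\<alpha> - 2) * indicator {0..a} x) (a powr (\<alpha> - 1) / (\<alpha> - 1))"
    using \<alpha> by (intro has_bochner_integral_nn_integral) (auto simp: ennreal_mult ennreal_indicator)
  have first: "\<bar>LBINT \<omega>. ?h \<omega> * indicator {0..<a} \<omega>\<bar> \<le> A * (a powr (\<alpha> - 1) / (\<alpha> - 1))"
  proof -
    have "\<bar>LBINT \<omega>. ?h \<omega> * indicator {0..<a} \<omega>\<bar> \<le> (LBINT \<omega>. \<bar>?h \<omega> * indicator {0..<a} \<omega>\<bar>)" by (rule integral_abs_bound)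
    also have "\<dots> \<le> (LBINT \<omega>. A * (\<omega> powr (\<alpha> - 2) * indicator {0..a} \<omega>))"
    proof (rule integral_mono)
      show "integrable lborel (\<lambda>\<omega>. A * (\<omega> powr (\<alpha> - 2) * indicator {0..a} \<omega>))"
        using bi by (auto simp: has_bochner_integral_iff)
      show "\<bar>?h \<omega> * indicator {0..<a} \<omega>\<bar> \<le> A * (\<omega> powr (\<alpha> - 2) * indicator {0..a} \<omega>)" for \<omega>
      proof (cases "\<omega> > 0 \<and> \<omega> < a")
        case True
        have "\<bar>\<kappa> \<omega>\<bar> * \<bar>cos (\<omega> * r)\<bar> \<le> A * \<omega> powr (\<alpha> - 2) * 1"
          using True b0[of \<omega>] by (intro mult_mono) auto
        thus ?thesis using True by (simp add: abs_mult indicator_def)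
      qed (use A in \<open>auto simp: indicator_def\<close>)
    qed (use i1 in \<open>rule integrable_abs\<close>)
    also have "\<dots> = A * (a powr (\<alpha> - 1) / (\<alpha> - 1))" using bi by (simp add: has_bochner_integral_iff)
    finally show ?thesis .
  qed
  \<comment> \<open>The bound does not depend on R, so R may go to infinity. The boundary terms at a
    and at R give the 2, the integral of \<omega>^(\<alpha> - 3) beyond a gives 1/(2 -
    \<alpha>).\<close>
  have part: "\<bar>LBINT \<omega>:{a..R}. ?h \<omega>\<bar> \<le> A * (2 + 1 / (2 - \<alpha>)) * r powr (1 - \<alpha>)" if R: "R \<ge> a" for R
  proof -
    let ?F = "\<lambda>\<omega>. \<kappa> \<omega> * sin (\<omega> * r) / r" and ?g = "\<lambda>\<omega>. \<kappa>' \<omega> * sin (\<omega> * r) / r"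
    have c': "continuous_on {a..R} \<kappa>'" by (rule continuous_on_subset[OF cont']) (use a in auto)
    have c: "continuous_on {a..R} \<kappa>"
      by (rule DERIV_continuous_on[where D = \<kappa>'], rule has_field_derivative_at_within, rule deriv) (use a in auto)
    have "integral\<^sup>L lborel (\<lambda>\<omega>. indicator {a..R} \<omega> *\<^sub>R (?g \<omega> + \<kappa> \<omega> * cos (\<omega> * r))) = ?F R - ?F a"
    proof (rule integral_FTC_atLeastAtMost[OF R])
      show "continuous_on {a..R} (\<lambda>\<omega>. ?g \<omega> + \<kappa> \<omega> * cos (\<omega> * r))"
        using r by (intro continuous_intros c c') auto
      fix \<omega> assume \<omega>: "a \<le> \<omega>" "\<omega> \<le> R"
      have "(\<kappa> has_real_derivative \<kappa>' \<omega>) (at \<omega> within {a..R})"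
        using deriv[of \<omega>] \<omega> a by (simp add: has_field_derivative_at_within)
      hence "(?F has_real_derivative (?g \<omega> + \<kappa> \<omega> * cos (\<omega> * r))) (at \<omega> within {a..R})"
        using r by (auto intro!: derivative_eq_intros simp: field_simps)
      thus "(?F has_vector_derivative (?g \<omega> + \<kappa> \<omega> * cos (\<omega> * r))) (at \<omega> within {a..R})"
        by (simp add: has_real_derivative_iff_has_vector_derivative)
    qed
    moreover have ig: "integrable lborel (\<lambda>\<omega>. indicator {a..R} \<omega> *\<^sub>R ?g \<omega>)"
    proof -
      have "continuous_on {a..R} ?g" using r by (intro continuous_intros c') auto
      from borel_integrable_atLeastAtMost'[OF this] show ?thesis unfolding set_integrable_def .
    qed
    moreover have ik: "integrable lborel (\<lambda>\<omega>. indicator {a..R} \<omega> *\<^sub>R (\<kappa> \<omega> * cos (\<omega> * r)))"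
    proof -
      have "continuous_on {a..R} (\<lambda>\<omega>. \<kappa> \<omega> * cos (\<omega> * r))" by (intro continuous_intros c)
      from borel_integrable_atLeastAtMost'[OF this] show ?thesis unfolding set_integrable_def .
    qed
    ultimately have "(LBINT \<omega>. indicator {a..R} \<omega> *\<^sub>R ?g \<omega>) + (LBINT \<omega>. indicator {a..R} \<omega> *\<^sub>R (\<kappa> \<omega> * cos (\<omega> * r))) = ?F R - ?F a"
      by (simp only: scaleR_add_right Bochner_Integration.integral_add)
    moreover have "(LBINT \<omega>. indicator {a..R} \<omega> *\<^sub>R (\<kappa> \<omega> * cos (\<omega> * r))) = (LBINT \<omega>:{a..R}. ?h \<omega>)"
      unfolding set_lebesgue_integral_def using a by (intro Bochner_Integration.integral_cong) (auto simp: indicator_def)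
    moreover have Fb: "\<bar>?F \<omega>\<bar> \<le> A * r powr (1 - \<alpha>)" if "\<omega> \<ge> a" for \<omega>
    proof -
      have "\<bar>\<kappa> \<omega>\<bar> * \<bar>sin (\<omega> * r)\<bar> \<le> A * \<omega> powr (\<alpha> - 2) * 1"
        using that a b0[of \<omega>] by (intro mult_mono) auto
      also have "\<dots> \<le> A * a powr (\<alpha> - 2)"
        using A that a \<alpha> by (auto intro!: mult_left_mono powr_mono2')
      finally have "\<bar>?F \<omega>\<bar> \<le> A * (a powr (\<alpha> - 2) / r)"
        using r by (simp add: abs_mult divide_right_mono)
      thus ?thesis unfolding ra(2) .
    qed
    moreover have "\<bar>LBINT \<omega>. indicator {a..R} \<omega> *\<^sub>R ?g \<omega>\<bar> \<le> A * (1 / (2 - \<alpha>)) * r powr (1 - \<alpha>)"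
    proof -
      have "\<bar>LBINT \<omega>. indicator {a..R} \<omega> *\<^sub>R ?g \<omega>\<bar> \<le> (LBINT \<omega>. \<bar>indicator {a..R} \<omega> *\<^sub>R ?g \<omega>\<bar>)" by (rule integral_abs_bound)
      also have "\<dots> \<le> (LBINT \<omega>. indicator {a..R} \<omega> *\<^sub>R (A / r * \<omega> powr (\<alpha> - 3)))"
      proof (rule integral_mono)
        show "integrable lborel (\<lambda>\<omega>. indicator {a..R} \<omega> *\<^sub>R (A / r * \<omega> powr (\<alpha> - 3)))"
        proof -
          have "continuous_on {a..R} (\<lambda>\<omega>. A / r * \<omega> powr (\<alpha> - 3))" using a r by (intro continuous_intros) auto
          from borel_integrable_atLeastAtMost'[OF this] show ?thesis unfolding set_integrable_def .
        qed
        show "\<bar>indicator {a..R} \<omega> *\<^sub>R ?g \<omega>\<bar> \<le> indicator {a..R} \<omega> *\<^sub>R (A / r * \<omega> powr (\<alpha> - 3))" for \<omega>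
        proof (cases "\<omega> \<in> {a..R}")
          case True
          have "\<bar>\<kappa>' \<omega>\<bar> * \<bar>sin (\<omega> * r)\<bar> \<le> A * \<omega> powr (\<alpha> - 3) * 1"
            using True a b1[of \<omega>] by (intro mult_mono) auto
          thus ?thesis using True r by (simp add: abs_mult divide_right_mono)
        qed simp
      qed (use ig in \<open>rule integrable_abs\<close>)
      also have "\<dots> = A / r * (R powr (\<alpha> - 2) / (\<alpha> - 2)) - A / r * (a powr (\<alpha> - 2) / (\<alpha> - 2))"
      proof (rule integral_FTC_atLeastAtMost[OF R])
        show "continuous_on {a..R} (\<lambda>\<omega>. A / r * \<omega> powr (\<alpha> - 3))" using a r by (intro continuous_intros) auto
        fix \<omega> assume \<omega>: "a \<le> \<omega>" "\<omega> \<le> R"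
        have "((\<lambda>x. x powr (\<alpha> - 2)) has_real_derivative (\<alpha> - 2) * \<omega> powr (\<alpha> - 2 - 1)) (at \<omega>)"
          using \<omega> a by (intro has_real_derivative_powr) auto
        from DERIV_cmult[OF DERIV_cdivide[OF this, of "\<alpha> - 2"], of "A / r"]
        have "((\<lambda>x. A / r * (x powr (\<alpha> - 2) / (\<alpha> - 2))) has_real_derivative A / r * \<omega> powr (\<alpha> - 3)) (at \<omega>)"
          using \<alpha> by simp
        thus "((\<lambda>x. A / r * (x powr (\<alpha> - 2) / (\<alpha> - 2))) has_vector_derivative A / r * \<omega> powr (\<alpha> - 3)) (at \<omega> within {a..R})"
          by (simp add: has_real_derivative_iff_has_vector_derivative[symmetric] has_field_derivative_at_within)
      qed
      also have "\<dots> = A * (1 / (2 - \<alpha>)) * (a powr (\<alpha> - 2) / r) - A / r * (R powr (\<alpha> - 2) / (2 - \<alpha>))"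
        using \<alpha> r by (simp add: field_simps)
      also have "\<dots> \<le> A * (1 / (2 - \<alpha>)) * (a powr (\<alpha> - 2) / r)"
        using A \<alpha> r by simp
      finally show ?thesis unfolding ra(2) .
    qed
    ultimately have "\<bar>LBINT \<omega>:{a..R}. ?h \<omega>\<bar> \<le> A * r powr (1 - \<alpha>) + A * r powr (1 - \<alpha>) + A * (1 / (2 - \<alpha>)) * r powr (1 - \<alpha>)"
      using Fb[of R] Fb[of a] R by linarith
    thus ?thesis by (simp add: algebra_simps)
  qed
  have "((\<lambda>R. LBINT \<omega>:{a..R}. ?h \<omega>) \<longlongrightarrow> (LBINT \<omega>:{a..}. ?h \<omega>)) at_top"
    by (rule tendsto_set_lebesgue_integral_at_top) (use i2 in \<open>auto simp: set_integrable_def mult.commute\<close>)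
  hence "((\<lambda>R. \<bar>LBINT \<omega>:{a..R}. ?h \<omega>\<bar>) \<longlongrightarrow> \<bar>LBINT \<omega>:{a..}. ?h \<omega>\<bar>) at_top"
    by (rule tendsto_rabs)
  hence "\<bar>LBINT \<omega>:{a..}. ?h \<omega>\<bar> \<le> A * (2 + 1 / (2 - \<alpha>)) * r powr (1 - \<alpha>)"
    by (rule tendsto_upperbound) (use part in \<open>auto simp: eventually_at_top_linorder\<close>)
  moreover have "(LBINT \<omega>:{a..}. ?h \<omega>) = (LBINT \<omega>. ?h \<omega> * indicator {a..} \<omega>)"
    by (simp add: set_lebesgue_integral_def mult.commute)
  ultimately have "\<bar>LBINT \<omega>. ?h \<omega>\<bar> \<le> A * (a powr (\<alpha> - 1) / (\<alpha> - 1)) + A * (2 + 1 / (2 - \<alpha>)) * r powr (1 - \<alpha>)"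
    using first split by linarith
  thus ?thesis unfolding cs ra r_def[symmetric] by (simp add: algebra_simps)
qed

section \<open>Multipliers acting on functions with jumps\<close>

text \<open>The constant of \<open>oscillatory_integral_bound\<close> times the integral of |s|^(1 -
  \<alpha>) over [-D, D].\<close>

definition kernel_const :: "real \<Rightarrow> real \<Rightarrow> real" where
  "kernel_const \<alpha> D = (1 / (\<alpha> - 1) + 2 + 1 / (2 - \<alpha>)) * (2 * (D powr (2 - \<alpha>) / (2 - \<alpha>)))"

lemma kernel_const_nonneg: "1 < \<alpha> \<Longrightarrow> \<alpha> < 2 \<Longrightarrow> kernel_const \<alpha> D \<ge> 0"
  unfolding kernel_const_def by (intro mult_nonneg_nonneg add_nonneg_nonneg divide_nonneg_nonneg) auto

text \<open>In physical space the multiplier is convolution with its own cosine transform, which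
  \<open>oscillatory_integral_bound\<close> compares with |s|^(1 - \<alpha>). The estimate therefore
  involves f only through its supremum and tolerates jumps at the ends. A enters linearly, which is
  how powers of the mesh size are carried through; the integrability of \<kappa> is only
  qualitative.\<close>

lemma multiplier_bound:
  fixes \<kappa> \<kappa>' f :: "real \<Rightarrow> real"
  assumes \<alpha>: "1 < \<alpha>" "\<alpha> < 2" and A: "A \<ge> 0"
    and deriv: "\<And>\<omega>. \<omega> > 0 \<Longrightarrow> (\<kappa> has_real_derivative \<kappa>' \<omega>) (at \<omega>)"
    and cont': "continuous_on {0<..} \<kappa>'"
    and b0: "\<And>\<omega>. \<omega> > 0 \<Longrightarrow> \<bar>\<kappa> \<omega>\<bar> \<le> A * \<omega> powr (\<alpha> - 2)"
    and b1: "\<And>\<omega>. \<omega> > 0 \<Longrightarrow> \<bar>\<kappa>' \<omega>\<bar> \<le> A * \<omega> powr (\<alpha> - 3)"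
    and int: "integrable lborel (\<lambda>\<omega>. indicator {0<..} \<omega> * \<kappa> \<omega>)"
    and f: "continuous_on {p..q} f" "\<And>y. y \<in> {p..q} \<Longrightarrow> \<bar>f y\<bar> \<le> W" and x: "x \<in> {p..q}"
  shows "\<bar>LBINT \<omega>. indicator {0<..} \<omega> * (\<kappa> \<omega> * cosine_transform (zero_extension p q f) (\<omega> * x) \<omega>)\<bar> \<le> A * kernel_const \<alpha> (q - p) * W"
proof -
  let ?f = "zero_extension p q f" and ?I = "indicator {0<..} :: real \<Rightarrow> real"
  let ?C = "1 / (\<alpha> - 1) + 2 + 1 / (2 - \<alpha>)"
  note intf = integrable_zero_extension[OF f(1)]
  have [measurable]: "?f \<in> borel_measurable borel" using intf by auto
  define rho where "rho \<omega> = ?I \<omega> * \<kappa> \<omega>" for \<omega>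
  have intrho: "integrable lborel rho" using int by (simp add: rho_def[abs_def])
  have [measurable]: "rho \<in> borel_measurable borel" using intrho by auto
  define k where "k s = (LBINT \<omega>. rho \<omega> * cos (\<omega> * s))" for s
  have [measurable]: "k \<in> borel_measurable borel" unfolding k_def by simp
  have kb: "\<bar>k s\<bar> \<le> A * ?C * \<bar>s\<bar> powr (1 - \<alpha>)" if "s \<noteq> 0" for s
    unfolding k_def rho_def by (rule oscillatory_integral_bound[OF \<alpha> A deriv cont' b0 b1 int that])
  define K where "K = (\<lambda>\<omega> y. rho \<omega> * (?f y * cos (\<omega> * x - \<omega> * y)))"
  have "(LBINT \<omega>. LBINT y. K \<omega> y) = (LBINT y. LBINT \<omega>. K \<omega> y)"
  proof (rule LBINT_swap[where K = K])
    show "case_prod K \<in> borel_measurable (lborel \<Otimes>\<^sub>M lborel)" unfolding K_def by simp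
    show "AE \<omega> in lborel. integrable lborel (K \<omega>)"
      unfolding K_def using integrable_cosine_transform[OF intf] by simp
    show "integrable lborel (\<lambda>\<omega>. LBINT y. \<bar>K \<omega> y\<bar>)"
    proof (rule Bochner_Integration.integrable_bound[OF integrable_mult_left[OF intrho, of "LBINT y. \<bar>?f y\<bar>"]])
      show "AE \<omega> in lborel. norm (LBINT y. \<bar>K \<omega> y\<bar>) \<le> norm (rho \<omega> * (LBINT y. \<bar>?f y\<bar>))"
      proof (intro AE_I2)
        fix \<omega>
        have "(LBINT y. \<bar>K \<omega> y\<bar>) = \<bar>rho \<omega>\<bar> * (LBINT y. \<bar>?f y * cos (\<omega> * x - \<omega> * y)\<bar>)"
          unfolding K_def by (simp add: abs_mult)
        also have "\<dots> \<le> \<bar>rho \<omega>\<bar> * (LBINT y. \<bar>?f y\<bar>)"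
          using integrable_abs[OF intf] integrable_abs[OF integrable_cosine_transform[OF intf]]
          by (intro mult_left_mono integral_mono) (auto simp: abs_mult intro!: mult_left_le)
        finally show "norm (LBINT y. \<bar>K \<omega> y\<bar>) \<le> norm (rho \<omega> * (LBINT y. \<bar>?f y\<bar>))" by (simp add: abs_mult)
      qed
    qed (simp add: K_def)
  qed
  moreover have "(LBINT y. K \<omega> y) = ?I \<omega> * (\<kappa> \<omega> * cosine_transform ?f (\<omega> * x) \<omega>)" for \<omega>
    unfolding K_def rho_def cosine_transform_def by simp
  moreover have "(LBINT \<omega>. K \<omega> y) = ?f y * k (x - y)" for y
  proof -
    have "K \<omega> y = ?f y * (rho \<omega> * cos (\<omega> * (x - y)))" for \<omega>
      unfolding K_def by (simp add: algebra_simps)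
    thus ?thesis unfolding k_def by simp
  qed
  ultimately have eq: "(LBINT \<omega>. ?I \<omega> * (\<kappa> \<omega> * cosine_transform ?f (\<omega> * x) \<omega>)) = (LBINT y. ?f y * k (x - y))"
    by simp
  have W: "W \<ge> 0" using f(2)[OF x] by linarith
  have C: "?C \<ge> 0" using \<alpha> by auto
  let ?R = "Riesz_kernel (\<alpha> - 1) (q - p)"
  have R: "integrable lborel ?R" "(LBINT s. ?R s) = 2 * ((q - p) powr (2 - \<alpha>) / (2 - \<alpha>))"
    using integrable_Riesz_kernel[of "\<alpha> - 1" "q - p"] \<alpha> x by simp_all
  have R': "integrable lborel (\<lambda>y. ?R (x - y))" "(LBINT y. ?R (x - y)) = (LBINT s. ?R s)"
    using lborel_integrable_real_affine[OF R(1), of "-1" x] lborel_integral_real_affine[of "-1" ?R x] by simp_all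
  \<comment> \<open>The estimate of k excludes s = 0, where \<open>Riesz_kernel\<close> has the
    value 0; hence the inequality is claimed almost everywhere.\<close>
  have ae: "AE y in lborel. \<bar>?f y * k (x - y)\<bar> \<le> (W * (A * ?C)) * ?R (x - y)"
    using AE_lborel_singleton[of x]
  proof eventually_elim
    fix y assume "y \<noteq> x"
    show "\<bar>?f y * k (x - y)\<bar> \<le> (W * (A * ?C)) * ?R (x - y)"
    proof (cases "y \<in> {p..q}")
      case True
      have "\<bar>f y\<bar> * \<bar>k (x - y)\<bar> \<le> W * (A * ?C * \<bar>x - y\<bar> powr (1 - \<alpha>))"
        using True \<open>y \<noteq> x\<close> f(2)[OF True] kb[of "x - y"] W by (intro mult_mono) auto
      moreover have "?R (x - y) = \<bar>x - y\<bar> powr (1 - \<alpha>)"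
        using True x by (auto simp: Riesz_kernel_def indicator_def)
      ultimately show ?thesis using True by (simp add: zero_extension_def abs_mult mult_ac)
    next
      case False
      have "0 \<le> (W * (A * ?C)) * ?R (x - y)"
        using W A C by (intro mult_nonneg_nonneg) (auto simp: Riesz_kernel_def)
      thus ?thesis using False by (auto simp: zero_extension_def)
    qed
  qed
  have iR: "integrable lborel (\<lambda>y. (W * (A * ?C)) * ?R (x - y))"
    by (rule integrable_mult_right) (rule R'(1))
  have "\<bar>LBINT y. ?f y * k (x - y)\<bar> \<le> (LBINT y. \<bar>?f y * k (x - y)\<bar>)" by (rule integral_abs_bound)
  also have "\<dots> \<le> (LBINT y. (W * (A * ?C)) * ?R (x - y))"
  proof (rule integral_mono_AE[OF _ iR ae])
    show "integrable lborel (\<lambda>y. \<bar>?f y * k (x - y)\<bar>)"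
    proof (rule Bochner_Integration.integrable_bound[OF iR])
      show "AE y in lborel. norm \<bar>?f y * k (x - y)\<bar> \<le> norm ((W * (A * ?C)) * ?R (x - y))"
        using ae
      proof eventually_elim
        case (elim y)
        from order_trans[OF elim abs_ge_self] show ?case by (simp only: real_norm_def abs_abs)
      qed
    qed simp
  qed
  also have "\<dots> = A * kernel_const \<alpha> (q - p) * W"
    using R R' by (simp add: kernel_const_def)
  finally show ?thesis unfolding eq .
qed

text \<open>At w = 0 the difference quotient is at most |h|^(\<alpha> - 1), which tends to 0 because
  \<alpha> > 1. This covers the zeros of the sine in the discrete symbol.\<close>

lemma has_derivative_abs_powr:
  assumes "(\<alpha>::real) > 1"
  shows "((\<lambda>w. \<bar>w\<bar> powr \<alpha>) has_real_derivative \<alpha> * sgn w * \<bar>w\<bar> powr (\<alpha> - 1)) (at w)"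
proof -
  consider "w > 0" | "w < 0" | "w = 0" by linarith
  thus ?thesis
  proof cases
    case 1
    have "((\<lambda>w. w powr \<alpha>) has_real_derivative \<alpha> * w powr (\<alpha> - 1)) (at w)" using 1 by (rule has_real_derivative_powr)
    from has_field_derivative_transform_within[OF this 1 UNIV_I, of "\<lambda>w. \<bar>w\<bar> powr \<alpha>"]
    show ?thesis using 1 by (auto simp: dist_real_def)
  next
    case 2
    have "((\<lambda>w. (- w) powr \<alpha>) has_real_derivative (\<alpha> * (- w) powr (\<alpha> - 1)) * (- 1)) (at w)"
      by (rule DERIV_chain2[OF has_real_derivative_powr]) (use 2 in \<open>auto intro!: derivative_eq_intros\<close>)
    hence "((\<lambda>w. (- w) powr \<alpha>) has_real_derivative \<alpha> * sgn w * \<bar>w\<bar> powr (\<alpha> - 1)) (at w)" using 2 by simp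
    from has_field_derivative_transform_within[OF this _ UNIV_I, of "- w" "\<lambda>w. \<bar>w\<bar> powr \<alpha>"]
    show ?thesis using 2 by (auto simp: dist_real_def)
  next
    case 3
    have "((\<lambda>h::real. \<bar>h\<bar> powr \<alpha> / h) \<longlongrightarrow> 0) (at 0)"
    proof (rule Lim_null_comparison)
      have "norm (\<bar>h\<bar> powr \<alpha> / h) \<le> \<bar>h\<bar> powr (\<alpha> - 1)" for h :: real
        by (cases "h = 0") (auto simp: powr_diff)
      thus "\<forall>\<^sub>F h in at 0. norm (\<bar>h\<bar> powr \<alpha> / h) \<le> \<bar>h::real\<bar> powr (\<alpha> - 1)" by simp
      have "((\<lambda>h::real. \<bar>h\<bar> powr (\<alpha> - 1)) \<longlongrightarrow> \<bar>0\<bar> powr (\<alpha> - 1)) (at 0)"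
        using assms by (intro tendsto_powr' tendsto_intros) auto
      thus "((\<lambda>h::real. \<bar>h\<bar> powr (\<alpha> - 1)) \<longlongrightarrow> 0) (at 0)" using assms by simp
    qed
    thus ?thesis using 3 assms unfolding DERIV_def by simp
  qed
qed

text \<open>The odd power is the difference of the powers of the positive and the negative part,
  both continuous for a positive exponent.\<close>

lemma continuous_sgn_abs_powr:
  assumes "(\<beta>::real) > 0"
  shows "continuous_on A (\<lambda>w::real. sgn w * \<bar>w\<bar> powr \<beta>)"
proof -
  have "(\<lambda>w::real. sgn w * \<bar>w\<bar> powr \<beta>) = (\<lambda>w. (max w 0) powr \<beta> - (max (- w) 0) powr \<beta>)"
    using assms by (auto simp: sgn_if max_def)
  moreover have "continuous_on A (\<lambda>w::real. (max w 0) powr \<beta> - (max (- w) 0) powr \<beta>)"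
    using assms by (intro continuous_on_diff continuous_on_powr' continuous_on_max continuous_on_minus continuous_on_const continuous_on_id) auto
  ultimately show ?thesis by (simp only:)
qed


text \<open>Lets symmetric stencils act on transforms as cosine multipliers.\<close>

lemma cosine_transform_pair:
  assumes "integrable lborel f"
  shows "cosine_transform f (\<omega> * (x - t)) \<omega> + cosine_transform f (\<omega> * (x + t)) \<omega> = 2 * cos (t * \<omega>) * cosine_transform f (\<omega> * x) \<omega>"
proof -
  have "cosine_transform f (\<omega> * (x - t)) \<omega> + cosine_transform f (\<omega> * (x + t)) \<omega>
    = (LBINT y. f y * cos (\<omega> * (x - t) - \<omega> * y) + f y * cos (\<omega> * (x + t) - \<omega> * y))"
    unfolding cosine_transform_def
    by (rule Bochner_Integration.integral_add[symmetric]; rule integrable_cosine_transform[OF assms])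
  also have "\<dots> = (LBINT y. 2 * cos (t * \<omega>) * (f y * cos (\<omega> * x - \<omega> * y)))"
  proof (rule Bochner_Integration.integral_cong[OF refl])
    fix y
    have e: "\<omega> * (x - t) - \<omega> * y = (\<omega> * x - \<omega> * y) - t * \<omega>" "\<omega> * (x + t) - \<omega> * y = (\<omega> * x - \<omega> * y) + t * \<omega>"
      by (simp_all add: algebra_simps)
    show "f y * cos (\<omega> * (x - t) - \<omega> * y) + f y * cos (\<omega> * (x + t) - \<omega> * y) = 2 * cos (t * \<omega>) * (f y * cos (\<omega> * x - \<omega> * y))"
      unfolding e cos_add cos_diff[of "\<omega> * x - \<omega> * y" "t * \<omega>"] by (simp add: algebra_simps)
  qed
  finally show ?thesis unfolding cosine_transform_def by simp
qed

text \<open>The two-sided stencil folded by symmetry and cut after K terms on either side; for a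
  function of bounded support nothing is lost once K is large.\<close>

definition frac_diff :: "real \<Rightarrow> real \<Rightarrow> nat \<Rightarrow> (real \<Rightarrow> real) \<Rightarrow> real \<Rightarrow> real" where
  "frac_diff \<alpha> h K e x = frac_coeff_nat \<alpha> 0 * e x
     + (\<Sum>k<K. frac_coeff_nat \<alpha> (Suc k) * (e (x - real (Suc k) * h) + e (x + real (Suc k) * h)))"

text \<open>Partial sums of the stencil correspond to partial sums of the symbol, which are bounded
  by the absolute sum of the coefficients. The stencil is constant from K on, so dominated
  convergence identifies it with the full symbol.\<close>

lemma frac_diff_cosine_transform:
  assumes V: "flat_jet m p q V" and "2 \<le> m" and \<alpha>: "1 < \<alpha>" "\<alpha> < 2"
    and out: "\<And>k. K \<le> k \<Longrightarrow> zero_extension p q (V 0) (x - real (Suc k) * h) = 0 \<and> zero_extension p q (V 0) (x + real (Suc k) * h) = 0"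
  shows "pi * frac_diff \<alpha> h K (zero_extension p q (V 0)) x
    = (LBINT \<omega>. indicator {0<..} \<omega> * (\<bar>2 * sin (h * \<omega> / 2)\<bar> powr \<alpha> * cosine_transform (zero_extension p q (V 0)) (\<omega> * x) \<omega>))"
proof -
  let ?e = "zero_extension p q (V 0)" and ?g = "frac_coeff_nat \<alpha>"
  let ?J = "\<lambda>x \<omega>. indicator {0<..} \<omega> * cosine_transform ?e (\<omega> * x) \<omega>"
  have jet: "jet m p q V" using V by (simp add: flat_jet_def)
  have inte: "integrable lborel ?e" using jet_continuous[OF jet, of 0] by (intro integrable_zero_extension) auto
  have [measurable]: "?e \<in> borel_measurable borel" using inte by auto
  note inv = flat_jet_inversion[OF V, of 0, unfolded add_0, OF assms(2)]
  define S where "S n \<theta> = ?g 0 + 2 * (\<Sum>k<n. ?g (Suc k) * cos (real (Suc k) * \<theta>))" for n \<theta>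
  have partial: "pi * frac_diff \<alpha> h n ?e x = (LBINT \<omega>. S n (h * \<omega>) * ?J x \<omega>)" for n
  proof -
    have "pi * frac_diff \<alpha> h n ?e x = ?g 0 * (LBINT \<omega>. ?J x \<omega>)
        + (\<Sum>k<n. ?g (Suc k) * ((LBINT \<omega>. ?J (x - real (Suc k) * h) \<omega>) + (LBINT \<omega>. ?J (x + real (Suc k) * h) \<omega>)))"
      unfolding inv(1) frac_diff_def by (simp add: algebra_simps sum_distrib_left)
    also have "\<dots> = (LBINT \<omega>. ?g 0 * ?J x \<omega> + (\<Sum>k<n. ?g (Suc k) * (?J (x - real (Suc k) * h) \<omega> + ?J (x + real (Suc k) * h) \<omega>)))"
      using inv(2) by simp
    also have "\<dots> = (LBINT \<omega>. S n (h * \<omega>) * ?J x \<omega>)"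
    proof (rule Bochner_Integration.integral_cong[OF refl])
      fix \<omega> :: real
      have "?J (x - real (Suc k) * h) \<omega> + ?J (x + real (Suc k) * h) \<omega> = 2 * cos (real (Suc k) * (h * \<omega>)) * ?J x \<omega>" for k
        using cosine_transform_pair[OF inte, of \<omega> x "real (Suc k) * h"] by (simp add: indicator_def mult.assoc)
      thus "?g 0 * ?J x \<omega> + (\<Sum>k<n. ?g (Suc k) * (?J (x - real (Suc k) * h) \<omega> + ?J (x + real (Suc k) * h) \<omega>)) = S n (h * \<omega>) * ?J x \<omega>"
        unfolding S_def by (simp add: algebra_simps sum_distrib_left sum_distrib_right)
    qed
    finally show ?thesis .
  qed
  have const: "frac_diff \<alpha> h n ?e x = frac_diff \<alpha> h K ?e x" if "n \<ge> K" for n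
  proof -
    have "(\<Sum>k<n. ?g (Suc k) * (?e (x - real (Suc k) * h) + ?e (x + real (Suc k) * h)))
      = (\<Sum>k<K. ?g (Suc k) * (?e (x - real (Suc k) * h) + ?e (x + real (Suc k) * h)))"
      using that out by (intro sum.mono_neutral_right) auto
    thus ?thesis by (simp add: frac_diff_def)
  qed
  have sm: "summable (\<lambda>k. \<bar>?g (Suc k)\<bar>)" using summable_abs_frac_coeff[OF \<alpha>] by (subst summable_Suc_iff)
  define G where "G = \<bar>?g 0\<bar> + 2 * (\<Sum>k. \<bar>?g (Suc k)\<bar>)"
  have SG: "\<bar>S n \<theta>\<bar> \<le> G" for n \<theta>
  proof -
    have "\<bar>\<Sum>k<n. ?g (Suc k) * cos (real (Suc k) * \<theta>)\<bar> \<le> (\<Sum>k<n. \<bar>?g (Suc k)\<bar>)"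
      by (rule order_trans[OF sum_abs]) (auto intro!: sum_mono mult_left_le simp: abs_mult)
    also have "\<dots> \<le> (\<Sum>k. \<bar>?g (Suc k)\<bar>)" by (rule sum_le_suminf[OF sm]) auto
    finally show ?thesis unfolding S_def G_def by linarith
  qed
  have "(\<lambda>n. LBINT \<omega>. S n (h * \<omega>) * ?J x \<omega>) \<longlonglongrightarrow> (LBINT \<omega>. frac_symbol \<alpha> (h * \<omega>) * ?J x \<omega>)"
  proof (rule integral_dominated_convergence[where w = "\<lambda>\<omega>. G * \<bar>?J x \<omega>\<bar>"])
    show "AE \<omega> in lborel. (\<lambda>n. S n (h * \<omega>) * ?J x \<omega>) \<longlonglongrightarrow> frac_symbol \<alpha> (h * \<omega>) * ?J x \<omega>"
    proof (intro AE_I2 tendsto_mult tendsto_const)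
      fix \<omega>
      have "summable (\<lambda>k. ?g (Suc k) * cos (real (Suc k) * (h * \<omega>)))" by (rule summable_frac_symbol(1)[OF \<alpha>]) simp
      thus "(\<lambda>n. S n (h * \<omega>)) \<longlonglongrightarrow> frac_symbol \<alpha> (h * \<omega>)"
        unfolding S_def frac_symbol_def by (intro tendsto_intros summable_LIMSEQ)
    qed
    show "AE \<omega> in lborel. norm (S n (h * \<omega>) * ?J x \<omega>) \<le> G * \<bar>?J x \<omega>\<bar>" for n
      using SG by (intro AE_I2) (simp add: abs_mult mult_right_mono del: abs_indicator)
    show "integrable lborel (\<lambda>\<omega>. G * \<bar>?J x \<omega>\<bar>)"
      by (rule integrable_mult_right, rule integrable_abs, rule inv(2))
    show "(\<lambda>\<omega>. frac_symbol \<alpha> (h * \<omega>) * ?J x \<omega>) \<in> borel_measurable lborel"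
      unfolding frac_symbol_eq[OF \<alpha>] by simp
    show "(\<lambda>\<omega>. S n (h * \<omega>) * ?J x \<omega>) \<in> borel_measurable lborel" for n
      unfolding S_def by simp
  qed
  moreover have "(\<lambda>n. LBINT \<omega>. S n (h * \<omega>) * ?J x \<omega>) \<longlonglongrightarrow> pi * frac_diff \<alpha> h K ?e x"
  proof (rule tendsto_eventually)
    show "\<forall>\<^sub>F n in sequentially. (LBINT \<omega>. S n (h * \<omega>) * ?J x \<omega>) = pi * frac_diff \<alpha> h K ?e x"
      using eventually_ge_at_top[of K]
    proof eventually_elim
      case (elim n)
      show ?case unfolding partial[symmetric] const[OF elim] ..
    qed
  qed
  ultimately have "pi * frac_diff \<alpha> h K ?e x = (LBINT \<omega>. frac_symbol \<alpha> (h * \<omega>) * ?J x \<omega>)"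
    by (rule LIMSEQ_unique[symmetric])
  also have "\<dots> = (LBINT \<omega>. indicator {0<..} \<omega> * (\<bar>2 * sin (h * \<omega> / 2)\<bar> powr \<alpha> * cosine_transform ?e (\<omega> * x) \<omega>))"
    unfolding frac_symbol_eq[OF \<alpha>] by (simp only: mult_ac)
  finally show ?thesis .
qed

section \<open>Fractional differences\<close>

lemma has_derivative_abs_sin_powr:
  assumes "(\<alpha>::real) > 1"
  shows "((\<lambda>\<omega>. \<bar>2 * sin (h * \<omega> / 2)\<bar> powr \<alpha>) has_real_derivative
    \<alpha> * (sgn (2 * sin (h * \<omega> / 2)) * \<bar>2 * sin (h * \<omega> / 2)\<bar> powr (\<alpha> - 1)) * (h * cos (h * \<omega> / 2))) (at \<omega>)"
proof -
  have "((\<lambda>\<omega>. 2 * sin (h * \<omega> / 2)) has_real_derivative h * cos (h * \<omega> / 2)) (at \<omega>)"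
    by (auto intro!: derivative_eq_intros)
  from DERIV_chain2[OF has_derivative_abs_powr[OF assms] this] show ?thesis by (simp only: mult.assoc)
qed

text \<open>Two derivatives are moved onto the function, and |2 sin(h \<omega>/2)| \<le> h \<omega>
  makes the bounds on the remaining multiplier free of h. Applied in both variables, this controls
  the mixed term of the scheme.\<close>

lemma frac_diff_bound:
  assumes V: "flat_jet m p q V" and m: "2 \<le> m" and \<alpha>: "1 < \<alpha>" "\<alpha> < 2" and h: "h > 0"
    and out: "\<And>k. K \<le> k \<Longrightarrow> zero_extension p q (V 0) (x - real (Suc k) * h) = 0 \<and> zero_extension p q (V 0) (x + real (Suc k) * h) = 0"
    and W: "\<And>y. y \<in> {p..q} \<Longrightarrow> \<bar>V 2 y\<bar> \<le> W" and x: "x \<in> {p..q}"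
  shows "\<bar>h powr (- \<alpha>) * frac_diff \<alpha> h K (zero_extension p q (V 0)) x\<bar> \<le> 4 * kernel_const \<alpha> (q - p) * W"
proof -
  have jet: "jet m p q V" using V by (simp add: flat_jet_def)
  have cont: "continuous_on {p..q} (V 2)" using jet_continuous[OF jet] m by simp
  let ?S = "\<lambda>\<omega>. \<bar>2 * sin (h * \<omega> / 2)\<bar>"
  let ?G = "\<lambda>\<omega>. \<alpha> * (sgn (2 * sin (h * \<omega> / 2)) * ?S \<omega> powr (\<alpha> - 1)) * (h * cos (h * \<omega> / 2))"
  \<comment> \<open>The factor \<omega>^(-2) is compensated by passing from \<open>V 0\<close> to
    \<open>V 2\<close>.\<close>
  define \<kappa> where "\<kappa> = (\<lambda>\<omega>. h powr (- \<alpha>) * (?S \<omega> powr \<alpha> * \<omega> powr (- 2)))"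
  define \<kappa>' where "\<kappa>' = (\<lambda>\<omega>. h powr (- \<alpha>) * (?G \<omega> * \<omega> powr (- 2) + ?S \<omega> powr \<alpha> * (- 2 * \<omega> powr (- 3))))"
  have S: "?S \<omega> \<le> h * \<omega>" if "\<omega> > 0" for \<omega>
    using abs_sin_x_le_abs_x[of "h * \<omega> / 2"] that h by (simp add: abs_mult)
  have Spow: "h powr (- \<beta>) * ?S \<omega> powr \<beta> \<le> \<omega> powr \<beta>" if "\<omega> > 0" "\<beta> > 0" for \<omega> \<beta>
  proof -
    have "?S \<omega> powr \<beta> \<le> (h * \<omega>) powr \<beta>" using S[OF that(1)] that by (intro powr_mono2) auto
    also have "\<dots> = h powr \<beta> * \<omega> powr \<beta>" using h that by (simp add: powr_mult)
    finally have "h powr (- \<beta>) * ?S \<omega> powr \<beta> \<le> h powr (- \<beta>) * (h powr \<beta> * \<omega> powr \<beta>)" by (intro mult_left_mono) auto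
    also have "\<dots> = \<omega> powr \<beta>" using h by (simp add: powr_minus)
    finally show ?thesis .
  qed
  have b0: "\<bar>\<kappa> \<omega>\<bar> \<le> 1 * \<omega> powr (\<alpha> - 2)" if "\<omega> > 0" for \<omega>
  proof -
    have "\<bar>\<kappa> \<omega>\<bar> = (h powr (- \<alpha>) * ?S \<omega> powr \<alpha>) * \<omega> powr (- 2)" unfolding \<kappa>_def by (simp add: abs_mult)
    also have "\<dots> \<le> \<omega> powr \<alpha> * \<omega> powr (- 2)" using Spow[OF that] \<alpha> by (intro mult_right_mono) auto
    also have "\<dots> = \<omega> powr (\<alpha> - 2)" by (simp flip: powr_add)
    finally show ?thesis by simp
  qed
  have "\<bar>LBINT \<omega>. indicator {0<..} \<omega> * (\<kappa> \<omega> * cosine_transform (zero_extension p q (V 2)) (\<omega> * x) \<omega>)\<bar> \<le> 4 * kernel_const \<alpha> (q - p) * W"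
  proof (rule multiplier_bound[where \<kappa>' = \<kappa>'])
    fix \<omega> :: real assume \<omega>: "\<omega> > 0"
    have "((\<lambda>\<omega>. ?S \<omega> powr \<alpha> * \<omega> powr (- 2)) has_real_derivative (?G \<omega> * \<omega> powr (- 2) + (- 2 * \<omega> powr (- 2 - 1)) * ?S \<omega> powr \<alpha>)) (at \<omega>)"
      by (rule DERIV_mult[OF has_derivative_abs_sin_powr[OF \<alpha>(1)] has_real_derivative_powr[OF \<omega>]])
    from DERIV_cmult[OF this, of "h powr (- \<alpha>)"]
    show "(\<kappa> has_real_derivative \<kappa>' \<omega>) (at \<omega>)"
      unfolding \<kappa>_def \<kappa>'_def by (simp only: mult.commute[of "- 2 * \<omega> powr (- 2 - 1)"]) simp
    show "\<bar>\<kappa> \<omega>\<bar> \<le> 4 * \<omega> powr (\<alpha> - 2)" using b0[OF \<omega>] powr_ge_zero[of \<omega> "\<alpha> - 2"] by linarith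
    have "\<bar>h powr (- \<alpha>) * (?G \<omega> * \<omega> powr (- 2))\<bar> \<le> \<alpha> * \<omega> powr (\<alpha> - 3)"
    proof -
      have "\<bar>h powr (- \<alpha>) * (?G \<omega> * \<omega> powr (- 2))\<bar> = (\<alpha> * (h powr (- \<alpha>) * h * ?S \<omega> powr (\<alpha> - 1)) * \<omega> powr (- 2)) * (\<bar>sgn (2 * sin (h * \<omega> / 2))\<bar> * \<bar>cos (h * \<omega> / 2)\<bar>)"
        using \<alpha> h by (simp add: abs_mult)
      also have "\<dots> \<le> (\<alpha> * (h powr (- \<alpha>) * h * ?S \<omega> powr (\<alpha> - 1)) * \<omega> powr (- 2)) * (1 * 1)"
        using \<alpha> h by (intro mult_left_mono mult_mono) (auto simp: abs_sgn_eq)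
      also have "h powr (- \<alpha>) * h = h powr (- (\<alpha> - 1))"
        using h powr_add[of h "- \<alpha>" 1] by simp
      also have "(\<alpha> * (h powr (- (\<alpha> - 1)) * ?S \<omega> powr (\<alpha> - 1)) * \<omega> powr (- 2)) * (1 * 1) \<le> (\<alpha> * \<omega> powr (\<alpha> - 1) * \<omega> powr (- 2)) * (1 * 1)"
        using Spow[OF \<omega>, of "\<alpha> - 1"] \<alpha> by (intro mult_right_mono mult_left_mono) auto
      also have "\<dots> = \<alpha> * \<omega> powr (\<alpha> - 1 + - 2)" by (simp only: powr_add mult_1_right mult.assoc)
      finally show ?thesis by simp
    qed
    moreover have "\<bar>h powr (- \<alpha>) * (?S \<omega> powr \<alpha> * (- 2 * \<omega> powr (- 3)))\<bar> \<le> 2 * \<omega> powr (\<alpha> - 3)"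
    proof -
      have "\<bar>h powr (- \<alpha>) * (?S \<omega> powr \<alpha> * (- 2 * \<omega> powr (- 3)))\<bar> = (h powr (- \<alpha>) * ?S \<omega> powr \<alpha>) * (2 * \<omega> powr (- 3))"
        by (simp add: abs_mult)
      also have "\<dots> \<le> \<omega> powr \<alpha> * (2 * \<omega> powr (- 3))"
        using Spow[OF \<omega>, of \<alpha>] \<alpha> by (intro mult_right_mono) auto
      also have "\<dots> = 2 * \<omega> powr (\<alpha> + - 3)" by (simp only: powr_add mult_ac)
      finally show ?thesis by simp
    qed
    \<comment> \<open>The derivative of the sine power contributes \<alpha>, at most 2, and that of
      \<omega>^(-2) contributes 2: this is the constant 4.\<close>
    moreover have "\<alpha> * \<omega> powr (\<alpha> - 3) \<le> 2 * \<omega> powr (\<alpha> - 3)" using \<alpha> by (intro mult_right_mono) auto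
    moreover have "\<kappa>' \<omega> = h powr (- \<alpha>) * (?G \<omega> * \<omega> powr (- 2)) + h powr (- \<alpha>) * (?S \<omega> powr \<alpha> * (- 2 * \<omega> powr (- 3)))"
      unfolding \<kappa>'_def by (simp only: distrib_left)
    ultimately show "\<bar>\<kappa>' \<omega>\<bar> \<le> 4 * \<omega> powr (\<alpha> - 3)" by linarith
  next
    show "continuous_on {0<..} \<kappa>'"
    proof -
      have c1: "continuous_on {0<..} (\<lambda>\<omega>. sgn (2 * sin (h * \<omega> / 2)) * ?S \<omega> powr (\<alpha> - 1))"
        by (rule continuous_on_compose2[OF continuous_sgn_abs_powr[of "\<alpha> - 1" UNIV]])
          (use \<alpha> in \<open>auto intro!: continuous_intros\<close>)
      have c2: "continuous_on {0<..} (\<lambda>\<omega>. ?S \<omega> powr \<alpha>)"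
        by (rule continuous_on_powr') (use \<alpha> in \<open>auto intro!: continuous_intros\<close>)
      have c3: "continuous_on {0<..} (\<lambda>\<omega>::real. \<omega> powr r)" for r
        by (auto intro!: continuous_intros)
      have c4: "continuous_on {0<..} (\<lambda>\<omega>::real. h * cos (h * \<omega> / 2))" by (auto intro!: continuous_intros)
      show ?thesis
        unfolding \<kappa>'_def
        by (rule continuous_on_mult[OF continuous_on_const continuous_on_add[OF
            continuous_on_mult[OF continuous_on_mult[OF continuous_on_mult[OF continuous_on_const c1] c4] c3]
            continuous_on_mult[OF c2 continuous_on_mult[OF continuous_on_const c3]]]])
    qed
    \<comment> \<open>Here the constant may depend on h, since only integrability is asked
      for.\<close>
    show "integrable lborel (\<lambda>\<omega>. indicator {0<..} \<omega> * \<kappa> \<omega>)"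
    proof (rule integrable_half_line[where a = "\<alpha> - 2" and b = 2 and A = "max 1 (h powr (- \<alpha>) * 2 powr \<alpha>)"])
      fix \<omega> :: real assume "0 < \<omega>"
      from b0[OF this] show "\<bar>\<kappa> \<omega>\<bar> \<le> max 1 (h powr (- \<alpha>) * 2 powr \<alpha>) * \<omega> powr (\<alpha> - 2)"
        by (rule order_trans) (intro mult_right_mono, auto)
    next
      fix \<omega> :: real assume "1 \<le> \<omega>"
      have "?S \<omega> powr \<alpha> \<le> 2 powr \<alpha>" using \<alpha> by (intro powr_mono2) (auto simp: abs_mult)
      hence "(h powr (- \<alpha>) * ?S \<omega> powr \<alpha>) * \<omega> powr (- 2) \<le> max 1 (h powr (- \<alpha>) * 2 powr \<alpha>) * \<omega> powr (- 2)"
        by (intro mult_right_mono max.coboundedI2 mult_left_mono) auto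
      thus "\<bar>\<kappa> \<omega>\<bar> \<le> max 1 (h powr (- \<alpha>) * 2 powr \<alpha>) * \<omega> powr (- 2)" unfolding \<kappa>_def by (simp add: abs_mult mult.assoc)
    qed (use \<alpha> in \<open>auto simp: \<kappa>_def\<close>)
  qed (use \<alpha> cont W x in auto)
  also have "(LBINT \<omega>. indicator {0<..} \<omega> * (\<kappa> \<omega> * cosine_transform (zero_extension p q (V 2)) (\<omega> * x) \<omega>))
     = (LBINT \<omega>. - (h powr (- \<alpha>)) * (indicator {0<..} \<omega> * (?S \<omega> powr \<alpha> * cosine_transform (zero_extension p q (V 0)) (\<omega> * x) \<omega>)))"
  proof (rule Bochner_Integration.integral_cong[OF refl])
    fix \<omega> :: real
    show "indicator {0<..} \<omega> * (\<kappa> \<omega> * cosine_transform (zero_extension p q (V 2)) (\<omega> * x) \<omega>)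
      = - (h powr (- \<alpha>)) * (indicator {0<..} \<omega> * (?S \<omega> powr \<alpha> * cosine_transform (zero_extension p q (V 0)) (\<omega> * x) \<omega>))"
    proof (cases "\<omega> > 0")
      case True
      have "\<omega> powr (- 2) * \<omega>\<^sup>2 = 1" using True by (simp add: powr_minus powr_numeral)
      moreover have "cosine_transform (zero_extension p q (V 2)) (\<omega> * x) \<omega> = - \<omega>\<^sup>2 * cosine_transform (zero_extension p q (V 0)) (\<omega> * x) \<omega>"
        using cosine_transform_flat_jet[OF V, of 0] m by (simp add: numeral_2_eq_2)
      ultimately show ?thesis using True by (simp add: \<kappa>_def)
    qed simp
  qed
  also have "\<dots> = - (h powr (- \<alpha>)) * (pi * frac_diff \<alpha> h K (zero_extension p q (V 0)) x)"
    using frac_diff_cosine_transform[OF V m \<alpha>, of K x h] out by simp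
  finally have "pi * \<bar>h powr (- \<alpha>) * frac_diff \<alpha> h K (zero_extension p q (V 0)) x\<bar> \<le> 4 * kernel_const \<alpha> (q - p) * W"
    by (simp add: abs_mult mult_ac)
  \<comment> \<open>The factor \<pi> of the inversion formula is discarded by means of 1 \<le>
    \<pi>.\<close>
  moreover have "1 * \<bar>h powr (- \<alpha>) * frac_diff \<alpha> h K (zero_extension p q (V 0)) x\<bar> \<le> pi * \<bar>h powr (- \<alpha>) * frac_diff \<alpha> h K (zero_extension p q (V 0)) x\<bar>"
    using pi_ge_two by (intro mult_right_mono) auto
  ultimately show ?thesis by linarith
qed


section \<open>Fourth-order agreement of the averaged symbols\<close>

lemma sin_cubic_bounds:
  fixes w :: real
  shows "\<bar>sin w - w\<bar> \<le> \<bar>w\<bar> ^ 3 / 6" and "\<bar>sin w - (w - w ^ 3 / 6)\<bar> \<le> \<bar>w\<bar> ^ 5 / 120"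
    and "\<bar>cos w - (1 - w\<^sup>2 / 2)\<bar> \<le> w ^ 4 / 24"
proof -
  have "(\<Sum>m<3. sin_coeff m * w ^ m) = w" by (simp add: lessThan_nat_numeral sin_coeff_def)
  with Maclaurin_sin_bound[of w 3] show "\<bar>sin w - w\<bar> \<le> \<bar>w\<bar> ^ 3 / 6"
    by (simp add: fact_numeral field_simps)
  have "(\<Sum>m<5. sin_coeff m * w ^ m) = w - w ^ 3 / 6"
    by (simp add: lessThan_nat_numeral sin_coeff_def fact_numeral)
  with Maclaurin_sin_bound[of w 5] show "\<bar>sin w - (w - w ^ 3 / 6)\<bar> \<le> \<bar>w\<bar> ^ 5 / 120"
    by (simp add: fact_numeral field_simps)
  obtain t where "cos w = (\<Sum>m<4. cos_coeff m * w ^ m) + cos (t + 1/2 * real 4 * pi) / fact 4 * w ^ 4"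
    using Maclaurin_cos_expansion[of w 4] by blast
  moreover have "(\<Sum>m<4. cos_coeff m * w ^ m) = 1 - w\<^sup>2 / 2"
    by (simp add: lessThan_nat_numeral cos_coeff_def fact_numeral)
  ultimately have "cos w - (1 - w\<^sup>2 / 2) = cos (t + 2 * pi) / 24 * w ^ 4"
    by (simp add: fact_numeral)
  hence "\<bar>cos w - (1 - w\<^sup>2 / 2)\<bar> = \<bar>cos (t + 2 * pi) / 24 * w ^ 4\<bar>" by (simp only:)
  also have "\<dots> = \<bar>cos t\<bar> * (w ^ 4 / 24)" by (simp add: abs_mult)
  also have "\<dots> \<le> 1 * (w ^ 4 / 24)" by (intro mult_right_mono) auto
  finally show "\<bar>cos w - (1 - w\<^sup>2 / 2)\<bar> \<le> w ^ 4 / 24" by simp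
qed

text \<open>With z = h \<omega>: the symbol of compact averaging minus the ratio of the discrete to
  the continuous symbol. The value c2 = \<alpha>/24 cancels the quadratic terms, as both parts are 1
  - \<alpha> z^2/24 up to order four.\<close>

definition symbol_defect :: "real \<Rightarrow> real \<Rightarrow> real" where
  "symbol_defect \<alpha> z = 1 + 2 * c2 \<alpha> * (cos z - 1) - \<bar>2 * sin (z / 2)\<bar> powr \<alpha> * z powr (- \<alpha>)"

text \<open>Keeping \<open>sgn\<close> next to the power of exponent \<alpha> - 1 gives one formula
  that is valid and continuous also where the sine vanishes.\<close>

definition symbol_defect' :: "real \<Rightarrow> real \<Rightarrow> real" where
  "symbol_defect' \<alpha> z = - 2 * c2 \<alpha> * sin z
     - (\<alpha> * (sgn (2 * sin (z / 2)) * \<bar>2 * sin (z / 2)\<bar> powr (\<alpha> - 1)) * cos (z / 2) * z powr (- \<alpha>)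
        + \<bar>2 * sin (z / 2)\<bar> powr \<alpha> * (- \<alpha> * z powr (- \<alpha> - 1)))"

lemma has_derivative_symbol_defect:
  assumes "1 < \<alpha>" "z > 0"
  shows "(symbol_defect \<alpha> has_real_derivative symbol_defect' \<alpha> z) (at z)"
proof -
  have 1: "((\<lambda>z. 1 + 2 * c2 \<alpha> * (cos z - 1)) has_real_derivative - 2 * c2 \<alpha> * sin z) (at z)"
    by (auto intro!: derivative_eq_intros)
  have 2: "((\<lambda>z. \<bar>2 * sin (z / 2)\<bar> powr \<alpha>) has_real_derivative
      \<alpha> * (sgn (2 * sin (z / 2)) * \<bar>2 * sin (z / 2)\<bar> powr (\<alpha> - 1)) * cos (z / 2)) (at z)"
    using has_derivative_abs_sin_powr[OF assms(1), of 1 z] by simp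
  have 3: "((\<lambda>z. z powr (- \<alpha>)) has_real_derivative - \<alpha> * z powr (- \<alpha> - 1)) (at z)"
    using assms by (intro has_real_derivative_powr)
  from DERIV_diff[OF 1 DERIV_mult[OF 2 3]] show ?thesis
    unfolding symbol_defect_def[abs_def] symbol_defect'_def by (simp only: mult_ac)
qed

lemma sin_quotient_powr_le_1:
  assumes "z > (0::real)" "\<beta> \<ge> 0"
  shows "\<bar>2 * sin (z / 2)\<bar> powr \<beta> * z powr (- \<beta>) \<le> 1"
proof -
  have "\<bar>2 * sin (z / 2)\<bar> \<le> z" using abs_sin_x_le_abs_x[of "z / 2"] assms by (simp add: abs_mult)
  hence "\<bar>2 * sin (z / 2)\<bar> powr \<beta> * z powr (- \<beta>) \<le> z powr \<beta> * z powr (- \<beta>)"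
    using assms by (intro mult_right_mono powr_mono2) auto
  also have "\<dots> = 1" using assms by (simp flip: powr_add)
  finally show ?thesis .
qed

text \<open>Beyond 1 the three terms are bounded by 1, 2 and 2. Up to 1 the derivative is expressed
  by q = 2 sin(z/2)/z and its derivative r, and regrouped so that the linear terms cancel and only
  cubic ones are left.\<close>

lemma symbol_defect_deriv_bound:
  assumes \<alpha>: "1 < \<alpha>" "\<alpha> < 2" and z: "z > 0"
  shows "\<bar>symbol_defect' \<alpha> z\<bar> \<le> 5 * z ^ 3"
proof -
  let ?S = "2 * sin (z / 2)"
  have e: "z powr (- \<alpha>) = z powr (- (\<alpha> - 1)) / z" "z powr (- \<alpha> - 1) = z powr (- \<alpha>) / z"
    using z by (simp_all add: powr_diff powr_minus powr_add field_simps)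
  show ?thesis
  proof (cases "z \<le> 1")
    case False
    have "\<bar>2 * c2 \<alpha> * sin z\<bar> \<le> 1 * 1"
      unfolding abs_mult using \<alpha> by (intro mult_mono) (auto simp: c2_def)
    moreover have "\<bar>\<alpha> * (sgn ?S * \<bar>?S\<bar> powr (\<alpha> - 1)) * cos (z / 2) * z powr (- \<alpha>)\<bar> \<le> 2"
    proof -
      have "\<bar>\<alpha> * (sgn ?S * \<bar>?S\<bar> powr (\<alpha> - 1)) * cos (z / 2) * z powr (- \<alpha>)\<bar>
        = (\<alpha> * (\<bar>sgn ?S\<bar> * \<bar>cos (z / 2)\<bar>)) * ((\<bar>?S\<bar> powr (\<alpha> - 1) * z powr (- (\<alpha> - 1))) / z)"
        using \<alpha> z unfolding e(1) by (simp add: abs_mult)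
      also have "\<dots> \<le> (2 * (1 * 1)) * (1 / 1)"
        using \<alpha> z False sin_quotient_powr_le_1[of z "\<alpha> - 1"]
        by (intro mult_mono frac_le) (auto simp: abs_sgn_eq)
      finally show ?thesis by simp
    qed
    moreover have "\<bar>\<bar>?S\<bar> powr \<alpha> * (- \<alpha> * z powr (- \<alpha> - 1))\<bar> \<le> 2"
    proof -
      have "\<bar>\<bar>?S\<bar> powr \<alpha> * (- \<alpha> * z powr (- \<alpha> - 1))\<bar> = \<alpha> * ((\<bar>?S\<bar> powr \<alpha> * z powr (- \<alpha>)) / z)"
        using \<alpha> z unfolding e(2) by (simp add: abs_mult)
      also have "\<dots> \<le> 2 * (1 / 1)"
        using \<alpha> z False sin_quotient_powr_le_1[of z \<alpha>] by (intro mult_mono frac_le) auto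
      finally show ?thesis by simp
    qed
    ultimately have "\<bar>symbol_defect' \<alpha> z\<bar> \<le> 5" unfolding symbol_defect'_def by linarith
    also have "5 \<le> 5 * z ^ 3" using False by (simp add: one_le_power)
    finally show ?thesis .
  next
    case True
    have Spos: "?S > 0" using z True pi_gt3 by (intro mult_pos_pos sin_gt_zero) auto
    define q where "q = ?S / z"
    \<comment> \<open>The derivative of \<open>q\<close> with respect to z.\<close>
    define r where "r = (cos (z / 2) - q) / z"
    have "\<bar>?S - (z - z ^ 3 / 24)\<bar> \<le> z ^ 5 / 1920"
      using sin_cubic_bounds(2)[of "z / 2"] z by (simp add: abs_if power_divide split: if_splits)
    from divide_right_mono[OF this less_imp_le[OF z]]
    have "\<bar>(?S - (z - z ^ 3 / 24)) / z\<bar> \<le> (z ^ 5 / 1920) / z"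
      unfolding abs_divide abs_of_pos[OF z] .
    also have "(?S - (z - z ^ 3 / 24)) / z = q - (1 - z\<^sup>2 / 24)"
      unfolding q_def using z by (simp add: field_simps power3_eq_cube power2_eq_square)
    also have "(z ^ 5 / 1920) / z = z ^ 4 / 1920" using z by (simp add: eval_nat_numeral)
    finally have q: "\<bar>q - (1 - z\<^sup>2 / 24)\<bar> \<le> z ^ 4 / 1920" .
    have c: "\<bar>cos (z / 2) - (1 - z\<^sup>2 / 8)\<bar> \<le> z ^ 4 / 384"
      using sin_cubic_bounds(3)[of "z / 2"] by (simp add: power_divide)
    have z42: "z ^ 4 \<le> z\<^sup>2" using z True by (intro power_decreasing) auto
    have z2: "z\<^sup>2 \<le> 1" using z True by (simp add: power_le_one)
    have "0 < q" unfolding q_def using Spos z by simp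
    moreover have q1: "1 - q \<le> z\<^sup>2 / 12" and "q \<le> 1"
      using q z42 zero_less_power[OF z, of 2] by linarith+
    ultimately have q01: "0 < q" "q \<le> 1" by simp_all
    \<comment> \<open>The quadratic coefficients combine as 1/8 - 1/24 = 1/12, and 1/384 + 1/1920 is
      below 1/100.\<close>
    have "\<bar>(cos (z / 2) - q) + z\<^sup>2 / 12\<bar> \<le> z ^ 4 / 100"
    proof -
      have "0 \<le> z ^ 4" using z by simp
      with q c show ?thesis by linarith
    qed
    from divide_right_mono[OF this less_imp_le[OF z]]
    have "\<bar>((cos (z / 2) - q) + z\<^sup>2 / 12) / z\<bar> \<le> (z ^ 4 / 100) / z"
      unfolding abs_divide abs_of_pos[OF z] .
    also have "((cos (z / 2) - q) + z\<^sup>2 / 12) / z = r + z / 12"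
      unfolding r_def using z by (simp add: field_simps power2_eq_square)
    also have "(z ^ 4 / 100) / z = z ^ 3 / 100" using z by (simp add: eval_nat_numeral)
    finally have r: "\<bar>r + z / 12\<bar> \<le> z ^ 3 / 100" .
    \<comment> \<open>As q \<le> 1 and \<alpha> - 1 < 1, the power q^(\<alpha> - 1) lies between q
      and 1, so it differs from 1 by at most z^2/12.\<close>
    have qa: "q \<le> q powr (\<alpha> - 1)" "q powr (\<alpha> - 1) \<le> 1"
      using q01 \<alpha> powr_mono'[of "\<alpha> - 1" 1 q] by (auto intro: powr_le1)
    \<comment> \<open>Multiples of z are added and subtracted to exhibit the small differences sin z
      - z, r + z/12 and 1 - q^(\<alpha> - 1). That they cancel is due to 2 c2 = \<alpha>/12.\<close>
    have eq: "symbol_defect' \<alpha> z = - (\<alpha> / 12) * (sin z - z) - \<alpha> * (q powr (\<alpha> - 1) * (r + z / 12)) - \<alpha> / 12 * z * (1 - q powr (\<alpha> - 1))"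
    proof -
      define P Z where "P = ?S powr (\<alpha> - 1)" and "Z = z powr (- (\<alpha> - 1))"
      have PZ: "P * Z = q powr (\<alpha> - 1)"
        unfolding q_def P_def Z_def powr_minus_divide using Spos z by (simp add: powr_divide)
      have "?S powr \<alpha> = P * (q * z)"
        unfolding P_def using Spos z by (simp add: q_def powr_diff)
      hence "\<alpha> * (sgn ?S * \<bar>?S\<bar> powr (\<alpha> - 1)) * cos (z / 2) * z powr (- \<alpha>) + \<bar>?S\<bar> powr \<alpha> * (- \<alpha> * z powr (- \<alpha> - 1))
        = \<alpha> * (1 * P) * cos (z / 2) * (Z / z) + P * (q * z) * (- \<alpha> * (Z / z / z))"
        unfolding e(2) e(1) abs_of_pos[OF Spos] sgn_pos[OF Spos] P_def[symmetric] Z_def[symmetric] by (simp only:)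
      also have "\<dots> = \<alpha> * ((P * Z) * r)"
        unfolding r_def using z by (simp add: field_simps)
      finally have "symbol_defect' \<alpha> z = - 2 * c2 \<alpha> * sin z - \<alpha> * (q powr (\<alpha> - 1) * r)"
        unfolding symbol_defect'_def PZ by (simp only:)
      thus ?thesis by (simp add: c2_def field_simps)
    qed
    have "\<bar>(\<alpha> / 12) * (sin z - z)\<bar> \<le> (2 / 12) * (z ^ 3 / 6)"
      unfolding abs_mult using \<alpha> z sin_cubic_bounds(1)[of z] by (intro mult_mono) auto
    moreover have "\<bar>\<alpha> * (q powr (\<alpha> - 1) * (r + z / 12))\<bar> \<le> 2 * (1 * (z ^ 3 / 100))"
      unfolding abs_mult using \<alpha> r qa by (intro mult_mono) auto
    moreover have "\<bar>\<alpha> / 12 * z * (1 - q powr (\<alpha> - 1))\<bar> \<le> (2 / 12 * z) * (z\<^sup>2 / 12)"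
      unfolding abs_mult using \<alpha> z qa q1 by (intro mult_mono) auto
    moreover have "(2 / 12 * z) * (z\<^sup>2 / 12) = z ^ 3 / 72" by (simp add: power3_eq_cube power2_eq_square)
    moreover have "0 \<le> z ^ 3" using z by simp
    ultimately show ?thesis unfolding eq by linarith
  qed
qed

text \<open>The quartic bound comes from the cubic bound on the derivative by the mean value
  theorem. By the convention for \<open>powr\<close> at 0 the value
  \<open>symbol_defect \<alpha> 0\<close> is 1 and not the limit 0, so the estimate starts at a
  small positive \<epsilon>, where the defect is at most \<epsilon>^2.\<close>

lemma symbol_defect_bound:
  assumes \<alpha>: "1 < \<alpha>" "\<alpha> < 2" and z: "z > 0"
  shows "\<bar>symbol_defect \<alpha> z\<bar> \<le> 5 * z ^ 4" and "\<bar>symbol_defect \<alpha> z\<bar> \<le> 3"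
proof -
  show "\<bar>symbol_defect \<alpha> z\<bar> \<le> 3"
  proof -
    have "\<bar>2 * c2 \<alpha> * (cos z - 1)\<bar> \<le> 1 * 2"
      unfolding abs_mult using \<alpha> by (intro mult_mono) (auto simp: c2_def abs_le_iff add_increasing2 cos_ge_minus_one)
    hence "\<bar>2 * c2 \<alpha> * (cos z - 1)\<bar> \<le> 2" by simp
    moreover have "0 \<le> \<bar>2 * sin (z / 2)\<bar> powr \<alpha> * z powr (- \<alpha>)" by simp
    ultimately show ?thesis
      using sin_quotient_powr_le_1[of z \<alpha>] \<alpha> z unfolding symbol_defect_def by linarith
  qed
  have small: "\<bar>symbol_defect \<alpha> \<epsilon>\<bar> \<le> \<epsilon>\<^sup>2" if \<epsilon>: "0 < \<epsilon>" "\<epsilon> \<le> 1" for \<epsilon>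
  proof -
    let ?S = "2 * sin (\<epsilon> / 2)"
    define q where "q = ?S / \<epsilon>"
    have Spos: "?S > 0" using \<epsilon> pi_gt3 by (intro mult_pos_pos sin_gt_zero) auto
    have "\<bar>?S - \<epsilon>\<bar> \<le> \<epsilon> ^ 3 / 24"
      using sin_cubic_bounds(1)[of "\<epsilon> / 2"] \<epsilon> by (simp add: abs_if power_divide split: if_splits)
    hence "?S \<ge> \<epsilon> - \<epsilon> ^ 3 / 24" by linarith
    hence "?S / \<epsilon> \<ge> (\<epsilon> - \<epsilon> ^ 3 / 24) / \<epsilon>" using \<epsilon> by (intro divide_right_mono) auto
    also have "(\<epsilon> - \<epsilon> ^ 3 / 24) / \<epsilon> = 1 - \<epsilon>\<^sup>2 / 24" using \<epsilon> by (simp add: field_simps power3_eq_cube power2_eq_square)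
    finally have q: "1 - q \<le> \<epsilon>\<^sup>2 / 24" by (simp add: q_def)
    have "?S \<le> \<epsilon>" using abs_sin_x_le_abs_x[of "\<epsilon> / 2"] \<epsilon> Spos by simp
    hence q01: "0 < q" "q \<le> 1" using Spos \<epsilon> by (auto simp: q_def)
    have sq: "\<bar>?S\<bar> powr \<alpha> * \<epsilon> powr (- \<alpha>) = q powr \<alpha>"
      unfolding q_def powr_minus_divide using Spos \<epsilon> by (simp add: powr_divide)
    have Q: "q powr \<alpha> \<le> 1" using q01 \<alpha> by (intro powr_le1) auto
    have "1 - q powr \<alpha> \<le> 1 - q\<^sup>2" using powr_mono'[of \<alpha> 2 q] q01 \<alpha> by (simp add: powr_numeral)
    also have "\<dots> = (1 + q) * (1 - q)" by (simp add: power2_eq_square algebra_simps)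
    also have "\<dots> \<le> 2 * (\<epsilon>\<^sup>2 / 24)" using q01 q by (intro mult_mono) auto
    finally have Q': "1 - q powr \<alpha> \<le> \<epsilon>\<^sup>2 / 12" by simp
    define X where "X = 2 * c2 \<alpha> * (cos \<epsilon> - 1)"
    have "\<bar>sin (\<epsilon> / 2)\<bar>\<^sup>2 \<le> \<bar>\<epsilon> / 2\<bar>\<^sup>2"
      by (intro power_mono abs_sin_x_le_abs_x) auto
    hence "1 - cos \<epsilon> \<le> \<epsilon>\<^sup>2 / 2"
      using cos_double_sin[of "\<epsilon> / 2"] by (simp add: power_divide)
    hence "\<bar>cos \<epsilon> - 1\<bar> \<le> \<epsilon>\<^sup>2 / 2" using cos_le_one[of \<epsilon>] by linarith
    hence "\<bar>X\<bar> \<le> 2 / 12 * (\<epsilon>\<^sup>2 / 2)"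
      unfolding X_def abs_mult using \<alpha> by (intro mult_mono) (auto simp: c2_def)
    hence X: "\<bar>X\<bar> \<le> \<epsilon>\<^sup>2 / 12" by simp
    have "symbol_defect \<alpha> \<epsilon> = X + (1 - q powr \<alpha>)"
      unfolding symbol_defect_def sq X_def by simp
    hence "\<bar>symbol_defect \<alpha> \<epsilon>\<bar> \<le> \<bar>X\<bar> + (1 - q powr \<alpha>)" using Q by linarith
    also have "\<dots> \<le> \<epsilon>\<^sup>2 / 12 + \<epsilon>\<^sup>2 / 12" using X Q' by (rule add_mono)
    also have "\<dots> \<le> \<epsilon>\<^sup>2" by simp
    finally show ?thesis .
  qed
  show "\<bar>symbol_defect \<alpha> z\<bar> \<le> 5 * z ^ 4"
  proof (rule field_le_epsilon)
    fix e :: real assume e: "e > 0"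
    define \<epsilon> where "\<epsilon> = min (min 1 z) e"
    have \<epsilon>: "0 < \<epsilon>" "\<epsilon> \<le> 1" "\<epsilon> \<le> z" "\<epsilon> \<le> e" using e z by (auto simp: \<epsilon>_def)
    have "norm (symbol_defect \<alpha> z - symbol_defect \<alpha> \<epsilon>) \<le> (5 * z ^ 3) * norm (z - \<epsilon>)"
    proof (rule field_differentiable_bound[of "{\<epsilon>..z}"])
      fix t assume t: "t \<in> {\<epsilon>..z}"
      show "(symbol_defect \<alpha> has_field_derivative symbol_defect' \<alpha> t) (at t within {\<epsilon>..z})"
        using t \<epsilon> \<alpha> by (intro has_field_derivative_at_within[OF has_derivative_symbol_defect]) auto
      have "\<bar>symbol_defect' \<alpha> t\<bar> \<le> 5 * t ^ 3" using t \<epsilon> \<alpha> by (intro symbol_defect_deriv_bound) auto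
      also have "\<dots> \<le> 5 * z ^ 3" using t \<epsilon> by (intro mult_left_mono power_mono) auto
      finally show "norm (symbol_defect' \<alpha> t) \<le> 5 * z ^ 3" by simp
    qed (use \<epsilon> in auto)
    also have "\<dots> \<le> (5 * z ^ 3) * z" using \<epsilon> z by (intro mult_left_mono) auto
    finally have "\<bar>symbol_defect \<alpha> z - symbol_defect \<alpha> \<epsilon>\<bar> \<le> 5 * z ^ 4" by (simp add: eval_nat_numeral)
    moreover have "\<epsilon>\<^sup>2 \<le> \<epsilon>" using \<epsilon> by (simp add: power2_eq_square mult_left_le)
    ultimately show "\<bar>symbol_defect \<alpha> z\<bar> \<le> 5 * z ^ 4 + e" using small[OF \<epsilon>(1,2)] \<epsilon>(4) by linarith
  qed
qed

lemma continuous_symbol_defect':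
  assumes "1 < \<alpha>"
  shows "continuous_on {0<..} (symbol_defect' \<alpha>)"
proof -
  have c1: "continuous_on {0<..} (\<lambda>z. sgn (2 * sin (z / 2)) * \<bar>2 * sin (z / 2)\<bar> powr (\<alpha> - 1))"
    by (rule continuous_on_compose2[OF continuous_sgn_abs_powr[of "\<alpha> - 1" UNIV]])
      (use assms in \<open>auto intro!: continuous_intros\<close>)
  have c2: "continuous_on {0<..} (\<lambda>z. \<bar>2 * sin (z / 2)\<bar> powr \<alpha>)"
    by (rule continuous_on_powr') (use assms in \<open>auto intro!: continuous_intros\<close>)
  have c3: "continuous_on {0<..} (\<lambda>z::real. z powr r)" for r
    by (auto intro!: continuous_intros)
  have c4: "continuous_on {0<..} (\<lambda>z::real. cos (z / 2))" by (auto intro!: continuous_intros)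
  have c5: "continuous_on {0<..} (\<lambda>z::real. - 2 * c2 \<alpha> * sin z)" by (auto intro!: continuous_intros)
  show ?thesis
    unfolding symbol_defect'_def[abs_def]
    by (rule continuous_on_diff[OF c5 continuous_on_add[OF
        continuous_on_mult[OF continuous_on_mult[OF continuous_on_mult[OF continuous_on_const c1] c4] c3]
        continuous_on_mult[OF c2 continuous_on_mult[OF continuous_on_const c3]]]])
qed

text \<open>In transforms the left side is, up to sign, \<omega>^\<alpha> times the defect at h
  \<omega> times the transform of \<open>V 0\<close>. Shifting six derivatives to \<open>V 6\<close>
  leaves a multiplier of size h^4 \<omega>^(\<alpha> + 4 - 6), which has exactly the exponent
  \<alpha> - 2 that \<open>multiplier_bound\<close> asks for.\<close>

lemma compact_Riesz_truncation:
  assumes V: "flat_jet 6 p q V" and \<alpha>: "1 < \<alpha>" "\<alpha> < 2" and h: "h > 0"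
    and out: "\<And>k. K \<le> k \<Longrightarrow> zero_extension p q (V 0) (x - real (Suc k) * h) = 0 \<and> zero_extension p q (V 0) (x + real (Suc k) * h) = 0"
    and W: "\<And>y. y \<in> {p..q} \<Longrightarrow> \<bar>V 6 y\<bar> \<le> W"
    and x: "x - h \<in> {p..q}" "x \<in> {p..q}" "x + h \<in> {p..q}"
  defines "R \<equiv> Riesz_potential \<alpha> p q (V 2)"
  shows "\<bar>c2 \<alpha> * R (x - h) + (1 - 2 * c2 \<alpha>) * R x + c2 \<alpha> * R (x + h)
      + h powr (- \<alpha>) * frac_diff \<alpha> h K (zero_extension p q (V 0)) x\<bar> \<le> 30 * h ^ 4 * kernel_const \<alpha> (q - p) * W"
proof -
  have jet: "jet 6 p q V" using V by (simp add: flat_jet_def)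
  have cont: "continuous_on {p..q} (V 6)" using jet_continuous[OF jet] by simp
  let ?I = "indicator {0<..} :: real \<Rightarrow> real" and ?e = "zero_extension p q (V 0)"
  let ?J = "\<lambda>x \<omega>. ?I \<omega> * (\<omega> powr \<alpha> * cosine_transform ?e (\<omega> * x) \<omega>)"
  let ?Y = "\<lambda>\<omega>. ?I \<omega> * (\<bar>2 * sin (h * \<omega> / 2)\<bar> powr \<alpha> * cosine_transform ?e (\<omega> * x) \<omega>)"
  have inte: "integrable lborel ?e" using jet_continuous[OF jet, of 0] by (intro integrable_zero_extension) auto
  note RJ = Riesz_potential_cosine_transform[OF V _ \<alpha>, folded R_def]
  have iJ: "integrable lborel (?J (x - h))" "integrable lborel (?J x)" "integrable lborel (?J (x + h))"
    using RJ(2)[OF _ x(1)] RJ(2)[OF _ x(2)] RJ(2)[OF _ x(3)] by simp_all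
  define \<kappa> where "\<kappa> = (\<lambda>\<omega>. \<omega> powr (\<alpha> - 6) * symbol_defect \<alpha> (h * \<omega>))"
  define \<kappa>' where "\<kappa>' = (\<lambda>\<omega>. (\<alpha> - 6) * \<omega> powr (\<alpha> - 6 - 1) * symbol_defect \<alpha> (h * \<omega>) + symbol_defect' \<alpha> (h * \<omega>) * h * \<omega> powr (\<alpha> - 6))"
  have powr_pow: "\<omega> powr (r - real n) * \<omega> ^ n = \<omega> powr r" if "\<omega> > 0" for \<omega> r n
    using that by (simp add: powr_diff powr_realpow)
  have b0: "\<bar>\<kappa> \<omega>\<bar> \<le> 5 * h ^ 4 * \<omega> powr (\<alpha> - 2)" if "\<omega> > 0" for \<omega>
  proof -
    have "\<bar>\<kappa> \<omega>\<bar> \<le> \<omega> powr (\<alpha> - 6) * (5 * (h * \<omega>) ^ 4)"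
      unfolding \<kappa>_def abs_mult using symbol_defect_bound(1)[OF \<alpha>, of "h * \<omega>"] that h by (intro mult_mono) auto
    also have "\<dots> = 5 * h ^ 4 * (\<omega> powr (\<alpha> - 2 - real 4) * \<omega> ^ 4)" by (simp add: power_mult_distrib)
    finally show ?thesis unfolding powr_pow[OF that] .
  qed
  have D6: "cosine_transform (zero_extension p q (V 6)) \<theta> \<omega> = - (\<omega> ^ 6) * cosine_transform ?e \<theta> \<omega>" for \<theta> \<omega>
    using cosine_transform_flat_jet[OF V, of 4 \<theta> \<omega>] cosine_transform_flat_jet[OF V, of 2 \<theta> \<omega>] cosine_transform_flat_jet[OF V, of 0 \<theta> \<omega>]
    by (simp add: eval_nat_numeral)
  \<comment> \<open>30 = 25 + 5: in the derivative of the multiplier, |\<alpha> - 6| \<le> 5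
    multiplies the 5 of the quartic defect bound, and the cubic bound on the derivative of the
    defect adds 5.\<close>
  have "\<bar>LBINT \<omega>. ?I \<omega> * (\<kappa> \<omega> * cosine_transform (zero_extension p q (V 6)) (\<omega> * x) \<omega>)\<bar> \<le> (30 * h ^ 4) * kernel_const \<alpha> (q - p) * W"
  proof (rule multiplier_bound[where \<kappa>' = \<kappa>'])
    fix \<omega> :: real assume \<omega>: "\<omega> > 0"
    have "((\<lambda>\<omega>. symbol_defect \<alpha> (h * \<omega>)) has_real_derivative symbol_defect' \<alpha> (h * \<omega>) * h) (at \<omega>)"
      by (rule DERIV_chain2[OF has_derivative_symbol_defect]) (use \<alpha> \<omega> h in \<open>auto intro!: derivative_eq_intros\<close>)
    from DERIV_mult[OF has_real_derivative_powr[OF \<omega>, of "\<alpha> - 6"] this]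
    show "(\<kappa> has_real_derivative \<kappa>' \<omega>) (at \<omega>)" unfolding \<kappa>_def \<kappa>'_def .
    show "\<bar>\<kappa> \<omega>\<bar> \<le> 30 * h ^ 4 * \<omega> powr (\<alpha> - 2)"
      using h by (intro order_trans[OF b0[OF \<omega>]] mult_right_mono) auto
    have "\<bar>(\<alpha> - 6) * \<omega> powr (\<alpha> - 6 - 1) * symbol_defect \<alpha> (h * \<omega>)\<bar> \<le> (5 * \<omega> powr (\<alpha> - 6 - 1)) * (5 * (h * \<omega>) ^ 4)"
      unfolding abs_mult using \<alpha> h \<omega> symbol_defect_bound(1)[OF \<alpha>, of "h * \<omega>"] by (intro mult_mono) auto
    also have "\<dots> = 25 * h ^ 4 * (\<omega> powr (\<alpha> - 3 - real 4) * \<omega> ^ 4)" by (simp add: power_mult_distrib)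
    also have "\<dots> = 25 * h ^ 4 * \<omega> powr (\<alpha> - 3)" unfolding powr_pow[OF \<omega>] ..
    finally have k1: "\<bar>(\<alpha> - 6) * \<omega> powr (\<alpha> - 6 - 1) * symbol_defect \<alpha> (h * \<omega>)\<bar> \<le> 25 * h ^ 4 * \<omega> powr (\<alpha> - 3)" .
    have "\<bar>symbol_defect' \<alpha> (h * \<omega>) * h * \<omega> powr (\<alpha> - 6)\<bar> \<le> (5 * (h * \<omega>) ^ 3) * h * \<omega> powr (\<alpha> - 6)"
      unfolding abs_mult using h \<omega> symbol_defect_deriv_bound[OF \<alpha>, of "h * \<omega>"] by (intro mult_mono) auto
    also have "\<dots> = 5 * h ^ 4 * (\<omega> powr (\<alpha> - 3 - real 3) * \<omega> ^ 3)" by (simp add: power_mult_distrib eval_nat_numeral)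
    also have "\<dots> = 5 * h ^ 4 * \<omega> powr (\<alpha> - 3)" unfolding powr_pow[OF \<omega>] ..
    finally have k2: "\<bar>symbol_defect' \<alpha> (h * \<omega>) * h * \<omega> powr (\<alpha> - 6)\<bar> \<le> 5 * h ^ 4 * \<omega> powr (\<alpha> - 3)" .
    have "\<bar>\<kappa>' \<omega>\<bar> \<le> 25 * h ^ 4 * \<omega> powr (\<alpha> - 3) + 5 * h ^ 4 * \<omega> powr (\<alpha> - 3)"
      unfolding \<kappa>'_def using k1 k2 by (rule order_trans[OF abs_triangle_ineq add_mono])
    thus "\<bar>\<kappa>' \<omega>\<bar> \<le> 30 * h ^ 4 * \<omega> powr (\<alpha> - 3)" by (simp add: algebra_simps)
  next
    have sd: "continuous_on {0<..} (symbol_defect \<alpha>)"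
      by (rule DERIV_continuous_on, rule has_field_derivative_at_within, rule has_derivative_symbol_defect[OF \<alpha>(1)]) simp
    have hh: "continuous_on {0<..} (\<lambda>\<omega>. h * \<omega>)" "(\<lambda>\<omega>. h * \<omega>) ` {0<..} \<subseteq> {0<..}"
      using h by (auto intro!: continuous_intros)
    have c: "continuous_on {0<..} (\<lambda>\<omega>. symbol_defect \<alpha> (h * \<omega>))" "continuous_on {0<..} (\<lambda>\<omega>. symbol_defect' \<alpha> (h * \<omega>))"
      by (rule continuous_on_compose2[OF sd hh], rule continuous_on_compose2[OF continuous_symbol_defect'[OF \<alpha>(1)] hh])
    have c3: "continuous_on {0<..} (\<lambda>z::real. z powr r)" for r
      by (auto intro!: continuous_intros)
    show "continuous_on {0<..} \<kappa>'"
      unfolding \<kappa>'_def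
      by (rule continuous_on_add[OF continuous_on_mult[OF continuous_on_mult[OF continuous_on_const c3] c(1)]
          continuous_on_mult[OF continuous_on_mult[OF c(2) continuous_on_const] c3]])
    show "integrable lborel (\<lambda>\<omega>. ?I \<omega> * \<kappa> \<omega>)"
    proof (rule integrable_half_line[where a = "\<alpha> - 2" and b = "6 - \<alpha>" and A = "max (5 * h ^ 4) 3"])
      fix \<omega> :: real assume "0 < \<omega>"
      from b0[OF this] show "\<bar>\<kappa> \<omega>\<bar> \<le> max (5 * h ^ 4) 3 * \<omega> powr (\<alpha> - 2)"
        by (rule order_trans) (intro mult_right_mono, auto)
    next
      fix \<omega> :: real assume \<omega>: "1 \<le> \<omega>"
      have "\<bar>\<kappa> \<omega>\<bar> \<le> \<omega> powr (\<alpha> - 6) * max (5 * h ^ 4) 3"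
        unfolding \<kappa>_def abs_mult using symbol_defect_bound(2)[OF \<alpha>, of "h * \<omega>"] \<omega> h by (intro mult_mono) auto
      thus "\<bar>\<kappa> \<omega>\<bar> \<le> max (5 * h ^ 4) 3 * \<omega> powr (- (6 - \<alpha>))" by (simp add: mult.commute)
    qed (use \<alpha> in \<open>auto simp: \<kappa>_def symbol_defect_def\<close>)
  qed (use \<alpha> h cont W x in auto)
  also have "(LBINT \<omega>. ?I \<omega> * (\<kappa> \<omega> * cosine_transform (zero_extension p q (V 6)) (\<omega> * x) \<omega>))
     = (LBINT \<omega>. - (c2 \<alpha> * ?J (x - h) \<omega> + (1 - 2 * c2 \<alpha>) * ?J x \<omega> + c2 \<alpha> * ?J (x + h) \<omega>) + h powr (- \<alpha>) * ?Y \<omega>)"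
  proof (rule Bochner_Integration.integral_cong[OF refl])
    fix \<omega> :: real
    show "?I \<omega> * (\<kappa> \<omega> * cosine_transform (zero_extension p q (V 6)) (\<omega> * x) \<omega>)
      = - (c2 \<alpha> * ?J (x - h) \<omega> + (1 - 2 * c2 \<alpha>) * ?J x \<omega> + c2 \<alpha> * ?J (x + h) \<omega>) + h powr (- \<alpha>) * ?Y \<omega>"
    proof (cases "\<omega> > 0")
      case True
      let ?c = "cosine_transform ?e (\<omega> * x) \<omega>"
      define P where "P = \<omega> powr \<alpha>"
      have "\<omega> powr (\<alpha> - 6) * \<omega> ^ 6 = P" using powr_pow[OF True, of \<alpha> 6] by (simp add: P_def)
      hence L: "?I \<omega> * (\<kappa> \<omega> * cosine_transform (zero_extension p q (V 6)) (\<omega> * x) \<omega>) = - (P * symbol_defect \<alpha> (h * \<omega>) * ?c)"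
        unfolding D6 \<kappa>_def using True by simp
      \<comment> \<open>The negative power inside the defect cancels \<omega>^\<alpha> and leaves
        the scaling h^(-\<alpha>) of the fractional difference.\<close>
      have Z: "P * (h * \<omega>) powr (- \<alpha>) = h powr (- \<alpha>)"
        unfolding P_def using True h by (simp add: powr_mult powr_minus)
      have m1: "P * symbol_defect \<alpha> (h * \<omega>) = P * (1 + 2 * c2 \<alpha> * (cos (h * \<omega>) - 1)) - \<bar>2 * sin (h * \<omega> / 2)\<bar> powr \<alpha> * (P * (h * \<omega>) powr (- \<alpha>))"
        unfolding symbol_defect_def by (simp add: algebra_simps)
      have m2: "c2 \<alpha> * ?J (x - h) \<omega> + c2 \<alpha> * ?J (x + h) \<omega> = c2 \<alpha> * (P * (2 * cos (h * \<omega>) * ?c))"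
        using True unfolding cosine_transform_pair[OF inte, of \<omega> x h, symmetric] by (simp add: P_def algebra_simps)
      have m3: "c2 \<alpha> * ?J (x - h) \<omega> + (1 - 2 * c2 \<alpha>) * ?J x \<omega> + c2 \<alpha> * ?J (x + h) \<omega>
          = (c2 \<alpha> * ?J (x - h) \<omega> + c2 \<alpha> * ?J (x + h) \<omega>) + (1 - 2 * c2 \<alpha>) * (P * ?c)"
        using True by (simp add: P_def)
      have m4: "?Y \<omega> = \<bar>2 * sin (h * \<omega> / 2)\<bar> powr \<alpha> * ?c" using True by simp
      show ?thesis
        unfolding L m1 Z m3 m2 m4 by (simp add: algebra_simps)
    qed simp
  qed
  also have "\<dots> = - (c2 \<alpha> * (LBINT \<omega>. ?J (x - h) \<omega>) + (1 - 2 * c2 \<alpha>) * (LBINT \<omega>. ?J x \<omega>) + c2 \<alpha> * (LBINT \<omega>. ?J (x + h) \<omega>)) + h powr (- \<alpha>) * (LBINT \<omega>. ?Y \<omega>)"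
  proof -
    have "integrable lborel (\<lambda>\<omega>. (?I \<omega> * cosine_transform ?e (\<omega> * x) \<omega>) * \<bar>2 * sin (h * \<omega> / 2)\<bar> powr \<alpha>)"
    proof (rule integrable_times_bounded[where B = "2 powr \<alpha>"])
      show "integrable lborel (\<lambda>\<omega>. ?I \<omega> * cosine_transform ?e (\<omega> * x) \<omega>)"
        by (rule flat_jet_inversion(2)[OF V]) simp
      show "\<bar>\<bar>2 * sin (h * \<omega> / 2)\<bar> powr \<alpha>\<bar> \<le> 2 powr \<alpha>" for \<omega>
        using \<alpha> by (auto intro!: powr_mono2 simp: abs_mult)
    qed simp
    hence "integrable lborel ?Y" by (simp add: mult_ac)
    thus ?thesis using iJ by simp
  qed
  also have "\<dots> = pi * (c2 \<alpha> * R (x - h) + (1 - 2 * c2 \<alpha>) * R x + c2 \<alpha> * R (x + h) + h powr (- \<alpha>) * frac_diff \<alpha> h K ?e x)"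
  proof -
    have J: "(LBINT \<omega>. ?J x' \<omega>) = - (pi * R x')" if "x' \<in> {p..q}" for x'
      using RJ(1)[OF _ that] by simp
    have Y: "(LBINT \<omega>. ?Y \<omega>) = pi * frac_diff \<alpha> h K ?e x"
      using frac_diff_cosine_transform[OF V _ \<alpha>, of K x h] out by simp
    show ?thesis unfolding J[OF x(1)] J[OF x(2)] J[OF x(3)] Y by (simp add: algebra_simps)
  qed
  finally have *: "pi * \<bar>c2 \<alpha> * R (x - h) + (1 - 2 * c2 \<alpha>) * R x + c2 \<alpha> * R (x + h) + h powr (- \<alpha>) * frac_diff \<alpha> h K ?e x\<bar>
    \<le> 30 * h ^ 4 * kernel_const \<alpha> (q - p) * W" by (simp add: abs_mult)
  have "1 * \<bar>c2 \<alpha> * R (x - h) + (1 - 2 * c2 \<alpha>) * R x + c2 \<alpha> * R (x + h) + h powr (- \<alpha>) * frac_diff \<alpha> h K ?e x\<bar>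
    \<le> pi * \<bar>c2 \<alpha> * R (x - h) + (1 - 2 * c2 \<alpha>) * R x + c2 \<alpha> * R (x + h) + h powr (- \<alpha>) * frac_diff \<alpha> h K ?e x\<bar>"
    using pi_ge_two by (intro mult_right_mono) auto
  from order_trans[OF this *] show ?thesis by simp
qed

section \<open>Stability of the BDF2 recursion\<close>

definition bform :: "'i set \<Rightarrow> ('i \<Rightarrow> 'i \<Rightarrow> real) \<Rightarrow> ('i \<Rightarrow> real) \<Rightarrow> ('i \<Rightarrow> real) \<Rightarrow> real" where
  "bform I A v w = (\<Sum>i\<in>I. \<Sum>k\<in>I. A i k * v k * w i)"

definition psd :: "'i set \<Rightarrow> ('i \<Rightarrow> 'i \<Rightarrow> real) \<Rightarrow> bool" where
  "psd I A \<longleftrightarrow> (\<forall>i\<in>I. \<forall>k\<in>I. A i k = A k i) \<and> (\<forall>v. 0 \<le> bform I A v v)"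

text \<open>A sum of rank-one squares. Pairs as index set suit diagonally dominant matrices, with
  one square per diagonal entry and one per off-diagonal position; the explicit factors make
  semidefiniteness of Kronecker products elementary.\<close>

definition gram :: "'i set \<Rightarrow> ('i \<Rightarrow> 'i \<Rightarrow> real) \<Rightarrow> bool" where
  "gram I A \<longleftrightarrow> (\<exists>c. \<forall>i\<in>I. \<forall>k\<in>I. A i k = (\<Sum>s\<in>I \<times> I. c s i * c s k))"

definition kron :: "('i \<Rightarrow> 'i \<Rightarrow> real) \<Rightarrow> ('j \<Rightarrow> 'j \<Rightarrow> real) \<Rightarrow> 'i \<times> 'j \<Rightarrow> 'i \<times> 'j \<Rightarrow> real" where
  "kron A B = (\<lambda>(i, j) (k, l). A i k * B j l)"

definition idm :: "'i \<Rightarrow> 'i \<Rightarrow> real" where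
  "idm i k = (if i = k then 1 else 0)"

lemma bform_lin_left:
  "bform I A (\<lambda>i. s * x i + t * y i) w = s * bform I A x w + t * bform I A y w"
  unfolding bform_def by (simp add: algebra_simps sum.distrib sum_distrib_left)

lemma bform_lin_right:
  "bform I A w (\<lambda>i. s * x i + t * y i) = s * bform I A w x + t * bform I A w y"
  unfolding bform_def by (simp add: algebra_simps sum.distrib sum_distrib_left)

lemma bform_matrix_lin:
  "bform I (\<lambda>i k. s * A i k + t * B i k) v w = s * bform I A v w + t * bform I B v w"
  unfolding bform_def by (simp add: algebra_simps sum.distrib sum_distrib_left)

lemma bform_sym: "psd I A \<Longrightarrow> bform I A v w = bform I A w v"
  unfolding bform_def by (subst sum.swap) (auto simp: psd_def mult_ac intro!: sum.cong)

lemma bform_cong: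
  assumes "\<And>i k. i \<in> I \<Longrightarrow> k \<in> I \<Longrightarrow> A i k = B i k" "\<And>i. i \<in> I \<Longrightarrow> v i = v' i" "\<And>i. i \<in> I \<Longrightarrow> w i = w' i"
  shows "bform I A v w = bform I B v' w'"
  unfolding bform_def using assms by (intro sum.cong) auto

lemma bform_idm: "finite I \<Longrightarrow> bform I idm v w = (\<Sum>i\<in>I. v i * w i)"
  unfolding bform_def idm_def by (simp add: if_distrib[of "\<lambda>x. x * _"] sum.delta cong: if_cong)

lemma psd_nonneg: "psd I A \<Longrightarrow> 0 \<le> bform I A v v"
  by (simp add: psd_def)

lemma bform_Cauchy_Schwarz:
  assumes "psd I A"
  shows "bform I A v w \<le> sqrt (bform I A v v) * sqrt (bform I A w w)"
proof -
  define a b c where "a = bform I A v v" and "b = bform I A v w" and "c = bform I A w w"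
  have nn: "0 \<le> a" "0 \<le> c" using assms by (auto simp: a_def c_def psd_nonneg)
  have quad: "0 \<le> s\<^sup>2 * a + 2 * s * t * b + t\<^sup>2 * c" for s t
  proof -
    have "0 \<le> bform I A (\<lambda>i. s * v i + t * w i) (\<lambda>i. s * v i + t * w i)" by (rule psd_nonneg[OF assms])
    also have "\<dots> = s\<^sup>2 * a + 2 * s * t * b + t\<^sup>2 * c"
      unfolding bform_lin_left bform_lin_right a_def b_def c_def bform_sym[OF assms, of w v]
      by (simp add: power2_eq_square algebra_simps)
    finally show ?thesis .
  qed
  have "b\<^sup>2 \<le> a * c"
  \<comment> \<open>The form may be degenerate. If a = 0 the quadratic is linear in s, which forces
    b = 0.\<close>
  proof (cases "a = 0")
    case True
    have "b = 0"
    proof (rule ccontr)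
      assume "b \<noteq> 0"
      \<comment> \<open>The value of s solves 2 s b + c = -1.\<close>
      have "0 \<le> 2 * (- (c + 1) / (2 * b)) * 1 * b + 1 * c" using quad[of "- (c + 1) / (2 * b)" 1] True by simp
      also have "\<dots> = -1" using \<open>b \<noteq> 0\<close> by (simp add: field_simps)
      finally show False by simp
    qed
    thus ?thesis using True by simp
  next
    case False
    hence "a > 0" using nn by simp
    have "0 \<le> b\<^sup>2 * a + 2 * (- b) * a * b + a\<^sup>2 * c" using quad[of "- b" a] by simp
    hence "0 \<le> a * (a * c - b\<^sup>2)" by (simp add: power2_eq_square algebra_simps)
    thus ?thesis using \<open>a > 0\<close> by (simp add: zero_le_mult_iff)
  qed
  hence "\<bar>b\<bar> \<le> sqrt (a * c)" by (simp add: real_le_rsqrt abs_le_square_iff real_sqrt_le_mono flip: real_sqrt_abs)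
  thus ?thesis unfolding a_def b_def c_def real_sqrt_mult by linarith
qed

text \<open>With unit vectors e_l, the matrix is the sum of r_l e_l e_l^T and of |A_lm|/2 times the
  square of e_l + sgn(A_lm) e_m over all l \<noteq> m. The half is there because each pair occurs in
  both orders; dominance says that the surplus r_l is nonnegative.\<close>

lemma gram_diagonally_dominant:
  assumes "finite I" and sym: "\<And>i k. i \<in> I \<Longrightarrow> k \<in> I \<Longrightarrow> A i k = A k i"
    and dom: "\<And>i. i \<in> I \<Longrightarrow> (\<Sum>k\<in>I - {i}. \<bar>A i k\<bar>) \<le> A i i"
  shows "gram I A"
proof -
  define r where "r i = A i i - (\<Sum>k\<in>I - {i}. \<bar>A i k\<bar>)" for i
  define c where "c = (\<lambda>(l, m) i. if l = m then sqrt (r l) * (if i = l then 1 else 0)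
      else sqrt (\<bar>A l m\<bar> / 2) * ((if i = l then 1 else 0) + sgn (A l m) * (if i = m then 1 else 0)))"
  have "A i k = (\<Sum>s\<in>I \<times> I. c s i * c s k)" if ik: "i \<in> I" "k \<in> I" for i k
  proof -
    have sq: "sqrt (r l) * sqrt (r l) = r l" if "l \<in> I" for l using dom[OF that] by (simp add: r_def)
    have "(\<Sum>s\<in>I \<times> I. c s i * c s k) = (\<Sum>l\<in>I. \<Sum>m\<in>I. c (l, m) i * c (l, m) k)"
      by (simp add: sum.cartesian_product)
    also have "\<dots> = (\<Sum>l\<in>I. r l * (if i = l \<and> k = l then 1 else 0)
        + (\<Sum>m\<in>I - {l}. \<bar>A l m\<bar> / 2 * (((if i = l then 1 else 0) + sgn (A l m) * (if i = m then 1 else 0))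
            * ((if k = l then 1 else 0) + sgn (A l m) * (if k = m then 1 else 0)))))"
    proof (rule sum.cong[OF refl])
      fix l assume l: "l \<in> I"
      have "(\<Sum>m\<in>I. c (l, m) i * c (l, m) k) = c (l, l) i * c (l, l) k + (\<Sum>m\<in>I - {l}. c (l, m) i * c (l, m) k)"
        by (rule sum.remove[OF assms(1) l])
      moreover have "c (l, l) i * c (l, l) k = r l * (if i = l \<and> k = l then 1 else 0)"
        using sq[OF l] by (simp add: c_def)
      moreover have "(\<Sum>m\<in>I - {l}. c (l, m) i * c (l, m) k) = (\<Sum>m\<in>I - {l}. \<bar>A l m\<bar> / 2 * (((if i = l then 1 else 0) + sgn (A l m) * (if i = m then 1 else 0))
            * ((if k = l then 1 else 0) + sgn (A l m) * (if k = m then 1 else 0))))"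
      proof (rule sum.cong[OF refl])
        fix m assume "m \<in> I - {l}"
        have "sqrt (\<bar>A l m\<bar> / 2) * X * (sqrt (\<bar>A l m\<bar> / 2) * Y) = \<bar>A l m\<bar> / 2 * (X * Y)" for X Y :: real
        proof -
          have "sqrt (\<bar>A l m\<bar> / 2) * X * (sqrt (\<bar>A l m\<bar> / 2) * Y) = (sqrt (\<bar>A l m\<bar> / 2) * sqrt (\<bar>A l m\<bar> / 2)) * (X * Y)"
            by (simp only: mult_ac)
          thus ?thesis by simp
        qed
        thus "c (l, m) i * c (l, m) k = \<bar>A l m\<bar> / 2 * (((if i = l then 1 else 0) + sgn (A l m) * (if i = m then 1 else 0))
            * ((if k = l then 1 else 0) + sgn (A l m) * (if k = m then 1 else 0)))"
          using \<open>m \<in> I - {l}\<close> unfolding c_def by auto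
      qed
      ultimately show "(\<Sum>m\<in>I. c (l, m) i * c (l, m) k) = r l * (if i = l \<and> k = l then 1 else 0)
        + (\<Sum>m\<in>I - {l}. \<bar>A l m\<bar> / 2 * (((if i = l then 1 else 0) + sgn (A l m) * (if i = m then 1 else 0))
            * ((if k = l then 1 else 0) + sgn (A l m) * (if k = m then 1 else 0))))" by simp
    qed
    also have "\<dots> = A i k"
    proof (cases "i = k")
      case True
      \<comment> \<open>A diagonal entry receives |A_im|/2 from the squares with first index i and
        the same from those with second index i; with the surplus r_i this restores A_ii.\<close>
      have t: "\<bar>A l m\<bar> / 2 * (((if i = l then 1 else 0) + sgn (A l m) * (if i = m then 1 else 0))
            * ((if k = l then 1 else 0) + sgn (A l m) * (if k = m then 1 else 0)))
        = (if l = i then \<bar>A i m\<bar> / 2 else 0) + (if m = i then \<bar>A l i\<bar> / 2 else 0)" if "m \<noteq> l" for l m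
        using that True by (auto simp: abs_sgn sgn_if)
      have "(\<Sum>l\<in>I. r l * (if i = l \<and> k = l then 1 else 0) + (\<Sum>m\<in>I - {l}. (if l = i then \<bar>A i m\<bar> / 2 else 0) + (if m = i then \<bar>A l i\<bar> / 2 else 0)))
        = r i + (\<Sum>m\<in>I - {i}. \<bar>A i m\<bar> / 2) + (\<Sum>l\<in>I. \<Sum>m\<in>I - {l}. if m = i then \<bar>A l i\<bar> / 2 else 0)"
      proof -
        have 1: "(\<Sum>l\<in>I. r l * (if i = l \<and> k = l then 1 else 0)) = r i"
          using True ik assms(1) by (simp add: if_distrib[of "\<lambda>x. _ * x"] cong: if_cong)
        have 2: "(\<Sum>l\<in>I. \<Sum>m\<in>I - {l}. (if l = i then \<bar>A i m\<bar> / 2 else 0)) = (\<Sum>m\<in>I - {i}. \<bar>A i m\<bar> / 2)"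
        proof -
          have "(\<Sum>l\<in>I. \<Sum>m\<in>I - {l}. (if l = i then \<bar>A i m\<bar> / 2 else 0)) = (\<Sum>l\<in>I. if l = i then (\<Sum>m\<in>I - {i}. \<bar>A i m\<bar> / 2) else 0)"
            by (rule sum.cong) auto
          thus ?thesis using ik assms(1) by simp
        qed
        show ?thesis unfolding sum.distrib 1 2 by simp
      qed
      also have "(\<Sum>l\<in>I. \<Sum>m\<in>I - {l}. if m = i then \<bar>A l i\<bar> / 2 else 0) = (\<Sum>l\<in>I - {i}. \<bar>A l i\<bar> / 2)"
      proof -
        have "(\<Sum>l\<in>I. \<Sum>m\<in>I - {l}. if m = i then \<bar>A l i\<bar> / 2 else 0) = (\<Sum>l\<in>I. if l = i then 0 else \<bar>A l i\<bar> / 2)"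
          using ik assms(1) by (intro sum.cong) auto
        also have "\<dots> = (\<Sum>l\<in>I - {i}. \<bar>A l i\<bar> / 2)"
          using assms(1) by (intro sum.mono_neutral_cong_right) auto
        finally show ?thesis .
      qed
      also have "(\<Sum>l\<in>I - {i}. \<bar>A l i\<bar> / 2) = (\<Sum>m\<in>I - {i}. \<bar>A i m\<bar> / 2)" using sym ik by (intro sum.cong) auto
      also have "r i + (\<Sum>m\<in>I - {i}. \<bar>A i m\<bar> / 2) + (\<Sum>m\<in>I - {i}. \<bar>A i m\<bar> / 2) = A i i"
        unfolding r_def by (simp add: sum_divide_distrib[symmetric])
      also have "(\<Sum>l\<in>I. r l * (if i = l \<and> k = l then 1 else 0) + (\<Sum>m\<in>I - {l}. (if l = i then \<bar>A i m\<bar> / 2 else 0) + (if m = i then \<bar>A l i\<bar> / 2 else 0)))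
        = (\<Sum>l\<in>I. r l * (if i = l \<and> k = l then 1 else 0)
        + (\<Sum>m\<in>I - {l}. \<bar>A l m\<bar> / 2 * (((if i = l then 1 else 0) + sgn (A l m) * (if i = m then 1 else 0))
            * ((if k = l then 1 else 0) + sgn (A l m) * (if k = m then 1 else 0)))))"
        by (intro sum.cong refl arg_cong2[where f = "(+)"] t[symmetric]) auto
      finally show ?thesis using True by simp
    next
      case False
      \<comment> \<open>Off the diagonal only the squares of the pairs (i, k) and (k, i) contribute,
        one half of the entry each.\<close>
      have t: "\<bar>A l m\<bar> / 2 * (((if i = l then 1 else 0) + sgn (A l m) * (if i = m then 1 else 0))
            * ((if k = l then 1 else 0) + sgn (A l m) * (if k = m then 1 else 0)))
        = (if l = i then (if m = k then A i k / 2 else 0) else 0) + (if l = k then (if m = i then A k i / 2 else 0) else 0)" if "m \<noteq> l" for l m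
        using that False by (auto simp: abs_mult_sgn sgn_if)
      have "(\<Sum>l\<in>I. r l * (if i = l \<and> k = l then 1 else 0) + (\<Sum>m\<in>I - {l}. (if l = i then (if m = k then A i k / 2 else 0) else 0) + (if l = k then (if m = i then A k i / 2 else 0) else 0)))
        = (\<Sum>l\<in>I. (if l = i then A i k / 2 else 0) + (if l = k then A k i / 2 else 0))"
        using False ik assms(1) by (intro sum.cong) (auto simp: sum.distrib)
      also have "\<dots> = A i k" using ik assms(1) sym[of i k] by (simp add: sum.distrib)
      also have "(\<Sum>l\<in>I. r l * (if i = l \<and> k = l then 1 else 0) + (\<Sum>m\<in>I - {l}. (if l = i then (if m = k then A i k / 2 else 0) else 0) + (if l = k then (if m = i then A k i / 2 else 0) else 0)))
        = (\<Sum>l\<in>I. r l * (if i = l \<and> k = l then 1 else 0)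
        + (\<Sum>m\<in>I - {l}. \<bar>A l m\<bar> / 2 * (((if i = l then 1 else 0) + sgn (A l m) * (if i = m then 1 else 0))
            * ((if k = l then 1 else 0) + sgn (A l m) * (if k = m then 1 else 0)))))"
        by (intro sum.cong refl arg_cong2[where f = "(+)"] t[symmetric]) auto
      finally show ?thesis .
    qed
    finally show ?thesis ..
  qed
  thus ?thesis unfolding gram_def by blast
qed

lemma gram_imp_psd:
  assumes "gram I A"
  shows "psd I A"
proof -
  obtain c where c: "\<And>i k. i \<in> I \<Longrightarrow> k \<in> I \<Longrightarrow> A i k = (\<Sum>s\<in>I \<times> I. c s i * c s k)"
    using assms by (auto simp: gram_def)
  have "bform I A v v = (\<Sum>s\<in>I \<times> I. (\<Sum>i\<in>I. c s i * v i)\<^sup>2)" for v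
  proof -
    have "bform I A v v = (\<Sum>i\<in>I. \<Sum>k\<in>I. \<Sum>s\<in>I \<times> I. c s i * v i * (c s k * v k))"
      unfolding bform_def by (intro sum.cong refl) (simp add: c sum_distrib_left sum_distrib_right mult_ac)
    also have "\<dots> = (\<Sum>i\<in>I. \<Sum>s\<in>I \<times> I. \<Sum>k\<in>I. c s i * v i * (c s k * v k))"
      by (intro sum.cong refl sum.swap)
    also have "\<dots> = (\<Sum>s\<in>I \<times> I. \<Sum>i\<in>I. \<Sum>k\<in>I. c s i * v i * (c s k * v k))" by (rule sum.swap)
    finally show ?thesis by (simp add: power2_eq_square sum_product)
  qed
  thus ?thesis unfolding psd_def using c by (auto intro!: sum_nonneg sum.cong simp: mult.commute)
qed

text \<open>Contracting v with each rank-one factor of A splits the form into values of the form of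
  B, one for every factor; so an explicit factorization is asked of the first matrix only.\<close>

lemma psd_kron:
  assumes "gram I A" "psd J B"
  shows "psd (I \<times> J) (kron A B)"
proof -
  obtain c where c: "\<And>i k. i \<in> I \<Longrightarrow> k \<in> I \<Longrightarrow> A i k = (\<Sum>s\<in>I \<times> I. c s i * c s k)"
    using assms by (auto simp: gram_def)
  define S where "S = I \<times> I"
  note c = c[folded S_def]
  have "bform (I \<times> J) (kron A B) v v = (\<Sum>s\<in>S. bform J B (\<lambda>j. \<Sum>i\<in>I. c s i * v (i, j)) (\<lambda>j. \<Sum>i\<in>I. c s i * v (i, j)))" for v
  proof -
    let ?t = "\<lambda>s i j k l. c s i * c s k * B j l * v (k, l) * v (i, j)"
    have "bform (I \<times> J) (kron A B) v v = (\<Sum>i\<in>I. \<Sum>j\<in>J. \<Sum>k\<in>I. \<Sum>l\<in>J. \<Sum>s\<in>S. ?t s i j k l)"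
      unfolding bform_def sum.cartesian_product' kron_def
      by (intro sum.cong refl) (simp add: c sum_distrib_left sum_distrib_right)
    also have "\<dots> = (\<Sum>x\<in>I \<times> J \<times> I \<times> J \<times> S. case x of (i, j, k, l, s) \<Rightarrow> ?t s i j k l)"
      by (simp add: sum.cartesian_product' split_def)
    also have "\<dots> = (\<Sum>x\<in>S \<times> J \<times> J \<times> I \<times> I. case x of (s, j, l, k, i) \<Rightarrow> ?t s i j k l)"
      by (rule sum.reindex_bij_witness[where i = "\<lambda>(s, j, l, k, i). (i, j, k, l, s)" and j = "\<lambda>(i, j, k, l, s). (s, j, l, k, i)"]) auto
    also have "\<dots> = (\<Sum>s\<in>S. \<Sum>j\<in>J. \<Sum>l\<in>J. \<Sum>k\<in>I. \<Sum>i\<in>I. ?t s i j k l)"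
      by (simp add: sum.cartesian_product' split_def)
    also have "\<dots> = (\<Sum>s\<in>S. bform J B (\<lambda>j. \<Sum>i\<in>I. c s i * v (i, j)) (\<lambda>j. \<Sum>i\<in>I. c s i * v (i, j)))"
      unfolding bform_def by (intro sum.cong refl) (simp add: sum_distrib_left sum_distrib_right mult_ac)
    finally show ?thesis .
  qed
  moreover have "kron A B x y = kron A B y x" if "x \<in> I \<times> J" "y \<in> I \<times> J" for x y
    using that assms(2) gram_imp_psd[OF assms(1)] by (auto simp: kron_def psd_def)
  ultimately show ?thesis
    unfolding psd_def using assms(2) by (auto intro!: sum_nonneg simp: psd_nonneg)
qed

section \<open>The BDF2 energy\<close>

text \<open>The G-stability identity of BDF2: with the energy (|a|^2 + |2a - b|^2)/4 the tested time
  difference telescopes up to the square of the second difference. It is used for the mass form and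
  for the splitting form alike.\<close>

lemma bform_bdf2:
  assumes "psd I A"
  shows "bform I A (\<lambda>i. (3 * a i - 4 * b i + c i) / 2) a =
    (bform I A a a + bform I A (\<lambda>i. 2 * a i - b i) (\<lambda>i. 2 * a i - b i)) / 4
    - (bform I A b b + bform I A (\<lambda>i. 2 * b i - c i) (\<lambda>i. 2 * b i - c i)) / 4
    + bform I A (\<lambda>i. a i - 2 * b i + c i) (\<lambda>i. a i - 2 * b i + c i) / 4"
proof -
  have e: "(\<lambda>i. (3 * a i - 4 * b i + c i) / 2) = (\<lambda>i. 3/2 * a i + 1 * ((-2) * b i + 1/2 * c i))"
    "(\<lambda>i. 2 * a i - b i) = (\<lambda>i. 2 * a i + (-1) * b i)" "(\<lambda>i. 2 * b i - c i) = (\<lambda>i. 2 * b i + (-1) * c i)"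
    "(\<lambda>i. a i - 2 * b i + c i) = (\<lambda>i. 1 * a i + 1 * ((-2) * b i + 1 * c i))"
    by (auto simp: field_simps)
  show ?thesis
    unfolding e bform_lin_left bform_lin_right bform_sym[OF assms, of b a] bform_sym[OF assms, of c a] bform_sym[OF assms, of c b]
    by (simp add: field_simps)
qed

text \<open>Passes from energies to their square roots, so that the recursion for the error becomes
  linear.\<close>

lemma sqrt_step_bound:
  assumes "x \<ge> (0::real)" "y \<ge> 0" "g \<ge> 0" "y\<^sup>2 \<le> x\<^sup>2 + g * y"
  shows "y \<le> x + g"
proof (rule ccontr)
  assume "\<not> y \<le> x + g"
  hence "y > x + g" by simp
  hence "y * y > (x + g) * y" using assms by (intro mult_strict_right_mono) auto
  moreover have "x * x \<le> x * y" using \<open>y > x + g\<close> assms by (intro mult_left_mono) auto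
  ultimately show False using assms(4) by (simp add: power2_eq_square algebra_simps)
qed

text \<open>P is the mass form, Q the splitting form and S the fractional diffusion, which is
  discarded as nonnegative. The splitting term is itself a BDF2 difference tested in Q and joins the
  energy. F1 gets a factor \<tau> because the initial error vanishes and it acts in one step only;
  this absorbs the lower order of the first step.\<close>

lemma bdf2_stability:
  fixes \<eta> :: "nat \<Rightarrow> 'i \<Rightarrow> real" and rhs :: "nat \<Rightarrow> real"
  assumes P: "psd I P" and Q: "psd I Q" and S: "\<And>v. 0 \<le> bform I S v v"
    and \<tau>: "\<tau> > 0" and L: "L \<ge> 0" and F: "F1 \<ge> 0" "F2 \<ge> 0"
    and zero: "\<And>i. i \<in> I \<Longrightarrow> \<eta> 0 i = 0"
    and eq1: "bform I P (\<lambda>i. (\<eta> 1 i - \<eta> 0 i) / \<tau>) (\<eta> 1) + \<tau>\<^sup>2 * bform I Q (\<lambda>i. (\<eta> 1 i - \<eta> 0 i) / \<tau>) (\<eta> 1)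
        + bform I S (\<eta> 1) (\<eta> 1) \<le> F1 * sqrt (bform I P (\<eta> 1) (\<eta> 1))"
    and eq: "\<And>n. 2 \<le> n \<Longrightarrow> n \<le> N \<Longrightarrow>
        bform I P (\<lambda>i. (3 * \<eta> n i - 4 * \<eta> (n - 1) i + \<eta> (n - 2) i) / 2 / \<tau>) (\<eta> n)
        + \<tau>\<^sup>2 * (2/3)\<^sup>2 * bform I Q (\<lambda>i. (3 * \<eta> n i - 4 * \<eta> (n - 1) i + \<eta> (n - 2) i) / 2 / \<tau>) (\<eta> n)
        + bform I S (\<eta> n) (\<eta> n)
        \<le> (F2 + L * sqrt (bform I P (\<lambda>i. 2 * \<eta> (n - 1) i - \<eta> (n - 2) i) (\<lambda>i. 2 * \<eta> (n - 1) i - \<eta> (n - 2) i)))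
          * sqrt (bform I P (\<eta> n) (\<eta> n))"
    and n: "1 \<le> n" "n \<le> N" and NT: "real N * \<tau> \<le> T"
  shows "sqrt (bform I P (\<eta> n) (\<eta> n)) \<le> 4 * exp (4 * L * T) * (\<tau> * F1 + T * F2)"
proof -
  define p where "p x = sqrt (bform I P x x)" for x
  \<comment> \<open>(2/3)^2 is \<sigma>_n^2 for n \<ge> 2. The same weight is kept at n = 1, where
    the inequality with \<sigma>_1 = 1 controls more than is needed.\<close>
  define Z where "Z n = \<tau>\<^sup>2 * (2/3)\<^sup>2 * ((bform I Q (\<eta> n) (\<eta> n) + bform I Q (\<lambda>i. 2 * \<eta> n i - \<eta> (n - 1) i) (\<lambda>i. 2 * \<eta> n i - \<eta> (n - 1) i)) / 4)" for n
  define E where "E n = (bform I P (\<eta> n) (\<eta> n) + bform I P (\<lambda>i. 2 * \<eta> n i - \<eta> (n - 1) i) (\<lambda>i. 2 * \<eta> n i - \<eta> (n - 1) i)) / 4 + Z n" for n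
  have nn: "0 \<le> bform I P v v" "0 \<le> bform I Q v v" for v using P Q by (auto simp: psd_nonneg)
  have Z0: "Z n \<ge> 0" for n unfolding Z_def using nn by (intro add_nonneg_nonneg mult_nonneg_nonneg divide_nonneg_nonneg) auto
  have E0: "E n \<ge> 0" for n unfolding E_def using nn Z0 by (intro add_nonneg_nonneg mult_nonneg_nonneg divide_nonneg_nonneg) auto
  have PE: "bform I P (\<eta> n) (\<eta> n) \<le> 4 * E n" "bform I P (\<lambda>i. 2 * \<eta> n i - \<eta> (n - 1) i) (\<lambda>i. 2 * \<eta> n i - \<eta> (n - 1) i) \<le> 4 * E n" for n
    unfolding E_def using nn(1)[of "\<eta> n"] nn(1)[of "\<lambda>i. 2 * \<eta> n i - \<eta> (n - 1) i"] Z0[of n] by (auto simp: field_simps)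
  define s where "s n = sqrt (E n)" for n
  have s0: "s n \<ge> 0" "(s n)\<^sup>2 = E n" for n using E0 by (auto simp: s_def)
  have ps: "p (\<eta> n) \<le> 2 * s n" "p (\<lambda>i. 2 * \<eta> n i - \<eta> (n - 1) i) \<le> 2 * s n" for n
  proof -
    have "sqrt (4 * E n) = 2 * s n" by (simp add: s_def real_sqrt_mult)
    thus "p (\<eta> n) \<le> 2 * s n" "p (\<lambda>i. 2 * \<eta> n i - \<eta> (n - 1) i) \<le> 2 * s n"
      unfolding p_def using PE[of n] by (metis real_sqrt_le_mono)+
  qed
  have s1: "s 1 \<le> 2 * (\<tau> * F1)"
  proof -
    define a where "a = bform I P (\<eta> 1) (\<eta> 1)"
    define b where "b = bform I Q (\<eta> 1) (\<eta> 1)"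
    have ab: "0 \<le> a" "0 \<le> b" using nn by (auto simp: a_def b_def)
    have 1: "bform I X (\<lambda>i. (\<eta> 1 i - \<eta> 0 i) / \<tau>) (\<eta> 1) = bform I X (\<eta> 1) (\<eta> 1) / \<tau>" for X
    proof -
      have "bform I X (\<lambda>i. (\<eta> 1 i - \<eta> 0 i) / \<tau>) (\<eta> 1) = bform I X (\<lambda>i. (1 / \<tau>) * \<eta> 1 i + 0 * \<eta> 1 i) (\<eta> 1)"
        using zero by (intro bform_cong) auto
      thus ?thesis unfolding bform_lin_left by simp
    qed
    have 2: "bform I X (\<lambda>i. 2 * \<eta> 1 i - \<eta> (1 - 1) i) (\<lambda>i. 2 * \<eta> 1 i - \<eta> (1 - 1) i) = 4 * bform I X (\<eta> 1) (\<eta> 1)" for X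
    proof -
      have "bform I X (\<lambda>i. 2 * \<eta> 1 i - \<eta> (1 - 1) i) (\<lambda>i. 2 * \<eta> 1 i - \<eta> (1 - 1) i) = bform I X (\<lambda>i. 2 * \<eta> 1 i + 0 * \<eta> 1 i) (\<lambda>i. 2 * \<eta> 1 i + 0 * \<eta> 1 i)"
        using zero by (intro bform_cong) auto
      thus ?thesis unfolding bform_lin_left bform_lin_right by simp
    qed
    have "a / \<tau> + \<tau>\<^sup>2 * (b / \<tau>) \<le> F1 * sqrt a"
      using eq1 S[of "\<eta> 1"] unfolding 1 a_def b_def by linarith
    hence "(a / \<tau> + \<tau>\<^sup>2 * (b / \<tau>)) * \<tau> \<le> F1 * sqrt a * \<tau>" using \<tau> by (intro mult_right_mono) auto
    moreover have "(a / \<tau> + \<tau>\<^sup>2 * (b / \<tau>)) * \<tau> = a + \<tau>\<^sup>2 * b" using \<tau> by (simp add: distrib_right)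
    ultimately have *: "a + \<tau>\<^sup>2 * b \<le> \<tau> * F1 * sqrt a" by (simp add: mult_ac)
    have "sqrt a \<le> 0 + \<tau> * F1"
    proof (rule sqrt_step_bound)
      have "0 \<le> \<tau>\<^sup>2 * b" using ab by simp
      with * have "a \<le> \<tau> * F1 * sqrt a" by linarith
      thus "(sqrt a)\<^sup>2 \<le> 0\<^sup>2 + \<tau> * F1 * sqrt a" using ab by simp
    qed (use \<tau> F ab in auto)
    hence "\<tau> * F1 * sqrt a \<le> \<tau> * F1 * (\<tau> * F1)" using \<tau> F by (intro mult_left_mono) auto
    hence ab2: "a + \<tau>\<^sup>2 * b \<le> (\<tau> * F1)\<^sup>2" using * by (simp add: power2_eq_square)
    \<comment> \<open>As \<eta> 0 = 0, the second vector of the energy is 2 \<eta> 1, so each form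
      is counted (1 + 4)/4 times; 5/9 is 5/4 times 4/9.\<close>
    have "E 1 = 5/4 * a + 5/9 * (\<tau>\<^sup>2 * b)"
      unfolding E_def Z_def 2 a_def b_def by (simp add: field_simps power2_eq_square)
    also have "\<dots> \<le> 4 * (a + \<tau>\<^sup>2 * b)"
    proof -
      have "0 \<le> \<tau>\<^sup>2 * b" using ab by simp
      with ab(1) show ?thesis unfolding distrib_left by linarith
    qed
    also have "\<dots> \<le> (2 * (\<tau> * F1))\<^sup>2" using ab2 by (simp add: power_mult_distrib)
    finally show ?thesis unfolding s_def using \<tau> F by (intro real_le_lsqrt) (auto intro: E0)
  qed
  have step: "s n \<le> (1 + 4 * L * \<tau>) * s (n - 1) + 2 * \<tau> * F2" if n: "2 \<le> n" "n \<le> N" for n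
  proof -
    let ?d = "\<lambda>i. \<eta> n i - 2 * \<eta> (n - 1) i + \<eta> (n - 2) i" and ?w = "\<lambda>i. (3 * \<eta> n i - 4 * \<eta> (n - 1) i + \<eta> (n - 2) i) / 2"
    have div: "bform I X (\<lambda>i. (3 * \<eta> n i - 4 * \<eta> (n - 1) i + \<eta> (n - 2) i) / 2 / \<tau>) (\<eta> n) = bform I X ?w (\<eta> n) / \<tau>" for X
      using bform_lin_left[of I X "1 / \<tau>" ?w 0 ?w "\<eta> n"] by (simp add: mult.commute)
    define G where "G = F2 + L * p (\<lambda>i. 2 * \<eta> (n - 1) i - \<eta> (n - 2) i)"
    have nm: "n - 1 - 1 = n - 2" by simp
    have "bform I P ?w (\<eta> n) / \<tau> + \<tau>\<^sup>2 * (2/3)\<^sup>2 * (bform I Q ?w (\<eta> n) / \<tau>) \<le> G * p (\<eta> n)"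
      using eq[OF n] S[of "\<eta> n"] unfolding div G_def p_def by linarith
    hence le: "(bform I P ?w (\<eta> n) / \<tau> + \<tau>\<^sup>2 * (2/3)\<^sup>2 * (bform I Q ?w (\<eta> n) / \<tau>)) * \<tau> \<le> G * p (\<eta> n) * \<tau>"
      using \<tau> by (intro mult_right_mono) auto
    have canc: "(x / \<tau> + \<tau>\<^sup>2 * (2/3)\<^sup>2 * (y / \<tau>)) * \<tau> = x + \<tau>\<^sup>2 * (2/3)\<^sup>2 * y" for x y
      using \<tau> by (simp add: distrib_right)
    have 1: "bform I P ?w (\<eta> n) + \<tau>\<^sup>2 * (2/3)\<^sup>2 * bform I Q ?w (\<eta> n) \<le> \<tau> * G * p (\<eta> n)"
      using le unfolding canc by (simp only: mult_ac)
    have 2: "E n - E (n - 1) + (bform I P ?d ?d / 4 + \<tau>\<^sup>2 * (2/3)\<^sup>2 * (bform I Q ?d ?d / 4)) = bform I P ?w (\<eta> n) + \<tau>\<^sup>2 * (2/3)\<^sup>2 * bform I Q ?w (\<eta> n)"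
      unfolding bform_bdf2[OF P] bform_bdf2[OF Q] E_def Z_def nm by (simp add: algebra_simps)
    have "0 \<le> bform I P ?d ?d / 4 + \<tau>\<^sup>2 * (2/3)\<^sup>2 * (bform I Q ?d ?d / 4)"
      using nn by (intro add_nonneg_nonneg mult_nonneg_nonneg divide_nonneg_nonneg) auto
    hence 3: "E n \<le> E (n - 1) + \<tau> * G * p (\<eta> n)" using 1 2 by linarith
    have p0: "p x \<ge> 0" for x unfolding p_def using nn by simp
    have G0: "G \<ge> 0" unfolding G_def using F L p0 by simp
    have "\<tau> * G * p (\<eta> n) \<le> \<tau> * G * (2 * s n)" using \<tau> G0 ps by (intro mult_left_mono) auto
    hence "E n \<le> E (n - 1) + \<tau> * G * (2 * s n)" using 3 by linarith
    hence sq: "(s n)\<^sup>2 \<le> (s (n - 1))\<^sup>2 + (2 * \<tau> * G) * s n" unfolding s0(2) by (simp only: mult_ac)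
    \<comment> \<open>The extrapolation 2 \<eta> (n - 1) - \<eta> (n - 2) is the second vector of
      the energy at level n - 1, so the source costs only the previous energy.\<close>
    have G1: "G \<le> F2 + L * (2 * s (n - 1))"
      unfolding G_def using L ps(2)[of "n - 1"] unfolding nm by (intro add_mono mult_left_mono) auto
    have "s n \<le> s (n - 1) + 2 * \<tau> * G"
      by (rule sqrt_step_bound[OF s0(1) s0(1) _ sq]) (use \<tau> G0 in auto)
    also have "\<dots> \<le> s (n - 1) + 2 * \<tau> * (F2 + L * (2 * s (n - 1)))"
      using \<tau> G1 by (intro add_left_mono mult_left_mono) auto
    also have "\<dots> = (1 + 4 * L * \<tau>) * s (n - 1) + 2 * \<tau> * F2" by (simp add: algebra_simps)
    finally show ?thesis .
  qed
  \<comment> \<open>Discrete Gronwall by 1 + x \<le> e^x, started at level 1, where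
    \<open>s1\<close> supplies the initial value.\<close>
  have growth: "s (Suc k) \<le> exp (4 * L * \<tau> * real k) * (s 1 + 2 * \<tau> * F2 * real k)" if "Suc k \<le> N" for k
    using that
  proof (induction k)
    case (Suc k)
    let ?e = "exp (4 * L * \<tau> * real (Suc k))"
    have IH: "s (Suc k) \<le> exp (4 * L * \<tau> * real k) * (s 1 + 2 * \<tau> * F2 * real k)" using Suc by simp
    have x0: "0 \<le> 4 * L * \<tau>" using L \<tau> by simp
    have "s (Suc (Suc k)) \<le> (1 + 4 * L * \<tau>) * s (Suc k) + 2 * \<tau> * F2" using step[of "Suc (Suc k)"] Suc.prems by simp
    moreover have "(1 + 4 * L * \<tau>) * s (Suc k) \<le> exp (4 * L * \<tau>) * (exp (4 * L * \<tau> * real k) * (s 1 + 2 * \<tau> * F2 * real k))"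
      using IH x0 s0 by (intro mult_mono exp_ge_add_one_self) auto
    moreover have "exp (4 * L * \<tau>) * (exp (4 * L * \<tau> * real k) * (s 1 + 2 * \<tau> * F2 * real k)) = ?e * (s 1 + 2 * \<tau> * F2 * real k)"
      unfolding mult.assoc[symmetric] exp_add[symmetric] by (simp add: algebra_simps)
    moreover have "2 * \<tau> * F2 \<le> ?e * (2 * \<tau> * F2)"
      using mult_right_mono[of 1 ?e "2 * \<tau> * F2"] x0 \<tau> F by simp
    ultimately have "s (Suc (Suc k)) \<le> ?e * (s 1 + 2 * \<tau> * F2 * real k) + ?e * (2 * \<tau> * F2)" by linarith
    also have "\<dots> = ?e * (s 1 + 2 * \<tau> * F2 * real (Suc k))" by (simp add: algebra_simps)
    finally show ?case .
  qed simp
  obtain k where k: "n = Suc k" using n(1) by (cases n) auto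
  have kT: "\<tau> * real k \<le> T"
  proof -
    have "\<tau> * real k \<le> \<tau> * real N" using n k \<tau> by (intro mult_left_mono) auto
    thus ?thesis using NT by (simp add: mult.commute)
  qed
  have T0: "0 \<le> T" using kT \<tau> by (meson mult_nonneg_nonneg of_nat_0_le_iff less_imp_le order_trans)
  have "s n \<le> exp (4 * L * \<tau> * real k) * (s 1 + 2 * \<tau> * F2 * real k)" using growth[of k] n k by simp
  also have "\<dots> \<le> exp (4 * L * T) * (2 * (\<tau> * F1) + 2 * T * F2)"
  proof (rule mult_mono)
    have "4 * L * (\<tau> * real k) \<le> 4 * L * T" using kT L by (intro mult_left_mono) auto
    thus "exp (4 * L * \<tau> * real k) \<le> exp (4 * L * T)" by (simp add: mult.assoc)
    have "(\<tau> * real k) * (2 * F2) \<le> T * (2 * F2)" using kT F by (intro mult_right_mono) auto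
    hence "2 * \<tau> * F2 * real k \<le> 2 * T * F2" by (simp add: mult_ac)
    thus "s 1 + 2 * \<tau> * F2 * real k \<le> 2 * (\<tau> * F1) + 2 * T * F2" by (rule add_mono[OF s1])
    show "0 \<le> s 1 + 2 * \<tau> * F2 * real k" using s0(1) \<tau> F by (intro add_nonneg_nonneg mult_nonneg_nonneg) auto
  qed simp
  finally have "s n \<le> exp (4 * L * T) * (2 * (\<tau> * F1) + 2 * T * F2)" .
  with ps(1)[of n] show ?thesis unfolding p_def by (simp add: algebra_simps)
qed

section \<open>The scheme in matrix form\<close>

definition compact_matrix :: "real \<Rightarrow> nat \<Rightarrow> nat \<Rightarrow> real" where
  "compact_matrix \<gamma> i k = (if i = k then 1 - 2 * c2 \<gamma> else if k = Suc i \<or> i = Suc k then c2 \<gamma> else 0)"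

definition frac_matrix :: "real \<Rightarrow> real \<Rightarrow> nat \<Rightarrow> nat \<Rightarrow> real" where
  "frac_matrix c \<gamma> i k = c * frac_coeff \<gamma> (int i - int k)"

lemma compact_matrix_offdiag:
  assumes "finite I" "0 \<le> \<gamma>"
  shows "(\<Sum>k\<in>I - {i}. \<bar>compact_matrix \<gamma> i k\<bar>) \<le> 2 * c2 \<gamma>"
proof -
  have "(\<Sum>k\<in>I - {i}. \<bar>compact_matrix \<gamma> i k\<bar>) = (\<Sum>k\<in>(I - {i}) \<inter> {Suc i, i - 1}. \<bar>compact_matrix \<gamma> i k\<bar>)"
    using assms by (intro sum.mono_neutral_right) (auto simp: compact_matrix_def)
  \<comment> \<open>For i = 0 the index i - 1 equals i and has already been removed; counting two
    neighbours is then merely generous.\<close>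
  also have "\<dots> \<le> (\<Sum>k\<in>{Suc i, i - 1}. c2 \<gamma>)"
    using assms by (intro order_trans[OF sum_mono sum_mono2]) (auto simp: compact_matrix_def c2_def)
  also have "\<dots> = 2 * c2 \<gamma>" by (subst sum.insert) auto
  finally show ?thesis .
qed

text \<open>Gershgorin bounds for the averaging matrix, expressed by forms: its spectrum lies
  between 1 - 4 c2 and 1. All three claims are diagonal dominance with off-diagonal row sums of at
  most 2 c2.\<close>

lemma gram_compact_matrix:
  assumes "finite I" "0 \<le> \<gamma>" "\<gamma> < 2"
  shows "gram I (compact_matrix \<gamma>)" "gram I (\<lambda>i k. idm i k - compact_matrix \<gamma> i k)"
    "gram I (\<lambda>i k. compact_matrix \<gamma> i k - (1 - 4 * c2 \<gamma>) * idm i k)"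
proof -
  have c2: "0 \<le> c2 \<gamma>" "c2 \<gamma> \<le> 1/12" using assms by (auto simp: c2_def)
  have sym: "compact_matrix \<gamma> i k = compact_matrix \<gamma> k i" "idm i k = idm k i" for i k by (auto simp: compact_matrix_def idm_def)
  note off = compact_matrix_offdiag[OF assms(1,2)]
  show "gram I (compact_matrix \<gamma>)"
  proof (rule gram_diagonally_dominant)
    fix i
    have "(\<Sum>k\<in>I - {i}. \<bar>compact_matrix \<gamma> i k\<bar>) \<le> 2 * c2 \<gamma>" by (rule off)
    also have "\<dots> \<le> compact_matrix \<gamma> i i" using c2 by (simp add: compact_matrix_def)
    finally show "(\<Sum>k\<in>I - {i}. \<bar>compact_matrix \<gamma> i k\<bar>) \<le> compact_matrix \<gamma> i i" .
  qed (use assms sym in auto)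
  show "gram I (\<lambda>i k. idm i k - compact_matrix \<gamma> i k)"
  proof (rule gram_diagonally_dominant)
    fix i
    have "(\<Sum>k\<in>I - {i}. \<bar>idm i k - compact_matrix \<gamma> i k\<bar>) = (\<Sum>k\<in>I - {i}. \<bar>compact_matrix \<gamma> i k\<bar>)"
      by (intro sum.cong) (auto simp: idm_def)
    also have "\<dots> \<le> 2 * c2 \<gamma>" by (rule off)
    finally show "(\<Sum>k\<in>I - {i}. \<bar>idm i k - compact_matrix \<gamma> i k\<bar>) \<le> idm i i - compact_matrix \<gamma> i i"
      by (simp add: compact_matrix_def idm_def)
  qed (use assms sym in auto)
  show "gram I (\<lambda>i k. compact_matrix \<gamma> i k - (1 - 4 * c2 \<gamma>) * idm i k)"
  proof (rule gram_diagonally_dominant)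
    fix i
    have "(\<Sum>k\<in>I - {i}. \<bar>compact_matrix \<gamma> i k - (1 - 4 * c2 \<gamma>) * idm i k\<bar>) = (\<Sum>k\<in>I - {i}. \<bar>compact_matrix \<gamma> i k\<bar>)"
      by (intro sum.cong) (auto simp: idm_def)
    also have "\<dots> \<le> 2 * c2 \<gamma>" by (rule off)
    finally show "(\<Sum>k\<in>I - {i}. \<bar>compact_matrix \<gamma> i k - (1 - 4 * c2 \<gamma>) * idm i k\<bar>) \<le> compact_matrix \<gamma> i i - (1 - 4 * c2 \<gamma>) * idm i i"
      by (simp add: compact_matrix_def idm_def)
  qed (use assms sym in auto)
qed

text \<open>The symbol vanishes at 0 and all coefficients except the first are negative, so the
  moduli off the centre add up exactly to the central one. This is the borderline case of diagonal
  dominance.\<close>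

lemma sum_frac_coeff_nat:
  assumes "1 < \<gamma>" "\<gamma> < 2"
  shows "2 * (\<Sum>k. \<bar>frac_coeff_nat \<gamma> (Suc k)\<bar>) = frac_coeff_nat \<gamma> 0"
proof -
  have "\<bar>frac_coeff_nat \<gamma> (Suc k)\<bar> = - frac_coeff_nat \<gamma> (Suc k)" for k
    using frac_coeff_nat_neg[of \<gamma> k] assms by simp
  moreover have "frac_symbol \<gamma> 0 = 0" using frac_symbol_eq[OF assms, of 0] by simp
  moreover have "summable (\<lambda>k. frac_coeff_nat \<gamma> (Suc k))"
    using summable_frac_symbol(1)[OF assms, of "\<lambda>_. 1"] by simp
  ultimately show ?thesis by (simp add: frac_symbol_def suminf_minus)
qed

text \<open>On either side of the diagonal a row meets each coefficient at most once, so each half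
  row is bounded by the full series, whatever the size of the matrix.\<close>

lemma gram_frac_matrix:
  assumes "finite I" "1 < \<gamma>" "\<gamma> < 2" "c \<ge> 0"
  shows "gram I (frac_matrix c \<gamma>)"
proof (rule gram_diagonally_dominant)
  fix i
  have sm: "summable (\<lambda>k. \<bar>frac_coeff_nat \<gamma> (Suc k)\<bar>)" using summable_abs_frac_coeff[OF assms(2,3)] by (subst summable_Suc_iff)
  let ?S = "\<Sum>k. \<bar>frac_coeff_nat \<gamma> (Suc k)\<bar>"
  have "(\<Sum>k\<in>{k\<in>I. k < i}. \<bar>frac_coeff \<gamma> (int i - int k)\<bar>) = (\<Sum>m\<in>(\<lambda>k. i - Suc k) ` {k\<in>I. k < i}. \<bar>frac_coeff_nat \<gamma> (Suc m)\<bar>)"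
  proof (subst sum.reindex)
    show "inj_on (\<lambda>k. i - Suc k) {k \<in> I. k < i}" by (auto simp: inj_on_def)
    show "(\<Sum>k\<in>{k\<in>I. k < i}. \<bar>frac_coeff \<gamma> (int i - int k)\<bar>) = sum ((\<lambda>m. \<bar>frac_coeff_nat \<gamma> (Suc m)\<bar>) \<circ> (\<lambda>k. i - Suc k)) {k \<in> I. k < i}"
      by (intro sum.cong) (auto simp: frac_coeff_def Suc_diff_Suc nat_diff_distrib')
  qed
  also have "\<dots> \<le> ?S" using assms(1) by (intro sum_le_suminf sm) auto
  finally have 1: "(\<Sum>k\<in>{k\<in>I. k < i}. \<bar>frac_coeff \<gamma> (int i - int k)\<bar>) \<le> ?S" .
  have "(\<Sum>k\<in>{k\<in>I. i < k}. \<bar>frac_coeff \<gamma> (int i - int k)\<bar>) = (\<Sum>m\<in>(\<lambda>k. k - Suc i) ` {k\<in>I. i < k}. \<bar>frac_coeff_nat \<gamma> (Suc m)\<bar>)"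
  proof (subst sum.reindex)
    show "inj_on (\<lambda>k. k - Suc i) {k \<in> I. i < k}" by (auto simp: inj_on_def)
    show "(\<Sum>k\<in>{k\<in>I. i < k}. \<bar>frac_coeff \<gamma> (int i - int k)\<bar>) = sum ((\<lambda>m. \<bar>frac_coeff_nat \<gamma> (Suc m)\<bar>) \<circ> (\<lambda>k. k - Suc i)) {k \<in> I. i < k}"
    proof (intro sum.cong refl)
      fix k assume "k \<in> {k \<in> I. i < k}"
      hence "nat \<bar>int i - int k\<bar> = Suc (k - Suc i)" by auto
      thus "\<bar>frac_coeff \<gamma> (int i - int k)\<bar> = ((\<lambda>m. \<bar>frac_coeff_nat \<gamma> (Suc m)\<bar>) \<circ> (\<lambda>k. k - Suc i)) k"
        by (simp add: frac_coeff_def)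
    qed
  qed
  also have "\<dots> \<le> ?S" using assms(1) by (intro sum_le_suminf sm) auto
  finally have 2: "(\<Sum>k\<in>{k\<in>I. i < k}. \<bar>frac_coeff \<gamma> (int i - int k)\<bar>) \<le> ?S" .
  have "(\<Sum>k\<in>I - {i}. \<bar>frac_matrix c \<gamma> i k\<bar>) = c * (\<Sum>k\<in>I - {i}. \<bar>frac_coeff \<gamma> (int i - int k)\<bar>)"
    using assms(4) by (simp add: frac_matrix_def abs_mult sum_distrib_left)
  also have "(\<Sum>k\<in>I - {i}. \<bar>frac_coeff \<gamma> (int i - int k)\<bar>)
      = (\<Sum>k\<in>{k\<in>I. k < i} \<union> {k\<in>I. i < k}. \<bar>frac_coeff \<gamma> (int i - int k)\<bar>)"
    by (rule sum.cong) auto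
  also have "\<dots> = (\<Sum>k\<in>{k\<in>I. k < i}. \<bar>frac_coeff \<gamma> (int i - int k)\<bar>) + (\<Sum>k\<in>{k\<in>I. i < k}. \<bar>frac_coeff \<gamma> (int i - int k)\<bar>)"
    using assms(1) by (intro sum.union_disjoint) auto
  also have "c * \<dots> \<le> c * (2 * ?S)" using 1 2 assms(4) by (intro mult_left_mono) auto
  also have "\<dots> = frac_matrix c \<gamma> i i" unfolding sum_frac_coeff_nat[OF assms(2,3)] by (simp add: frac_matrix_def frac_coeff_def)
  finally show "(\<Sum>k\<in>I - {i}. \<bar>frac_matrix c \<gamma> i k\<bar>) \<le> frac_matrix c \<gamma> i i" .
qed (use assms(1) in \<open>auto simp: frac_matrix_def frac_coeff_def abs_minus_commute\<close>)

definition zero_boundary :: "nat \<Rightarrow> nat \<Rightarrow> (nat \<Rightarrow> nat \<Rightarrow> real) \<Rightarrow> bool" where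
  "zero_boundary M1 M2 w \<longleftrightarrow> (\<forall>i\<le>M1. \<forall>j\<le>M2. i = 0 \<or> i = M1 \<or> j = 0 \<or> j = M2 \<longrightarrow> w i j = 0)"

text \<open>Neighbours on the boundary carry the value 0, so the matrix over interior indices
  reproduces the whole stencil.\<close>

lemma sum_compact_matrix:
  fixes w :: "nat \<Rightarrow> real"
  assumes "i \<in> {1..<M}" "w 0 = 0" "w M = 0"
  shows "(\<Sum>k\<in>{1..<M}. compact_matrix \<gamma> i k * w k) = c2 \<gamma> * w (i - 1) + (1 - 2 * c2 \<gamma>) * w i + c2 \<gamma> * w (i + 1)"
proof -
  have "(\<Sum>k\<in>{1..<M}. compact_matrix \<gamma> i k * w k) = (\<Sum>k\<in>{0..M}. compact_matrix \<gamma> i k * w k)"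
    using assms by (intro sum.mono_neutral_left) (auto simp: not_less not_le le_less)
  also have "\<dots> = (\<Sum>k\<in>{i - 1, i, i + 1}. compact_matrix \<gamma> i k * w k)"
    using assms by (intro sum.mono_neutral_right) (auto simp: compact_matrix_def)
  also have "\<dots> = c2 \<gamma> * w (i - 1) + (1 - 2 * c2 \<gamma>) * w i + c2 \<gamma> * w (i + 1)"
    using assms(1) by (cases i) (auto simp: compact_matrix_def)
  finally show ?thesis .
qed

lemma compact_x_matrix:
  assumes "i \<in> {1..<M}" "w 0 j = 0" "w M j = 0"
  shows "compact_x \<gamma> M w i j = (\<Sum>k\<in>{1..<M}. compact_matrix \<gamma> i k * w k j)"
  using sum_compact_matrix[of i M "\<lambda>k. w k j"] assms by (simp add: compact_x_def)

lemma compact_y_matrix: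
  assumes "j \<in> {1..<M}" "w i 0 = 0" "w i M = 0"
  shows "compact_y \<gamma> M w i j = (\<Sum>l\<in>{1..<M}. compact_matrix \<gamma> j l * w i l)"
  using sum_compact_matrix[of j M "w i"] assms by (simp add: compact_y_def)

lemma sum_frac_coeff_reindex:
  fixes w :: "nat \<Rightarrow> real"
  assumes "i \<le> M"
  shows "(\<Sum>k\<in>{int i - int M..int i}. frac_coeff \<gamma> k * w (nat (int i - k))) = (\<Sum>l\<in>{0..M}. frac_coeff \<gamma> (int i - int l) * w l)"
  by (rule sum.reindex_bij_witness[where i = "\<lambda>l. int i - int l" and j = "\<lambda>k. nat (int i - k)"]) auto

lemma sum_frac_matrix:
  fixes w :: "nat \<Rightarrow> real"
  assumes "i \<le> M" "w 0 = 0" "w M = 0"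
  shows "- (\<kappa> / h powr \<gamma>) * (\<Sum>k\<in>{int i - int M..int i}. frac_coeff \<gamma> k * w (nat (int i - k)))
    = - (\<Sum>k\<in>{1..<M}. frac_matrix (\<kappa> / h powr \<gamma>) \<gamma> i k * w k)"
proof -
  have "(\<Sum>l\<in>{0..M}. frac_coeff \<gamma> (int i - int l) * w l) = (\<Sum>l\<in>{1..<M}. frac_coeff \<gamma> (int i - int l) * w l)"
    using assms by (intro sum.mono_neutral_right) (auto simp: not_less not_le le_less)
  thus ?thesis unfolding sum_frac_coeff_reindex[OF assms(1)] by (simp add: frac_matrix_def sum_distrib_left mult.assoc sum_negf)
qed

lemma delta_x_matrix:
  assumes "i \<le> M" "w 0 j = 0" "w M j = 0"
  shows "delta_x \<kappa> \<gamma> h M w i j = - (\<Sum>k\<in>{1..<M}. frac_matrix (\<kappa> / h powr \<gamma>) \<gamma> i k * w k j)"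
  unfolding delta_x_def using sum_frac_matrix[of i M "\<lambda>k. w k j"] assms by simp

lemma delta_y_matrix:
  assumes "j \<le> M" "w i 0 = 0" "w i M = 0"
  shows "delta_y \<kappa> \<gamma> h M w i j = - (\<Sum>l\<in>{1..<M}. frac_matrix (\<kappa> / h powr \<gamma>) \<gamma> j l * w i l)"
  unfolding delta_y_def using sum_frac_matrix[of j M "w i"] assms by simp

definition mapply :: "'i set \<Rightarrow> ('i \<Rightarrow> 'i \<Rightarrow> real) \<Rightarrow> ('i \<Rightarrow> real) \<Rightarrow> 'i \<Rightarrow> real" where
  "mapply I A v i = (\<Sum>k\<in>I. A i k * v k)"

lemma bform_mapply: "bform I A v w = (\<Sum>i\<in>I. mapply I A v i * w i)"
  unfolding bform_def mapply_def by (simp add: sum_distrib_right)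

lemma mapply_kron: "mapply (I \<times> J) (kron A B) (case_prod w) (i, j) = (\<Sum>k\<in>I. A i k * (\<Sum>l\<in>J. B j l * w k l))"
  unfolding mapply_def kron_def by (simp add: sum.cartesian_product' sum_distrib_left mult.assoc)

lemma zero_boundaryD:
  assumes "zero_boundary M1 M2 w"
  shows "j \<le> M2 \<Longrightarrow> w 0 j = 0" "j \<le> M2 \<Longrightarrow> w M1 j = 0" "i \<le> M1 \<Longrightarrow> w i 0 = 0" "i \<le> M1 \<Longrightarrow> w i M2 = 0"
  using assms by (auto simp: zero_boundary_def)

text \<open>The outer operator reaches boundary nodes, so the result of the inner operator must
  vanish there too; it does, because along a side all values of w are 0. The fractional differences
  carry a minus sign each, which cancels in the mixed term.\<close>

lemma grid_operators_kron:
  assumes w: "zero_boundary M1 M2 w" and ij: "i \<in> {1..<M1}" "j \<in> {1..<M2}"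
  defines "I \<equiv> {1..<M1} \<times> {1..<M2}"
  shows "compact_x \<alpha> M1 (compact_y \<beta> M2 w) i j = mapply I (kron (compact_matrix \<alpha>) (compact_matrix \<beta>)) (case_prod w) (i, j)"
    and "delta_x \<kappa>1 \<alpha> hx M1 (delta_y \<kappa>2 \<beta> hy M2 w) i j
      = mapply I (kron (frac_matrix (\<kappa>1 / hx powr \<alpha>) \<alpha>) (frac_matrix (\<kappa>2 / hy powr \<beta>) \<beta>)) (case_prod w) (i, j)"
    and "compact_y \<beta> M2 (delta_x \<kappa>1 \<alpha> hx M1 w) i j
      = - mapply I (kron (frac_matrix (\<kappa>1 / hx powr \<alpha>) \<alpha>) (compact_matrix \<beta>)) (case_prod w) (i, j)"
    and "compact_x \<alpha> M1 (delta_y \<kappa>2 \<beta> hy M2 w) i j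
      = - mapply I (kron (compact_matrix \<alpha>) (frac_matrix (\<kappa>2 / hy powr \<beta>) \<beta>)) (case_prod w) (i, j)"
proof -
  note z = zero_boundaryD[OF w]
  have By0: "compact_y \<beta> M2 w 0 j = 0" "compact_y \<beta> M2 w M1 j = 0"
    using ij z by (auto simp: compact_y_def)
  show "compact_x \<alpha> M1 (compact_y \<beta> M2 w) i j = mapply I (kron (compact_matrix \<alpha>) (compact_matrix \<beta>)) (case_prod w) (i, j)"
    unfolding I_def mapply_kron compact_x_matrix[where w = "compact_y \<beta> M2 w", OF ij(1) By0]
    using ij z by (intro sum.cong refl) (simp add: compact_y_matrix)
  have dy0: "delta_y \<kappa>2 \<beta> hy M2 w 0 j = 0" "delta_y \<kappa>2 \<beta> hy M2 w M1 j = 0"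
    using ij z by (auto simp: delta_y_def intro!: sum.neutral)
  have im: "i \<le> M1" using ij by simp
  show "delta_x \<kappa>1 \<alpha> hx M1 (delta_y \<kappa>2 \<beta> hy M2 w) i j
      = mapply I (kron (frac_matrix (\<kappa>1 / hx powr \<alpha>) \<alpha>) (frac_matrix (\<kappa>2 / hy powr \<beta>) \<beta>)) (case_prod w) (i, j)"
    unfolding I_def mapply_kron delta_x_matrix[where w = "delta_y \<kappa>2 \<beta> hy M2 w", OF im dy0] sum_negf[symmetric]
    using ij z by (intro sum.cong refl) (simp add: delta_y_matrix)
  show "compact_x \<alpha> M1 (delta_y \<kappa>2 \<beta> hy M2 w) i j
      = - mapply I (kron (compact_matrix \<alpha>) (frac_matrix (\<kappa>2 / hy powr \<beta>) \<beta>)) (case_prod w) (i, j)"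
    unfolding I_def mapply_kron compact_x_matrix[where w = "delta_y \<kappa>2 \<beta> hy M2 w", OF ij(1) dy0] sum_negf[symmetric]
    using ij z by (intro sum.cong refl) (simp add: delta_y_matrix)
  have dx0: "delta_x \<kappa>1 \<alpha> hx M1 w i 0 = 0" "delta_x \<kappa>1 \<alpha> hx M1 w i M2 = 0"
    using ij z by (auto simp: delta_x_def intro!: sum.neutral)
  have "compact_y \<beta> M2 (delta_x \<kappa>1 \<alpha> hx M1 w) i j = (\<Sum>l\<in>{1..<M2}. compact_matrix \<beta> j l * - (\<Sum>k\<in>{1..<M1}. frac_matrix (\<kappa>1 / hx powr \<alpha>) \<alpha> i k * w k l))"
    unfolding compact_y_matrix[where w = "delta_x \<kappa>1 \<alpha> hx M1 w", OF ij(2) dx0]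
    using ij z by (intro sum.cong refl) (simp add: delta_x_matrix)
  also have "\<dots> = - (\<Sum>l\<in>{1..<M2}. \<Sum>k\<in>{1..<M1}. frac_matrix (\<kappa>1 / hx powr \<alpha>) \<alpha> i k * (compact_matrix \<beta> j l * w k l))"
    by (simp add: sum_distrib_left sum_negf mult_ac)
  also have "(\<Sum>l\<in>{1..<M2}. \<Sum>k\<in>{1..<M1}. frac_matrix (\<kappa>1 / hx powr \<alpha>) \<alpha> i k * (compact_matrix \<beta> j l * w k l))
      = mapply I (kron (frac_matrix (\<kappa>1 / hx powr \<alpha>) \<alpha>) (compact_matrix \<beta>)) (case_prod w) (i, j)"
    unfolding I_def mapply_kron by (subst sum.swap) (simp add: sum_distrib_left)
  finally show "compact_y \<beta> M2 (delta_x \<kappa>1 \<alpha> hx M1 w) i j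
      = - mapply I (kron (frac_matrix (\<kappa>1 / hx powr \<alpha>) \<alpha>) (compact_matrix \<beta>)) (case_prod w) (i, j)" .
qed

lemma compact_x_diff: "compact_x \<gamma> M (\<lambda>i j. f i j - g i j) = (\<lambda>i j. compact_x \<gamma> M f i j - compact_x \<gamma> M g i j)"
  by (intro ext) (simp add: compact_x_def algebra_simps)

lemma compact_y_diff: "compact_y \<gamma> M (\<lambda>i j. f i j - g i j) = (\<lambda>i j. compact_y \<gamma> M f i j - compact_y \<gamma> M g i j)"
  by (intro ext) (simp add: compact_y_def algebra_simps)

lemma delta_x_diff: "delta_x \<kappa> \<gamma> h M (\<lambda>i j. f i j - g i j) = (\<lambda>i j. delta_x \<kappa> \<gamma> h M f i j - delta_x \<kappa> \<gamma> h M g i j)"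
  by (intro ext) (simp add: delta_x_def sum_subtractf right_diff_distrib)

lemma delta_y_diff: "delta_y \<kappa> \<gamma> h M (\<lambda>i j. f i j - g i j) = (\<lambda>i j. delta_y \<kappa> \<gamma> h M f i j - delta_y \<kappa> \<gamma> h M g i j)"
  by (intro ext) (simp add: delta_y_def sum_subtractf right_diff_distrib)

lemmas grid_operators_diff = compact_x_diff compact_y_diff delta_x_diff delta_y_diff

text \<open>Writing x for the Kronecker product, I x I - A x B = (I - A) x I + A x (I - B), and
  similarly A x B - ab (I x I) = (A - aI) x B + a I x (B - bI). Every summand is semidefinite. As c2
  \<le> 1/12, both lower bounds 1 - 4 c2 are at least 2/3, whence 9/4.\<close>

lemma compact_kron_bounds:
  assumes "finite I" "finite J" "0 \<le> \<alpha>" "\<alpha> < 2" "0 \<le> \<beta>" "\<beta> < 2"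
  defines "P \<equiv> kron (compact_matrix \<alpha>) (compact_matrix \<beta>)"
  shows "psd (I \<times> J) P" "bform (I \<times> J) P v v \<le> (\<Sum>x\<in>I \<times> J. (v x)\<^sup>2)"
    "(\<Sum>x\<in>I \<times> J. (v x)\<^sup>2) \<le> 9/4 * bform (I \<times> J) P v v"
proof -
  note gx = gram_compact_matrix[OF assms(1,3,4)] and gy = gram_compact_matrix[OF assms(2,5,6)]
  note py = gy[THEN gram_imp_psd]
  show "psd (I \<times> J) P" unfolding P_def by (rule psd_kron[OF gx(1) py(1)])
  have gid: "gram A idm" if "finite A" for A :: "nat set"
    by (rule gram_diagonally_dominant) (use that in \<open>auto simp: idm_def\<close>)
  have id: "bform (I \<times> J) (kron idm idm) v v = (\<Sum>x\<in>I \<times> J. (v x)\<^sup>2)"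
  proof -
    have "bform (I \<times> J) (kron idm idm) v v = bform (I \<times> J) idm v v"
      by (rule bform_cong) (auto simp: kron_def idm_def split: if_splits)
    thus ?thesis using assms by (simp add: bform_idm power2_eq_square)
  qed
  have "0 \<le> bform (I \<times> J) (kron (\<lambda>i k. idm i k - compact_matrix \<alpha> i k) idm) v v"
    "0 \<le> bform (I \<times> J) (kron (compact_matrix \<alpha>) (\<lambda>i k. idm i k - compact_matrix \<beta> i k)) v v"
    using psd_kron[OF gx(2) gram_imp_psd[OF gid[OF assms(2)]]] psd_kron[OF gx(1) py(2)] by (auto simp: psd_nonneg)
  moreover have "bform (I \<times> J) (kron idm idm) v v = 1 * bform (I \<times> J) P v v + 1 * bform (I \<times> J)
      (\<lambda>i k. 1 * kron (\<lambda>i k. idm i k - compact_matrix \<alpha> i k) idm i k + 1 * kron (compact_matrix \<alpha>) (\<lambda>i k. idm i k - compact_matrix \<beta> i k) i k) v v"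
    unfolding bform_matrix_lin[symmetric] by (rule bform_cong) (auto simp: kron_def P_def algebra_simps)
  ultimately show "bform (I \<times> J) P v v \<le> (\<Sum>x\<in>I \<times> J. (v x)\<^sup>2)"
    unfolding id bform_matrix_lin by simp
  let ?a = "1 - 4 * c2 \<alpha>" and ?b = "1 - 4 * c2 \<beta>"
  have ab: "2/3 \<le> ?a" "2/3 \<le> ?b" using assms by (auto simp: c2_def)
  have "0 \<le> bform (I \<times> J) (kron (\<lambda>i k. compact_matrix \<alpha> i k - ?a * idm i k) (compact_matrix \<beta>)) v v"
    "0 \<le> bform (I \<times> J) (kron idm (\<lambda>i k. compact_matrix \<beta> i k - ?b * idm i k)) v v"
    using psd_kron[OF gx(3) py(1)] psd_kron[OF gid[OF assms(1)] py(3)] by (auto simp: psd_nonneg)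
  moreover have "bform (I \<times> J) P v v = (?a * ?b) * bform (I \<times> J) (kron idm idm) v v + 1 * bform (I \<times> J)
      (\<lambda>i k. 1 * kron (\<lambda>i k. compact_matrix \<alpha> i k - ?a * idm i k) (compact_matrix \<beta>) i k + ?a * kron idm (\<lambda>i k. compact_matrix \<beta> i k - ?b * idm i k) i k) v v"
    unfolding bform_matrix_lin[symmetric] by (rule bform_cong) (auto simp: kron_def P_def algebra_simps)
  ultimately have "(?a * ?b) * (\<Sum>x\<in>I \<times> J. (v x)\<^sup>2) \<le> bform (I \<times> J) P v v"
    unfolding id bform_matrix_lin using ab by simp
  moreover have "(2/3) * (2/3) \<le> ?a * ?b" using ab by (intro mult_mono) auto
  hence "(2/3) * (2/3) * (\<Sum>x\<in>I \<times> J. (v x)\<^sup>2) \<le> (?a * ?b) * (\<Sum>x\<in>I \<times> J. (v x)\<^sup>2)"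
    by (intro mult_right_mono sum_nonneg) auto
  ultimately show "(\<Sum>x\<in>I \<times> J. (v x)\<^sup>2) \<le> 9/4 * bform (I \<times> J) P v v" by linarith
qed


lemma L2_set_const: "L2_set (\<lambda>_. e) A = sqrt (real (card A)) * \<bar>e\<bar>"
  by (simp add: L2_set_def real_sqrt_mult)

lemma sum_mult_le_L2_set: "(\<Sum>x\<in>A. f x * g x) \<le> L2_set f A * L2_set g A"
proof -
  have "(\<Sum>x\<in>A. f x * g x) \<le> (\<Sum>x\<in>A. \<bar>f x\<bar> * \<bar>g x\<bar>)"
    by (intro sum_mono) (simp flip: abs_mult)
  also have "\<dots> \<le> L2_set f A * L2_set g A" by (rule L2_set_mult_ineq)
  finally show ?thesis .
qed

lemma L2_set_mono_abs: "(\<And>x. x \<in> A \<Longrightarrow> \<bar>f x\<bar> \<le> g x) \<Longrightarrow> L2_set f A \<le> L2_set g A"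
  unfolding L2_set_def
  by (intro real_sqrt_le_mono sum_mono) (metis abs_ge_zero order_trans power2_abs power_mono)

section \<open>The discrete error equation\<close>

text \<open>The error \<eta> satisfies P D + \<tau>^2 \<sigma>^2 Q D + S \<eta> = P q + \<rho>,
  where q is the error of the source and \<rho> the residual of W in the scheme; tested with \<eta>
  it has the form of \<open>bdf2_stability\<close>. Exchanging the Euclidean norm for that of P
  costs 3/2, which turns L into 3/2 L inside and 4 into 6 outside.\<close>

lemma scheme_error_bound:
  fixes W U :: "nat \<Rightarrow> nat \<Rightarrow> nat \<Rightarrow> real" and G :: "nat \<Rightarrow> nat \<Rightarrow> nat \<Rightarrow> real \<Rightarrow> real"
  assumes par: "1 < \<alpha>" "\<alpha> < 2" "1 < \<beta>" "\<beta> < 2" "0 \<le> \<kappa>1" "0 \<le> \<kappa>2" and \<tau>: "\<tau> > 0" and L: "L \<ge> 0"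
    and r: "r1 \<ge> 0" "r2 \<ge> 0" and e: "e1 \<ge> 0" "e2 \<ge> 0"
    and bdry: "\<And>n. n \<le> N \<Longrightarrow> zero_boundary M1 M2 (W n)" "\<And>n. n \<le> N \<Longrightarrow> zero_boundary M1 M2 (U n)"
    and init: "\<And>i j. i \<le> M1 \<Longrightarrow> j \<le> M2 \<Longrightarrow> U 0 i j = W 0 i j"
    and lip: "\<And>n i j w w'. 1 \<le> n \<Longrightarrow> n \<le> N \<Longrightarrow> i \<le> M1 \<Longrightarrow> j \<le> M2 \<Longrightarrow> \<bar>G n i j w - G n i j w'\<bar> \<le> L * \<bar>w - w'\<bar>"
    and scheme: "\<And>n i j. 1 \<le> n \<Longrightarrow> n \<le> N \<Longrightarrow> i \<in> {1..<M1} \<Longrightarrow> j \<in> {1..<M2} \<Longrightarrow>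
      compact_x \<alpha> M1 (compact_y \<beta> M2 (bdf2 \<tau> U n)) i j
        + \<tau>\<^sup>2 * (sigma n)\<^sup>2 * delta_x \<kappa>1 \<alpha> hx M1 (delta_y \<kappa>2 \<beta> hy M2 (bdf2 \<tau> U n)) i j
      = compact_y \<beta> M2 (delta_x \<kappa>1 \<alpha> hx M1 (U n)) i j + compact_x \<alpha> M1 (delta_y \<kappa>2 \<beta> hy M2 (U n)) i j
        + compact_x \<alpha> M1 (compact_y \<beta> M2 (\<lambda>i j. G n i j (if n = 1 then U 0 i j else 2 * U (n - 1) i j - U (n - 2) i j))) i j"
    and resid: "\<And>n i j. 1 \<le> n \<Longrightarrow> n \<le> N \<Longrightarrow> i \<in> {1..<M1} \<Longrightarrow> j \<in> {1..<M2} \<Longrightarrow>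
      \<bar>compact_x \<alpha> M1 (compact_y \<beta> M2 (bdf2 \<tau> W n)) i j
        + \<tau>\<^sup>2 * (sigma n)\<^sup>2 * delta_x \<kappa>1 \<alpha> hx M1 (delta_y \<kappa>2 \<beta> hy M2 (bdf2 \<tau> W n)) i j
      - (compact_y \<beta> M2 (delta_x \<kappa>1 \<alpha> hx M1 (W n)) i j + compact_x \<alpha> M1 (delta_y \<kappa>2 \<beta> hy M2 (W n)) i j
        + compact_x \<alpha> M1 (compact_y \<beta> M2 (\<lambda>i j. G n i j (W n i j))) i j)\<bar> \<le> (if n = 1 then r1 else r2)"
    and diff1: "\<And>i j. 1 \<le> N \<Longrightarrow> i \<in> {1..<M1} \<Longrightarrow> j \<in> {1..<M2} \<Longrightarrow> \<bar>W 1 i j - W 0 i j\<bar> \<le> e1"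
    and diff2: "\<And>n i j. 2 \<le> n \<Longrightarrow> n \<le> N \<Longrightarrow> i \<in> {1..<M1} \<Longrightarrow> j \<in> {1..<M2} \<Longrightarrow> \<bar>W n i j - 2 * W (n - 1) i j + W (n - 2) i j\<bar> \<le> e2"
    and n: "1 \<le> n" "n \<le> N" and NT: "real N * \<tau> \<le> T"
  shows "sqrt (\<Sum>i\<in>{1..<M1}. \<Sum>j\<in>{1..<M2}. (W n i j - U n i j)\<^sup>2)
    \<le> 6 * exp (6 * L * T) * sqrt (real (card ({1..<M1} \<times> {1..<M2}))) * (\<tau> * (L * e1 + 3/2 * r1) + T * (L * e2 + 3/2 * r2))"
proof -
  define I where "I = {1..<M1} \<times> {1..<M2}"
  have fin: "finite I" by (simp add: I_def)
  define P where "P = kron (compact_matrix \<alpha>) (compact_matrix \<beta>)"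
  define Q where "Q = kron (frac_matrix (\<kappa>1 / hx powr \<alpha>) \<alpha>) (frac_matrix (\<kappa>2 / hy powr \<beta>) \<beta>)"
  define S1 where "S1 = kron (frac_matrix (\<kappa>1 / hx powr \<alpha>) \<alpha>) (compact_matrix \<beta>)"
  define S2 where "S2 = kron (compact_matrix \<alpha>) (frac_matrix (\<kappa>2 / hy powr \<beta>) \<beta>)"
  define S where "S = (\<lambda>x y. 1 * S1 x y + 1 * S2 x y)"
  define ew where "ew n = (\<lambda>i j. W n i j - U n i j)" for n
  define \<eta> where "\<eta> n = case_prod (ew n)" for n
  define D where "D n = (\<lambda>i j. bdf2 \<tau> W n i j - bdf2 \<tau> U n i j)" for n
  define lin where "lin n = (\<lambda>i j. if n = 1 then U 0 i j else 2 * U (n - 1) i j - U (n - 2) i j)" for n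
  \<comment> \<open>The source at the exact value is compared with the source at the extrapolated
    numerical value. Thus the extrapolation error of W is charged to \<open>e1\<close> and
    \<open>e2\<close>, not to the residual.\<close>
  define q where "q n = (\<lambda>i j. G n i j (W n i j) - G n i j (lin n i j))" for n
  define \<rho> where "\<rho> n = (\<lambda>i j. compact_x \<alpha> M1 (compact_y \<beta> M2 (bdf2 \<tau> W n)) i j
        + \<tau>\<^sup>2 * (sigma n)\<^sup>2 * delta_x \<kappa>1 \<alpha> hx M1 (delta_y \<kappa>2 \<beta> hy M2 (bdf2 \<tau> W n)) i j
      - (compact_y \<beta> M2 (delta_x \<kappa>1 \<alpha> hx M1 (W n)) i j + compact_x \<alpha> M1 (delta_y \<kappa>2 \<beta> hy M2 (W n)) i j
        + compact_x \<alpha> M1 (compact_y \<beta> M2 (\<lambda>i j. G n i j (W n i j))) i j))" for n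
  define c where "c = sqrt (real (card I))"
  define p where "p x = sqrt (bform I P x x)" for x
  have c0: "c \<ge> 0" by (simp add: c_def)
  note Pb = compact_kron_bounds[of "{1..<M1}" "{1..<M2}" \<alpha> \<beta>, folded P_def I_def]
  have psdP: "psd I P" using Pb(1) par by simp
  have gx: "gram {1..<M1} (frac_matrix (\<kappa>1 / hx powr \<alpha>) \<alpha>)" and gy: "gram {1..<M2} (frac_matrix (\<kappa>2 / hy powr \<beta>) \<beta>)"
    using par by (auto intro!: gram_frac_matrix)
  have cx: "gram {1..<M1} (compact_matrix \<alpha>)" and cy: "gram {1..<M2} (compact_matrix \<beta>)"
    using par by (auto intro!: gram_compact_matrix)
  have psdQ: "psd I Q" unfolding I_def Q_def by (rule psd_kron[OF gx gram_imp_psd[OF gy]])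
  have S0: "0 \<le> bform I S v v" for v
    unfolding S_def bform_matrix_lin I_def S1_def S2_def
    using psd_nonneg[OF psd_kron[OF gx gram_imp_psd[OF cy]], of v] psd_nonneg[OF psd_kron[OF cx gram_imp_psd[OF gy]], of v]
    by simp
  have pnorm: "L2_set v I \<le> 3/2 * p v" and ple: "p v \<le> L2_set v I" for v
  proof -
    have "p v \<le> L2_set v I" unfolding p_def L2_set_def using Pb(2)[of v] par by (intro real_sqrt_le_mono) auto
    thus "p v \<le> L2_set v I" .
    have "L2_set v I \<le> sqrt (9/4 * bform I P v v)" unfolding L2_set_def using Pb(3)[of v] par by (intro real_sqrt_le_mono) auto
    also have "\<dots> = 3/2 * p v" unfolding p_def by (simp add: real_sqrt_mult real_sqrt_divide)
    finally show "L2_set v I \<le> 3/2 * p v" .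
  qed
  have zew: "zero_boundary M1 M2 (ew n)" if "n \<le> N" for n
    using bdry[OF that] by (auto simp: zero_boundary_def ew_def)
  have zD: "zero_boundary M1 M2 (D n)" if "1 \<le> n" "n \<le> N" for n
  proof -
    have le: "n - 1 \<le> N" "n - 2 \<le> N" "1 \<le> N" using that by auto
    show ?thesis
      unfolding zero_boundary_def
    proof (intro allI impI)
      fix i j assume ij: "i \<le> M1" "j \<le> M2" "i = 0 \<or> i = M1 \<or> j = 0 \<or> j = M2"
      have "W k i j = 0" "U k i j = 0" if "k \<le> N" for k
        using bdry[OF that] ij unfolding zero_boundary_def by blast+
      thus "D n i j = 0" using le that(2) by (simp add: D_def bdf2_def)
    qed
  qed
  have qb: "\<bar>q n i j\<bar> \<le> L * \<bar>W n i j - lin n i j\<bar>" if "1 \<le> n" "n \<le> N" "i \<le> M1" "j \<le> M2" for n i j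
    unfolding q_def using lip[OF that] .
  \<comment> \<open>The source itself need not vanish on the boundary, but the difference does: W
    and the extrapolated U are both 0 there. This admits the matrix form of the averages.\<close>
  have zq: "zero_boundary M1 M2 (q n)" if "1 \<le> n" "n \<le> N" for n
    unfolding zero_boundary_def
  proof (intro allI impI)
    fix i j assume ij: "i \<le> M1" "j \<le> M2" "i = 0 \<or> i = M1 \<or> j = 0 \<or> j = M2"
    have "n - 1 \<le> N" "n - 2 \<le> N" using that by auto
    have W0: "W k i j = 0" and U0: "U k i j = 0" if "k \<le> N" for k
      using bdry[OF that] ij unfolding zero_boundary_def by blast+
    have "W n i j = 0" by (rule W0[OF that(2)])
    moreover have "lin n i j = 0"
      unfolding lin_def using U0[of 0] U0[OF \<open>n - 1 \<le> N\<close>] U0[OF \<open>n - 2 \<le> N\<close>] by simp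
    ultimately have "W n i j = 0" "lin n i j = 0" by simp_all
    thus "q n i j = 0" using qb[OF that ij(1,2)] by simp
  qed
  have pointwise: "mapply I P (case_prod (D n)) (i, j) + \<tau>\<^sup>2 * (sigma n)\<^sup>2 * mapply I Q (case_prod (D n)) (i, j)
      + (mapply I S1 (\<eta> n) (i, j) + mapply I S2 (\<eta> n) (i, j)) = mapply I P (case_prod (q n)) (i, j) + \<rho> n i j"
    if nn: "1 \<le> n" "n \<le> N" and ij: "i \<in> {1..<M1}" "j \<in> {1..<M2}" for n i j
  proof -
    note k = grid_operators_kron[OF _ ij, folded I_def]
    have PD: "mapply I P (case_prod (D n)) (i, j) = compact_x \<alpha> M1 (compact_y \<beta> M2 (bdf2 \<tau> W n)) i j - compact_x \<alpha> M1 (compact_y \<beta> M2 (bdf2 \<tau> U n)) i j"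
      unfolding P_def k(1)[OF zD[OF nn], symmetric] by (simp only: D_def grid_operators_diff)
    have QD: "mapply I Q (case_prod (D n)) (i, j) = delta_x \<kappa>1 \<alpha> hx M1 (delta_y \<kappa>2 \<beta> hy M2 (bdf2 \<tau> W n)) i j - delta_x \<kappa>1 \<alpha> hx M1 (delta_y \<kappa>2 \<beta> hy M2 (bdf2 \<tau> U n)) i j"
      unfolding Q_def k(2)[OF zD[OF nn], symmetric] by (simp only: D_def grid_operators_diff)
    have S1: "mapply I S1 (\<eta> n) (i, j) = compact_y \<beta> M2 (delta_x \<kappa>1 \<alpha> hx M1 (U n)) i j - compact_y \<beta> M2 (delta_x \<kappa>1 \<alpha> hx M1 (W n)) i j"
    proof -
      have "- mapply I S1 (\<eta> n) (i, j) = compact_y \<beta> M2 (delta_x \<kappa>1 \<alpha> hx M1 (ew n)) i j"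
        unfolding S1_def \<eta>_def k(3)[OF zew[OF nn(2)]] ..
      also have "\<dots> = compact_y \<beta> M2 (delta_x \<kappa>1 \<alpha> hx M1 (W n)) i j - compact_y \<beta> M2 (delta_x \<kappa>1 \<alpha> hx M1 (U n)) i j"
        by (simp only: ew_def grid_operators_diff)
      finally show ?thesis by simp
    qed
    have S2: "mapply I S2 (\<eta> n) (i, j) = compact_x \<alpha> M1 (delta_y \<kappa>2 \<beta> hy M2 (U n)) i j - compact_x \<alpha> M1 (delta_y \<kappa>2 \<beta> hy M2 (W n)) i j"
    proof -
      have "- mapply I S2 (\<eta> n) (i, j) = compact_x \<alpha> M1 (delta_y \<kappa>2 \<beta> hy M2 (ew n)) i j"
        unfolding S2_def \<eta>_def k(4)[OF zew[OF nn(2)]] ..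
      also have "\<dots> = compact_x \<alpha> M1 (delta_y \<kappa>2 \<beta> hy M2 (W n)) i j - compact_x \<alpha> M1 (delta_y \<kappa>2 \<beta> hy M2 (U n)) i j"
        by (simp only: ew_def grid_operators_diff)
      finally show ?thesis by simp
    qed
    have Pq: "mapply I P (case_prod (q n)) (i, j) = compact_x \<alpha> M1 (compact_y \<beta> M2 (\<lambda>i j. G n i j (W n i j))) i j - compact_x \<alpha> M1 (compact_y \<beta> M2 (\<lambda>i j. G n i j (lin n i j))) i j"
      unfolding P_def k(1)[OF zq[OF nn], symmetric] by (simp only: q_def grid_operators_diff)
    show ?thesis
      unfolding PD QD S1 S2 Pq \<rho>_def lin_def using scheme[OF nn ij] by (simp add: algebra_simps)
  qed
  have weak: "bform I P (case_prod (D n)) (\<eta> n) + \<tau>\<^sup>2 * (sigma n)\<^sup>2 * bform I Q (case_prod (D n)) (\<eta> n) + bform I S (\<eta> n) (\<eta> n)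
      = bform I P (case_prod (q n)) (\<eta> n) + (\<Sum>x\<in>I. case_prod (\<rho> n) x * \<eta> n x)"
    if nn: "1 \<le> n" "n \<le> N" for n
  proof -
    have "bform I P (case_prod (D n)) (\<eta> n) + \<tau>\<^sup>2 * (sigma n)\<^sup>2 * bform I Q (case_prod (D n)) (\<eta> n) + bform I S (\<eta> n) (\<eta> n)
      = (\<Sum>x\<in>I. (mapply I P (case_prod (D n)) x + \<tau>\<^sup>2 * (sigma n)\<^sup>2 * mapply I Q (case_prod (D n)) x
      + (mapply I S1 (\<eta> n) x + mapply I S2 (\<eta> n) x)) * \<eta> n x)"
      unfolding S_def bform_matrix_lin bform_mapply by (simp add: distrib_right sum.distrib sum_distrib_left mult.assoc)
    also have "\<dots> = (\<Sum>x\<in>I. (mapply I P (case_prod (q n)) x + case_prod (\<rho> n) x) * \<eta> n x)"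
      using pointwise[OF nn] by (intro sum.cong refl arg_cong2[where f = "(*)"]) (auto simp: I_def)
    finally show ?thesis unfolding bform_mapply by (simp add: distrib_right sum.distrib)
  qed
  \<comment> \<open>q is already under the form P, so Cauchy-Schwarz for P suffices; \<rho> is
    paired with \<eta> in the Euclidean product, hence the factor 3/2.\<close>
  have rhs: "bform I P (case_prod (q n)) (\<eta> n) + (\<Sum>x\<in>I. case_prod (\<rho> n) x * \<eta> n x) \<le> (L2_set (case_prod (q n)) I + 3/2 * (c * (if n = 1 then r1 else r2))) * p (\<eta> n)"
    if nn: "1 \<le> n" "n \<le> N" for n
  proof -
    have p0: "0 \<le> p (\<eta> n)" unfolding p_def using psdP by (simp add: psd_nonneg)
    have "bform I P (case_prod (q n)) (\<eta> n) \<le> p (case_prod (q n)) * p (\<eta> n)"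
      unfolding p_def by (rule bform_Cauchy_Schwarz[OF psdP])
    also have "\<dots> \<le> L2_set (case_prod (q n)) I * p (\<eta> n)" using p0 ple by (intro mult_right_mono)
    finally have 1: "bform I P (case_prod (q n)) (\<eta> n) \<le> L2_set (case_prod (q n)) I * p (\<eta> n)" .
    have "L2_set (case_prod (\<rho> n)) I \<le> L2_set (\<lambda>_. if n = 1 then r1 else r2) I"
      using resid[OF nn] by (intro L2_set_mono_abs) (auto simp: I_def \<rho>_def)
    also have "\<dots> = c * (if n = 1 then r1 else r2)" using r by (simp add: L2_set_const c_def)
    finally have "L2_set (case_prod (\<rho> n)) I * L2_set (\<eta> n) I \<le> (c * (if n = 1 then r1 else r2)) * (3/2 * p (\<eta> n))"
      using c0 r by (intro mult_mono pnorm) auto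
    hence 2: "(\<Sum>x\<in>I. case_prod (\<rho> n) x * \<eta> n x) \<le> (c * (if n = 1 then r1 else r2)) * (3/2 * p (\<eta> n))"
      using sum_mult_le_L2_set[of "case_prod (\<rho> n)" "\<eta> n" I] by linarith
    from add_mono[OF 1 2] show ?thesis by (simp add: algebra_simps)
  qed
  have "p (\<eta> n) \<le> 4 * exp (4 * (3/2 * L) * T) * (\<tau> * (c * (L * e1 + 3/2 * r1)) + T * (c * (L * e2 + 3/2 * r2)))"
    unfolding p_def
  proof (rule bdf2_stability[OF psdP psdQ S0 \<tau>, where \<eta> = \<eta> and N = N])
    show "\<eta> 0 x = 0" if "x \<in> I" for x using that init by (auto simp: \<eta>_def ew_def I_def)
    have N1: "1 \<le> N" using n by simp
    have D1: "bform I X (\<lambda>x. (\<eta> 1 x - \<eta> 0 x) / \<tau>) (\<eta> 1) = bform I X (case_prod (D 1)) (\<eta> 1)" for X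
      by (rule bform_cong) (auto simp: \<eta>_def ew_def D_def bdf2_def diff_divide_distrib)
    have "L2_set (case_prod (q 1)) I \<le> L2_set (\<lambda>_. L * e1) I"
    proof (rule L2_set_mono_abs)
      fix x assume "x \<in> I"
      then obtain i j where x: "x = (i, j)" and ij: "i \<in> {1..<M1}" "j \<in> {1..<M2}" by (auto simp: I_def)
      have "\<bar>q 1 i j\<bar> \<le> L * \<bar>W 1 i j - lin 1 i j\<bar>" using ij N1 by (intro qb) auto
      also have "\<dots> \<le> L * e1" using diff1[OF N1 ij] init[of i j] ij L by (intro mult_left_mono) (auto simp: lin_def)
      finally show "\<bar>case_prod (q 1) x\<bar> \<le> L * e1" by (simp add: x)
    qed
    also have "\<dots> = c * (L * e1)" using L e by (simp add: L2_set_const c_def)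
    finally have q1: "L2_set (case_prod (q 1)) I \<le> c * (L * e1)" .
    have "(L2_set (case_prod (q 1)) I + 3/2 * (c * r1)) * p (\<eta> 1) \<le> (c * (L * e1 + 3/2 * r1)) * p (\<eta> 1)"
      using q1 psdP by (intro mult_right_mono) (auto simp: algebra_simps p_def psd_nonneg)
    with rhs[of 1] weak[of 1] N1
    show "bform I P (\<lambda>i. (\<eta> 1 i - \<eta> 0 i) / \<tau>) (\<eta> 1) + \<tau>\<^sup>2 * bform I Q (\<lambda>i. (\<eta> 1 i - \<eta> 0 i) / \<tau>) (\<eta> 1)
        + bform I S (\<eta> 1) (\<eta> 1) \<le> c * (L * e1 + 3/2 * r1) * sqrt (bform I P (\<eta> 1) (\<eta> 1))"
      unfolding D1 by (simp add: sigma_def p_def)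
  next
    fix n assume n: "2 \<le> n" "n \<le> N"
    let ?w = "\<lambda>x. 2 * \<eta> (n - 1) x - \<eta> (n - 2) x"
    have n1: "1 \<le> n" "n \<noteq> 1" using n by auto
    have Dn: "bform I X (\<lambda>x. (3 * \<eta> n x - 4 * \<eta> (n - 1) x + \<eta> (n - 2) x) / 2 / \<tau>) (\<eta> n) = bform I X (case_prod (D n)) (\<eta> n)" for X
    proof (rule bform_cong)
      fix x :: "nat \<times> nat"
      show "(3 * \<eta> n x - 4 * \<eta> (n - 1) x + \<eta> (n - 2) x) / 2 / \<tau> = case_prod (D n) x"
        using n1 \<tau> by (cases x) (simp add: \<eta>_def ew_def D_def bdf2_def field_simps)
    qed auto
    have "L2_set (case_prod (q n)) I \<le> L2_set (\<lambda>x. L * e2 + L * \<bar>?w x\<bar>) I"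
    proof (rule L2_set_mono_abs)
      fix x assume "x \<in> I"
      then obtain i j where x: "x = (i, j)" and ij: "i \<in> {1..<M1}" "j \<in> {1..<M2}" by (auto simp: I_def)
      have "\<bar>q n i j\<bar> \<le> L * \<bar>W n i j - lin n i j\<bar>" using ij n n1 by (intro qb) auto
      \<comment> \<open>Inserting the exact extrapolation separates a part that is small by
        smoothness from the extrapolated error of earlier levels.\<close>
      also have "W n i j - lin n i j = (W n i j - 2 * W (n - 1) i j + W (n - 2) i j) + ?w x"
        using n1 by (simp add: lin_def x \<eta>_def ew_def)
      also have "L * \<bar>(W n i j - 2 * W (n - 1) i j + W (n - 2) i j) + ?w x\<bar> \<le> L * (e2 + \<bar>?w x\<bar>)"
        using L diff2[OF n ij] by (intro mult_left_mono order_trans[OF abs_triangle_ineq]) auto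
      finally show "\<bar>case_prod (q n) x\<bar> \<le> L * e2 + L * \<bar>?w x\<bar>" by (simp add: x distrib_left)
    qed
    also have "\<dots> \<le> L2_set (\<lambda>_. L * e2) I + L2_set (\<lambda>x. L * \<bar>?w x\<bar>) I" by (rule L2_set_triangle_ineq)
    also have "L2_set (\<lambda>_. L * e2) I = c * (L * e2)" using L e by (simp add: L2_set_const c_def)
    also have "L2_set (\<lambda>x. L * \<bar>?w x\<bar>) I = L * L2_set ?w I"
      using L by (simp add: L2_set_def power_mult_distrib real_sqrt_mult flip: sum_distrib_left)
    also have "c * (L * e2) + L * L2_set ?w I \<le> c * (L * e2) + L * (3/2 * p ?w)"
      using L pnorm by (intro add_left_mono mult_left_mono)
    finally have qn: "L2_set (case_prod (q n)) I \<le> c * (L * e2) + L * (3/2 * p ?w)" .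
    have "(L2_set (case_prod (q n)) I + 3/2 * (c * r2)) * p (\<eta> n) \<le> (c * (L * e2 + 3/2 * r2) + 3/2 * L * p ?w) * p (\<eta> n)"
      using qn psdP by (intro mult_right_mono) (auto simp: algebra_simps p_def psd_nonneg)
    with rhs[of n] weak[of n] n n1
    show "bform I P (\<lambda>i. (3 * \<eta> n i - 4 * \<eta> (n - 1) i + \<eta> (n - 2) i) / 2 / \<tau>) (\<eta> n)
        + \<tau>\<^sup>2 * (2/3)\<^sup>2 * bform I Q (\<lambda>i. (3 * \<eta> n i - 4 * \<eta> (n - 1) i + \<eta> (n - 2) i) / 2 / \<tau>) (\<eta> n)
        + bform I S (\<eta> n) (\<eta> n)
        \<le> (c * (L * e2 + 3/2 * r2) + 3/2 * L * sqrt (bform I P ?w ?w)) * sqrt (bform I P (\<eta> n) (\<eta> n))"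
      unfolding Dn by (simp add: sigma_def p_def)
  qed (use L e r c0 n NT in auto)
  hence "3/2 * p (\<eta> n) \<le> 3/2 * (4 * exp (4 * (3/2 * L) * T) * (\<tau> * (c * (L * e1 + 3/2 * r1)) + T * (c * (L * e2 + 3/2 * r2))))"
    by (intro mult_left_mono) auto
  also have "\<dots> = 6 * exp (6 * L * T) * c * (\<tau> * (L * e1 + 3/2 * r1) + T * (L * e2 + 3/2 * r2))"
    by (simp add: algebra_simps)
  finally have "L2_set (\<eta> n) I \<le> 6 * exp (6 * L * T) * c * (\<tau> * (L * e1 + 3/2 * r1) + T * (L * e2 + 3/2 * r2))"
    using pnorm[of "\<eta> n"] by linarith
  moreover have "L2_set (\<eta> n) I = sqrt (\<Sum>i\<in>{1..<M1}. \<Sum>j\<in>{1..<M2}. (W n i j - U n i j)\<^sup>2)"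
    unfolding L2_set_def I_def by (simp add: sum.cartesian_product \<eta>_def ew_def split_def)
  ultimately show ?thesis unfolding c_def I_def by simp
qed

section \<open>Consistency\<close>

lemma has_derivative_of_zero_function:
  fixes f :: "real \<Rightarrow> real"
  assumes "p < q" "x \<in> {p..q}" "(f has_real_derivative l) (at x within {p..q})" "\<And>z. z \<in> {p..q} \<Longrightarrow> f z = 0"
  shows "l = 0"
proof -
  have "((\<lambda>_. 0) has_real_derivative l) (at x within {p..q})"
    by (rule has_field_derivative_transform_within[OF assms(3), of 1]) (use assms in auto)
  hence "((\<lambda>_. 0) has_vector_derivative l) (at x within {p..q})"
    by (simp add: has_real_derivative_iff_has_vector_derivative)
  moreover have "((\<lambda>_. 0::real) has_vector_derivative 0) (at x within {p..q})" by simp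
  moreover have "at x within {p..q} \<noteq> bot"
    using assms(1,2) by (auto simp: trivial_limit_within)
  ultimately show ?thesis using vector_derivative_unique_within by blast
qed

text \<open>The derivative is bounded only at points no farther from x than y is. A remainder whose
  derivative is bounded by a power of |y - x| thus gains one more power, which is how the Taylor
  estimates iterate.\<close>

lemma increment_bound:
  fixes f :: "real \<Rightarrow> real"
  assumes "\<And>z. z \<in> {p..q} \<Longrightarrow> (f has_real_derivative f' z) (at z within {p..q})"
    and "\<And>z. z \<in> {p..q} \<Longrightarrow> \<bar>z - x\<bar> \<le> \<bar>y - x\<bar> \<Longrightarrow> \<bar>f' z\<bar> \<le> M" and xy: "x \<in> {p..q}" "y \<in> {p..q}"
  shows "\<bar>f y - f x\<bar> \<le> M * \<bar>y - x\<bar>"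
proof -
  have sub: "z \<in> {p..q} \<and> \<bar>z - x\<bar> \<le> \<bar>y - x\<bar>" if "z \<in> closed_segment x y" for z
    using that xy by (auto simp: closed_segment_eq_real_ivl split: if_splits)
  have "norm (f y - f x) \<le> M * norm (y - x)"
  proof (rule field_differentiable_bound[OF convex_closed_segment[of x y]])
    fix z assume z: "z \<in> closed_segment x y"
    show "(f has_field_derivative f' z) (at z within closed_segment x y)"
      using sub[OF z] by (intro DERIV_subset[OF assms(1)]) (use sub in auto)
    show "norm (f' z) \<le> M" using assms(2)[of z] sub[OF z] by simp
  qed auto
  thus ?thesis by simp
qed

text \<open>One constant B serves all remainders; factorials are dropped because only the order
  matters.\<close>

lemma Taylor_bounds:
  fixes f :: "nat \<Rightarrow> real \<Rightarrow> real"
  assumes d: "\<And>k z. k < 3 \<Longrightarrow> z \<in> {p..q} \<Longrightarrow> (f k has_real_derivative f (Suc k) z) (at z within {p..q})"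
    and B: "\<And>k z. k \<le> 3 \<Longrightarrow> z \<in> {p..q} \<Longrightarrow> \<bar>f k z\<bar> \<le> B" and xy: "x \<in> {p..q}" "y \<in> {p..q}"
  shows "\<bar>f 0 y - f 0 x\<bar> \<le> B * \<bar>y - x\<bar>"
    and "\<bar>f 0 y - f 0 x - (y - x) * f 1 x\<bar> \<le> B * \<bar>y - x\<bar>\<^sup>2"
    and "\<bar>f 0 y - f 0 x - (y - x) * f 1 x - (y - x)\<^sup>2 / 2 * f 2 x\<bar> \<le> B * \<bar>y - x\<bar> ^ 3"
proof -
  have B0: "B \<ge> 0" using B[of 0 x] xy by (intro order_trans[OF abs_ge_zero]) auto
  have d0: "(f 0 has_real_derivative f 1 z) (at z within {p..q})" and d1: "(f 1 has_real_derivative f 2 z) (at z within {p..q})"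
    and d2: "(f 2 has_real_derivative f 3 z) (at z within {p..q})" if "z \<in> {p..q}" for z
    using d[of 0 z] d[of 1 z] d[of 2 z] that by (simp_all add: eval_nat_numeral)
  have 0: "\<bar>f k z - f k x\<bar> \<le> B * \<bar>z - x\<bar>" if "k < 3" "z \<in> {p..q}" for k z
    using that d[OF that(1)] B[of "Suc k"] xy by (intro increment_bound[where f' = "f (Suc k)"]) auto
  show "\<bar>f 0 y - f 0 x\<bar> \<le> B * \<bar>y - x\<bar>" using 0[of 0 y] xy by simp
  have lin: "((\<lambda>w. (w - z) * e) has_real_derivative e) (at w within S)" for z e w :: real and S
    by (auto intro!: derivative_eq_intros)
  have quad: "((\<lambda>w. (w - z)\<^sup>2 / 2 * e) has_real_derivative (w - z) * e) (at w within S)" for z e w :: real and S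
    by (auto intro!: derivative_eq_intros)
  have sq: "B * r * r = B * r\<^sup>2" "B * r\<^sup>2 * r = B * r ^ 3" for r by (simp_all add: power2_eq_square power3_eq_cube)
  have 1: "\<bar>f k z - f k x - (z - x) * f (Suc k) x\<bar> \<le> B * \<bar>z - x\<bar>\<^sup>2" if k: "k < 2" and z: "z \<in> {p..q}" for k z
  proof -
    have "\<bar>(f k z - z * f (Suc k) x) - (f k x - x * f (Suc k) x)\<bar> \<le> (B * \<bar>z - x\<bar>) * \<bar>z - x\<bar>"
    proof (rule increment_bound[where f' = "\<lambda>w. f (Suc k) w - f (Suc k) x" and f = "\<lambda>w. f k w - w * f (Suc k) x"])
      fix w assume w: "w \<in> {p..q}"
      show "((\<lambda>w. f k w - w * f (Suc k) x) has_real_derivative f (Suc k) w - f (Suc k) x) (at w within {p..q})"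
      proof (rule DERIV_diff)
        show "(f k has_real_derivative f (Suc k) w) (at w within {p..q})" using d[OF _ w, of k] k by simp
        show "((\<lambda>w. w * f (Suc k) x) has_real_derivative f (Suc k) x) (at w within {p..q})" using lin[of 0] by simp
      qed
      assume "\<bar>w - x\<bar> \<le> \<bar>z - x\<bar>"
      hence "B * \<bar>w - x\<bar> \<le> B * \<bar>z - x\<bar>" using B0 by (rule mult_left_mono)
      moreover have "\<bar>f (Suc k) w - f (Suc k) x\<bar> \<le> B * \<bar>w - x\<bar>" by (rule 0) (use k w in auto)
      ultimately show "\<bar>f (Suc k) w - f (Suc k) x\<bar> \<le> B * \<bar>z - x\<bar>" by linarith
    qed (use xy z in auto)
    thus ?thesis unfolding sq by (simp add: algebra_simps)
  qed
  show "\<bar>f 0 y - f 0 x - (y - x) * f 1 x\<bar> \<le> B * \<bar>y - x\<bar>\<^sup>2" using 1[of 0 y] xy by simp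
  \<comment> \<open>The derivative of this remainder of f 0 is the lower-order remainder of f 1,
    already bounded quadratically.\<close>
  let ?h = "\<lambda>w. f 0 w - (w - x) * f 1 x - (w - x)\<^sup>2 / 2 * f 2 x"
  have "\<bar>?h y - ?h x\<bar> \<le> (B * \<bar>y - x\<bar>\<^sup>2) * \<bar>y - x\<bar>"
  proof (rule increment_bound[where f' = "\<lambda>w. f 1 w - f 1 x - (w - x) * f 2 x" and f = ?h])
    fix w assume w: "w \<in> {p..q}"
    show "(?h has_real_derivative f 1 w - f 1 x - (w - x) * f 2 x) (at w within {p..q})"
    proof (intro DERIV_diff)
      show "(f 0 has_real_derivative f 1 w) (at w within {p..q})" by (rule d0[OF w])
      show "((\<lambda>w. (w - x) * f 1 x) has_real_derivative f 1 x) (at w within {p..q})" by (rule lin)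
      show "((\<lambda>w. (w - x)\<^sup>2 / 2 * f 2 x) has_real_derivative (w - x) * f 2 x) (at w within {p..q})" by (rule quad)
    qed
    assume "\<bar>w - x\<bar> \<le> \<bar>y - x\<bar>"
    hence "B * \<bar>w - x\<bar>\<^sup>2 \<le> B * \<bar>y - x\<bar>\<^sup>2" using B0 by (intro mult_left_mono power_mono) auto
    thus "\<bar>f 1 w - f 1 x - (w - x) * f 2 x\<bar> \<le> B * \<bar>y - x\<bar>\<^sup>2"
      using 1[of 1 w] w by (simp add: numeral_2_eq_2)
  qed (use xy in auto)
  thus "\<bar>f 0 y - f 0 x - (y - x) * f 1 x - (y - x)\<^sup>2 / 2 * f 2 x\<bar> \<le> B * \<bar>y - x\<bar> ^ 3"
    unfolding sq by (simp add: algebra_simps)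
qed

text \<open>The first step is backward Euler and of first order, the later ones of second order. The
  6 of the truncation error is (8 + 4)/2, from the cubes of the shifts 2 \<tau> and \<tau> with
  weights 1 and 4; that of the extrapolation error is 2 + 4.\<close>

lemma bdf2_truncation:
  fixes f :: "nat \<Rightarrow> real \<Rightarrow> real"
  assumes d: "\<And>k z. k < 3 \<Longrightarrow> z \<in> {0..T} \<Longrightarrow> (f k has_real_derivative f (Suc k) z) (at z within {0..T})"
    and B: "\<And>k z. k \<le> 3 \<Longrightarrow> z \<in> {0..T} \<Longrightarrow> \<bar>f k z\<bar> \<le> B" and \<tau>: "\<tau> > 0"
  shows "\<tau> \<le> T \<Longrightarrow> \<bar>(f 0 \<tau> - f 0 0) / \<tau> - f 1 \<tau>\<bar> \<le> B * \<tau>"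
    and "2 * \<tau> \<le> t \<Longrightarrow> t \<le> T \<Longrightarrow> \<bar>3/2 * ((f 0 t - f 0 (t - \<tau>)) / \<tau>) - 1/2 * ((f 0 (t - \<tau>) - f 0 (t - 2 * \<tau>)) / \<tau>) - f 1 t\<bar> \<le> 6 * B * \<tau>\<^sup>2"
    and "2 * \<tau> \<le> t \<Longrightarrow> t \<le> T \<Longrightarrow> \<bar>f 0 t - 2 * f 0 (t - \<tau>) + f 0 (t - 2 * \<tau>)\<bar> \<le> 6 * B * \<tau>\<^sup>2"
    and "\<tau> \<le> T \<Longrightarrow> \<bar>f 0 \<tau> - f 0 0\<bar> \<le> B * \<tau>"
proof -
  note Tb = Taylor_bounds[where f = f and p = 0 and q = T and B = B, OF d B]
  show "\<bar>f 0 \<tau> - f 0 0\<bar> \<le> B * \<tau>" if "\<tau> \<le> T" using Tb(1)[of 0 \<tau>] that \<tau> by simp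
  show "\<bar>(f 0 \<tau> - f 0 0) / \<tau> - f 1 \<tau>\<bar> \<le> B * \<tau>" if "\<tau> \<le> T"
  proof -
    have "\<bar>f 0 0 - f 0 \<tau> - (0 - \<tau>) * f 1 \<tau>\<bar> \<le> B * \<bar>0 - \<tau>\<bar>\<^sup>2" by (rule Tb(2)) (use that \<tau> in auto)
    hence "\<bar>f 0 0 - f 0 \<tau> - (0 - \<tau>) * f 1 \<tau>\<bar> / \<tau> \<le> B * \<tau>\<^sup>2 / \<tau>" using \<tau> by (intro divide_right_mono) auto
    also have "\<bar>f 0 0 - f 0 \<tau> - (0 - \<tau>) * f 1 \<tau>\<bar> / \<tau> = \<bar>(f 0 0 - f 0 \<tau> - (0 - \<tau>) * f 1 \<tau>) / \<tau>\<bar>" using \<tau> by simp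
    also have "(f 0 0 - f 0 \<tau> - (0 - \<tau>) * f 1 \<tau>) / \<tau> = - ((f 0 \<tau> - f 0 0) / \<tau> - f 1 \<tau>)" using \<tau> by (simp add: field_simps)
    finally show ?thesis using \<tau> by (simp add: power2_eq_square)
  qed
  assume t: "2 * \<tau> \<le> t" "t \<le> T"
  have "\<bar>f 0 (t - \<tau>) - f 0 t - (t - \<tau> - t) * f 1 t\<bar> \<le> B * \<bar>t - \<tau> - t\<bar>\<^sup>2"
    "\<bar>f 0 (t - 2 * \<tau>) - f 0 t - (t - 2 * \<tau> - t) * f 1 t\<bar> \<le> B * \<bar>t - 2 * \<tau> - t\<bar>\<^sup>2"
    by (rule Tb(2); use t \<tau> in auto)+
  hence s: "\<bar>f 0 (t - \<tau>) - f 0 t + \<tau> * f 1 t\<bar> \<le> B * \<tau>\<^sup>2" "\<bar>f 0 (t - 2 * \<tau>) - f 0 t + 2 * \<tau> * f 1 t\<bar> \<le> 4 * (B * \<tau>\<^sup>2)"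
    by (simp_all add: power_mult_distrib mult_ac)
  have lin: "\<bar>- 2 * r + s\<bar> \<le> 2 * e + 4 * e" if "\<bar>r\<bar> \<le> e" "\<bar>s\<bar> \<le> 4 * e" for r s e :: real using that by linarith
  have "\<bar>- 2 * (f 0 (t - \<tau>) - f 0 t + \<tau> * f 1 t) + (f 0 (t - 2 * \<tau>) - f 0 t + 2 * \<tau> * f 1 t)\<bar> \<le> 2 * (B * \<tau>\<^sup>2) + 4 * (B * \<tau>\<^sup>2)"
    by (rule lin[OF s])
  also have "- 2 * (f 0 (t - \<tau>) - f 0 t + \<tau> * f 1 t) + (f 0 (t - 2 * \<tau>) - f 0 t + 2 * \<tau> * f 1 t) = f 0 t - 2 * f 0 (t - \<tau>) + f 0 (t - 2 * \<tau>)"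
    by (simp add: algebra_simps)
  finally show "\<bar>f 0 t - 2 * f 0 (t - \<tau>) + f 0 (t - 2 * \<tau>)\<bar> \<le> 6 * B * \<tau>\<^sup>2" by simp
  have "\<bar>f 0 (t - \<tau>) - f 0 t - (t - \<tau> - t) * f 1 t - (t - \<tau> - t)\<^sup>2 / 2 * f 2 t\<bar> \<le> B * \<bar>t - \<tau> - t\<bar> ^ 3"
    "\<bar>f 0 (t - 2 * \<tau>) - f 0 t - (t - 2 * \<tau> - t) * f 1 t - (t - 2 * \<tau> - t)\<^sup>2 / 2 * f 2 t\<bar> \<le> B * \<bar>t - 2 * \<tau> - t\<bar> ^ 3"
    by (rule Tb(3); use t \<tau> in auto)+
  moreover define R1 where "R1 = f 0 (t - \<tau>) - f 0 t + \<tau> * f 1 t - \<tau>\<^sup>2 / 2 * f 2 t"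
  moreover define R2 where "R2 = f 0 (t - 2 * \<tau>) - f 0 t + 2 * \<tau> * f 1 t - 2 * \<tau>\<^sup>2 * f 2 t"
  ultimately have R: "\<bar>R1\<bar> \<le> B * \<tau> ^ 3" "\<bar>R2\<bar> \<le> 8 * (B * \<tau> ^ 3)"
    using \<tau> by (simp_all add: power_mult_distrib mult_ac)
  \<comment> \<open>In R2 - 4 R1 the second derivatives cancel and the first derivatives leave -2
    \<tau> f 1 t.\<close>
  have "3/2 * ((f 0 t - f 0 (t - \<tau>)) / \<tau>) - 1/2 * ((f 0 (t - \<tau>) - f 0 (t - 2 * \<tau>)) / \<tau>) - f 1 t = (R2 - 4 * R1) / (2 * \<tau>)"
    using \<tau> by (simp add: R1_def R2_def field_simps power2_eq_square)
  also have "\<bar>\<dots>\<bar> = \<bar>R2 - 4 * R1\<bar> / (2 * \<tau>)" using \<tau> by simp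
  also have "\<dots> \<le> (12 * (B * \<tau> ^ 3)) / (2 * \<tau>)" using R \<tau> by (intro divide_right_mono) auto
  also have "\<dots> = 6 * B * \<tau>\<^sup>2" using \<tau> by (simp add: power2_eq_square power3_eq_cube)
  finally show "\<bar>3/2 * ((f 0 t - f 0 (t - \<tau>)) / \<tau>) - 1/2 * ((f 0 (t - \<tau>) - f 0 (t - 2 * \<tau>)) / \<tau>) - f 1 t\<bar> \<le> 6 * B * \<tau>\<^sup>2" .
qed

section \<open>Potentials and fractional differences at grid nodes\<close>

text \<open>In convolution form both the point and the parameter sit in the clamped continuous
  factor, while the kernel stays fixed; B times the kernel dominates.\<close>

lemma continuous_Riesz_potential:
  fixes F :: "real \<Rightarrow> real \<Rightarrow> real"
  assumes \<alpha>: "1 < \<alpha>" "\<alpha> < 2" and pq: "p \<le> q" and cont: "continuous_on ({p..q} \<times> Y) (\<lambda>(x, y). F x y)"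
    and zero: "\<And>y. y \<in> Y \<Longrightarrow> F p y = 0 \<and> F q y = 0" and B: "\<And>x y. x \<in> {p..q} \<Longrightarrow> y \<in> Y \<Longrightarrow> \<bar>F x y\<bar> \<le> B"
  shows "continuous_on ({p..q} \<times> Y) (\<lambda>(x, y). Riesz_potential \<alpha> p q (\<lambda>x. F x y) x)"
proof (rule continuous_on_sequentiallyI)
  let ?K = "Riesz_kernel (\<alpha> - 1) (q - p)"
  fix u z assume u: "\<forall>n. u n \<in> {p..q} \<times> Y" and z: "z \<in> {p..q} \<times> Y" and lim: "u \<longlonglongrightarrow> z"
  have intK: "integrable lborel ?K" using integrable_Riesz_kernel(1) \<alpha> pq by simp
  let ?cl = "\<lambda>x. max p (min q x)"
  have ext: "zero_extension p q (\<lambda>x. F x y) = (\<lambda>x. F (?cl x) y)" if "y \<in> Y" for y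
    using zero_extension_eq_clamp[OF pq, of "\<lambda>x. F x y"] zero[OF that] by simp
  have meas: "zero_extension p q (\<lambda>x. F x y) \<in> borel_measurable borel" if "y \<in> Y" for y
  proof -
    have "continuous_on {p..q} (\<lambda>x. (x, y))" by (intro continuous_intros)
    from continuous_on_compose2[OF cont this] have "continuous_on {p..q} (\<lambda>x. F x y)" using that by auto
    from integrable_zero_extension[OF this] show ?thesis by auto
  qed
  have un: "snd (u n) \<in> Y" for n using u by (auto simp: mem_Times_iff)
  have zn: "snd z \<in> Y" using z by (auto simp: mem_Times_iff)
  have "(\<lambda>n. LBINT s. zero_extension p q (\<lambda>x. F x (snd (u n))) (fst (u n) - s) * ?K s)
    \<longlonglongrightarrow> (LBINT s. zero_extension p q (\<lambda>x. F x (snd z)) (fst z - s) * ?K s)"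
  proof (rule integral_dominated_convergence[where w = "\<lambda>s. B * ?K s"])
    show "integrable lborel (\<lambda>s. B * ?K s)" by (rule integrable_mult_right) (rule intK)
    show "AE s in lborel. norm (zero_extension p q (\<lambda>x. F x (snd (u n))) (fst (u n) - s) * ?K s) \<le> B * ?K s" for n
    proof (intro AE_I2)
      fix s
      have "\<bar>F (?cl (fst (u n) - s)) (snd (u n))\<bar> \<le> B" using pq un[of n] by (intro B) auto
      thus "norm (zero_extension p q (\<lambda>x. F x (snd (u n))) (fst (u n) - s) * ?K s) \<le> B * ?K s"
        unfolding ext[OF un] real_norm_def abs_mult by (intro mult_mono) (auto simp: Riesz_kernel_def)
    qed
    show "AE s in lborel. (\<lambda>n. zero_extension p q (\<lambda>x. F x (snd (u n))) (fst (u n) - s) * ?K s)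
        \<longlonglongrightarrow> zero_extension p q (\<lambda>x. F x (snd z)) (fst z - s) * ?K s"
    proof (intro AE_I2 tendsto_mult tendsto_const)
      fix s
      have "(\<lambda>n. (?cl (fst (u n) - s), snd (u n))) \<longlonglongrightarrow> (?cl (fst z - s), snd z)"
        using lim by (intro tendsto_intros)
      from continuous_on_tendsto_compose[OF cont this]
      have "(\<lambda>n. F (?cl (fst (u n) - s)) (snd (u n))) \<longlonglongrightarrow> F (?cl (fst z - s)) (snd z)"
        using pq un zn by auto
      thus "(\<lambda>n. zero_extension p q (\<lambda>x. F x (snd (u n))) (fst (u n) - s)) \<longlonglongrightarrow> zero_extension p q (\<lambda>x. F x (snd z)) (fst z - s)"
        unfolding ext[OF un] ext[OF zn] .
    qed
    show "(\<lambda>s. zero_extension p q (\<lambda>x. F x (snd z)) (fst z - s) * ?K s) \<in> borel_measurable lborel"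
      using meas[OF zn] intK by measurable
    show "(\<lambda>s. zero_extension p q (\<lambda>x. F x (snd (u n))) (fst (u n) - s) * ?K s) \<in> borel_measurable lborel" for n
      using meas[OF un] intK by measurable
  qed
  thus "(\<lambda>n. (\<lambda>(x, y). Riesz_potential \<alpha> p q (\<lambda>x. F x y) x) (u n)) \<longlonglongrightarrow> (\<lambda>(x, y). Riesz_potential \<alpha> p q (\<lambda>x. F x y) x) z"
    unfolding Riesz_potential_def split_def by (intro tendsto_mult tendsto_const)
qed

lemma node_step:
  assumes "M \<ge> 1"
  shows "node p q M 0 = p" "node p q M M = q" "node p q M (Suc i) = node p q M i + (q - p) / real M"
    "k \<le> i \<Longrightarrow> node p q M i - real k * ((q - p) / real M) = node p q M (i - k)"
    "node p q M i + real k * ((q - p) / real M) = node p q M (i + k)"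
  using assms by (auto simp: node_def field_simps of_nat_diff)

lemma node_mem:
  assumes "p < q" "M \<ge> 1"
  shows "node p q M i \<in> {p..q} \<longleftrightarrow> i \<le> M"
proof -
  define h where "h = (q - p) / real M"
  have h: "h > 0" and q: "q = p + real M * h" using assms by (auto simp: h_def)
  have "real i * h \<le> real M * h \<longleftrightarrow> i \<le> M" using h by simp
  thus ?thesis using h unfolding node_def h_def[symmetric] by (subst q) auto
qed

text \<open>Translates of a node by multiples of h are nodes or lie outside the interval. M terms on
  either side therefore exhaust the grid, and the truncated stencil is the sum used by the
  scheme.\<close>

lemma frac_diff_node:
  assumes pq: "p < q" and M: "M \<ge> 1" and i: "i \<le> M"
  defines "h \<equiv> (q - p) / real M"
  shows "frac_diff \<gamma> h M (zero_extension p q f) (node p q M i) = (\<Sum>l\<in>{0..M}. frac_coeff \<gamma> (int i - int l) * f (node p q M l))"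
    and "M \<le> k \<Longrightarrow> zero_extension p q f (node p q M i - real (Suc k) * h) = 0 \<and> zero_extension p q f (node p q M i + real (Suc k) * h) = 0"
proof -
  let ?e = "zero_extension p q f" and ?x = "node p q M i"
  have h: "h > 0" using pq M by (simp add: h_def)
  have down: "?e (?x - real (Suc k) * h) = (if Suc k \<le> i then f (node p q M (i - Suc k)) else 0)" for k
  proof (cases "Suc k \<le> i")
    case True
    have "?x - real (Suc k) * h = node p q M (i - Suc k)" unfolding h_def using node_step(4)[OF M True] .
    moreover have "node p q M (i - Suc k) \<in> {p..q}" using node_mem[OF pq M] i by simp
    ultimately show ?thesis using True by (simp add: zero_extension_def)
  next
    case False
    have "?x - real (Suc k) * h = p + (real i - real (Suc k)) * h" by (simp add: node_def h_def algebra_simps)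
    also have "\<dots> < p" using False h by (simp add: mult_less_0_iff)
    finally show ?thesis using False by (simp add: zero_extension_def)
  qed
  have up: "?e (?x + real (Suc k) * h) = (if i + Suc k \<le> M then f (node p q M (i + Suc k)) else 0)" for k
    using node_step(5)[OF M, of p q i "Suc k"] node_mem[OF pq M, of "i + Suc k"]
    unfolding h_def by (simp add: zero_extension_def)
  show "?e (?x - real (Suc k) * h) = 0 \<and> ?e (?x + real (Suc k) * h) = 0" if "M \<le> k"
    unfolding down up using that i by auto
  have 1: "(\<Sum>k<M. frac_coeff_nat \<gamma> (Suc k) * ?e (?x - real (Suc k) * h)) = (\<Sum>l\<in>{0..<i}. frac_coeff \<gamma> (int i - int l) * f (node p q M l))"
  proof -
    have "(\<Sum>k<M. frac_coeff_nat \<gamma> (Suc k) * ?e (?x - real (Suc k) * h)) = (\<Sum>k<i. frac_coeff_nat \<gamma> (Suc k) * f (node p q M (i - Suc k)))"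
      unfolding down using i by (intro sum.mono_neutral_cong_right) auto
    also have "\<dots> = (\<Sum>l\<in>{0..<i}. frac_coeff \<gamma> (int i - int l) * f (node p q M l))"
    proof (rule sum.reindex_bij_witness[where i = "\<lambda>l. i - Suc l" and j = "\<lambda>k. i - Suc k"])
      fix k assume "k \<in> {..<i}"
      hence "frac_coeff \<gamma> (int i - int (i - Suc k)) = frac_coeff_nat \<gamma> (Suc k)"
        unfolding frac_coeff_def by (intro arg_cong[of _ _ "frac_coeff_nat \<gamma>"]) auto
      thus "frac_coeff \<gamma> (int i - int (i - Suc k)) * f (node p q M (i - Suc k)) = frac_coeff_nat \<gamma> (Suc k) * f (node p q M (i - Suc k))"
        by simp
    qed auto
    finally show ?thesis .
  qed
  have 2: "(\<Sum>k<M. frac_coeff_nat \<gamma> (Suc k) * ?e (?x + real (Suc k) * h)) = (\<Sum>l\<in>{i<..M}. frac_coeff \<gamma> (int i - int l) * f (node p q M l))"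
  proof -
    have "(\<Sum>k<M. frac_coeff_nat \<gamma> (Suc k) * ?e (?x + real (Suc k) * h)) = (\<Sum>k<M - i. frac_coeff_nat \<gamma> (Suc k) * f (node p q M (i + Suc k)))"
      unfolding up by (intro sum.mono_neutral_cong_right) auto
    also have "\<dots> = (\<Sum>l\<in>{i<..M}. frac_coeff \<gamma> (int i - int l) * f (node p q M l))"
    proof (rule sum.reindex_bij_witness[where i = "\<lambda>l. l - Suc i" and j = "\<lambda>k. i + Suc k"])
      fix k
      have "frac_coeff \<gamma> (int i - int (i + Suc k)) = frac_coeff_nat \<gamma> (Suc k)"
        unfolding frac_coeff_def by (intro arg_cong[of _ _ "frac_coeff_nat \<gamma>"]) auto
      thus "frac_coeff \<gamma> (int i - int (i + Suc k)) * f (node p q M (i + Suc k)) = frac_coeff_nat \<gamma> (Suc k) * f (node p q M (i + Suc k))"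
        by simp
    qed auto
    finally show ?thesis .
  qed
  have "?e ?x = f ?x" using node_mem[OF pq M, of i] i by (simp add: zero_extension_def)
  hence "frac_diff \<gamma> h M ?e ?x = frac_coeff \<gamma> (int i - int i) * f ?x
      + ((\<Sum>l\<in>{0..<i}. frac_coeff \<gamma> (int i - int l) * f (node p q M l)) + (\<Sum>l\<in>{i<..M}. frac_coeff \<gamma> (int i - int l) * f (node p q M l)))"
    unfolding frac_diff_def 1[symmetric] 2[symmetric] by (simp add: distrib_left sum.distrib frac_coeff_def)
  also have "\<dots> = (\<Sum>l\<in>insert i ({0..<i} \<union> {i<..M}). frac_coeff \<gamma> (int i - int l) * f (node p q M l))"
    by (subst sum.insert, simp, simp, subst sum.union_disjoint) auto
  also have "insert i ({0..<i} \<union> {i<..M}) = {0..M}" using i by auto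
  finally show "frac_diff \<gamma> h M ?e ?x = (\<Sum>l\<in>{0..M}. frac_coeff \<gamma> (int i - int l) * f (node p q M l))" .
qed

lemma frac_sum_node_bound:
  assumes V: "flat_jet m p q V" and m: "2 \<le> m" and \<gamma>: "1 < \<gamma>" "\<gamma> < 2" and M: "M \<ge> 1" and i: "i \<le> M"
    and W: "\<And>y. y \<in> {p..q} \<Longrightarrow> \<bar>V 2 y\<bar> \<le> W" and \<kappa>: "\<kappa> \<ge> 0"
  defines "h \<equiv> (q - p) / real M"
  shows "\<bar>(\<kappa> / h powr \<gamma>) * (\<Sum>l\<in>{0..M}. frac_coeff \<gamma> (int i - int l) * V 0 (node p q M l))\<bar> \<le> \<kappa> * (4 * kernel_const \<gamma> (q - p) * W)"
proof -
  have pq: "p < q" using V by (auto simp: flat_jet_def jet_def)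
  have "h > 0" using pq M by (simp add: h_def)
  note fd = frac_diff_node[OF pq M i, folded h_def]
  have "\<bar>h powr (- \<gamma>) * frac_diff \<gamma> h M (zero_extension p q (V 0)) (node p q M i)\<bar> \<le> 4 * kernel_const \<gamma> (q - p) * W"
    using fd(2) node_mem[OF pq M, of i] i by (intro frac_diff_bound[OF V m \<gamma> \<open>h > 0\<close> _ W]) auto
  hence "\<kappa> * \<bar>h powr (- \<gamma>) * frac_diff \<gamma> h M (zero_extension p q (V 0)) (node p q M i)\<bar> \<le> \<kappa> * (4 * kernel_const \<gamma> (q - p) * W)"
    using \<kappa> by (intro mult_left_mono) auto
  thus ?thesis unfolding fd(1) using \<kappa> by (simp add: abs_mult powr_minus divide_inverse mult.assoc)
qed

text \<open>Continuity is given only for each frozen last argument; the Lipschitz bound, uniform in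
  z, makes up for it.\<close>

lemma continuous_compose_lipschitz:
  fixes G :: "'a::metric_space \<Rightarrow> real \<Rightarrow> real"
  assumes cont: "\<And>w. continuous_on S (\<lambda>z. G z w)" and lip: "\<And>z v w. z \<in> S \<Longrightarrow> \<bar>G z v - G z w\<bar> \<le> L * \<bar>v - w\<bar>"
    and h: "continuous_on S h"
  shows "continuous_on S (\<lambda>z. G z (h z))"
proof (rule continuous_on_sequentiallyI)
  fix u z assume u: "\<forall>n. u n \<in> S" "z \<in> S" "u \<longlonglongrightarrow> z"
  have hl: "(\<lambda>n. h (u n)) \<longlonglongrightarrow> h z" and Gl: "(\<lambda>n. G (u n) (h z)) \<longlonglongrightarrow> G z (h z)"
    using u by (auto intro!: continuous_on_tendsto_compose[OF h] continuous_on_tendsto_compose[OF cont])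
  have "(\<lambda>n. L * \<bar>h (u n) - h z\<bar>) \<longlonglongrightarrow> L * \<bar>h z - h z\<bar>" by (intro tendsto_intros hl)
  hence lim: "(\<lambda>n. L * \<bar>h (u n) - h z\<bar>) \<longlonglongrightarrow> 0" by simp
  have "norm (G (u n) (h (u n)) - G (u n) (h z)) \<le> L * \<bar>h (u n) - h z\<bar>" for n
    unfolding real_norm_def by (rule lip) (use u(1) in blast)
  hence "(\<lambda>n. G (u n) (h (u n)) - G (u n) (h z)) \<longlonglongrightarrow> 0"
    by (intro Lim_null_comparison[OF _ lim] always_eventually allI)
  from tendsto_add[OF this Gl] show "(\<lambda>n. G (u n) (h (u n))) \<longlonglongrightarrow> G z (h z)" by simp
qed

text \<open>Lets a fractional difference taken in one variable be treated as a flat function of the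
  other.\<close>

lemma flat_jet_sum:
  assumes "p < q" and V: "\<And>l. l \<in> S \<Longrightarrow> flat_jet m p q (V l)"
  shows "flat_jet m p q (\<lambda>k x. e * (\<Sum>l\<in>S. w l * V l k x))"
  unfolding flat_jet_def jet_def
proof (intro conjI allI impI ballI)
  show "p < q" by fact
  show "continuous_on {p..q} (\<lambda>x. e * (\<Sum>l\<in>S. w l * V l m x))"
    using V by (intro continuous_intros) (auto simp: flat_jet_def jet_def)
  show "e * (\<Sum>l\<in>S. w l * V l k p) = 0" "e * (\<Sum>l\<in>S. w l * V l k q) = 0" if "k < m" for k
    using V that by (auto simp: flat_jet_def)
  show "((\<lambda>x. e * (\<Sum>l\<in>S. w l * V l k x)) has_real_derivative e * (\<Sum>l\<in>S. w l * V l (Suc k) x)) (at x within {p..q})"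
    if "k < m" "x \<in> {p..q}" for k x
    using V that by (intro DERIV_cmult DERIV_sum) (auto simp: flat_jet_def jet_def)
qed

lemma compact_node_truncation:
  assumes V: "flat_jet 6 p q V" and \<gamma>: "1 < \<gamma>" "\<gamma> < 2" and i: "0 < i" "i < M"
    and W: "\<And>y. y \<in> {p..q} \<Longrightarrow> \<bar>V 6 y\<bar> \<le> W" and \<kappa>: "\<kappa> \<ge> 0"
  defines "h \<equiv> (q - p) / real M" and "R \<equiv> \<lambda>i. Riesz_potential \<gamma> p q (V 2) (node p q M i)"
  shows "\<bar>\<kappa> * (c2 \<gamma> * R (i - 1) + (1 - 2 * c2 \<gamma>) * R i + c2 \<gamma> * R (i + 1))
      - - (\<kappa> / h powr \<gamma>) * (\<Sum>l\<in>{0..M}. frac_coeff \<gamma> (int i - int l) * V 0 (node p q M l))\<bar>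
    \<le> \<kappa> * (30 * h ^ 4 * kernel_const \<gamma> (q - p) * W)"
proof -
  have pq: "p < q" using V by (auto simp: flat_jet_def jet_def)
  have M: "M \<ge> 1" "i \<le> M" using i by auto
  have h: "h > 0" using pq M by (simp add: h_def)
  have nd: "node p q M i - h = node p q M (i - 1)" "node p q M i + h = node p q M (i + 1)"
    using node_step(4)[OF M(1), of 1 i p q] node_step(5)[OF M(1), of p q i 1] i by (simp_all add: h_def)
  note fd = frac_diff_node[OF pq M, folded h_def]
  let ?S = "\<Sum>l\<in>{0..M}. frac_coeff \<gamma> (int i - int l) * V 0 (node p q M l)"
  let ?C = "c2 \<gamma> * R (i - 1) + (1 - 2 * c2 \<gamma>) * R i + c2 \<gamma> * R (i + 1)"
  have "\<bar>c2 \<gamma> * Riesz_potential \<gamma> p q (V 2) (node p q M i - h) + (1 - 2 * c2 \<gamma>) * Riesz_potential \<gamma> p q (V 2) (node p q M i)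
      + c2 \<gamma> * Riesz_potential \<gamma> p q (V 2) (node p q M i + h)
      + h powr (- \<gamma>) * frac_diff \<gamma> h M (zero_extension p q (V 0)) (node p q M i)\<bar> \<le> 30 * h ^ 4 * kernel_const \<gamma> (q - p) * W"
    using fd(2) i node_mem[OF pq M(1)] by (intro compact_Riesz_truncation[OF V \<gamma> h _ W]) (auto simp: nd simp del: of_nat_Suc)
  hence "\<bar>?C + h powr (- \<gamma>) * ?S\<bar> \<le> 30 * h ^ 4 * kernel_const \<gamma> (q - p) * W"
    unfolding fd(1) nd R_def .
  hence "\<kappa> * \<bar>?C + h powr (- \<gamma>) * ?S\<bar> \<le> \<kappa> * (30 * h ^ 4 * kernel_const \<gamma> (q - p) * W)" using \<kappa> by (rule mult_left_mono)
  moreover have "\<kappa> * ?C - - (\<kappa> / h powr \<gamma>) * ?S = \<kappa> * (?C + h powr (- \<gamma>) * ?S)"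
    unfolding powr_minus_divide by (simp only: distrib_left) simp
  ultimately show ?thesis using \<kappa> by (simp only: abs_mult abs_of_nonneg)
qed

text \<open>The averages are convex combinations, since c2 \<le> 1/12.\<close>

lemma compact_bound:
  assumes "0 \<le> \<gamma>" "\<gamma> \<le> 2"
  shows "(\<And>k. k \<le> M \<Longrightarrow> \<bar>v k j\<bar> \<le> e) \<Longrightarrow> i \<le> M \<Longrightarrow> \<bar>compact_x \<gamma> M v i j\<bar> \<le> e"
    and "(\<And>k. k \<le> M \<Longrightarrow> \<bar>v i k\<bar> \<le> e) \<Longrightarrow> j \<le> M \<Longrightarrow> \<bar>compact_y \<gamma> M v i j\<bar> \<le> e"
proof -
  have c: "0 \<le> c2 \<gamma>" "0 \<le> 1 - 2 * c2 \<gamma>" using assms by (auto simp: c2_def)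
  have avg: "\<bar>c2 \<gamma> * r + (1 - 2 * c2 \<gamma>) * s + c2 \<gamma> * t\<bar> \<le> e" if "\<bar>r\<bar> \<le> e" "\<bar>s\<bar> \<le> e" "\<bar>t\<bar> \<le> e" for r s t :: real
  proof -
    have "\<bar>c2 \<gamma> * r\<bar> \<le> c2 \<gamma> * e" "\<bar>(1 - 2 * c2 \<gamma>) * s\<bar> \<le> (1 - 2 * c2 \<gamma>) * e" "\<bar>c2 \<gamma> * t\<bar> \<le> c2 \<gamma> * e"
      using that c by (auto simp: abs_mult intro!: mult_left_mono)
    moreover have "c2 \<gamma> * e + (1 - 2 * c2 \<gamma>) * e + c2 \<gamma> * e = e" by (simp add: algebra_simps)
    ultimately show ?thesis by linarith
  qed
  show "\<bar>compact_x \<gamma> M v i j\<bar> \<le> e" if "\<And>k. k \<le> M \<Longrightarrow> \<bar>v k j\<bar> \<le> e" "i \<le> M"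
    using that unfolding compact_x_def by (auto intro!: avg)
  show "\<bar>compact_y \<gamma> M v i j\<bar> \<le> e" if "\<And>k. k \<le> M \<Longrightarrow> \<bar>v i k\<bar> \<le> e" "j \<le> M"
    using that unfolding compact_y_def by (auto intro!: avg)
qed

text \<open>At every node, boundary included, the equation replaces the source by the time
  derivative P minus the Riesz terms. As the averages in x and y commute, the residual becomes one
  time error, the splitting term Z and one space error in each direction.\<close>

lemma residual_split:
  assumes ij: "0 < i" "i < M1" "0 < j" "j < M2"
    and P: "\<And>i j. i \<le> M1 \<Longrightarrow> j \<le> M2 \<Longrightarrow> G i j = P i j - \<kappa>1 * Rx i j - \<kappa>2 * Ry i j"
  shows "compact_x \<alpha> M1 (compact_y \<beta> M2 B) i j + Z
      - (compact_y \<beta> M2 X i j + compact_x \<alpha> M1 Y i j + compact_x \<alpha> M1 (compact_y \<beta> M2 G) i j)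
    = compact_x \<alpha> M1 (compact_y \<beta> M2 (\<lambda>i j. B i j - P i j)) i j + Z
      + compact_y \<beta> M2 (\<lambda>i j. \<kappa>1 * compact_x \<alpha> M1 Rx i j - X i j) i j
      + compact_x \<alpha> M1 (\<lambda>i j. \<kappa>2 * compact_y \<beta> M2 Ry i j - Y i j) i j"
  using ij unfolding compact_x_def compact_y_def by (simp add: P) algebra

lemma delta_x_bdf2: "delta_x \<kappa> \<gamma> h M (bdf2 \<tau> W n) i j = bdf2 \<tau> (\<lambda>n. delta_x \<kappa> \<gamma> h M (W n)) n i j"
proof -
  have 1: "delta_x \<kappa> \<gamma> h M (\<lambda>i j. s * f i j) = (\<lambda>i j. s * delta_x \<kappa> \<gamma> h M f i j)" for s f
    by (intro ext) (simp add: delta_x_def sum_distrib_left mult_ac)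
  have 2: "delta_x \<kappa> \<gamma> h M (\<lambda>i j. f i j / s) = (\<lambda>i j. delta_x \<kappa> \<gamma> h M f i j / s)" for s f
    using 1[of "1 / s" f] by simp
  have "bdf2 \<tau> W n = (if n = 1 then (\<lambda>i j. (W 1 i j - W 0 i j) / \<tau>) else
      (\<lambda>i j. 3/2 * ((W n i j - W (n - 1) i j) / \<tau>) - 1/2 * ((W (n - 1) i j - W (n - 2) i j) / \<tau>)))"
    by (auto simp: bdf2_def fun_eq_iff)
  thus ?thesis by (simp only: delta_x_diff 1 2 bdf2_def split: if_split) blast
qed

lemma delta_y_bdf2: "delta_y \<kappa> \<gamma> h M (bdf2 \<tau> W n) i j = bdf2 \<tau> (\<lambda>n. delta_y \<kappa> \<gamma> h M (W n)) n i j"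
proof -
  have 1: "delta_y \<kappa> \<gamma> h M (\<lambda>i j. s * f i j) = (\<lambda>i j. s * delta_y \<kappa> \<gamma> h M f i j)" for s f
    by (intro ext) (simp add: delta_y_def sum_distrib_left mult_ac)
  have 2: "delta_y \<kappa> \<gamma> h M (\<lambda>i j. f i j / s) = (\<lambda>i j. delta_y \<kappa> \<gamma> h M f i j / s)" for s f
    using 1[of "1 / s" f] by simp
  have "bdf2 \<tau> W n = (if n = 1 then (\<lambda>i j. (W 1 i j - W 0 i j) / \<tau>) else
      (\<lambda>i j. 3/2 * ((W n i j - W (n - 1) i j) / \<tau>) - 1/2 * ((W (n - 1) i j - W (n - 2) i j) / \<tau>)))"
    by (auto simp: bdf2_def fun_eq_iff)
  thus ?thesis by (simp only: delta_y_diff 1 2 bdf2_def split: if_split) blast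
qed

text \<open>The weights 3/2 and 1/2 of the two increments add up to 2 in modulus.\<close>

lemma bdf2_bound:
  assumes "\<tau> > 0" and inc: "\<And>m. 1 \<le> m \<Longrightarrow> m \<le> n \<Longrightarrow> \<bar>Z m i j - Z (m - 1) i j\<bar> \<le> C * \<tau>" and "1 \<le> n"
  shows "\<bar>bdf2 \<tau> Z n i j\<bar> \<le> 2 * C"
proof -
  have q: "\<bar>(Z m i j - Z (m - 1) i j) / \<tau>\<bar> \<le> C" if "1 \<le> m" "m \<le> n" for m
    using inc[OF that] assms(1) by (simp add: field_simps)
  have "0 \<le> C" using q[of 1] assms by linarith
  show ?thesis
  proof (cases "n = 1")
    case True
    thus ?thesis using q[of 1] \<open>0 \<le> C\<close> by (simp add: bdf2_def)
  next
    case False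
    hence "\<bar>(Z n i j - Z (n - 1) i j) / \<tau>\<bar> \<le> C" "\<bar>(Z (n - 1) i j - Z (n - 1 - 1) i j) / \<tau>\<bar> \<le> C"
      using assms(3) by (intro q; simp)+
    moreover have "n - 1 - 1 = n - 2" by simp
    ultimately have *: "\<bar>(Z n i j - Z (n - 1) i j) / \<tau>\<bar> \<le> C" "\<bar>(Z (n - 1) i j - Z (n - 2) i j) / \<tau>\<bar> \<le> C"
      by (simp_all only:)
    have "\<bar>3/2 * r - 1/2 * s\<bar> \<le> 2 * C" if "\<bar>r\<bar> \<le> C" "\<bar>s\<bar> \<le> C" for r s :: real using that by linarith
    from this[OF *] show ?thesis unfolding bdf2_def by (simp only: False if_False)
  qed
qed

section \<open>The solution on the closed box\<close>

text \<open>\<open>D\<close> is a witness for \<open>C_box\<close>. The edge conditions are stated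
  for pure derivatives in the normal variable, as the Fourier hypotheses deliver them; the mixed
  ones are consequences.\<close>

locale smooth_box =
  fixes a b c d T :: real and D :: "nat \<Rightarrow> nat \<Rightarrow> nat \<Rightarrow> real \<Rightarrow> real \<Rightarrow> real \<Rightarrow> real"
  assumes ab: "a < b" and cd: "c < d" and T: "0 < T"
    and cont: "p \<le> 6 \<Longrightarrow> q \<le> 6 \<Longrightarrow> r \<le> 3 \<Longrightarrow> continuous_on ({a..b} \<times> {c..d} \<times> {0..T}) (\<lambda>(x, y, t). D p q r x y t)"
    and deriv_x: "p < 6 \<Longrightarrow> q \<le> 6 \<Longrightarrow> r \<le> 3 \<Longrightarrow> x \<in> {a..b} \<Longrightarrow> y \<in> {c..d} \<Longrightarrow> t \<in> {0..T} \<Longrightarrow>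
      ((\<lambda>z. D p q r z y t) has_real_derivative D (Suc p) q r x y t) (at x within {a..b})"
    and deriv_y: "p \<le> 6 \<Longrightarrow> q < 6 \<Longrightarrow> r \<le> 3 \<Longrightarrow> x \<in> {a..b} \<Longrightarrow> y \<in> {c..d} \<Longrightarrow> t \<in> {0..T} \<Longrightarrow>
      ((\<lambda>z. D p q r x z t) has_real_derivative D p (Suc q) r x y t) (at y within {c..d})"
    and deriv_t: "p \<le> 6 \<Longrightarrow> q \<le> 6 \<Longrightarrow> r < 3 \<Longrightarrow> x \<in> {a..b} \<Longrightarrow> y \<in> {c..d} \<Longrightarrow> t \<in> {0..T} \<Longrightarrow>
      ((\<lambda>z. D p q r x y z) has_real_derivative D p q (Suc r) x y t) (at t within {0..T})"
    and edge_x: "p < 6 \<Longrightarrow> y \<in> {c..d} \<Longrightarrow> t \<in> {0..T} \<Longrightarrow> D p 0 0 a y t = 0 \<and> D p 0 0 b y t = 0"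
    and edge_y: "q < 6 \<Longrightarrow> x \<in> {a..b} \<Longrightarrow> t \<in> {0..T} \<Longrightarrow> D 0 q 0 x c t = 0 \<and> D 0 q 0 x d t = 0"
begin

text \<open>The locale is symmetric in the two space variables, so statements in y can be obtained
  from those in x.\<close>

lemma flip: "smooth_box c d a b T (\<lambda>p q r x y t. D q p r y x t)"
proof
  show "continuous_on ({c..d} \<times> {a..b} \<times> {0..T}) (\<lambda>(x, y, t). D q p r y x t)" if "p \<le> 6" "q \<le> 6" "r \<le> 3" for p q r
  proof -
    have "continuous_on ({c..d} \<times> {a..b} \<times> {0..T}) (\<lambda>z. (fst (snd z), fst z, snd (snd z)))" by (intro continuous_intros)
    from continuous_on_compose2[OF cont[OF that(2,1,3)] this] show ?thesis by (simp add: split_def image_subset_iff)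
  qed
qed (use ab cd T deriv_x deriv_y deriv_t edge_x edge_y in auto)

text \<open>A function that vanishes along an edge has vanishing tangential derivatives there: the
  edge identity is differentiated in y, then in t.\<close>

lemma edge_x_mixed:
  assumes p: "p < 6" and q: "q \<le> 6" and r: "r \<le> 3" and yt: "y \<in> {c..d}" "t \<in> {0..T}"
  shows "D p q r a y t = 0 \<and> D p q r b y t = 0"
proof -
  have ends: "D p q r e y t = 0" if e: "e \<in> {a, b}" for e
  proof -
    have eab: "e \<in> {a..b}" using e ab by auto
    have zero: "D p q 0 e y t = 0" if "q \<le> 6" "y \<in> {c..d}" "t \<in> {0..T}" for y t q
      using that
    proof (induction q arbitrary: y)
      case 0
      thus ?case using edge_x[OF p] e by auto
    next
      case (Suc q)
      show ?case
        by (rule has_derivative_of_zero_function[OF cd Suc.prems(2) deriv_y[of p q 0 e y t]])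
          (use p eab Suc in auto)
    qed
    show ?thesis using r yt
    proof (induction r arbitrary: t)
      case 0
      thus ?case using q zero by auto
    next
      case (Suc r)
      show ?case
        by (rule has_derivative_of_zero_function[OF T Suc.prems(3) deriv_t[of p q r e y t]])
          (use p q eab Suc in auto)
    qed
  qed
  thus ?thesis by auto
qed

lemma flat_x:
  assumes "q \<le> 6" "r \<le> 3" "y \<in> {c..d}" "t \<in> {0..T}"
  shows "flat_jet 6 a b (\<lambda>p x. D p q r x y t)"
  unfolding flat_jet_def jet_def
proof (intro conjI allI impI ballI)
  have "continuous_on {a..b} (\<lambda>x. (x, y, t))" by (intro continuous_intros)
  from continuous_on_compose2[OF cont[of 6 q r] this] show "continuous_on {a..b} (\<lambda>x. D 6 q r x y t)"
    using assms by (simp add: image_subset_iff)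
qed (use ab assms edge_x_mixed deriv_x in auto)

lemma flat_y:
  assumes "p \<le> 6" "r \<le> 3" "x \<in> {a..b}" "t \<in> {0..T}"
  shows "flat_jet 6 c d (\<lambda>q y. D p q r x y t)"
  using smooth_box.flat_x[OF flip] assms by simp

lemma bounded_derivatives:
  "\<exists>B>0. \<forall>p\<le>6. \<forall>q\<le>6. \<forall>r\<le>3. \<forall>x\<in>{a..b}. \<forall>y\<in>{c..d}. \<forall>t\<in>{0..T}. \<bar>D p q r x y t\<bar> \<le> B"
proof -
  let ?X = "{a..b} \<times> {c..d} \<times> {0..T}" and ?I = "{..6::nat} \<times> {..6::nat} \<times> {..3::nat}"
  let ?f = "\<lambda>(p, q, r) (x, y, t). D p q r x y t"
  have comp: "compact ?X" by (intro compact_Times) auto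
  have "bounded (?f i ` ?X)" if "i \<in> ?I" for i
  proof -
    obtain p q r where i: "i = (p, q, r)" by (cases i) blast
    have "continuous_on ?X (\<lambda>(x, y, t). D p q r x y t)" using that by (intro cont) (simp_all add: i)
    thus ?thesis unfolding i prod.case by (rule compact_imp_bounded[OF compact_continuous_image[OF _ comp]])
  qed
  hence "bounded (\<Union>i\<in>?I. ?f i ` ?X)" by (intro bounded_UN finite_cartesian_product finite_atMost ballI)
  then obtain B where "\<forall>z\<in>(\<Union>i\<in>?I. ?f i ` ?X). norm z \<le> B" unfolding bounded_iff ..
  note B = bspec[OF this]
  have "\<bar>D p q r x y t\<bar> \<le> \<bar>B\<bar> + 1"
    if "p \<le> 6" "q \<le> 6" "r \<le> 3" "x \<in> {a..b}" "y \<in> {c..d}" "t \<in> {0..T}" for p q r x y t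
  proof -
    have "?f (p, q, r) (x, y, t) \<in> (\<Union>i\<in>?I. ?f i ` ?X)"
      by (rule UN_I[where a = "(p, q, r)"], use that in simp, rule imageI) (use that in simp)
    from B[OF this] have "\<bar>D p q r x y t\<bar> \<le> B" by simp
    thus ?thesis by linarith
  qed
  thus ?thesis by (intro exI[of _ "\<bar>B\<bar> + 1"]) auto
qed

lemma continuous_Riesz_x:
  assumes \<alpha>: "1 < \<alpha>" "\<alpha> < 2" and t: "t \<in> {0..T}"
  shows "continuous_on ({a..b} \<times> {c..d}) (\<lambda>z. Riesz_potential \<alpha> a b (\<lambda>x. D 2 0 0 x (snd z) t) (fst z))"
proof -
  obtain B where B: "\<forall>p\<le>6. \<forall>q\<le>6. \<forall>r\<le>3. \<forall>x\<in>{a..b}. \<forall>y\<in>{c..d}. \<forall>t\<in>{0..T}. \<bar>D p q r x y t\<bar> \<le> B"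
    using bounded_derivatives by blast
  have "continuous_on ({a..b} \<times> {c..d}) (\<lambda>z. (fst z, snd z, t))" by (intro continuous_intros)
  from continuous_on_compose2[OF cont[of 2 0 0] this]
  have "continuous_on ({a..b} \<times> {c..d}) (\<lambda>(x, y). D 2 0 0 x y t)" using t by (simp add: split_def image_subset_iff)
  from this have "continuous_on ({a..b} \<times> {c..d}) (\<lambda>(x, y). Riesz_potential \<alpha> a b (\<lambda>x. D 2 0 0 x y t) x)"
  proof (rule continuous_Riesz_potential[OF \<alpha> less_imp_le[OF ab]])
    show "D 2 0 0 a y t = 0 \<and> D 2 0 0 b y t = 0" if "y \<in> {c..d}" for y by (rule edge_x_mixed) (use that t in auto)
    show "\<bar>D 2 0 0 x y t\<bar> \<le> B" if "x \<in> {a..b}" "y \<in> {c..d}" for x y using B that t by simp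
  qed
  thus ?thesis by (simp add: split_def)
qed

lemma continuous_Riesz_y:
  assumes \<beta>: "1 < \<beta>" "\<beta> < 2" and t: "t \<in> {0..T}"
  shows "continuous_on ({a..b} \<times> {c..d}) (\<lambda>z. Riesz_potential \<beta> c d (\<lambda>y. D 0 2 0 (fst z) y t) (snd z))"
proof -
  have "continuous_on ({a..b} \<times> {c..d}) (\<lambda>z. (snd z, fst z))" by (intro continuous_intros)
  from continuous_on_compose2[OF smooth_box.continuous_Riesz_x[OF flip \<beta> t] this] show ?thesis by (simp add: image_subset_iff)
qed

text \<open>The equation is only assumed at interior points, but the compact operators also evaluate it on the boundary.\<close>

lemma equation_on_closed_box:
  assumes \<alpha>: "1 < \<alpha>" "\<alpha> < 2" and \<beta>: "1 < \<beta>" "\<beta> < 2" and t: "t \<in> {0..T}"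
    and cont_g: "\<And>w. continuous_on ({a..b} \<times> {c..d}) (\<lambda>(x, y). g x y w)"
    and lip: "\<And>x y v w. x \<in> {a..b} \<Longrightarrow> y \<in> {c..d} \<Longrightarrow> \<bar>g x y v - g x y w\<bar> \<le> L * \<bar>v - w\<bar>"
    and eq: "\<And>x y. x \<in> {a<..<b} \<Longrightarrow> y \<in> {c<..<d} \<Longrightarrow> D 0 0 1 x y t = \<kappa>1 * riesz_deriv \<alpha> a b (\<lambda>\<xi>. D 0 0 0 \<xi> y t) x
      + \<kappa>2 * riesz_deriv \<beta> c d (\<lambda>\<xi>. D 0 0 0 x \<xi> t) y + g x y (D 0 0 0 x y t)"
    and xy: "x \<in> {a..b}" "y \<in> {c..d}"
  shows "D 0 0 1 x y t = \<kappa>1 * Riesz_potential \<alpha> a b (\<lambda>x. D 2 0 0 x y t) x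
      + \<kappa>2 * Riesz_potential \<beta> c d (\<lambda>y. D 0 2 0 x y t) y + g x y (D 0 0 0 x y t)"
proof -
  let ?S = "{a..b} \<times> {c..d}"
  define f where "f z = D 0 0 1 (fst z) (snd z) t - (\<kappa>1 * Riesz_potential \<alpha> a b (\<lambda>x. D 2 0 0 x (snd z) t) (fst z)
      + \<kappa>2 * Riesz_potential \<beta> c d (\<lambda>y. D 0 2 0 (fst z) y t) (snd z) + g (fst z) (snd z) (D 0 0 0 (fst z) (snd z) t))" for z
  have slice: "continuous_on ?S (\<lambda>z. D 0 0 r (fst z) (snd z) t)" if "r \<le> 3" for r
  proof -
    have "continuous_on ?S (\<lambda>z. (fst z, snd z, t))" by (intro continuous_intros)
    from continuous_on_compose2[OF cont[of 0 0 r] this] show ?thesis using t that by (simp add: split_def image_subset_iff)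
  qed
  have "continuous_on ?S (\<lambda>z. g (fst z) (snd z) (D 0 0 0 (fst z) (snd z) t))"
    by (rule continuous_compose_lipschitz[where G = "\<lambda>z. g (fst z) (snd z)" and L = L])
      (use cont_g lip slice[of 0] in \<open>auto simp: split_def\<close>)
  hence contf: "continuous_on ?S f" unfolding f_def
    by (intro continuous_on_diff continuous_on_add continuous_on_mult continuous_on_const slice
        continuous_Riesz_x[OF \<alpha> t] continuous_Riesz_y[OF \<beta> t]) auto
  have cl: "closure ({a<..<b} \<times> {c<..<d}) = ?S" using ab cd by (simp add: closure_Times)
  have "f (x, y) = 0"
  proof (rule continuous_constant_on_closure[where f = f and S = "{a<..<b} \<times> {c<..<d}"])
    show "continuous_on (closure ({a<..<b} \<times> {c<..<d})) f" unfolding cl by (rule contf)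
    fix z assume "z \<in> {a<..<b} \<times> {c<..<d}"
    then obtain x y where z: "z = (x, y)" "x \<in> {a<..<b}" "y \<in> {c<..<d}" by auto
    have "riesz_deriv \<alpha> a b (\<lambda>\<xi>. D 0 0 0 \<xi> y t) x = Riesz_potential \<alpha> a b (\<lambda>x. D 2 0 0 x y t) x"
      by (rule riesz_deriv_eq_Riesz_potential[OF flat_x[of 0 0 y t] _ \<alpha>]) (use z t in auto)
    moreover have "riesz_deriv \<beta> c d (\<lambda>\<xi>. D 0 0 0 x \<xi> t) y = Riesz_potential \<beta> c d (\<lambda>y. D 0 2 0 x y t) y"
      by (rule riesz_deriv_eq_Riesz_potential[OF flat_y[of 0 0 x t] _ \<beta>]) (use z t in auto)
    ultimately show "f z = 0" using eq[OF z(2,3)] by (simp add: f_def z(1))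
  qed (use xy in \<open>simp add: cl\<close>)
  thus ?thesis by (simp add: f_def)
qed

end

context smooth_box
begin

section \<open>The local truncation error\<close>

text \<open>The one-dimensional bound is used twice. For fixed j the y-differences of the
  x-derivatives, the family \<open>V\<close>, form a flat jet in x; its second member is a
  y-difference of \<open>D 2 0 1\<close>, which in turn is bounded through
  \<open>D 2 2 1\<close>.\<close>

lemma mixed_difference_bound:
  assumes par: "1 < \<alpha>" "\<alpha> < 2" "1 < \<beta>" "\<beta> < 2" "0 \<le> \<kappa>1" "0 \<le> \<kappa>2" and M: "M1 \<ge> 1" "M2 \<ge> 1" and ij: "i \<le> M1" "j \<le> M2"
    and B: "\<And>x y. x \<in> {a..b} \<Longrightarrow> y \<in> {c..d} \<Longrightarrow> \<bar>D 2 2 1 x y s\<bar> \<le> B" and s: "s \<in> {0..T}"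
  shows "\<bar>delta_x \<kappa>1 \<alpha> ((b - a) / real M1) M1 (delta_y \<kappa>2 \<beta> ((d - c) / real M2) M2
      (\<lambda>i j. D 0 0 1 (node a b M1 i) (node c d M2 j) s)) i j\<bar>
    \<le> \<kappa>1 * (4 * kernel_const \<alpha> (b - a) * (\<kappa>2 * (4 * kernel_const \<beta> (d - c) * B)))"
proof -
  let ?hx = "(b - a) / real M1" and ?hy = "(d - c) / real M2"
  define V where "V p x = - (\<kappa>2 / ?hy powr \<beta>) * (\<Sum>l\<in>{0..M2}. frac_coeff \<beta> (int j - int l) * D p 0 1 x (node c d M2 l) s)" for p x
  have V: "flat_jet 6 a b V" unfolding V_def
    by (rule flat_jet_sum[OF ab]) (rule flat_x, use s node_mem[OF cd M(2)] in auto)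
  have bound: "\<bar>V 2 x\<bar> \<le> \<kappa>2 * (4 * kernel_const \<beta> (d - c) * B)" if x: "x \<in> {a..b}" for x
  proof -
    have "\<bar>(\<kappa>2 / ?hy powr \<beta>) * (\<Sum>l\<in>{0..M2}. frac_coeff \<beta> (int j - int l) * D 2 0 1 x (node c d M2 l) s)\<bar>
        \<le> \<kappa>2 * (4 * kernel_const \<beta> (d - c) * B)"
      by (rule frac_sum_node_bound[where V = "\<lambda>q y. D 2 q 1 x y s", OF flat_y _ par(3,4) M(2) ij(2) B par(6)])
        (use x s in auto)
    thus ?thesis by (simp add: V_def abs_mult)
  qed
  have Vy: "delta_y \<kappa>2 \<beta> ?hy M2 (\<lambda>i j. D 0 0 1 (node a b M1 i) (node c d M2 j) s) i j = V 0 (node a b M1 i)" for i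
    unfolding delta_y_def V_def using sum_frac_coeff_reindex[OF ij(2), of \<beta> "\<lambda>l. D 0 0 1 (node a b M1 i) (node c d M2 l) s"] by simp
  have "\<bar>(\<kappa>1 / ?hx powr \<alpha>) * (\<Sum>l\<in>{0..M1}. frac_coeff \<alpha> (int i - int l) * V 0 (node a b M1 l))\<bar>
      \<le> \<kappa>1 * (4 * kernel_const \<alpha> (b - a) * (\<kappa>2 * (4 * kernel_const \<beta> (d - c) * B)))"
    by (rule frac_sum_node_bound[OF V _ par(1,2) M(1) ij(1) bound par(5)]) simp_all
  thus ?thesis unfolding delta_x_def Vy
    using sum_frac_coeff_reindex[OF ij(1), of \<alpha> "\<lambda>l. V 0 (node a b M1 l)"] by (simp add: abs_mult)
qed

text \<open>The summands of the bound are the time error, the splitting term and the space errors in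
  x and y. The averages do not increase the maximum, so they add no constants.\<close>

lemma truncation_error:
  assumes par: "1 < \<alpha>" "\<alpha> < 2" "1 < \<beta>" "\<beta> < 2" "0 \<le> \<kappa>1" "0 \<le> \<kappa>2"
    and B: "\<And>p q r x y t. p \<le> 6 \<Longrightarrow> q \<le> 6 \<Longrightarrow> r \<le> 3 \<Longrightarrow> x \<in> {a..b} \<Longrightarrow> y \<in> {c..d} \<Longrightarrow> t \<in> {0..T} \<Longrightarrow> \<bar>D p q r x y t\<bar> \<le> B"
    and n: "1 \<le> n" "n \<le> N" and i: "i \<in> {1..<M1}" and j: "j \<in> {1..<M2}"
    and eq: "\<And>x y. x \<in> {a..b} \<Longrightarrow> y \<in> {c..d} \<Longrightarrow> D 0 0 1 x y (node 0 T N n) =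
      \<kappa>1 * Riesz_potential \<alpha> a b (\<lambda>x. D 2 0 0 x y (node 0 T N n)) x
      + \<kappa>2 * Riesz_potential \<beta> c d (\<lambda>y. D 0 2 0 x y (node 0 T N n)) y + G x y"
  defines "hx \<equiv> (b - a) / real M1" and "hy \<equiv> (d - c) / real M2" and "\<tau> \<equiv> T / real N"
    and "W \<equiv> \<lambda>n i j. D 0 0 0 (node a b M1 i) (node c d M2 j) (node 0 T N n)"
  shows "\<bar>compact_x \<alpha> M1 (compact_y \<beta> M2 (bdf2 \<tau> W n)) i j
        + \<tau>\<^sup>2 * (sigma n)\<^sup>2 * delta_x \<kappa>1 \<alpha> hx M1 (delta_y \<kappa>2 \<beta> hy M2 (bdf2 \<tau> W n)) i j
      - (compact_y \<beta> M2 (delta_x \<kappa>1 \<alpha> hx M1 (W n)) i j + compact_x \<alpha> M1 (delta_y \<kappa>2 \<beta> hy M2 (W n)) i j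
        + compact_x \<alpha> M1 (compact_y \<beta> M2 (\<lambda>i j. G (node a b M1 i) (node c d M2 j))) i j)\<bar>
    \<le> (if n = 1 then B * \<tau> else 6 * B * \<tau>\<^sup>2)
      + \<tau>\<^sup>2 * (2 * (\<kappa>1 * (4 * kernel_const \<alpha> (b - a) * (\<kappa>2 * (4 * kernel_const \<beta> (d - c) * B)))))
      + \<kappa>1 * (30 * hx ^ 4 * kernel_const \<alpha> (b - a) * B) + \<kappa>2 * (30 * hy ^ 4 * kernel_const \<beta> (d - c) * B)"
proof -
  let ?x = "node a b M1" and ?y = "node c d M2" and ?t = "node 0 T N"
  have N: "N \<ge> 1" and M: "M1 \<ge> 1" "M2 \<ge> 1" using n i j by auto
  have \<tau>: "\<tau> > 0" using T N by (simp add: \<tau>_def)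
  have tmem: "?t m \<in> {0..T}" if "m \<le> N" for m using node_mem[OF T N] that by blast
  have xmem: "?x k \<in> {a..b}" if "k \<le> M1" for k using node_mem[OF ab M(1)] that by blast
  have ymem: "?y k \<in> {c..d}" if "k \<le> M2" for k using node_mem[OF cd M(2)] that by blast
  have tn: "?t m = real m * \<tau>" for m by (simp add: node_def \<tau>_def)
  define P where "P i j = D 0 0 1 (?x i) (?y j) (?t n)" for i j
  define Rx where "Rx i j = Riesz_potential \<alpha> a b (\<lambda>x. D 2 0 0 x (?y j) (?t n)) (?x i)" for i j
  define Ry where "Ry i j = Riesz_potential \<beta> c d (\<lambda>y. D 0 2 0 (?x i) y (?t n)) (?y j)" for i j
  let ?Z = "\<tau>\<^sup>2 * (sigma n)\<^sup>2 * delta_x \<kappa>1 \<alpha> hx M1 (delta_y \<kappa>2 \<beta> hy M2 (bdf2 \<tau> W n)) i j"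
  have split: "compact_x \<alpha> M1 (compact_y \<beta> M2 (bdf2 \<tau> W n)) i j + ?Z
      - (compact_y \<beta> M2 (delta_x \<kappa>1 \<alpha> hx M1 (W n)) i j + compact_x \<alpha> M1 (delta_y \<kappa>2 \<beta> hy M2 (W n)) i j
        + compact_x \<alpha> M1 (compact_y \<beta> M2 (\<lambda>i j. G (node a b M1 i) (node c d M2 j))) i j)
    = compact_x \<alpha> M1 (compact_y \<beta> M2 (\<lambda>i j. bdf2 \<tau> W n i j - P i j)) i j + ?Z
      + compact_y \<beta> M2 (\<lambda>i j. \<kappa>1 * compact_x \<alpha> M1 Rx i j - delta_x \<kappa>1 \<alpha> hx M1 (W n) i j) i j
      + compact_x \<alpha> M1 (\<lambda>i j. \<kappa>2 * compact_y \<beta> M2 Ry i j - delta_y \<kappa>2 \<beta> hy M2 (W n) i j) i j"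
    by (rule residual_split) (use i j eq[OF xmem ymem] in \<open>auto simp: P_def Rx_def Ry_def\<close>)
  have time: "\<bar>bdf2 \<tau> W n i j - P i j\<bar> \<le> (if n = 1 then B * \<tau> else 6 * B * \<tau>\<^sup>2)" if ij: "i \<le> M1" "j \<le> M2" for i j
  proof -
    let ?f = "\<lambda>r t. D 0 0 r (?x i) (?y j) t"
    have d: "(?f r has_real_derivative ?f (Suc r) z) (at z within {0..T})" if "r < 3" "z \<in> {0..T}" for r z
      by (rule deriv_t) (use that xmem ymem ij in auto)
    have Bf: "\<bar>?f r z\<bar> \<le> B" if "r \<le> 3" "z \<in> {0..T}" for r z by (rule B) (use that xmem ymem ij in auto)
    note tr = bdf2_truncation[where f = ?f, OF d Bf \<tau>]
    show ?thesis
    proof (cases "n = 1")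
      case True
      have "\<tau> \<le> T" using tmem[of 1] n tn[of 1] by simp
      from tr(1)[OF _ _ _ _ this] show ?thesis using True by (simp add: bdf2_def W_def P_def tn)
    next
      case False
      have t: "2 * \<tau> \<le> ?t n" "?t n \<le> T" "?t (n - 1) = ?t n - \<tau>" "?t (n - 2) = ?t n - 2 * \<tau>"
        using False n tmem[OF n(2)] \<tau> by (auto simp: tn of_nat_diff algebra_simps)
      from tr(2)[OF _ _ _ _ t(1,2)] show ?thesis using False unfolding bdf2_def W_def P_def t(3,4) by simp
    qed
  qed
  have term1: "\<bar>compact_x \<alpha> M1 (compact_y \<beta> M2 (\<lambda>i j. bdf2 \<tau> W n i j - P i j)) i j\<bar> \<le> (if n = 1 then B * \<tau> else 6 * B * \<tau>\<^sup>2)"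
    by (rule compact_bound(1), use par in simp, use par in simp, rule compact_bound(2)) (use par i j time in auto)
  let ?C = "\<kappa>1 * (4 * kernel_const \<alpha> (b - a) * (\<kappa>2 * (4 * kernel_const \<beta> (d - c) * B)))"
  have mixed: "\<bar>delta_x \<kappa>1 \<alpha> hx M1 (delta_y \<kappa>2 \<beta> hy M2 (bdf2 \<tau> W n)) i j\<bar> \<le> 2 * ?C"
  proof -
    \<comment> \<open>Increments in time of the mixed differences of the solution are bounded
      through the mixed differences of its time derivative, so the division by \<tau> in the BDF2
      quotient costs nothing.\<close>
    define Z where "Z r t = delta_x \<kappa>1 \<alpha> hx M1 (delta_y \<kappa>2 \<beta> hy M2 (\<lambda>i j. D 0 0 r (?x i) (?y j) t)) i j" for r t
    have dZ: "(Z 0 has_real_derivative Z 1 t) (at t within {0..T})" if "t \<in> {0..T}" for t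
    proof -
      have "((\<lambda>t. D 0 0 0 (?x k) (?y l) t) has_real_derivative D 0 0 1 (?x k) (?y l) t) (at t within {0..T})"
        if "k \<le> M1" "l \<le> M2" for k l
        using deriv_t[of 0 0 0 "?x k" "?y l" t] xmem ymem that \<open>t \<in> _\<close> by simp
      thus ?thesis using i j unfolding Z_def delta_x_def delta_y_def
        by (intro DERIV_cmult DERIV_sum) auto
    qed
    have inc: "\<bar>Z 0 (?t m) - Z 0 (?t (m - 1))\<bar> \<le> ?C * \<tau>" if m: "1 \<le> m" "m \<le> n" for m
    proof -
      have "\<bar>Z 0 (?t m) - Z 0 (?t (m - 1))\<bar> \<le> ?C * \<bar>?t m - ?t (m - 1)\<bar>"
      proof (rule increment_bound[OF dZ])
        fix z assume "z \<in> {0..T}"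
        thus "\<bar>Z 1 z\<bar> \<le> ?C" unfolding Z_def hx_def hy_def
          by (intro mixed_difference_bound par M B) (use i j in auto)
      qed (use tmem m n in auto)
      moreover have "?t m - ?t (m - 1) = \<tau>" using m by (simp add: tn of_nat_diff algebra_simps)
      ultimately show ?thesis using \<tau> by simp
    qed
    have "delta_x \<kappa>1 \<alpha> hx M1 (delta_y \<kappa>2 \<beta> hy M2 (bdf2 \<tau> W n)) i j = bdf2 \<tau> (\<lambda>m i j. delta_x \<kappa>1 \<alpha> hx M1 (delta_y \<kappa>2 \<beta> hy M2 (W m)) i j) n i j"
    proof -
      have "delta_y \<kappa>2 \<beta> hy M2 (bdf2 \<tau> W n) = bdf2 \<tau> (\<lambda>m. delta_y \<kappa>2 \<beta> hy M2 (W m)) n"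
        by (intro ext) (rule delta_y_bdf2)
      thus ?thesis by (simp only: delta_x_bdf2)
    qed
    also have "\<bar>\<dots>\<bar> \<le> 2 * ?C"
      by (rule bdf2_bound[OF \<tau> _ n(1)]) (use inc in \<open>simp add: Z_def W_def\<close>)
    finally show ?thesis .
  qed
  have s: "(sigma n)\<^sup>2 \<le> 1" by (simp add: sigma_def power2_eq_square)
  have term2: "\<bar>?Z\<bar> \<le> \<tau>\<^sup>2 * (2 * ?C)"
  proof -
    have "\<tau>\<^sup>2 * (sigma n)\<^sup>2 * \<bar>delta_x \<kappa>1 \<alpha> hx M1 (delta_y \<kappa>2 \<beta> hy M2 (bdf2 \<tau> W n)) i j\<bar> \<le> (\<tau>\<^sup>2 * 1) * (2 * ?C)"
      by (rule mult_mono[OF mult_left_mono[OF s] mixed]) auto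
    thus ?thesis by (simp add: abs_mult)
  qed
  have term3: "\<bar>compact_y \<beta> M2 (\<lambda>i j. \<kappa>1 * compact_x \<alpha> M1 Rx i j - delta_x \<kappa>1 \<alpha> hx M1 (W n) i j) i j\<bar>
      \<le> \<kappa>1 * (30 * hx ^ 4 * kernel_const \<alpha> (b - a) * B)"
  proof (rule compact_bound(2))
    fix k assume k: "k \<le> M2"
    have i': "0 < i" "i < M1" "i \<le> M1" using i by auto
    have "flat_jet 6 a b (\<lambda>p x. D p 0 0 x (?y k) (?t n))" by (rule flat_x) (use k ymem tmem n in auto)
    from compact_node_truncation[OF this par(1,2) i'(1,2) _ par(5), of B]
    show "\<bar>\<kappa>1 * compact_x \<alpha> M1 Rx i k - delta_x \<kappa>1 \<alpha> hx M1 (W n) i k\<bar> \<le> \<kappa>1 * (30 * hx ^ 4 * kernel_const \<alpha> (b - a) * B)"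
      unfolding compact_x_def delta_x_def W_def Rx_def hx_def
        sum_frac_coeff_reindex[OF i'(3), of _ "\<lambda>l. D 0 0 0 (?x l) (?y k) (?t n)"]
      using B[of 6 0 0] k ymem tmem n i' by simp
  qed (use par j in auto)
  have term4: "\<bar>compact_x \<alpha> M1 (\<lambda>i j. \<kappa>2 * compact_y \<beta> M2 Ry i j - delta_y \<kappa>2 \<beta> hy M2 (W n) i j) i j\<bar>
      \<le> \<kappa>2 * (30 * hy ^ 4 * kernel_const \<beta> (d - c) * B)"
  proof (rule compact_bound(1))
    fix k assume k: "k \<le> M1"
    have j': "0 < j" "j < M2" "j \<le> M2" using j by auto
    have "flat_jet 6 c d (\<lambda>q y. D 0 q 0 (?x k) y (?t n))" by (rule flat_y) (use k xmem tmem n in auto)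
    from compact_node_truncation[OF this par(3,4) j'(1,2) _ par(6), of B]
    show "\<bar>\<kappa>2 * compact_y \<beta> M2 Ry k j - delta_y \<kappa>2 \<beta> hy M2 (W n) k j\<bar> \<le> \<kappa>2 * (30 * hy ^ 4 * kernel_const \<beta> (d - c) * B)"
      unfolding compact_y_def delta_y_def W_def Ry_def hy_def
        sum_frac_coeff_reindex[OF j'(3), of _ "\<lambda>l. D 0 0 0 (?x k) (?y l) (?t n)"]
      using B[of 0 6 0] k xmem tmem n j' by simp
  qed (use par i in auto)
  show ?thesis unfolding split using term1 term2 term3 term4 by linarith
qed

end

section \<open>Convergence\<close>

context smooth_box
begin

text \<open>The nodal values of the solution are the reference grid function of
  \<open>scheme_error_bound\<close>. The first-order residual B \<tau> of level 1 is kept apart from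
  the others because the stability estimate multiplies it by \<tau>.\<close>

lemma grid_error_bound:
  assumes par: "1 < \<alpha>" "\<alpha> < 2" "1 < \<beta>" "\<beta> < 2" "0 \<le> \<kappa>1" "0 \<le> \<kappa>2" and L: "L \<ge> 0" and M: "1 \<le> M1" "1 \<le> M2" "1 \<le> N"
    and B0: "B \<ge> 0"
    and B: "\<And>p q r x y t. p \<le> 6 \<Longrightarrow> q \<le> 6 \<Longrightarrow> r \<le> 3 \<Longrightarrow> x \<in> {a..b} \<Longrightarrow> y \<in> {c..d} \<Longrightarrow> t \<in> {0..T} \<Longrightarrow> \<bar>D p q r x y t\<bar> \<le> B"
    and lip: "\<And>x y t v w. x \<in> {a..b} \<Longrightarrow> y \<in> {c..d} \<Longrightarrow> t \<in> {0..T} \<Longrightarrow> \<bar>g x y t v - g x y t w\<bar> \<le> L * \<bar>v - w\<bar>"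
    and eq: "\<And>x y t. x \<in> {a..b} \<Longrightarrow> y \<in> {c..d} \<Longrightarrow> t \<in> {0<..T} \<Longrightarrow> D 0 0 1 x y t =
      \<kappa>1 * Riesz_potential \<alpha> a b (\<lambda>x. D 2 0 0 x y t) x + \<kappa>2 * Riesz_potential \<beta> c d (\<lambda>y. D 0 2 0 x y t) y + g x y t (D 0 0 0 x y t)"
    and \<phi>: "\<And>x y. x \<in> {a..b} \<Longrightarrow> y \<in> {c..d} \<Longrightarrow> D 0 0 0 x y 0 = \<phi> x y"
    and U: "numerical_solution \<alpha> \<beta> \<kappa>1 \<kappa>2 a b c d T \<phi> g M1 M2 N U" and n: "1 \<le> n" "n \<le> N"
  defines "hx \<equiv> (b - a) / real M1" and "hy \<equiv> (d - c) / real M2" and "\<tau> \<equiv> T / real N"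
    and "W \<equiv> \<lambda>n i j. D 0 0 0 (node a b M1 i) (node c d M2 j) (node 0 T N n)"
    and "K \<equiv> 2 * (\<kappa>1 * (4 * kernel_const \<alpha> (b - a) * (\<kappa>2 * (4 * kernel_const \<beta> (d - c) * B))))
      + \<kappa>1 * (30 * kernel_const \<alpha> (b - a) * B) + \<kappa>2 * (30 * kernel_const \<beta> (d - c) * B)"
  shows "sqrt (\<Sum>i\<in>{1..<M1}. \<Sum>j\<in>{1..<M2}. (W n i j - U n i j)\<^sup>2)
    \<le> 6 * exp (6 * L * T) * sqrt (real (card ({1..<M1} \<times> {1..<M2})))
      * (\<tau> * (L * (B * \<tau>) + 3/2 * (B * \<tau> + K * (\<tau>\<^sup>2 + hx ^ 4 + hy ^ 4)))
        + T * (L * (6 * B * \<tau>\<^sup>2) + 3/2 * (6 * B * \<tau>\<^sup>2 + K * (\<tau>\<^sup>2 + hx ^ 4 + hy ^ 4))))"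
proof -
  let ?x = "node a b M1" and ?y = "node c d M2" and ?t = "node 0 T N"
  let ?S = "\<tau>\<^sup>2 + hx ^ 4 + hy ^ 4"
  have \<tau>: "\<tau> > 0" using T M by (simp add: \<tau>_def)
  have tmem: "?t m \<in> {0..T}" if "m \<le> N" for m using node_mem[OF T M(3)] that by blast
  have xmem: "?x k \<in> {a..b}" if "k \<le> M1" for k using node_mem[OF ab M(1)] that by blast
  have ymem: "?y k \<in> {c..d}" if "k \<le> M2" for k using node_mem[OF cd M(2)] that by blast
  have tn: "?t m = real m * \<tau>" for m by (simp add: node_def \<tau>_def)
  have kc: "kernel_const \<alpha> (b - a) \<ge> 0" "kernel_const \<beta> (d - c) \<ge> 0" using kernel_const_nonneg par by simp_all
  define K0 where "K0 = 2 * (\<kappa>1 * (4 * kernel_const \<alpha> (b - a) * (\<kappa>2 * (4 * kernel_const \<beta> (d - c) * B))))"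
  define Kx where "Kx = \<kappa>1 * (30 * kernel_const \<alpha> (b - a) * B)"
  define Ky where "Ky = \<kappa>2 * (30 * kernel_const \<beta> (d - c) * B)"
  have K: "K = K0 + Kx + Ky" by (simp add: K_def K0_def Kx_def Ky_def)
  have Kn: "K0 \<ge> 0" "Kx \<ge> 0" "Ky \<ge> 0" unfolding K0_def Kx_def Ky_def
    by (intro mult_nonneg_nonneg kc B0 par(5,6); simp)+
  have S: "?S \<ge> 0" by (intro add_nonneg_nonneg zero_le_even_power) simp_all
  have KS: "\<tau>\<^sup>2 * K0 + Kx * hx ^ 4 + Ky * hy ^ 4 \<le> K * ?S"
  proof -
    have "K0 * \<tau>\<^sup>2 \<le> K0 * ?S" "Kx * hx ^ 4 \<le> Kx * ?S" "Ky * hy ^ 4 \<le> Ky * ?S" using Kn by (auto intro!: mult_left_mono)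
    moreover have "K * ?S = K0 * ?S + Kx * ?S + Ky * ?S" unfolding K by (simp only: distrib_right)
    ultimately show ?thesis by (simp only: mult.commute[of "\<tau>\<^sup>2"])
  qed
  have KS0: "K * ?S \<ge> 0" using Kn S unfolding K by (intro mult_nonneg_nonneg) auto
  note num = U[unfolded numerical_solution_def Let_def, folded hx_def hy_def \<tau>_def]
  have bU: "U n i j = 0" if "1 \<le> n" "n \<le> N" "i \<le> M1" "j \<le> M2" "i = 0 \<or> i = M1 \<or> j = 0 \<or> j = M2" for n i j
  proof -
    have "n \<in> {1..N}" using that by simp
    with conjunct1[OF conjunct2[OF num]] that(3-5) show ?thesis by blast
  qed
  have U0: "U 0 i j = W 0 i j" if "i \<le> M1" "j \<le> M2" for i j
    using conjunct2[OF conjunct2[OF num]] that \<phi>[OF xmem ymem] by (simp add: W_def tn)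
  \<comment> \<open>Level 0 is included: flatness at the sides holds at t = 0 as well. For U the
    scheme prescribes boundary zeros from level 1 on, so its level 0 gets them from the initial
    values.\<close>
  have bW: "zero_boundary M1 M2 (W n)" if "n \<le> N" for n
    using edge_x[of 0 _ "?t n"] edge_y[of 0 _ "?t n"] tmem[OF that] xmem ymem
    unfolding zero_boundary_def W_def by (auto simp: node_step(1,2)[OF M(1)] node_step(1,2)[OF M(2)])
  have bU': "zero_boundary M1 M2 (U n)" if "n \<le> N" for n
  proof (cases "n = 0")
    case True
    thus ?thesis using bW[of 0] U0 unfolding zero_boundary_def by simp
  next
    case False
    thus ?thesis using bU that unfolding zero_boundary_def by simp
  qed
  have taylor: "\<bar>W 1 i j - W 0 i j\<bar> \<le> B * \<tau>" "2 \<le> n \<Longrightarrow> n \<le> N \<Longrightarrow> \<bar>W n i j - 2 * W (n - 1) i j + W (n - 2) i j\<bar> \<le> 6 * B * \<tau>\<^sup>2"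
    if ij: "i \<in> {1..<M1}" "j \<in> {1..<M2}" for n i j
  proof -
    let ?f = "\<lambda>r t. D 0 0 r (?x i) (?y j) t"
    have d: "(?f r has_real_derivative ?f (Suc r) z) (at z within {0..T})" if "r < 3" "z \<in> {0..T}" for r z
      by (rule deriv_t) (use that xmem ymem ij in auto)
    have Bf: "\<bar>?f r z\<bar> \<le> B" if "r \<le> 3" "z \<in> {0..T}" for r z by (rule B) (use that xmem ymem ij in auto)
    note tr = bdf2_truncation[where f = ?f, OF d Bf \<tau>]
    have "\<tau> \<le> T" using tmem[of 1] M tn[of 1] by simp
    from tr(4)[OF _ _ _ _ this] show "\<bar>W 1 i j - W 0 i j\<bar> \<le> B * \<tau>" by (simp add: W_def tn)
    assume n: "2 \<le> n" "n \<le> N"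
    have t: "2 * \<tau> \<le> ?t n" "?t n \<le> T" "?t (n - 1) = ?t n - \<tau>" "?t (n - 2) = ?t n - 2 * \<tau>"
      using n tmem[OF n(2)] \<tau> by (auto simp: tn of_nat_diff algebra_simps)
    from tr(3)[OF _ _ _ _ t(1,2)] show "\<bar>W n i j - 2 * W (n - 1) i j + W (n - 2) i j\<bar> \<le> 6 * B * \<tau>\<^sup>2"
      unfolding W_def t(3,4) by simp
  qed
  show ?thesis
  proof (rule scheme_error_bound[where W = W and U = U and N = N and n = n and G = "\<lambda>n i j w. g (?x i) (?y j) (?t n) w"
        and \<alpha> = \<alpha> and \<beta> = \<beta> and ?\<kappa>1.0 = \<kappa>1 and ?\<kappa>2.0 = \<kappa>2 and hx = hx and hy = hy, OF par \<tau> L])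
    show "0 \<le> B * \<tau> + K * ?S" "0 \<le> 6 * B * \<tau>\<^sup>2 + K * ?S" "0 \<le> B * \<tau>" "0 \<le> 6 * B * \<tau>\<^sup>2"
      using B0 \<tau> KS0 by (auto intro!: add_nonneg_nonneg)
    show "zero_boundary M1 M2 (W n)" "zero_boundary M1 M2 (U n)" if "n \<le> N" for n using bW bU' that by auto
    show "U 0 i j = W 0 i j" if "i \<le> M1" "j \<le> M2" for i j by (rule U0[OF that])
    show "\<bar>g (?x i) (?y j) (?t n) w - g (?x i) (?y j) (?t n) w'\<bar> \<le> L * \<bar>w - w'\<bar>"
      if "1 \<le> n" "n \<le> N" "i \<le> M1" "j \<le> M2" for n i j w w'
      by (rule lip) (use that xmem ymem tmem in auto)
    show "compact_x \<alpha> M1 (compact_y \<beta> M2 (bdf2 \<tau> U n)) i j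
        + \<tau>\<^sup>2 * (sigma n)\<^sup>2 * delta_x \<kappa>1 \<alpha> hx M1 (delta_y \<kappa>2 \<beta> hy M2 (bdf2 \<tau> U n)) i j
      = compact_y \<beta> M2 (delta_x \<kappa>1 \<alpha> hx M1 (U n)) i j + compact_x \<alpha> M1 (delta_y \<kappa>2 \<beta> hy M2 (U n)) i j
        + compact_x \<alpha> M1 (compact_y \<beta> M2 (\<lambda>i j. g (?x i) (?y j) (?t n) (if n = 1 then U 0 i j else 2 * U (n - 1) i j - U (n - 2) i j))) i j"
      if "1 \<le> n" "n \<le> N" "i \<in> {1..<M1}" "j \<in> {1..<M2}" for n i j
    proof -
      have lin: "linearized_source a b c d T g M1 M2 N U n
          = (\<lambda>i j. g (?x i) (?y j) (?t n) (if n = 1 then U 0 i j else 2 * U (n - 1) i j - U (n - 2) i j))"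
        by (intro ext) (rule linearized_source_def)
      have mem: "n \<in> {1..N}" "i \<in> {0<..<M1}" "j \<in> {0<..<M2}" using that by auto
      from bspec[OF bspec[OF bspec[OF conjunct1[OF num] mem(1)] mem(2)] mem(3)] show ?thesis unfolding lin .
    qed
    show "\<bar>compact_x \<alpha> M1 (compact_y \<beta> M2 (bdf2 \<tau> W n)) i j
        + \<tau>\<^sup>2 * (sigma n)\<^sup>2 * delta_x \<kappa>1 \<alpha> hx M1 (delta_y \<kappa>2 \<beta> hy M2 (bdf2 \<tau> W n)) i j
      - (compact_y \<beta> M2 (delta_x \<kappa>1 \<alpha> hx M1 (W n)) i j + compact_x \<alpha> M1 (delta_y \<kappa>2 \<beta> hy M2 (W n)) i j
        + compact_x \<alpha> M1 (compact_y \<beta> M2 (\<lambda>i j. g (?x i) (?y j) (?t n) (W n i j))) i j)\<bar>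
      \<le> (if n = 1 then B * \<tau> + K * ?S else 6 * B * \<tau>\<^sup>2 + K * ?S)"
      if n: "1 \<le> n" "n \<le> N" and ij: "i \<in> {1..<M1}" "j \<in> {1..<M2}" for n i j
    proof -
      have tpos: "?t n \<in> {0<..T}" using tmem[OF n(2)] n \<tau> by (simp add: tn)
      let ?\<rho> = "compact_x \<alpha> M1 (compact_y \<beta> M2 (bdf2 \<tau> W n)) i j
        + \<tau>\<^sup>2 * (sigma n)\<^sup>2 * delta_x \<kappa>1 \<alpha> hx M1 (delta_y \<kappa>2 \<beta> hy M2 (bdf2 \<tau> W n)) i j
      - (compact_y \<beta> M2 (delta_x \<kappa>1 \<alpha> hx M1 (W n)) i j + compact_x \<alpha> M1 (delta_y \<kappa>2 \<beta> hy M2 (W n)) i j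
        + compact_x \<alpha> M1 (compact_y \<beta> M2 (\<lambda>i j. g (?x i) (?y j) (?t n) (W n i j))) i j)"
      have "\<bar>?\<rho>\<bar> \<le> (if n = 1 then B * \<tau> else 6 * B * \<tau>\<^sup>2) + \<tau>\<^sup>2 * K0
          + \<kappa>1 * (30 * hx ^ 4 * kernel_const \<alpha> (b - a) * B) + \<kappa>2 * (30 * hy ^ 4 * kernel_const \<beta> (d - c) * B)"
        unfolding W_def hx_def hy_def \<tau>_def K0_def
        by (rule truncation_error[where G = "\<lambda>x y. g x y (?t n) (D 0 0 0 x y (?t n))", OF par B n ij eq[OF _ _ tpos]])
      moreover have "\<kappa>1 * (30 * hx ^ 4 * kernel_const \<alpha> (b - a) * B) = Kx * hx ^ 4" "\<kappa>2 * (30 * hy ^ 4 * kernel_const \<beta> (d - c) * B) = Ky * hy ^ 4"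
        by (simp_all add: Kx_def Ky_def)
      ultimately have "\<bar>?\<rho>\<bar> \<le> (if n = 1 then B * \<tau> else 6 * B * \<tau>\<^sup>2) + (\<tau>\<^sup>2 * K0 + Kx * hx ^ 4 + Ky * hy ^ 4)" by linarith
      with KS have "\<bar>?\<rho>\<bar> \<le> (if n = 1 then B * \<tau> else 6 * B * \<tau>\<^sup>2) + K * ?S" by linarith
      thus ?thesis by (cases "n = 1") simp_all
    qed
    show "\<bar>W 1 i j - W 0 i j\<bar> \<le> B * \<tau>" if "i \<in> {1..<M1}" "j \<in> {1..<M2}" for i j by (rule taylor(1)[OF that])
    show "\<bar>W n i j - 2 * W (n - 1) i j + W (n - 2) i j\<bar> \<le> 6 * B * \<tau>\<^sup>2"
      if "2 \<le> n" "n \<le> N" "i \<in> {1..<M1}" "j \<in> {1..<M2}" for n i j by (rule taylor(2)[OF that(3,4,1,2)])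
    show "real N * \<tau> \<le> T" using M by (simp add: \<tau>_def)
  qed (use n in auto)
qed

end

text \<open>What is left is to collect constants that depend neither on the grid nor on U, and to
  balance the number of nodes against the cell area in the norm.\<close>

lemma (in smooth_box) convergence_order:
  assumes par: "1 < \<alpha>" "\<alpha> < 2" "1 < \<beta>" "\<beta> < 2" "0 \<le> \<kappa>1" "0 \<le> \<kappa>2" and L: "L \<ge> 0"
    and lip: "\<And>x y t v w. x \<in> {a..b} \<Longrightarrow> y \<in> {c..d} \<Longrightarrow> t \<in> {0..T} \<Longrightarrow> \<bar>g x y t v - g x y t w\<bar> \<le> L * \<bar>v - w\<bar>"
    and eq: "\<And>x y t. x \<in> {a..b} \<Longrightarrow> y \<in> {c..d} \<Longrightarrow> t \<in> {0<..T} \<Longrightarrow> D 0 0 1 x y t =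
      \<kappa>1 * Riesz_potential \<alpha> a b (\<lambda>x. D 2 0 0 x y t) x + \<kappa>2 * Riesz_potential \<beta> c d (\<lambda>y. D 0 2 0 x y t) y + g x y t (D 0 0 0 x y t)"
    and \<phi>: "\<And>x y. x \<in> {a..b} \<Longrightarrow> y \<in> {c..d} \<Longrightarrow> D 0 0 0 x y 0 = \<phi> x y"
    and u: "\<And>x y t. x \<in> {a..b} \<Longrightarrow> y \<in> {c..d} \<Longrightarrow> t \<in> {0..T} \<Longrightarrow> u x y t = D 0 0 0 x y t"
  shows "\<exists>C>0. \<forall>M1 M2 N U. 1 \<le> M1 \<and> 1 \<le> M2 \<and> 1 \<le> N \<and> numerical_solution \<alpha> \<beta> \<kappa>1 \<kappa>2 a b c d T \<phi> g M1 M2 N U \<longrightarrow>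
    max_error a b c d T u M1 M2 N U \<le> C * ((T / real N)\<^sup>2 + ((b - a) / real M1) ^ 4 + ((d - c) / real M2) ^ 4)"
proof -
  obtain B where B0: "B > 0"
    and B: "\<forall>p\<le>6. \<forall>q\<le>6. \<forall>r\<le>3. \<forall>x\<in>{a..b}. \<forall>y\<in>{c..d}. \<forall>t\<in>{0..T}. \<bar>D p q r x y t\<bar> \<le> B"
    using bounded_derivatives by blast
  define K where "K = 2 * (\<kappa>1 * (4 * kernel_const \<alpha> (b - a) * (\<kappa>2 * (4 * kernel_const \<beta> (d - c) * B))))
      + \<kappa>1 * (30 * kernel_const \<alpha> (b - a) * B) + \<kappa>2 * (30 * kernel_const \<beta> (d - c) * B)"
  have K: "K \<ge> 0" unfolding K_def using B0 par kernel_const_nonneg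
    by (intro add_nonneg_nonneg mult_nonneg_nonneg) auto
  \<comment> \<open>With S the sum of \<tau>^2 and the fourth powers of the mesh sizes, everything
    is collected by \<tau>^2 \<le> S, and a surplus factor \<tau> is bounded by T.\<close>
  define C0 where "C0 = L * B + 3/2 * (B + T * K) + T * (6 * L * B + 3/2 * (6 * B + K))"
  have C0: "C0 > 0"
    unfolding C0_def using L K B0 T
    by (intro add_pos_nonneg[OF add_nonneg_pos] mult_pos_pos) (auto intro!: mult_nonneg_nonneg add_nonneg_nonneg add_pos_nonneg)
  define C where "C = sqrt ((b - a) * (d - c)) * (6 * exp (6 * L * T) * C0)"
  have "C > 0" using ab cd C0 by (simp add: C_def)
  moreover have "max_error a b c d T u M1 M2 N U \<le> C * ((T / real N)\<^sup>2 + ((b - a) / real M1) ^ 4 + ((d - c) / real M2) ^ 4)"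
    if M: "1 \<le> M1" "1 \<le> M2" "1 \<le> N" and U: "numerical_solution \<alpha> \<beta> \<kappa>1 \<kappa>2 a b c d T \<phi> g M1 M2 N U" for M1 M2 N U
  proof -
    define hx where "hx = (b - a) / real M1"
    define hy where "hy = (d - c) / real M2"
    define \<tau> where "\<tau> = T / real N"
    define S where "S = \<tau>\<^sup>2 + hx ^ 4 + hy ^ 4"
    have pos: "hx > 0" "hy > 0" "\<tau> > 0" using ab cd T M by (simp_all add: hx_def hy_def \<tau>_def)
    have \<tau>T: "\<tau> \<le> T" using T M by (simp add: \<tau>_def field_simps)
    have S: "\<tau>\<^sup>2 \<le> S" "0 \<le> S" by (simp_all add: S_def)
    have rhs: "\<tau> * (L * (B * \<tau>) + 3/2 * (B * \<tau> + K * S)) + T * (L * (6 * B * \<tau>\<^sup>2) + 3/2 * (6 * B * \<tau>\<^sup>2 + K * S)) \<le> C0 * S"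
    proof -
      have e: "\<tau> * (L * (B * \<tau>) + 3/2 * (B * \<tau> + K * S)) + T * (L * (6 * B * \<tau>\<^sup>2) + 3/2 * (6 * B * \<tau>\<^sup>2 + K * S))
          = (L * B + 3/2 * B + T * (6 * L * B + 9 * B)) * \<tau>\<^sup>2 + 3/2 * (\<tau> * (K * S)) + 3/2 * (T * (K * S))"
        by (simp add: algebra_simps power2_eq_square)
      have "(L * B + 3/2 * B + T * (6 * L * B + 9 * B)) * \<tau>\<^sup>2 \<le> (L * B + 3/2 * B + T * (6 * L * B + 9 * B)) * S"
        using S(1) L B0 T by (intro mult_left_mono) auto
      moreover have "\<tau> * (K * S) \<le> T * (K * S)" using \<tau>T K S by (intro mult_right_mono) auto
      moreover have "C0 * S = (L * B + 3/2 * B + T * (6 * L * B + 9 * B)) * S + 3/2 * (T * (K * S)) + 3/2 * (T * (K * S))"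
        by (simp add: C0_def field_simps)
      ultimately show ?thesis unfolding e by linarith
    qed
    have level: "grid_norm hx hy M1 M2 (\<lambda>i j. u (node a b M1 i) (node c d M2 j) (node 0 T N n) - U n i j) \<le> C * S" if n: "n \<in> {1..N}" for n
    proof -
      let ?E = "\<Sum>i\<in>{1..<M1}. \<Sum>j\<in>{1..<M2}. (D 0 0 0 (node a b M1 i) (node c d M2 j) (node 0 T N n) - U n i j)\<^sup>2"
      have nodes: "u (node a b M1 i) (node c d M2 j) (node 0 T N n) = D 0 0 0 (node a b M1 i) (node c d M2 j) (node 0 T N n)"
        if "i \<in> {1..<M1}" "j \<in> {1..<M2}" for i j
        using node_mem[OF ab M(1), of i] node_mem[OF cd M(2), of j] node_mem[OF T M(3), of n] n that by (intro u) auto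
      have "sqrt ?E \<le> 6 * exp (6 * L * T) * sqrt (real (card ({1..<M1} \<times> {1..<M2})))
          * (\<tau> * (L * (B * \<tau>) + 3/2 * (B * \<tau> + K * S)) + T * (L * (6 * B * \<tau>\<^sup>2) + 3/2 * (6 * B * \<tau>\<^sup>2 + K * S)))"
        unfolding S_def hx_def hy_def \<tau>_def K_def
        by (rule grid_error_bound[where g = g and \<phi> = \<phi>]) (use par L M B0 B lip eq \<phi> U n in auto)
      also have "\<dots> \<le> 6 * exp (6 * L * T) * sqrt (real (card ({1..<M1} \<times> {1..<M2}))) * (C0 * S)"
        by (rule mult_left_mono[OF rhs]) simp
      \<comment> \<open>The (M1 - 1) (M2 - 1) interior nodes are counted as M1 M2, which fits the
        cell area.\<close>
      also have "\<dots> \<le> 6 * exp (6 * L * T) * sqrt (real (M1 * M2)) * (C0 * S)"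
        using C0 S(2) by (intro mult_right_mono mult_left_mono) (auto simp: card_cartesian_product intro!: mult_mono)
      finally have "sqrt (hx * hy) * sqrt ?E \<le> sqrt (hx * hy) * (6 * exp (6 * L * T) * sqrt (real (M1 * M2)) * (C0 * S))"
        using pos by (intro mult_left_mono) auto
      \<comment> \<open>Number of nodes times cell area is the area of the domain.\<close>
      moreover have "sqrt (hx * hy) * sqrt (real (M1 * M2)) = sqrt ((b - a) * (d - c))"
        using M by (simp add: real_sqrt_mult[symmetric] hx_def hy_def)
      hence "sqrt (hx * hy) * (6 * exp (6 * L * T) * sqrt (real (M1 * M2)) * (C0 * S)) = C * S"
        by (simp add: C_def)
      moreover have "(\<Sum>i\<in>{1..<M1}. \<Sum>j\<in>{1..<M2}. (u (node a b M1 i) (node c d M2 j) (node 0 T N n) - U n i j)\<^sup>2) = ?E"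
        by (intro sum.cong refl) (simp add: nodes)
      hence "grid_norm hx hy M1 M2 (\<lambda>i j. u (node a b M1 i) (node c d M2 j) (node 0 T N n) - U n i j) = sqrt (hx * hy) * sqrt ?E"
        unfolding grid_norm_def by (simp only: real_sqrt_mult)
      ultimately show ?thesis by (simp only:)
    qed
    show ?thesis unfolding max_error_def
      using M(3) level[unfolded S_def hx_def hy_def \<tau>_def] by (subst Max_le_iff) auto
  qed
  ultimately show ?thesis by blast
qed

text \<open>The exponent 5 is what \<open>fourier_class_imp_flat_jet\<close> asks for at order six;
  4 + \<alpha> and 4 + \<beta> exceed it.\<close>

lemma smooth_box_of_solution:
  assumes ab: "a < b" and cd: "c < d" and T: "0 < T" and C: "C_box 6 6 3 a b c d T u" and s: "5 \<le> s" "5 \<le> s'"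
    and fx: "\<And>t y. t \<in> {0..T} \<Longrightarrow> y \<in> {c..d} \<Longrightarrow> zero_extension a b (\<lambda>x. u x y t) \<in> fourier_class s"
    and fy: "\<And>t x. t \<in> {0..T} \<Longrightarrow> x \<in> {a..b} \<Longrightarrow> zero_extension c d (\<lambda>y. u x y t) \<in> fourier_class s'"
  obtains D where "smooth_box a b c d T D" "\<And>x y t. x \<in> {a..b} \<Longrightarrow> y \<in> {c..d} \<Longrightarrow> t \<in> {0..T} \<Longrightarrow> u x y t = D 0 0 0 x y t"
proof -
  from C obtain D where D0: "\<forall>x\<in>{a..b}. \<forall>y\<in>{c..d}. \<forall>t\<in>{0..T}. D 0 0 0 x y t = u x y t"
    and D: "\<forall>p\<le>6. \<forall>q\<le>6. \<forall>r\<le>3.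
           continuous_on ({a..b} \<times> {c..d} \<times> {0..T}) (\<lambda>(x, y, t). D p q r x y t) \<and>
           (\<forall>x\<in>{a..b}. \<forall>y\<in>{c..d}. \<forall>t\<in>{0..T}.
              (p < 6 \<longrightarrow> ((\<lambda>z. D p q r z y t) has_real_derivative D (Suc p) q r x y t) (at x within {a..b})) \<and>
              (q < 6 \<longrightarrow> ((\<lambda>z. D p q r x z t) has_real_derivative D p (Suc q) r x y t) (at y within {c..d})) \<and>
              (r < 3 \<longrightarrow> ((\<lambda>z. D p q r x y z) has_real_derivative D p q (Suc r) x y t) (at t within {0..T})))"
    unfolding C_box_def by blast
  have cont: "continuous_on ({a..b} \<times> {c..d} \<times> {0..T}) (\<lambda>(x, y, t). D p q r x y t)" if "p \<le> 6" "q \<le> 6" "r \<le> 3" for p q r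
    using D that by blast
  have dx: "((\<lambda>z. D p q r z y t) has_real_derivative D (Suc p) q r x y t) (at x within {a..b})"
    if "p < 6" "q \<le> 6" "r \<le> 3" "x \<in> {a..b}" "y \<in> {c..d}" "t \<in> {0..T}" for p q r x y t
    using D[rule_format, of p q r] that by auto
  have dy: "((\<lambda>z. D p q r x z t) has_real_derivative D p (Suc q) r x y t) (at y within {c..d})"
    if "p \<le> 6" "q < 6" "r \<le> 3" "x \<in> {a..b}" "y \<in> {c..d}" "t \<in> {0..T}" for p q r x y t
    using D[rule_format, of p q r] that by auto
  have dt: "((\<lambda>z. D p q r x y z) has_real_derivative D p q (Suc r) x y t) (at t within {0..T})"
    if "p \<le> 6" "q \<le> 6" "r < 3" "x \<in> {a..b}" "y \<in> {c..d}" "t \<in> {0..T}" for p q r x y t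
    using D[rule_format, of p q r] that by auto
  have flat_x: "flat_jet 6 a b (\<lambda>p x. D p 0 0 x y t)" if yt: "y \<in> {c..d}" "t \<in> {0..T}" for y t
  proof (rule fourier_class_imp_flat_jet)
    have "continuous_on {a..b} (\<lambda>x. (x, y, t))" by (intro continuous_intros)
    from continuous_on_compose2[OF cont[of 6 0 0] this] have "continuous_on {a..b} (\<lambda>x. D 6 0 0 x y t)"
      using yt by (simp add: image_subset_iff)
    thus "jet 6 a b (\<lambda>p x. D p 0 0 x y t)" unfolding jet_def using ab dx yt by auto
    have "zero_extension a b (\<lambda>x. D 0 0 0 x y t) = zero_extension a b (\<lambda>x. u x y t)"
      using D0 yt by (auto simp: zero_extension_def)
    thus "zero_extension a b (\<lambda>x. D 0 0 0 x y t) \<in> fourier_class s" using fx yt by simp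
  qed (use s in simp)
  have flat_y: "flat_jet 6 c d (\<lambda>q y. D 0 q 0 x y t)" if xt: "x \<in> {a..b}" "t \<in> {0..T}" for x t
  proof (rule fourier_class_imp_flat_jet)
    have "continuous_on {c..d} (\<lambda>y. (x, y, t))" by (intro continuous_intros)
    from continuous_on_compose2[OF cont[of 0 6 0] this] have "continuous_on {c..d} (\<lambda>y. D 0 6 0 x y t)"
      using xt by (simp add: image_subset_iff)
    thus "jet 6 c d (\<lambda>q y. D 0 q 0 x y t)" unfolding jet_def using cd dy xt by auto
    have "zero_extension c d (\<lambda>y. D 0 0 0 x y t) = zero_extension c d (\<lambda>y. u x y t)"
      using D0 xt by (auto simp: zero_extension_def)
    thus "zero_extension c d (\<lambda>y. D 0 0 0 x y t) \<in> fourier_class s'" using fy xt by simp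
  qed (use s in simp)
  have "smooth_box a b c d T D"
    by unfold_locales (use ab cd T cont dx dy dt flat_x flat_y in \<open>auto simp: flat_jet_def\<close>)
  thus thesis using that D0 by auto
qed

text \<open>C is quantified before the grids and before U, so it depends on the data alone, and both
  claims concern every grid function that satisfies the scheme. The first conjunct is convergence
  under refinement and follows from the rate. Continuity of g in (x, y) carries the equation to the
  sides, where the compact averages evaluate it.\<close>

theorem theorem3p2:
  fixes \<alpha> \<beta> \<kappa>1 \<kappa>2 a b c d T L \<nu> :: real
    and \<phi> :: "real \<Rightarrow> real \<Rightarrow> real"
    and g :: "real \<Rightarrow> real \<Rightarrow> real \<Rightarrow> real \<Rightarrow> real"
    and u :: "real \<Rightarrow> real \<Rightarrow> real \<Rightarrow> real"
  assumes "1 < \<alpha>" "\<alpha> < 2" "1 < \<beta>" "\<beta> < 2"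
    and "0 < \<kappa>1" "0 < \<kappa>2" "a < b" "c < d" "0 < T" "0 < L"
    and lipschitz: "\<forall>x\<in>{a..b}. \<forall>y\<in>{c..d}. \<forall>t\<in>{0..T}. L-lipschitz_on UNIV (\<lambda>w. g x y t w)"
    and g_cont: "\<forall>t\<in>{0..T}. \<forall>w. continuous_on ({a..b} \<times> {c..d}) (\<lambda>(x, y). g x y t w)"
    and solution: "unique_smooth_solution \<alpha> \<beta> \<kappa>1 \<kappa>2 a b c d T \<phi> g u"
    and fourier_x: "\<forall>t\<in>{0..T}. \<forall>y\<in>{c..d}.
           zero_extension a b (\<lambda>x. u x y t) \<in> fourier_class (4 + \<alpha>)"
    and fourier_y: "\<forall>t\<in>{0..T}. \<forall>x\<in>{a..b}.
           zero_extension c d (\<lambda>y. u x y t) \<in> fourier_class (4 + \<beta>)"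
    and "0 < \<nu>" "\<nu> < 1"
  shows
    "(\<forall>\<epsilon>>0. \<exists>\<delta>>0. \<forall>M1 M2 N U.
        1 \<le> M1 \<and> 1 \<le> M2 \<and> 1 \<le> N \<and> T / real N \<le> (1 - \<nu>) / (9 * L) \<and>
        T / real N < \<delta> \<and> (b - a) / real M1 < \<delta> \<and> (d - c) / real M2 < \<delta> \<and>
        numerical_solution \<alpha> \<beta> \<kappa>1 \<kappa>2 a b c d T \<phi> g M1 M2 N U \<longrightarrow>
        max_error a b c d T u M1 M2 N U < \<epsilon>) \<and>
     (\<exists>C>0. \<forall>M1 M2 N U.
        1 \<le> M1 \<and> 1 \<le> M2 \<and> 1 \<le> N \<and> T / real N \<le> (1 - \<nu>) / (9 * L) \<and>
        numerical_solution \<alpha> \<beta> \<kappa>1 \<kappa>2 a b c d T \<phi> g M1 M2 N U \<longrightarrow>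
        max_error a b c d T u M1 M2 N U
          \<le> C * ((T / real N)\<^sup>2 + ((b - a) / real M1) ^ 4 + ((d - c) / real M2) ^ 4))"
proof -
  have smooth: "C_box 6 6 3 a b c d T u" and solves: "solves_problem \<alpha> \<beta> \<kappa>1 \<kappa>2 a b c d T \<phi> g u"
    using solution by (auto simp: unique_smooth_solution_def)
  obtain D where D: "smooth_box a b c d T D" and u: "\<And>x y t. x \<in> {a..b} \<Longrightarrow> y \<in> {c..d} \<Longrightarrow> t \<in> {0..T} \<Longrightarrow> u x y t = D 0 0 0 x y t"
    by (rule smooth_box_of_solution[OF \<open>a < b\<close> \<open>c < d\<close> \<open>0 < T\<close> smooth, of "4 + \<alpha>" "4 + \<beta>"])
      (use fourier_x fourier_y \<open>1 < \<alpha>\<close> \<open>1 < \<beta>\<close> in auto)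
  interpret smooth_box a b c d T D by (rule D)
  have lip: "\<bar>g x y t v - g x y t w\<bar> \<le> L * \<bar>v - w\<bar>" if "x \<in> {a..b}" "y \<in> {c..d}" "t \<in> {0..T}" for x y t v w
    using lipschitz_onD[of L UNIV "\<lambda>w. g x y t w" v w] lipschitz that by (auto simp: dist_real_def)
  \<comment> \<open>\<open>solves_problem\<close> speaks of u and the locale of \<open>D\<close>,
    and the two agree on the closed box only. Riesz derivatives are compared through their common
    potential, time derivatives through uniqueness of one-sided derivatives.\<close>
  have interior: "D 0 0 1 x y t = \<kappa>1 * riesz_deriv \<alpha> a b (\<lambda>\<xi>. D 0 0 0 \<xi> y t) x
      + \<kappa>2 * riesz_deriv \<beta> c d (\<lambda>\<xi>. D 0 0 0 x \<xi> t) y + g x y t (D 0 0 0 x y t)"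
    if xyt: "x \<in> {a<..<b}" "y \<in> {c<..<d}" "t \<in> {0<..T}" for x y t
  proof -
    have cl: "x \<in> {a..b}" "y \<in> {c..d}" "t \<in> {0..T}" using xyt by auto
    have rx: "riesz_deriv \<alpha> a b (\<lambda>\<xi>. u \<xi> y t) x = riesz_deriv \<alpha> a b (\<lambda>\<xi>. D 0 0 0 \<xi> y t) x"
      using riesz_deriv_eq_Riesz_potential[OF flat_x[of 0 0 y t] _ \<open>1 < \<alpha>\<close> \<open>\<alpha> < 2\<close> xyt(1), where v = "\<lambda>\<xi>. u \<xi> y t"]
        riesz_deriv_eq_Riesz_potential[OF flat_x[of 0 0 y t] _ \<open>1 < \<alpha>\<close> \<open>\<alpha> < 2\<close> xyt(1), where v = "\<lambda>\<xi>. D 0 0 0 \<xi> y t"] u cl by simp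
    have ry: "riesz_deriv \<beta> c d (\<lambda>\<xi>. u x \<xi> t) y = riesz_deriv \<beta> c d (\<lambda>\<xi>. D 0 0 0 x \<xi> t) y"
      using riesz_deriv_eq_Riesz_potential[OF flat_y[of 0 0 x t] _ \<open>1 < \<beta>\<close> \<open>\<beta> < 2\<close> xyt(2), where v = "\<lambda>\<xi>. u x \<xi> t"]
        riesz_deriv_eq_Riesz_potential[OF flat_y[of 0 0 x t] _ \<open>1 < \<beta>\<close> \<open>\<beta> < 2\<close> xyt(2), where v = "\<lambda>\<xi>. D 0 0 0 x \<xi> t"] u cl by simp
    define r where "r = \<kappa>1 * riesz_deriv \<alpha> a b (\<lambda>\<xi>. u \<xi> y t) x + \<kappa>2 * riesz_deriv \<beta> c d (\<lambda>\<xi>. u x \<xi> t) y + g x y t (u x y t)"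
    have "((\<lambda>s. u x y s) has_real_derivative r) (at t within {0..T})"
      using solves xyt unfolding solves_problem_def r_def by blast
    from DERIV_diff[OF this deriv_t[of 0 0 0, OF _ _ _ cl]]
    have "((\<lambda>s. u x y s - D 0 0 0 x y s) has_real_derivative r - D 0 0 1 x y t) (at t within {0..T})" by simp
    from has_derivative_of_zero_function[OF \<open>0 < T\<close> cl(3) this] have "r = D 0 0 1 x y t" using u cl by simp
    thus ?thesis using u[OF cl] by (simp add: r_def rx ry)
  qed
  have eq: "D 0 0 1 x y t = \<kappa>1 * Riesz_potential \<alpha> a b (\<lambda>x. D 2 0 0 x y t) x
      + \<kappa>2 * Riesz_potential \<beta> c d (\<lambda>y. D 0 2 0 x y t) y + g x y t (D 0 0 0 x y t)"
    if "x \<in> {a..b}" "y \<in> {c..d}" "t \<in> {0<..T}" for x y t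
    by (rule equation_on_closed_box[where g = "\<lambda>x y w. g x y t w" and L = L])
      (use that assms(1-4) g_cont lip interior in auto)
  have \<phi>: "D 0 0 0 x y 0 = \<phi> x y" if "x \<in> {a..b}" "y \<in> {c..d}" for x y
  proof -
    have "(x, y) \<in> closure ({a<..<b} \<times> {c<..<d})" using that \<open>a < b\<close> \<open>c < d\<close> by (simp add: closure_Times)
    hence "u x y 0 = \<phi> x y" using solves unfolding solves_problem_def by blast
    thus ?thesis using u[of x y 0] that \<open>0 < T\<close> by simp
  qed
  have "\<exists>C>0. \<forall>M1 M2 N U. 1 \<le> M1 \<and> 1 \<le> M2 \<and> 1 \<le> N \<and> numerical_solution \<alpha> \<beta> \<kappa>1 \<kappa>2 a b c d T \<phi> g M1 M2 N U \<longrightarrow>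
    max_error a b c d T u M1 M2 N U \<le> C * ((T / real N)\<^sup>2 + ((b - a) / real M1) ^ 4 + ((d - c) / real M2) ^ 4)"
    by (rule convergence_order[where L = L and g = g]) (use assms(1-6,10) lip eq \<phi> u in \<open>auto intro: less_imp_le\<close>)
  then obtain C where C: "C > 0" "\<And>M1 M2 N U. 1 \<le> M1 \<and> 1 \<le> M2 \<and> 1 \<le> N \<and> numerical_solution \<alpha> \<beta> \<kappa>1 \<kappa>2 a b c d T \<phi> g M1 M2 N U \<Longrightarrow>
    max_error a b c d T u M1 M2 N U \<le> C * ((T / real N)\<^sup>2 + ((b - a) / real M1) ^ 4 + ((d - c) / real M2) ^ 4)"
    by blast
  show ?thesis
  proof (intro conjI allI impI)
    fix \<epsilon> :: real assume \<epsilon>: "\<epsilon> > 0"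
    \<comment> \<open>Each of the three terms is a power of a mesh size below \<delta> \<le> 1,
      hence itself below \<delta>; three of them times C stay below \<epsilon>.\<close>
    define \<delta> where "\<delta> = min 1 (\<epsilon> / (3 * C))"
    have \<delta>: "\<delta> > 0" "\<delta> \<le> 1" "C * (3 * \<delta>) \<le> \<epsilon>"
      using \<epsilon> C(1) by (auto simp: \<delta>_def min_def field_simps)
    have small: "h ^ Suc k < \<delta>" if "0 < h" "h < \<delta>" for h k
    proof -
      have "h ^ k \<le> 1" using that \<delta> by (intro power_le_one) auto
      hence "h * h ^ k \<le> h * 1" using that by (intro mult_left_mono) auto
      thus ?thesis using that unfolding power_Suc by linarith
    qed
    have "max_error a b c d T u M1 M2 N U < \<epsilon>"
      if "1 \<le> M1 \<and> 1 \<le> M2 \<and> 1 \<le> N \<and> T / real N \<le> (1 - \<nu>) / (9 * L) \<and>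
        T / real N < \<delta> \<and> (b - a) / real M1 < \<delta> \<and> (d - c) / real M2 < \<delta> \<and>
        numerical_solution \<alpha> \<beta> \<kappa>1 \<kappa>2 a b c d T \<phi> g M1 M2 N U" for M1 M2 N U
    proof -
      have "(T / real N)\<^sup>2 < \<delta>" "((b - a) / real M1) ^ 4 < \<delta>" "((d - c) / real M2) ^ 4 < \<delta>"
        using small[of "T / real N" 1] small[of "(b - a) / real M1" 3] small[of "(d - c) / real M2" 3] that \<open>0 < T\<close> \<open>a < b\<close> \<open>c < d\<close>
        by (simp_all add: eval_nat_numeral)
      hence "C * ((T / real N)\<^sup>2 + ((b - a) / real M1) ^ 4 + ((d - c) / real M2) ^ 4) < C * (3 * \<delta>)"
        using C(1) by (intro mult_strict_left_mono) auto
      moreover have "max_error a b c d T u M1 M2 N U \<le> C * ((T / real N)\<^sup>2 + ((b - a) / real M1) ^ 4 + ((d - c) / real M2) ^ 4)"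
        using C(2) that by simp
      ultimately show ?thesis using \<delta>(3) by linarith
    qed
    thus "\<exists>\<delta>>0. \<forall>M1 M2 N U.
        1 \<le> M1 \<and> 1 \<le> M2 \<and> 1 \<le> N \<and> T / real N \<le> (1 - \<nu>) / (9 * L) \<and>
        T / real N < \<delta> \<and> (b - a) / real M1 < \<delta> \<and> (d - c) / real M2 < \<delta> \<and>
        numerical_solution \<alpha> \<beta> \<kappa>1 \<kappa>2 a b c d T \<phi> g M1 M2 N U \<longrightarrow>
        max_error a b c d T u M1 M2 N U < \<epsilon>" using \<delta>(1) by blast
  next
    show "\<exists>C>0. \<forall>M1 M2 N U.
        1 \<le> M1 \<and> 1 \<le> M2 \<and> 1 \<le> N \<and> T / real N \<le> (1 - \<nu>) / (9 * L) \<and>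
        numerical_solution \<alpha> \<beta> \<kappa>1 \<kappa>2 a b c d T \<phi> g M1 M2 N U \<longrightarrow>
        max_error a b c d T u M1 M2 N U
          \<le> C * ((T / real N)\<^sup>2 + ((b - a) / real M1) ^ 4 + ((d - c) / real M2) ^ 4)"
      using C by blast
  qed
qed

end
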